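(* Let $g \ge 0$, $k \ge 2$, $p \ge 4$ be integers such that: (1) $g = 0$ if $k = 2$; (2) $g \ge \tfrac{1}{2}(k-1)(k-2)$ if $k \ge 3$; (3) $p$ is even and $p \ge 4g - 2(k^2 - 4k + 2)$. Then there exists a quadrangulation of $\Sigma_g$ having $p$ vertices, whose graph has vertex chromatic number equal to $k$, and whose face chromatic number is less than or equal to $k$.
   Context: All graphs are undirected, simple and finite. $\Sigma_g$ denotes the closed orientable surface of genus $g$ (the sphere with $g$ handles). A quadrangulation of $\Sigma_g$ with a graph $G$ is an embedding $G \to \Sigma_g$ in which every face is a quadrilateral, i.e. a face bounded by a simple cycle of length $4$, and every edge meets exactly two quadrilaterals. The vertex chromatic number $\chi_V(G)$ of a graph is the minimum number of colors in a coloring of its vertices in which adjacent vertices get distinct colors. The face chromatic number $\chi_F(Q)$ of a quadrangulation $Q$ is the minimum number of colors in a coloring of its quadrilaterals in which any two quadrilaterals meeting a common edge get distinct colors. *)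

theory Defs
  imports "HOL-Analysis.Analysis"
begin

section \<open>The closed orientable surface of genus \<open>g\<close>\<close>

text \<open>
  The sphere with \<open>g\<close> handles is realised in three-space as the boundary of a
  rectangular block pierced by \<open>g\<close> disjoint parallel tunnels running in the third coordinate
  direction. For \<open>g = 0\<close> this is the boundary of a box, i.e. a sphere; the wall of each
  tunnel is a tube joining two discs removed from that sphere.
\<close>

definition tunnel :: "nat \<Rightarrow> (real \<times> real \<times> real) set" where
  "tunnel i = {2 * real i + 1 <..< 2 * real i + 2} \<times> {1 <..< 2} \<times> UNIV"

definition pierced_block :: "nat \<Rightarrow> (real \<times> real \<times> real) set" where
  "pierced_block g = {0 .. 2 * real g + 1} \<times> {0 .. 3} \<times> {0 .. 1} - (\<Union>i<g. tunnel i)"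

definition genus_surface :: "nat \<Rightarrow> (real \<times> real \<times> real) set" where
  "genus_surface g = frontier (pierced_block g)"

section \<open>Graphs and their embeddings\<close>

definition simple_graph :: "'v set \<Rightarrow> 'v set set \<Rightarrow> bool" where
  "simple_graph V E \<longleftrightarrow> finite V \<and> (\<forall>e\<in>E. e \<subseteq> V \<and> card e = 2)"

text \<open>
  A topological embedding of the graph into \<open>S\<close> is given by the positions \<open>\<phi>\<close> of the
  vertices and a parametrised arc \<open>\<gamma> e\<close> for every edge \<open>e\<close>; the arcs are
  disjoint from each other and from the vertices except at common ends.
\<close>

definition graph_embedding ::
  "'a::topological_space set \<Rightarrow> 'v set \<Rightarrow> 'v set set \<Rightarrow> ('v \<Rightarrow> 'a) \<Rightarrow> ('v set \<Rightarrow> real \<Rightarrow> 'a) \<Rightarrow> bool"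
where
  "graph_embedding S V E \<phi> \<gamma> \<longleftrightarrow>
     \<phi> ` V \<subseteq> S \<and> inj_on \<phi> V \<and>
     (\<forall>e\<in>E. arc (\<gamma> e) \<and> path_image (\<gamma> e) \<subseteq> S \<and>
            {pathstart (\<gamma> e), pathfinish (\<gamma> e)} = \<phi> ` e \<and>
            path_image (\<gamma> e) \<inter> \<phi> ` V = \<phi> ` e) \<and>
     (\<forall>e\<in>E. \<forall>e'\<in>E. e \<noteq> e' \<longrightarrow> path_image (\<gamma> e) \<inter> path_image (\<gamma> e') = \<phi> ` (e \<inter> e'))"

definition embedded_graph ::
  "'v set \<Rightarrow> 'v set set \<Rightarrow> ('v \<Rightarrow> 'a::topological_space) \<Rightarrow> ('v set \<Rightarrow> real \<Rightarrow> 'a) \<Rightarrow> 'a set"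
where
  "embedded_graph V E \<phi> \<gamma> = \<phi> ` V \<union> (\<Union>e\<in>E. path_image (\<gamma> e))"

definition faces ::
  "'a::topological_space set \<Rightarrow> 'v set \<Rightarrow> 'v set set \<Rightarrow> ('v \<Rightarrow> 'a) \<Rightarrow> ('v set \<Rightarrow> real \<Rightarrow> 'a) \<Rightarrow> 'a set set"
where
  "faces S V E \<phi> \<gamma> = components (S - embedded_graph V E \<phi> \<gamma>)"

text \<open>
  A face is an open region of the surface. It is a quadrilateral if its closure is a closed disc
  whose boundary circle is a simple cycle of length four of the embedded graph. Having such a
  cycle as mere point-set frontier would not be enough: the complement of a small disc in a torus
  is not a quadrilateral.
\<close>

definition quadrilateral ::
  "'v set set \<Rightarrow> ('v set \<Rightarrow> real \<Rightarrow> 'a::topological_space) \<Rightarrow> 'a set \<Rightarrow> bool"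
where
  "quadrilateral E \<gamma> f \<longleftrightarrow>
     (\<exists>a b c d. distinct [a, b, c, d] \<and> {{a, b}, {b, c}, {c, d}, {d, a}} \<subseteq> E \<and>
        (\<exists>h h'. homeomorphism (cball (0::complex) 1) (closure f) h h' \<and>
           h ` ball 0 1 = f \<and>
           h ` sphere 0 1 = (\<Union>e\<in>{{a, b}, {b, c}, {c, d}, {d, a}}. path_image (\<gamma> e))))"

definition meets_edge ::
  "('v set \<Rightarrow> real \<Rightarrow> 'a::topological_space) \<Rightarrow> 'a set \<Rightarrow> 'v set \<Rightarrow> bool"
where
  "meets_edge \<gamma> f e \<longleftrightarrow> path_image (\<gamma> e) \<subseteq> closure f"

definition quadrangulation ::
  "'a::topological_space set \<Rightarrow> 'v set \<Rightarrow> 'v set set \<Rightarrow> ('v \<Rightarrow> 'a) \<Rightarrow> ('v set \<Rightarrow> real \<Rightarrow> 'a) \<Rightarrow> bool"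
where
  "quadrangulation S V E \<phi> \<gamma> \<longleftrightarrow>
     simple_graph V E \<and> graph_embedding S V E \<phi> \<gamma> \<and>
     (\<forall>f\<in>faces S V E \<phi> \<gamma>. quadrilateral E \<gamma> f) \<and>
     (\<forall>e\<in>E. card {f \<in> faces S V E \<phi> \<gamma>. meets_edge \<gamma> f e} = 2)"

section \<open>Chromatic numbers\<close>

definition proper_colouring :: "'x set \<Rightarrow> ('x \<Rightarrow> 'x \<Rightarrow> bool) \<Rightarrow> nat \<Rightarrow> ('x \<Rightarrow> nat) \<Rightarrow> bool" where
  "proper_colouring X adj n c \<longleftrightarrow>
     (\<forall>x\<in>X. c x < n) \<and> (\<forall>x\<in>X. \<forall>y\<in>X. adj x y \<longrightarrow> c x \<noteq> c y)"

text \<open>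
  The minimum exists whenever \<open>X\<close> is finite and \<open>adj\<close> is irreflexive, which is the case
  in both uses below: a quadrangulation has finitely many faces, since each of its finitely many
  edges meets two of them and each face meets an edge.
\<close>

definition chromatic_number :: "'x set \<Rightarrow> ('x \<Rightarrow> 'x \<Rightarrow> bool) \<Rightarrow> nat" where
  "chromatic_number X adj = (LEAST n. \<exists>c. proper_colouring X adj n c)"

definition vertex_chromatic_number :: "'v set \<Rightarrow> 'v set set \<Rightarrow> nat" where
  "vertex_chromatic_number V E = chromatic_number V (\<lambda>u v. u \<noteq> v \<and> {u, v} \<in> E)"

definition face_chromatic_number ::
  "'a::topological_space set \<Rightarrow> 'v set \<Rightarrow> 'v set set \<Rightarrow> ('v \<Rightarrow> 'a) \<Rightarrow> ('v set \<Rightarrow> real \<Rightarrow> 'a) \<Rightarrow> nat"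
where
  "face_chromatic_number S V E \<phi> \<gamma> =
     chromatic_number (faces S V E \<phi> \<gamma>)
       (\<lambda>f f'. f \<noteq> f' \<and> (\<exists>e\<in>E. meets_edge \<gamma> f e \<and> meets_edge \<gamma> f' e))"

end

(* A quadrangulation is encoded by its oriented faces (a, b, c, d) and by a drawing, i.e. one map of
   the diamond |Re z| + |Im z| <= 1 into the surface per face. Two moves are used.
   Splitting: two new vertices are put into a face (a, b, c, d) and joined to a and c, which cuts the
   face into three. The middle one may receive any other colour.
   Joining: small discs inside the faces (x, a, y, c) and (e, v, e', u) are removed and a tube is
   attached; it carries four new edges, from x and y to e and e'. The genus grows by one, no vertex is
   added, and the four new faces keep the colours of the two old ones, which have to be different. As
   germs of faces can be moved to any place of the surface, every two faces can be brought to the right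
   end of the pierced block, where the next handle grows.
   Starting from the 4-cycle on the sphere, one splitting and m - 1 joinings attach a further pair of
   vertices to the complete multipartite graph on m pairs. With k pairs this gives genus
   (k - 1) (k - 2) / 2, and the chromatic number is k. Two splittings followed by joining the two middle
   faces add one handle and four vertices without new colours, and splittings alone add pairs of
   vertices; this yields all p allowed by the bound. *)

theory Submission
  imports Defs
begin

section \<open>Moving pieces of the plane\<close>

text \<open>The surface is a fixed subset of three-space, so everything is done by explicit maps. A
  handle can grow in one place only, hence faces travel to the handle and not the handle to faces.
  Only germs have to travel, i.e. the face maps restricted to half-size diamonds, because exactly
  these are cut out when a tube is attached; they move by bijections of the plane supported in one
  face or in two neighbouring ones. What is left of a drawing is combinatorics of directed edges.
  The two faces to be joined need different colours because every new edge on the tube has a face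
  coloured like one end on one side and a face coloured like the other end on the other side. Origin
  of the bounds: by Euler's formula a quadrangulation of genus g with p vertices has 2p - 4 + 4g
  edges. The complete multipartite graph on k pairs has 2k vertices and 2k(k-1) edges, which forces
  g = (k-1)(k-2)/2. Each surplus handle is paid with four vertices here, and p >= 2k + 4(g -
  (k-1)(k-2)/2) is condition (3) rewritten.\<close>

definition planar_move :: "complex set \<Rightarrow> complex set \<Rightarrow> (complex \<Rightarrow> complex) \<Rightarrow> bool" where
  "planar_move U K \<alpha> \<longleftrightarrow>
     (\<exists>h. bij h \<and> continuous_on UNIV h \<and> (\<forall>z. z \<notin> U \<longrightarrow> h z = z) \<and> (\<forall>z\<in>K. h z = \<alpha> z))"

lemma planar_move_id: "planar_move U K (\<lambda>z. z)"
  unfolding planar_move_def by (rule exI[of _ "\<lambda>z. z"]) (auto intro: bij_id[unfolded id_def])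

lemma planar_move_cong: "planar_move U K \<alpha> \<Longrightarrow> (\<And>z. z \<in> K \<Longrightarrow> \<alpha> z = \<beta> z) \<Longrightarrow> planar_move U K \<beta>"
  unfolding planar_move_def by metis

lemma planar_move_comp:
  assumes "planar_move U K \<alpha>" "planar_move U (\<alpha> ` K) \<beta>"
  shows "planar_move U K (\<lambda>z. \<beta> (\<alpha> z))"
proof -
  obtain h where h: "bij h" "continuous_on UNIV h" "\<And>z. z \<notin> U \<Longrightarrow> h z = z" "\<And>z. z \<in> K \<Longrightarrow> h z = \<alpha> z"
    using assms(1) unfolding planar_move_def by metis
  obtain k where k: "bij k" "continuous_on UNIV k" "\<And>z. z \<notin> U \<Longrightarrow> k z = z" "\<And>z. z \<in> \<alpha> ` K \<Longrightarrow> k z = \<beta> z"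
    using assms(2) unfolding planar_move_def by metis
  have "bij (k \<circ> h)" using h k by (simp add: bij_comp)
  moreover have "continuous_on UNIV (k \<circ> h)"
    using h k by (intro continuous_on_compose) (auto intro: continuous_on_subset)
  ultimately show ?thesis
    unfolding planar_move_def using h k by (intro exI[of _ "k \<circ> h"]) auto
qed

text \<open>A preimage of \<open>y\<close> is a fixed point of the contraction
  \<open>x \<mapsto> y - \<psi> x\<close>, and two points with the same image have distance at most
  \<open>L\<close> times itself.\<close>

lemma bij_id_plus_contraction:
  fixes \<psi> :: "complex \<Rightarrow> complex"
  assumes "L < 1" "0 \<le> L" and lip: "\<And>w w'. dist (\<psi> w) (\<psi> w') \<le> L * dist w w'"
  shows "bij (\<lambda>w. w + \<psi> w)" "continuous_on UNIV (\<lambda>w. w + \<psi> w)"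
proof -
  have "continuous_on UNIV \<psi>"
    using assms(2) lip by (intro lipschitz_on_continuous_on[where L=L] lipschitz_onI) auto
  then show "continuous_on UNIV (\<lambda>w. w + \<psi> w)" by (intro continuous_intros)
  have "inj (\<lambda>w. w + \<psi> w)"
  proof (rule injI)
    fix x y assume "x + \<psi> x = y + \<psi> y"
    then have "x - y = \<psi> y - \<psi> x" by (simp add: algebra_simps)
    then have "dist x y = dist (\<psi> x) (\<psi> y)" by (metis dist_commute dist_norm)
    then have "dist x y \<le> L * dist x y" using lip[of x y] by simp
    then have "(1 - L) * dist x y \<le> 0" by (simp add: algebra_simps)
    then show "x = y" using assms(1) by (simp add: mult_le_0_iff)
  qed
  moreover have "surj (\<lambda>w. w + \<psi> w)"
    unfolding surj_def
  proof
    show "\<exists>x. y = x + \<psi> x" for y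
    proof -
      have "\<exists>!x. x \<in> UNIV \<and> y - \<psi> x = x"
        using assms(1,2) lip
        by (intro Banach_fix[where c=L]) (auto simp: dist_norm complete_UNIV norm_minus_commute)
      then obtain x where "y - \<psi> x = x" by blast
      then show ?thesis by (intro exI[of _ x]) (simp add: algebra_simps)
    qed
  qed
  ultimately show "bij (\<lambda>w. w + \<psi> w)" by (simp add: bij_def)
qed

text \<open>The affine map is reached from the identity by a straight line of affine embeddings, which is
  cut into steps so small that each of them is realised by a perturbation of the identity with a
  small Lipschitz constant.\<close>

lemma planar_move_affine:
  fixes a b c :: complex
  assumes U: "open U" "convex U" and K: "compact K" "K \<subseteq> U"
    and pos: "cmod c < Re a" and im: "(\<lambda>z. b + a * z + c * cnj z) ` K \<subseteq> U"
  shows "planar_move U K (\<lambda>z. b + a * z + c * cnj z)"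
proof -
  define A where "A t = 1 + of_real t * (a - 1)" for t
  \<comment> \<open>Every real-affine map of the plane has the form
    \<open>b + a * z + c * cnj z\<close>. \<open>\<alpha> t\<close> is the straight line from the
    identity to it, and \<open>\<delta>\<close> is its constant velocity.\<close>
  define \<alpha> where "\<alpha> t z = of_real t * b + A t * z + of_real t * c * cnj z" for t :: real and z :: complex
  define \<delta> where "\<delta> z = b + (a - 1) * z + c * cnj z" for z
  define m where "m = min 1 (Re a - cmod c)"
  have m: "0 < m" "m \<le> 1" "m \<le> Re a - cmod c" using pos by (auto simp: m_def)
  have \<alpha>\<delta>: "\<alpha> t z = z + of_real t * \<delta> z" for t z
    by (simp add: \<alpha>_def A_def \<delta>_def algebra_simps)
  define N where "N = cmod (a - 1) + cmod c"
  have N: "0 \<le> N" by (simp add: N_def)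
  have \<delta>lip: "dist (\<delta> z) (\<delta> z') \<le> N * dist z z'" for z z'
  proof -
    have "\<delta> z - \<delta> z' = (a - 1) * (z - z') + c * cnj (z - z')" by (simp add: \<delta>_def algebra_simps)
    then have "cmod (\<delta> z - \<delta> z') \<le> cmod (a - 1) * cmod (z - z') + cmod c * cmod (z - z')"
      by (metis complex_mod_cnj norm_mult norm_triangle_ineq)
    then show ?thesis by (simp add: dist_norm N_def algebra_simps)
  qed
  \<comment> \<open>The inequality \<open>cmod c < Re a\<close> survives mixing with the identity,
    so a single constant \<open>m\<close> bounds all linear parts of the line from below. Hence the
    inverses \<open>\<beta> t\<close> share the Lipschitz constant \<open>1 / m\<close>.\<close>
  have expand: "m * cmod z \<le> cmod (A t * z + of_real t * c * cnj z)" if t: "0 \<le> t" "t \<le> 1" for t z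
  proof -
    have "m \<le> (1 - t) * 1 + t * (Re a - cmod c)"
    proof -
      have "(1 - t) * m + t * m \<le> (1 - t) * 1 + t * (Re a - cmod c)"
        using t m by (intro add_mono mult_left_mono) auto
      then show ?thesis by (simp add: algebra_simps)
    qed
    also have "\<dots> = Re (A t) - t * cmod c" by (simp add: A_def algebra_simps)
    also have "\<dots> \<le> cmod (A t) - t * cmod c" using complex_Re_le_cmod[of "A t"] by simp
    finally have "m * cmod z \<le> (cmod (A t) - t * cmod c) * cmod z" by (intro mult_right_mono) auto
    also have "\<dots> = cmod (A t * z) - cmod (of_real t * c * cnj z)"
      using t by (simp add: norm_mult algebra_simps)
    also have "\<dots> \<le> cmod (A t * z + of_real t * c * cnj z)"
      by (metis norm_diff_ineq)
    finally show ?thesis .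
  qed
  have surj: "\<exists>z. \<alpha> t z = w" if t: "0 \<le> t" "t \<le> 1" for t w
  proof -
    \<comment> \<open>The determinant of the real-linear part of \<open>\<alpha> t\<close>; the
      solution \<open>z\<close> below is Cramer's rule.\<close>
    define D where "D = A t * cnj (A t) - of_real t * c * cnj (of_real t * c)"
    have "D \<noteq> 0"
    proof
      assume "D = 0"
      then have "A t * cnj (A t) = of_real t * c * cnj (of_real t * c)" by (simp add: D_def)
      then have eq: "(cmod (A t))\<^sup>2 = (cmod (of_real t * c))\<^sup>2"
        by (metis complex_norm_square of_real_eq_iff)
      then have "cmod (A t) = cmod (of_real t * c)" by (simp add: power2_eq_iff_nonneg)
      moreover have "m \<le> cmod (A t) - cmod (of_real t * c)"
      proof -
        have "m \<le> (1 - t) * 1 + t * (Re a - cmod c)"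
        proof -
          have "(1 - t) * m + t * m \<le> (1 - t) * 1 + t * (Re a - cmod c)"
            using t m by (intro add_mono mult_left_mono) auto
          then show ?thesis by (simp add: algebra_simps)
        qed
        also have "\<dots> = Re (A t) - t * cmod c" by (simp add: A_def algebra_simps)
        also have "\<dots> \<le> cmod (A t) - t * cmod c" using complex_Re_le_cmod[of "A t"] by simp
        finally show ?thesis using t by (simp add: norm_mult)
      qed
      ultimately show False using m by simp
    qed
    define y where "y = w - of_real t * b"
    define z where "z = (cnj (A t) * y - of_real t * c * cnj y) / D"
    have cD: "cnj D = D" by (simp add: D_def algebra_simps)
    have "A t * z + of_real t * c * cnj z = y"
    proof -
      have "A t * z + of_real t * c * cnj z =
         (A t * (cnj (A t) * y - of_real t * c * cnj y) + of_real t * c * (A t * cnj y - of_real t * cnj c * y)) / D"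
        by (simp add: z_def cD add_divide_distrib)
      also have "\<dots> = (D * y) / D" by (rule arg_cong[where f="\<lambda>x. x / D"]) (simp add: D_def algebra_simps)
      finally show ?thesis using \<open>D \<noteq> 0\<close> by simp
    qed
    then show ?thesis by (intro exI[of _ z]) (simp add: \<alpha>_def y_def algebra_simps)
  qed
  define \<beta> where "\<beta> t w = (SOME z. \<alpha> t z = w)" for t w
  have \<alpha>\<beta>: "\<alpha> t (\<beta> t w) = w" if "0 \<le> t" "t \<le> 1" for t w
    using someI_ex[OF surj[OF that]] by (simp add: \<beta>_def)
  have \<beta>lip: "m * dist (\<beta> t w) (\<beta> t w') \<le> dist w w'" if t: "0 \<le> t" "t \<le> 1" for t w w'
  proof -
    let ?z = "\<beta> t w - \<beta> t w'"
    have "A t * ?z + of_real t * c * cnj ?z = \<alpha> t (\<beta> t w) - \<alpha> t (\<beta> t w')"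
      by (simp add: \<alpha>_def algebra_simps)
    then show ?thesis using expand[OF t, of ?z] \<alpha>\<beta>[OF t] by (simp add: dist_norm)
  qed
  have \<beta>\<alpha>: "\<beta> t (\<alpha> t z) = z" if t: "0 \<le> t" "t \<le> 1" for t z
  proof -
    let ?z = "\<beta> t (\<alpha> t z) - z"
    have "A t * ?z + of_real t * c * cnj ?z = \<alpha> t (\<beta> t (\<alpha> t z)) - \<alpha> t z"
      by (simp add: \<alpha>_def algebra_simps)
    then have "m * cmod ?z \<le> 0" using expand[OF t, of ?z] \<alpha>\<beta>[OF t] by simp
    then show ?thesis using m by (simp add: mult_le_0_iff)
  qed
  \<comment> \<open>The track swept out by \<open>K\<close> along the line. Convexity keeps it
    inside \<open>U\<close>, and compactness keeps it at a positive distance from the complement of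
    \<open>U\<close>.\<close>
  define Ks where "Ks = (\<lambda>(t, z). \<alpha> t z) ` ({0..1} \<times> K)"
  have "compact Ks" unfolding Ks_def
  proof (rule compact_continuous_image)
    show "continuous_on ({0..1} \<times> K) (\<lambda>(t, z). \<alpha> t z)"
      unfolding \<alpha>_def A_def case_prod_unfold by (intro continuous_intros)
  qed (use K in \<open>auto intro: compact_Times\<close>)
  have KsU: "Ks \<subseteq> U"
  proof
    fix w assume "w \<in> Ks"
    then obtain t z where tz: "0 \<le> t" "t \<le> 1" "z \<in> K" "w = \<alpha> t z" by (auto simp: Ks_def)
    have "z \<in> U" "b + a * z + c * cnj z \<in> U" using tz K im by auto
    then have "(1 - t) *\<^sub>R z + t *\<^sub>R (b + a * z + c * cnj z) \<in> U"
      using U(2) tz by (intro convexD) auto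
    moreover have "(1 - t) *\<^sub>R z + t *\<^sub>R (b + a * z + c * cnj z) = w"
      by (simp add: tz(4) \<alpha>\<delta> \<delta>_def scaleR_conv_of_real algebra_simps)
    ultimately show "w \<in> U" by simp
  qed
  show ?thesis
  proof (cases "K = {}")
    case True then show ?thesis by (intro planar_move_cong[OF planar_move_id]) auto
  next
    case False
    then have Ksne: "Ks \<noteq> {}" by (auto simp: Ks_def)
    obtain d where d: "0 < d" "\<And>w x. w \<in> Ks \<Longrightarrow> x \<notin> U \<Longrightarrow> d \<le> dist w x"
      using separate_compact_closed[OF \<open>compact Ks\<close>, of "- U"] U KsU by (metis (no_types, lifting) Compl_iff closed_Compl disjoint_eq_subset_Compl double_compl)
    \<comment> \<open>A Lipschitz cutoff which is 1 on the track and 0 outside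
      \<open>U\<close>.\<close>
    define \<rho> where "\<rho> w = max 0 (1 - infdist w Ks / d)" for w
    have \<rho>1: "\<rho> w = 1" if "w \<in> Ks" for w using that by (simp add: \<rho>_def)
    have \<rho>0: "\<rho> w = 0" if "w \<notin> U" for w
    proof -
      have "d \<le> infdist w Ks" unfolding infdist_notempty[OF Ksne]
        using d(2) that Ksne by (intro cINF_greatest) (auto simp: dist_commute)
      then show ?thesis using d by (simp add: \<rho>_def)
    qed
    have \<rho>r: "0 \<le> \<rho> w" "\<rho> w \<le> 1" for w using d by (auto simp: \<rho>_def infdist_nonneg)
    have \<rho>lip: "\<bar>\<rho> w - \<rho> w'\<bar> \<le> dist w w' / d" for w w'
    proof -
      have "\<bar>infdist w Ks - infdist w' Ks\<bar> \<le> dist w w'"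
        using infdist_triangle[of w Ks w'] infdist_triangle[of w' Ks w] by (simp add: dist_commute abs_le_iff)
      then have "\<bar>infdist w Ks / d - infdist w' Ks / d\<bar> \<le> dist w w' / d"
        using d by (simp add: diff_divide_distrib[symmetric] divide_right_mono)
      then show ?thesis by (simp add: \<rho>_def)
    qed
    obtain B0 where B0: "\<And>w. w \<in> Ks \<Longrightarrow> cmod w \<le> B0" using compact_imp_bounded[OF \<open>compact Ks\<close>] by (auto simp: bounded_iff)
    define B where "B = B0 + d"
    have B: "cmod w \<le> B" if "\<rho> w \<noteq> 0" for w
    proof -
      have "infdist w Ks < d"
      proof (rule ccontr)
        assume "\<not> infdist w Ks < d"
        then have "1 \<le> infdist w Ks / d" using d by simp
        then show False using that by (simp add: \<rho>_def)
      qed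
      moreover obtain x where "x \<in> Ks" "infdist w Ks = dist w x"
        using infdist_attains_inf[OF compact_imp_closed[OF \<open>compact Ks\<close>] Ksne] .
      ultimately have x: "x \<in> Ks" "dist w x < d" by auto
      have "cmod w \<le> cmod x + dist w x" using norm_triangle_sub[of w x] by (simp add: dist_norm)
      then show ?thesis using x(2) B0[OF x(1)] by (simp add: B_def)
    qed
    define G where "G = cmod b + N * ((\<bar>B\<bar> + cmod b) / m)"
    have G: "0 \<le> G" using N m by (simp add: G_def)
    have gbd: "cmod (\<delta> (\<beta> t w)) \<le> G" if t: "0 \<le> t" "t \<le> 1" and w: "\<rho> w \<noteq> 0" for t w
    proof -
      have "w - of_real t * b = A t * (\<beta> t w) + of_real t * c * cnj (\<beta> t w)"
        using \<alpha>\<beta>[OF t, of w] by (simp add: \<alpha>_def algebra_simps)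
      then have "m * cmod (\<beta> t w) \<le> cmod (w - of_real t * b)" using expand[OF t, of "\<beta> t w"] by simp
      also have "\<dots> \<le> cmod w + cmod b"
      proof -
        have "t * cmod b \<le> cmod b" using t by (simp add: mult_left_le_one_le)
        then show ?thesis using t norm_triangle_ineq4[of w "of_real t * b"] by (simp add: norm_mult)
      qed
      also have "\<dots> \<le> \<bar>B\<bar> + cmod b" using B[OF w] by simp
      finally have "cmod (\<beta> t w) \<le> (\<bar>B\<bar> + cmod b) / m" using m by (simp add: field_simps)
      then have "N * dist (\<beta> t w) 0 \<le> N * ((\<bar>B\<bar> + cmod b) / m)" using N by (intro mult_left_mono) auto
      moreover have "cmod (\<delta> (\<beta> t w)) \<le> cmod (\<delta> 0) + dist (\<delta> (\<beta> t w)) (\<delta> 0)"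
        using norm_triangle_sub[of "\<delta> (\<beta> t w)" "\<delta> 0"] by (simp add: dist_norm)
      moreover have "\<delta> 0 = b" by (simp add: \<delta>_def)
      ultimately show ?thesis using \<delta>lip[of "\<beta> t w" 0] by (simp add: G_def)
    qed
    define C where "C = G / d + N / m"
    have C: "0 \<le> C" using G N m d by (simp add: C_def)
    \<comment> \<open>The velocity at time \<open>t\<close>, expressed at the moved point
      \<open>w\<close> and cut off by \<open>\<rho>\<close>. Its Lipschitz constant does not depend
      on \<open>t\<close>, so the number of steps can be fixed in advance. The product estimate uses
      that the velocity is bounded by \<open>G\<close> where the cutoff does not vanish.\<close>
    have glip: "dist (of_real (\<rho> w) * \<delta> (\<beta> t w)) (of_real (\<rho> w') * \<delta> (\<beta> t w')) \<le> C * dist w w'"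
      if t: "0 \<le> t" "t \<le> 1" for t w w'
    proof -
      have *: "dist (of_real (\<rho> w) * \<delta> (\<beta> t w)) (of_real (\<rho> w') * \<delta> (\<beta> t w')) \<le> C * dist w w'"
        if w: "\<rho> w \<noteq> 0" for w w'
      proof -
        let ?g = "\<delta> (\<beta> t w)" and ?g' = "\<delta> (\<beta> t w')"
        have "of_real (\<rho> w) * ?g - of_real (\<rho> w') * ?g' = of_real (\<rho> w - \<rho> w') * ?g + of_real (\<rho> w') * (?g - ?g')"
          by (simp add: algebra_simps)
        then have "dist (of_real (\<rho> w) * ?g) (of_real (\<rho> w') * ?g') \<le> cmod (of_real (\<rho> w - \<rho> w') * ?g) + cmod (of_real (\<rho> w') * (?g - ?g'))"
          by (simp add: dist_norm norm_triangle_ineq del: of_real_diff)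
        also have "\<dots> = \<bar>\<rho> w - \<rho> w'\<bar> * cmod ?g + \<rho> w' * dist ?g ?g'"
          using \<rho>r by (simp add: norm_mult dist_norm del: of_real_diff)
        also have "\<dots> \<le> dist w w' / d * G + 1 * (N * (dist w w' / m))"
        proof (intro add_mono mult_mono)
          show "dist ?g ?g' \<le> N * (dist w w' / m)"
          proof -
            have "dist (\<beta> t w) (\<beta> t w') \<le> dist w w' / m" using \<beta>lip[OF t, of w w'] m by (simp add: field_simps)
            then have "N * dist (\<beta> t w) (\<beta> t w') \<le> N * (dist w w' / m)" using N by (intro mult_left_mono)
            then show ?thesis using \<delta>lip[of "\<beta> t w" "\<beta> t w'"] by simp
          qed
        next
          show "\<bar>\<rho> w - \<rho> w'\<bar> \<le> dist w w' / d" by (rule \<rho>lip)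
          show "cmod ?g \<le> G" by (rule gbd[OF t w])
        qed (use \<rho>r d N m in auto)
        also have "\<dots> = C * dist w w'" by (simp add: C_def algebra_simps)
        finally show ?thesis .
      qed
      show ?thesis
      proof (cases "\<rho> w = 0")
        case True
        show ?thesis
        proof (cases "\<rho> w' = 0")
          case True with \<open>\<rho> w = 0\<close> C show ?thesis by simp
        next
          case False
          from *[OF this, of w] show ?thesis by (simp add: dist_commute)
        qed
      qed (rule *)
    qed
    have step: "planar_move U (\<alpha> t ` K) (\<lambda>w. \<alpha> s (\<beta> t w))"
      if t: "0 \<le> t" "t \<le> 1" and s: "0 \<le> s" "s \<le> 1" and st: "\<bar>s - t\<bar> * C < 1" for s t
    proof -
      define \<psi> where "\<psi> w = of_real (s - t) * (of_real (\<rho> w) * \<delta> (\<beta> t w))" for w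
      have lip: "dist (\<psi> w) (\<psi> w') \<le> (\<bar>s - t\<bar> * C) * dist w w'" for w w'
      proof -
        have "dist (\<psi> w) (\<psi> w') = \<bar>s - t\<bar> * dist (of_real (\<rho> w) * \<delta> (\<beta> t w)) (of_real (\<rho> w') * \<delta> (\<beta> t w'))"
          unfolding \<psi>_def dist_norm right_diff_distrib[symmetric] norm_mult norm_of_real by simp
        also have "\<dots> \<le> \<bar>s - t\<bar> * (C * dist w w')" using glip[OF t] by (intro mult_left_mono) auto
        finally show ?thesis by (simp add: algebra_simps)
      qed
      have bc: "bij (\<lambda>w. w + \<psi> w)" "continuous_on UNIV (\<lambda>w. w + \<psi> w)"
        using bij_id_plus_contraction[OF st _ lip] C by auto
      have "w + \<psi> w = \<alpha> s (\<beta> t w)" if "w \<in> \<alpha> t ` K" for w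
      proof -
        have "w \<in> Ks" using that t by (auto simp: Ks_def)
        have "\<alpha> s (\<beta> t w) = \<alpha> t (\<beta> t w) + of_real (s - t) * \<delta> (\<beta> t w)" by (simp add: \<alpha>\<delta> algebra_simps)
        then show ?thesis using \<rho>1[OF \<open>w \<in> Ks\<close>] \<alpha>\<beta>[OF t, of w] by (simp add: \<psi>_def)
      qed
      moreover have "w + \<psi> w = w" if "w \<notin> U" for w using \<rho>0[OF that] by (simp add: \<psi>_def)
      ultimately show ?thesis unfolding planar_move_def using bc by (intro exI[of _ "\<lambda>w. w + \<psi> w"]) auto
    qed
    \<comment> \<open>With more than \<open>C\<close> equal steps every single perturbation has
      Lipschitz constant below 1.\<close>
    obtain n :: nat where n: "C < real n" using reals_Archimedean2 by blast
    then have n0: "0 < real n" using C by linarith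
    have "planar_move U K (\<alpha> (real i / real n))" if "i \<le> n" for i
      using that
    proof (induction i)
      case 0
      show ?case by (rule planar_move_cong[OF planar_move_id]) (simp add: \<alpha>\<delta>)
    next
      case (Suc i)
      let ?t = "real i / real n" and ?s = "real (Suc i) / real n"
      have "planar_move U (\<alpha> ?t ` K) (\<lambda>w. \<alpha> ?s (\<beta> ?t w))"
      proof (rule step)
        have "?s - ?t = 1 / real n" by (simp add: diff_divide_distrib[symmetric])
        then show "\<bar>?s - ?t\<bar> * C < 1" using n n0 by simp
      qed (use Suc n0 in auto)
      moreover have "planar_move U K (\<alpha> ?t)" using Suc by simp
      ultimately have "planar_move U K (\<lambda>z. \<alpha> ?s (\<beta> ?t (\<alpha> ?t z)))" by (rule planar_move_comp[rotated])
      then show ?case using Suc.prems n0 by (elim planar_move_cong) (simp add: \<beta>\<alpha>)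
    qed
    from this[of n] have "planar_move U K (\<alpha> 1)" using n0 by simp
    then show ?thesis by (elim planar_move_cong) (simp add: \<alpha>\<delta> \<delta>_def algebra_simps)
  qed
qed

section \<open>Quadrilateral complexes and their drawings\<close>

type_synonym quad = "nat \<times> nat \<times> nat \<times> nat"

text \<open>The unit ball of this norm is the square whose corners are the fourth roots of unity;
  therefore multiplication by \<open>\<i>\<close> turns a face by one corner.\<close>

definition nd :: "complex \<Rightarrow> real" where "nd z = \<bar>Re z\<bar> + \<bar>Im z\<bar>"

definition diamond :: "real \<Rightarrow> complex set" where "diamond r = {z. nd z \<le> r}"

lemma mem_diamond: "z \<in> diamond r \<longleftrightarrow> nd z \<le> r"
  by (simp add: diamond_def)

lemma nd_nonneg: "0 \<le> nd z"
  by (simp add: nd_def)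

lemma nd_rot: "nd (\<i> * z) = nd z" "nd (\<i> ^ m * z) = nd z" "nd (- z) = nd z"
proof -
  show *: "nd (\<i> * z) = nd z" for z by (simp add: nd_def)
  show "nd (\<i> ^ m * z) = nd z" by (induction m) (simp_all add: * mult.assoc)
  show "nd (- z) = nd z" by (simp add: nd_def)
qed

lemma continuous_on_nd: "continuous_on A nd"
  unfolding nd_def by (intro continuous_intros)

lemma closed_diamond: "closed (diamond r)"
  unfolding diamond_def by (intro closed_Collect_le continuous_on_nd continuous_on_const)

lemma compact_diamond: "compact (diamond r)"
proof -
  have "diamond r \<subseteq> cball 0 r"
  proof
    fix z assume "z \<in> diamond r"
    then show "z \<in> cball 0 r" using cmod_le[of z] by (simp add: diamond_def nd_def)
  qed
  then show ?thesis using closed_diamond by (meson bounded_cball bounded_subset compact_eq_bounded_closed)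
qed

text \<open>The corners \<open>1, \<i>, -1, -\<i>\<close> of the unit diamond stand for the four vertices; a boundary point is
  recorded by its barycentric coordinates with respect to the vertices.\<close>

fun bweight :: "quad \<Rightarrow> complex \<Rightarrow> nat \<Rightarrow> real" where
  "bweight (a, b, c, d) z n =
     (if n = a then max 0 (Re z) else 0) + (if n = b then max 0 (Im z) else 0) +
     (if n = c then max 0 (- Re z) else 0) + (if n = d then max 0 (- Im z) else 0)"

text \<open>Two points of drawn faces are to coincide on the surface exactly when their labels
  agree. Interior points are never identified. Boundary points are identified by their weights
  alone, so an edge is determined by its two ends and the resulting graph is simple.\<close>

definition label :: "quad \<Rightarrow> complex \<Rightarrow> (nat \<Rightarrow> real) + (quad \<times> complex)" where
  "label f z = (if nd z < 1 then Inr (f, z) else Inl (bweight f z))"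

definition drawing :: "'a::topological_space set \<Rightarrow> quad set \<Rightarrow> (quad \<Rightarrow> complex \<Rightarrow> 'a) \<Rightarrow> bool" where
  "drawing S F H \<longleftrightarrow>
     (\<forall>f\<in>F. continuous_on (diamond 1) (H f)) \<and> (\<Union>f\<in>F. H f ` diamond 1) = S \<and>
     (\<forall>f\<in>F. \<forall>f'\<in>F. \<forall>z\<in>diamond 1. \<forall>z'\<in>diamond 1. H f z = H f' z' \<longleftrightarrow> label f z = label f' z')"

fun dedges :: "quad \<Rightarrow> (nat \<times> nat) set" where
  "dedges (a, b, c, d) = {(a, b), (b, c), (c, d), (d, a)}"

fun distinct_quad :: "quad \<Rightarrow> bool" where
  "distinct_quad (a, b, c, d) \<longleftrightarrow> distinct [a, b, c, d]"

fun rotq :: "quad \<Rightarrow> quad" where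
  "rotq (a, b, c, d) = (b, c, d, a)"

definition adjacent :: "quad \<Rightarrow> quad \<Rightarrow> bool" where
  "adjacent f f' \<longleftrightarrow> (\<exists>a b. (a, b) \<in> dedges f \<and> (b, a) \<in> dedges f')"

text \<open>Orientation is built in: a directed edge belongs to one face only, and its reverse
  belongs to some face as well. Connectedness is stated as an induction principle for properties
  passed on between adjacent faces, which is how it is applied.\<close>

definition quad_surface :: "quad set \<Rightarrow> bool" where
  "quad_surface F \<longleftrightarrow> finite F \<and> (\<forall>f\<in>F. distinct_quad f) \<and>
     (\<forall>f\<in>F. \<forall>f'\<in>F. \<forall>e. e \<in> dedges f \<longrightarrow> e \<in> dedges f' \<longrightarrow> f = f') \<and>
     (\<forall>f\<in>F. \<forall>a b. (a, b) \<in> dedges f \<longrightarrow> (\<exists>f'\<in>F. (b, a) \<in> dedges f')) \<and>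
     (\<forall>P. (\<exists>f\<in>F. P f) \<and> (\<forall>f\<in>F. \<forall>f'\<in>F. adjacent f f' \<longrightarrow> P f \<longrightarrow> P f') \<longrightarrow> (\<forall>f\<in>F. P f))"

lemma adjacent_sym: "adjacent f f' \<Longrightarrow> adjacent f' f"
  by (auto simp: adjacent_def)

text \<open>Renaming corners cyclically amounts to turning the diamond. Thus any edge of a face can
  be assumed to run from the corner \<open>1\<close> to the corner \<open>\<i>\<close>.\<close>

lemma bweight_rot: "bweight (rotq f) z = bweight f (\<i> * z)"
  by (cases f) (auto simp: fun_eq_iff)

lemma bweight_rot_pow: "bweight ((rotq ^^ m) f) z = bweight f (\<i> ^ m * z)"
  by (induction m arbitrary: z) (simp_all add: bweight_rot mult.assoc[symmetric] power_commutes)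

lemma dedges_rot: "dedges (rotq f) = dedges f"
  by (cases f) auto

lemma dedges_rot_pow: "dedges ((rotq ^^ m) f) = dedges f"
  by (induction m) (simp_all add: dedges_rot)

lemma distinct_quad_rot_pow: "distinct_quad ((rotq ^^ m) f) = distinct_quad f"
proof -
  have "distinct_quad (rotq f) = distinct_quad f" for f by (cases f) auto
  then show ?thesis by (induction m) simp_all
qed

lemma dedge_rotE:
  assumes "(a, b) \<in> dedges f"
  obtains m c d where "(rotq ^^ m) f = (a, b, c, d)"
proof -
  obtain p q r s where f: "f = (p, q, r, s)" by (cases f) auto
  have "(rotq ^^ 0) f = (p,q,r,s)" "(rotq ^^ Suc 0) f = (q,r,s,p)"
    "(rotq ^^ Suc (Suc 0)) f = (r,s,p,q)" "(rotq ^^ Suc (Suc (Suc 0))) f = (s,p,q,r)"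
    by (simp_all add: f)
  then show ?thesis using assms that unfolding f dedges.simps by blast
qed

lemma bweight_pos_dedge:
  assumes "bweight f z a > 0" "bweight f z b > 0" "a \<noteq> b"
  shows "(a, b) \<in> dedges f \<or> (b, a) \<in> dedges f"
  using assms by (cases f) (auto split: if_splits simp: max_def)

lemma label_eq_iff:
  assumes "nd z \<le> 1" "nd z' \<le> 1"
  shows "label f z = label f' z' \<longleftrightarrow>
    (nd z < 1 \<and> f = f' \<and> z = z') \<or> (nd z = 1 \<and> nd z' = 1 \<and> bweight f z = bweight f' z')"
  using assms by (auto simp: label_def)

lemma drawing_eq_iff:
  assumes "drawing S F H" "f \<in> F" "f' \<in> F" "nd z \<le> 1" "nd z' \<le> 1"
  shows "H f z = H f' z' \<longleftrightarrow>
    (nd z < 1 \<and> f = f' \<and> z = z') \<or> (nd z = 1 \<and> nd z' = 1 \<and> bweight f z = bweight f' z')"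
  using assms label_eq_iff[of z z' f f'] by (auto simp: drawing_def mem_diamond)

lemma drawing_in:
  assumes "drawing S F H" "f \<in> F" "nd z \<le> 1"
  shows "H f z \<in> S"
  using assms by (auto simp: drawing_def mem_diamond)

text \<open>Continuity is asked of \<open>H'\<close> rather than of \<open>k\<close>, because the
  maps \<open>k\<close> used later are defined piecewise on the surface while \<open>H'\<close> has
  one formula on each diamond.\<close>

lemma drawing_transport:
  assumes "drawing S F H" "inj_on k S" "k ` S = T"
    and "\<And>f. f \<in> F \<Longrightarrow> continuous_on (diamond 1) (H' f)"
    and "\<And>f z. f \<in> F \<Longrightarrow> nd z \<le> 1 \<Longrightarrow> H' f z = k (H f z)"
  shows "drawing T F H'"
  unfolding drawing_def
proof (intro conjI ballI)
  have "(\<Union>f\<in>F. H' f ` diamond 1) = k ` (\<Union>f\<in>F. H f ` diamond 1)"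
    using assms(5) unfolding image_UN image_image
    by (intro SUP_cong image_cong) (auto simp: mem_diamond)
  then show "(\<Union>f\<in>F. H' f ` diamond 1) = T" using assms(1,3) by (simp add: drawing_def)
  fix f f' z z' assume *: "f \<in> F" "f' \<in> F" "z \<in> diamond 1" "z' \<in> diamond 1"
  then have "H' f z = H' f' z' \<longleftrightarrow> H f z = H f' z'"
    using assms(5) drawing_in[OF assms(1)] inj_on_eq_iff[OF assms(2)] by (simp add: mem_diamond)
  then show "H' f z = H' f' z' \<longleftrightarrow> label f z = label f' z'" using assms(1) * by (auto simp: drawing_def)
qed (use assms(4) in auto)

section \<open>Tiles across an edge\<close>

text \<open>The open unit diamond, its image under the half turn
  \<open>z \<mapsto> 1 + \<i> - z\<close>, and the open edge between them: a rectangle in the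
  coordinates \<open>Re z + Im z\<close> and \<open>Re z - Im z\<close>.\<close>

definition tile_int :: "complex set" where
  "tile_int = {z. \<bar>Re z - Im z\<bar> < 1 \<and> -1 < Re z + Im z \<and> Re z + Im z < 3}"

definition tile :: "complex set" where
  "tile = {z. \<bar>Re z - Im z\<bar> \<le> 1 \<and> -1 \<le> Re z + Im z \<and> Re z + Im z \<le> 3}"

lemma nd_less_iff: "nd z < r \<longleftrightarrow> \<bar>Re z + Im z\<bar> < r \<and> \<bar>Re z - Im z\<bar> < r"
  unfolding nd_def by linarith

lemma nd_le_iff: "nd z \<le> r \<longleftrightarrow> \<bar>Re z + Im z\<bar> \<le> r \<and> \<bar>Re z - Im z\<bar> \<le> r"
  unfolding nd_def by linarith

lemma open_tile_int: "open tile_int"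
  unfolding tile_int_def by (intro open_Collect_conj open_Collect_less continuous_intros)

lemma convex_strips:
  "convex {z. Re z + Im z < c}" "convex {z. c < Re z + Im z}"
  "convex {z. Re z - Im z < c}" "convex {z. c < Re z - Im z}"
proof -
  have *: "{z. Re z + Im z < c} = {z. inner (Complex 1 1) z < c}" "{z. c < Re z + Im z} = {z. inner (Complex 1 1) z > c}"
    "{z. Re z - Im z < c} = {z. inner (Complex 1 (-1)) z < c}" "{z. c < Re z - Im z} = {z. inner (Complex 1 (-1)) z > c}"
    by (auto simp: inner_complex_def)
  show "convex {z. Re z + Im z < c}" "convex {z. c < Re z + Im z}"
    "convex {z. Re z - Im z < c}" "convex {z. c < Re z - Im z}"
    unfolding * by (rule convex_halfspace_lt convex_halfspace_gt)+
qed

lemma convex_tile_int: "convex tile_int"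
proof -
  have *: "tile_int = {z. Re z + Im z < 3} \<inter> {z. -1 < Re z + Im z} \<inter> ({z. Re z - Im z < 1} \<inter> {z. -1 < Re z - Im z})"
    by (auto simp: tile_int_def)
  show ?thesis unfolding * by (intro convex_Int convex_strips)
qed

text \<open>The half turn exchanges the corners \<open>1\<close> and \<open>\<i>\<close>. This fits
  the orientations: the common edge runs from \<open>a\<close> to \<open>b\<close> in one face and
  from \<open>b\<close> to \<open>a\<close> in the other.\<close>

definition tile_map :: "(quad \<Rightarrow> complex \<Rightarrow> 'a) \<Rightarrow> quad \<Rightarrow> nat \<Rightarrow> quad \<Rightarrow> nat \<Rightarrow> complex \<Rightarrow> 'a" where
  "tile_map H f m f' n z = (if Re z + Im z \<le> 1 then H f (\<i> ^ m * z) else H f' (\<i> ^ n * (1 + \<i> - z)))"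

locale two_tiles =
  fixes S :: "'a::topological_space set" and F H f m f' n a b c d c' d'
  assumes dr: "drawing S F H" and surf: "quad_surface F" and fF: "f \<in> F" "f' \<in> F"
    and g: "(rotq ^^ m) f = (a, b, c, d)" and g': "(rotq ^^ n) f' = (b, a, c', d')"
begin

abbreviation "\<xi> \<equiv> tile_map H f m f' n"

lemma edges: "(a, b) \<in> dedges f" "(b, a) \<in> dedges f'"
  using dedges_rot_pow[of m f] dedges_rot_pow[of n f'] g g' by auto

lemma dist: "distinct [a, b, c, d]" "distinct [b, a, c', d']"
proof -
  have "distinct_quad f" "distinct_quad f'" using surf fF by (auto simp: quad_surface_def)
  then show "distinct [a, b, c, d]" "distinct [b, a, c', d']"
    using distinct_quad_rot_pow[of m f] distinct_quad_rot_pow[of n f'] g g' by auto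
qed

lemma ne: "f \<noteq> f'"
proof
  assume "f = f'"
  then have "(b, a) \<in> dedges f" using edges by simp
  then have "(b, a) \<in> dedges (a, b, c, d)" using dedges_rot_pow[of m f] g by simp
  then show False using dist by auto
qed

lemma bg: "bweight f (\<i> ^ m * z) = bweight (a, b, c, d) z" "bweight f' (\<i> ^ n * z) = bweight (b, a, c', d') z"
  using bweight_rot_pow[of m f z] bweight_rot_pow[of n f' z] g g' by simp_all

lemma seam: assumes "z \<in> tile" "Re z + Im z = 1" shows "H f (\<i> ^ m * z) = H f' (\<i> ^ n * (1 + \<i> - z))"
proof -
  have z: "0 \<le> Re z" "0 \<le> Im z" "Im z = 1 - Re z" using assms by (auto simp: tile_def)
  then have nd: "nd z = 1" "nd (1 + \<i> - z) = 1" by (auto simp: nd_def)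
  have "bweight (a, b, c, d) z = bweight (b, a, c', d') (1 + \<i> - z)"
  proof
    fix n
    have "max 0 (Re z) = Re z" "max 0 (- Re z) = 0" "max 0 (1 - Re z) = 1 - Re z" "max 0 (Re z - 1) = 0"
      using z by auto
    then show "bweight (a, b, c, d) z n = bweight (b, a, c', d') (1 + \<i> - z) n" using z(3) by simp
  qed
  then show ?thesis using drawing_eq_iff[OF dr fF, of "\<i> ^ m * z" "\<i> ^ n * (1 + \<i> - z)"] nd by (simp add: nd_rot bg)
qed

lemma tile_halves:
  assumes "z \<in> tile"
  shows "Re z + Im z \<le> 1 \<Longrightarrow> nd z \<le> 1" "1 \<le> Re z + Im z \<Longrightarrow> nd (1 + \<i> - z) \<le> 1"
  using assms by (auto simp: tile_def nd_def)

lemma continuous: "continuous_on tile \<xi>"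
proof -
  have tile: "tile = {z \<in> tile. Re z + Im z \<le> 1} \<union> {z \<in> tile. 1 \<le> Re z + Im z}" by auto
  have closed: "closed tile" unfolding tile_def
    by (intro closed_Collect_conj closed_Collect_le continuous_intros)
  have H: "continuous_on (diamond 1) (H f)" "continuous_on (diamond 1) (H f')" using dr fF by (auto simp: drawing_def)
  have "continuous_on ({z \<in> tile. Re z + Im z \<le> 1} \<union> {z \<in> tile. 1 \<le> Re z + Im z}) \<xi>"
    unfolding tile_map_def
  proof (rule continuous_on_If)
    have c: "{z \<in> tile. Re z + Im z \<le> 1} = tile \<inter> {z. Re z + Im z \<le> 1}" "{z \<in> tile. 1 \<le> Re z + Im z} = tile \<inter> {z. 1 \<le> Re z + Im z}" by auto
    show "closed {z \<in> tile. Re z + Im z \<le> 1}" "closed {z \<in> tile. 1 \<le> Re z + Im z}" unfolding c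
      using closed by (auto intro!: closed_Int closed_Collect_le continuous_intros)
    show "continuous_on {z \<in> tile. Re z + Im z \<le> 1} (\<lambda>z. H f (\<i> ^ m * z))"
      by (rule continuous_on_compose2[OF H(1)]) (auto intro!: continuous_intros simp: mem_diamond nd_rot tile_halves)
    show "continuous_on {z \<in> tile. 1 \<le> Re z + Im z} (\<lambda>z. H f' (\<i> ^ n * (1 + \<i> - z)))"
      by (rule continuous_on_compose2[OF H(2)]) (auto intro!: continuous_intros simp: mem_diamond nd_rot tile_halves)
  qed (use seam in auto)
  then show ?thesis using tile by simp
qed

text \<open>Only one of the two points may be on the boundary of the tile, since outer edges of the
  tile can be glued to each other on the surface.\<close>

lemma injective:
  assumes z: "z \<in> tile_int" and z': "z' \<in> tile" and eq: "\<xi> z = \<xi> z'"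
  shows "z = z'"
proof -
  let ?w = "1 + \<i> - z" and ?w' = "1 + \<i> - z'"
  have zt: "z \<in> tile" using z by (auto simp: tile_def tile_int_def)
  have le: "Re z + Im z \<le> 1 \<Longrightarrow> nd z \<le> 1" "1 \<le> Re z + Im z \<Longrightarrow> nd ?w \<le> 1" 
     "Re z' + Im z' \<le> 1 \<Longrightarrow> nd z' \<le> 1" "1 \<le> Re z' + Im z' \<Longrightarrow> nd ?w' \<le> 1"
    using tile_halves[OF zt] tile_halves[OF z'] by auto
  consider "Re z + Im z < 1" | "Re z + Im z > 1" | "Re z + Im z = 1" by linarith
  then show ?thesis
  proof cases
    case 1
    then have "nd z < 1" using z by (auto simp: nd_less_iff tile_int_def)
    with 1 show ?thesis using eq le ne drawing_eq_iff[OF dr fF(1) fF(1), of "\<i> ^ m * z" "\<i> ^ m * z'"]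
        drawing_eq_iff[OF dr fF, of "\<i> ^ m * z" "\<i> ^ n * ?w'"]
      by (auto simp: tile_map_def nd_rot split: if_splits)
  next
    case 2
    then have "nd ?w < 1" using z by (auto simp: nd_less_iff tile_int_def)
    with 2 show ?thesis using eq le ne drawing_eq_iff[OF dr fF(2) fF(2), of "\<i> ^ n * ?w" "\<i> ^ n * ?w'"]
        drawing_eq_iff[OF dr fF(2) fF(1), of "\<i> ^ n * ?w" "\<i> ^ m * z'"]
      by (auto simp: tile_map_def nd_rot split: if_splits)
  next
    case 3
    then have pos: "0 < Re z" "0 < Im z" using z by (auto simp: tile_int_def)
    then have nd: "\<not> nd z < 1" using 3 by (simp add: nd_def)
    have wa: "bweight (a, b, c, d) z a = Re z" "bweight (a, b, c, d) z b = Im z" using pos dist by auto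
    show ?thesis
    proof (cases "Re z' + Im z' \<le> 1")
      case True
      then have "bweight (a, b, c, d) z = bweight (a, b, c, d) z'"
        using eq 3 nd le drawing_eq_iff[OF dr fF(1) fF(1), of "\<i> ^ m * z" "\<i> ^ m * z'"]
        by (auto simp: tile_map_def nd_rot bg)
      then have "max 0 (Re z') = Re z" "max 0 (Im z') = Im z"
        using wa dist fun_cong[of "bweight (a, b, c, d) z" "bweight (a, b, c, d) z'"] by (force simp: )+
      then show ?thesis using pos by (auto simp: complex_eq_iff max_def split: if_splits)
    next
      case False
      then have "bweight (a, b, c, d) z = bweight (b, a, c', d') ?w'"
        using eq 3 nd le drawing_eq_iff[OF dr fF, of "\<i> ^ m * z" "\<i> ^ n * ?w'"]
        by (auto simp: tile_map_def nd_rot bg)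
      then have "bweight (b, a, c', d') ?w' a = Re z" "bweight (b, a, c', d') ?w' b = Im z"
        using wa by simp_all
      moreover have "bweight (b, a, c', d') ?w' a = max 0 (1 - Im z')" "bweight (b, a, c', d') ?w' b = max 0 (1 - Re z')"
        using dist by auto
      ultimately show ?thesis using pos 3 False by (auto simp: max_def split: if_splits)
    qed
  qed
qed

text \<open>A point of the open common edge has positive weight at \<open>a\<close> and at
  \<open>b\<close>. A face through it therefore has \<open>(a, b)\<close> or \<open>(b, a)\<close>
  as a directed edge, and each of these belongs to one face only.\<close>

lemma avoids_other_faces:
  assumes z: "z \<in> tile_int" and f'': "f'' \<in> F" "f'' \<noteq> f" "f'' \<noteq> f'" and w: "nd w \<le> 1"
  shows "H f'' w \<noteq> \<xi> z"
proof
  assume eq: "H f'' w = \<xi> z"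
  have zt: "z \<in> tile" using z by (auto simp: tile_def tile_int_def)
  consider "Re z + Im z < 1" | "Re z + Im z > 1" | "Re z + Im z = 1" by linarith
  then show False
  proof cases
    case 1
    then have "nd z < 1" using z by (auto simp: nd_less_iff tile_int_def)
    then show ?thesis using 1 eq w f'' drawing_eq_iff[OF dr fF(1) f''(1), of "\<i> ^ m * z" w]
      by (auto simp: tile_map_def nd_rot)
  next
    case 2
    then have "nd (1 + \<i> - z) < 1" using z by (auto simp: nd_less_iff tile_int_def)
    then show ?thesis using 2 eq w f'' drawing_eq_iff[OF dr fF(2) f''(1), of "\<i> ^ n * (1 + \<i> - z)" w]
      by (auto simp: tile_map_def nd_rot)
  next
    case 3
    then have pos: "0 < Re z" "0 < Im z" using z by (auto simp: tile_int_def)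
    have "nd z \<le> 1" "\<not> nd z < 1" using 3 pos by (auto simp: nd_def)
    then have "bweight (a, b, c, d) z = bweight f'' w"
      using 3 eq w drawing_eq_iff[OF dr fF(1) f''(1), of "\<i> ^ m * z" w] by (auto simp: tile_map_def nd_rot bg)
    moreover have "bweight (a, b, c, d) z a = Re z" "bweight (a, b, c, d) z b = Im z" using pos dist by auto
    ultimately have "(a, b) \<in> dedges f'' \<or> (b, a) \<in> dedges f''"
      using bweight_pos_dedge[of f'' w a b] pos dist by simp
    then show False using edges surf fF f'' unfolding quad_surface_def by metis
  qed
qed

text \<open>The map \<open>h\<close>, read in tile coordinates and extended by the identity, is a
  bijection of the surface; composing the drawing with it gives a new drawing. The extension is
  consistent because \<open>h\<close> fixes everything outside the open tile.\<close>

lemma tile_move: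
  assumes h: "bij h" "continuous_on UNIV h" "\<And>z. z \<notin> tile_int \<Longrightarrow> h z = z"
  obtains H' where "drawing S F H'"
    "\<And>z. nd z \<le> 1 \<Longrightarrow> H' f (\<i> ^ m * z) = \<xi> (h z)"
    "\<And>z. nd z \<le> 1 \<Longrightarrow> H' f' (\<i> ^ n * z) = \<xi> (h (1 + \<i> - z))"
    "\<And>f'' z. f'' \<in> F \<Longrightarrow> f'' \<noteq> f \<Longrightarrow> f'' \<noteq> f' \<Longrightarrow> H' f'' z = H f'' z"
proof -
  define k where "k s = (if s \<in> \<xi> ` tile_int then \<xi> (h (inv_into tile_int \<xi> s)) else s)" for s
  have int_tile: "tile_int \<subseteq> tile" by (auto simp: tile_def tile_int_def)
  have inj: "inj_on \<xi> tile_int" using injective int_tile by (auto intro!: inj_onI)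
  have h_int: "h z \<in> tile_int \<longleftrightarrow> z \<in> tile_int" for z
    using h(1,3) by (metis bij_is_inj injD)
  have h_tile: "h z \<in> tile" if "z \<in> tile" for z
    using that h_int[of z] int_tile h(3)[of z] by (cases "z \<in> tile_int") auto
  have k\<xi>: "k (\<xi> z) = \<xi> (h z)" if "z \<in> tile" for z
  proof (cases "z \<in> tile_int")
    case True then show ?thesis by (simp add: k_def inv_into_f_f[OF inj])
  next
    case False
    then have "\<xi> z \<notin> \<xi> ` tile_int" using injective[of _ z] that by force
    then show ?thesis using False h(3) by (simp add: k_def)
  qed
  have \<xi>S: "\<xi> z \<in> S" if "z \<in> tile" for z
    using that tile_halves[OF that] drawing_in[OF dr] fF by (auto simp: tile_map_def nd_rot)
  have kin: "k s = \<xi> (h (inv_into tile_int \<xi> s)) \<and> h (inv_into tile_int \<xi> s) \<in> tile_int \<and> \<xi> (inv_into tile_int \<xi> s) = s"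
    if "s \<in> \<xi> ` tile_int" for s
    using that by (auto simp: k_def h_int inv_into_into f_inv_into_f inv_into_f_f[OF inj])
  have "inj_on k S"
  proof (rule inj_onI)
    fix s s' assume eq: "k s = k s'"
    show "s = s'"
    proof (cases "s \<in> \<xi> ` tile_int"; cases "s' \<in> \<xi> ` tile_int")
      assume s: "s \<in> \<xi> ` tile_int" "s' \<in> \<xi> ` tile_int"
      then have "h (inv_into tile_int \<xi> s) = h (inv_into tile_int \<xi> s')"
        using kin[OF s(1)] kin[OF s(2)] eq inj by (auto dest: inj_onD)
      then have "inv_into tile_int \<xi> s = inv_into tile_int \<xi> s'" using h(1) by (metis bij_is_inj injD)
      then show ?thesis using kin[OF s(1)] kin[OF s(2)] by metis
    next
      assume s: "s \<in> \<xi> ` tile_int" "s' \<notin> \<xi> ` tile_int"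
      then show ?thesis using kin[OF s(1)] eq by (auto simp: k_def)
    next
      assume s: "s \<notin> \<xi> ` tile_int" "s' \<in> \<xi> ` tile_int"
      then show ?thesis using kin[OF s(2)] eq by (auto simp: k_def)
    qed (use eq in \<open>simp add: k_def\<close>)
  qed
  moreover have "k ` S = S"
  proof
    have "\<xi> (h z) \<in> S" if "z \<in> tile_int" for z
      using \<xi>S[of "h z"] h_int[of z] int_tile that by auto
    then show "k ` S \<subseteq> S" by (auto simp: k_def inv_into_f_f[OF inj])
    show "S \<subseteq> k ` S"
    proof
      fix s assume s: "s \<in> S"
      show "s \<in> k ` S"
      proof (cases "s \<in> \<xi> ` tile_int")
        case True
        then obtain z where z: "z \<in> tile_int" "s = \<xi> z" by auto
        obtain z0 where z0: "z = h z0" using h(1) by (metis bij_pointE)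
        then have "z0 \<in> tile" using z h_int int_tile by auto
        then show ?thesis using k\<xi>[of z0] \<xi>S z z0 by (metis imageI)
      next
        case False then show ?thesis using s by (auto simp: k_def intro!: rev_image_eqI[of s])
      qed
    qed
  qed
  \<comment> \<open>This is \<open>k\<close> after \<open>H\<close>, written out in the tile
    coordinates of the two faces so that continuity can be read off.\<close>
  moreover define H' where "H' f'' w = (if f'' = f then \<xi> (h (w / \<i> ^ m)) else if f'' = f' then \<xi> (h (1 + \<i> - w / \<i> ^ n)) else H f'' w)" for f'' w
  have nd': "nd (w / \<i> ^ m) = nd w" for w m using nd_rot(2)[of m "w / \<i> ^ m"] by simp
  have t1: "w \<in> tile" "1 + \<i> - w \<in> tile" if "nd w \<le> 1" for w
    using that by (auto simp: nd_le_iff tile_def)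
  have ccomp: "continuous_on (diamond 1) (\<lambda>w. \<xi> (h (g w)))" if "continuous_on (diamond 1) g" "\<And>w. w \<in> diamond 1 \<Longrightarrow> g w \<in> tile" for g
  proof (rule continuous_on_compose2[OF continuous])
    show "continuous_on (diamond 1) (\<lambda>w. h (g w))" by (rule continuous_on_compose2[OF h(2) that(1)]) auto
  qed (use that h_tile in auto)
  have "continuous_on (diamond 1) (H' f'')" if f'': "f'' \<in> F" for f''
  proof -
    have "continuous_on (diamond 1) (\<lambda>w. \<xi> (h (w / \<i> ^ m)))" "continuous_on (diamond 1) (\<lambda>w. \<xi> (h (1 + \<i> - w / \<i> ^ n)))"
      by (rule ccomp; (intro continuous_intros)?; auto simp: mem_diamond nd' t1)+
    moreover have "continuous_on (diamond 1) (H f'')" using dr f'' by (auto simp: drawing_def)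
    ultimately show ?thesis using ne by (cases "f'' = f"; cases "f'' = f'") (simp_all add: H'_def[abs_def])
  qed
  moreover have "H' f'' w = k (H f'' w)" if f'': "f'' \<in> F" and w: "nd w \<le> 1" for f'' w
  proof -
    consider "f'' = f" | "f'' = f'" | "f'' \<noteq> f" "f'' \<noteq> f'" by auto
    then show ?thesis
    proof cases
      case 1
      let ?z = "w / \<i> ^ m"
      have "nd ?z \<le> 1" using w nd' by simp
      then have z: "?z \<in> tile" "Re ?z + Im ?z \<le> 1" by (auto simp: nd_le_iff tile_def)
      then have "H f w = \<xi> ?z" by (simp add: tile_map_def)
      then show ?thesis using 1 k\<xi>[OF z(1)] by (simp add: H'_def)
    next
      case 2
      let ?z = "1 + \<i> - w / \<i> ^ n"
      have "nd (w / \<i> ^ n) \<le> 1" using w nd' by simp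
      then have z: "?z \<in> tile" "1 \<le> Re ?z + Im ?z" by (auto simp: nd_le_iff tile_def)
      then have "H f' w = \<xi> ?z" using seam[OF z(1)] by (auto simp: tile_map_def)
      then show ?thesis using 2 k\<xi>[OF z(1)] ne by (simp add: H'_def)
    next
      case 3
      then have "H f'' w \<notin> \<xi> ` tile_int" using avoids_other_faces[OF _ f'' _ _ w] by auto
      then show ?thesis using 3 by (simp add: H'_def k_def)
    qed
  qed
  ultimately have "drawing S F H'" by (intro drawing_transport[OF dr]) auto
  then show ?thesis using ne by (intro that[of H']) (auto simp: H'_def)
qed

end

section \<open>Moving half-size diamonds\<close>

lemma nd_open_convex: "open {z. nd z < r}" "convex {z. nd z < r}"
proof -
  show "open {z. nd z < r}" by (intro open_Collect_less continuous_on_nd continuous_on_const)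
  have *: "{z. nd z < r} = {z. Re z + Im z < r} \<inter> {z. -r < Re z + Im z} \<inter> ({z. Re z - Im z < r} \<inter> {z. -r < Re z - Im z})"
    by (auto simp: nd_less_iff)
  show "convex {z. nd z < r}" unfolding * by (intro convex_Int convex_strips)
qed

text \<open>Multiplication about \<open>p\<close> by a factor with positive real part is an
  admissible affine move. Chains of such factors also reach rotations whose own factor has no
  positive real part.\<close>

lemma planar_move_scale:
  assumes "planar_move U K (\<lambda>z. p + A * (z - p))" "open U" "convex U" "compact K" "0 < Re a"
    and "\<And>z. z \<in> K \<Longrightarrow> p + A * (z - p) \<in> U" "\<And>z. z \<in> K \<Longrightarrow> p + a * A * (z - p) \<in> U"
  shows "planar_move U K (\<lambda>z. p + a * A * (z - p))"
proof -
  have "planar_move U ((\<lambda>z. p + A * (z - p)) ` K) (\<lambda>w. (p - a * p) + a * w + 0 * cnj w)"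
  proof (rule planar_move_affine)
    show "compact ((\<lambda>z. p + A * (z - p)) ` K)"
      by (intro compact_continuous_image continuous_intros assms(4))
  qed (use assms in \<open>auto simp: algebra_simps\<close>)
  from planar_move_comp[OF assms(1) this] show ?thesis
    by (elim planar_move_cong) (simp add: algebra_simps)
qed

lemma half_diamondD:
  assumes "z \<in> diamond (1/2)"
  shows "- 1 \<le> 2 * Re z + 2 * Im z \<and> 2 * Re z + 2 * Im z \<le> 1 \<and> - 1 \<le> 2 * Re z - 2 * Im z \<and> 2 * Re z - 2 * Im z \<le> 1 \<and> nd z \<le> 1"
  using assms unfolding mem_diamond nd_def by (intro conjI) linarith+

text \<open>The factor \<open>\<i>\<close> is the product of \<open>1/4\<close>, twice
  \<open>1 + \<i>\<close>, and \<open>2\<close>. The shrinking comes at the beginning so that all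
  intermediate images stay inside the open diamond.\<close>

lemma planar_move_quarter_turn: "planar_move {z. nd z < 1} (diamond (1/2)) (\<lambda>z. \<i> * z)"
proof -
  note sc = planar_move_scale[where p = 0 and U = "{z. nd z < 1}" and K = "diamond (1/2)", OF _ nd_open_convex compact_diamond]
  have 0: "planar_move {z. nd z < 1} (diamond (1/2)) (\<lambda>z. 0 + 1 * (z - 0))"
    by (rule planar_move_cong[OF planar_move_id]) simp
  have 1: "planar_move {z. nd z < 1} (diamond (1/2)) (\<lambda>z. 0 + (1/4) * 1 * (z - 0))"
    by (rule sc[OF 0]) (auto simp: nd_less_iff abs_less_iff field_simps dest!: half_diamondD)
  have 2: "planar_move {z. nd z < 1} (diamond (1/2)) (\<lambda>z. 0 + (1 + \<i>) * ((1/4) * 1) * (z - 0))"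
    by (rule sc[OF 1]) (auto simp: nd_less_iff abs_less_iff field_simps dest!: half_diamondD)
  have 3: "planar_move {z. nd z < 1} (diamond (1/2)) (\<lambda>z. 0 + (1 + \<i>) * ((1 + \<i>) * ((1/4) * 1)) * (z - 0))"
    by (rule sc[OF 2]) (auto simp: nd_less_iff abs_less_iff field_simps dest!: half_diamondD)
  have 4: "planar_move {z. nd z < 1} (diamond (1/2)) (\<lambda>z. 0 + 2 * ((1 + \<i>) * ((1 + \<i>) * ((1/4) * 1))) * (z - 0))"
    by (rule sc[OF 3]) (auto simp: nd_less_iff abs_less_iff field_simps dest!: half_diamondD)
  show ?thesis by (rule planar_move_cong[OF 4]) (simp add: complex_eq_iff)
qed

text \<open>Since the fourth power of \<open>1 + \<i>\<close> is \<open>- 4\<close>, the factors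
  \<open>1/8\<close>, four times \<open>1 + \<i>\<close>, and \<open>2\<close> multiply to
  \<open>- 1\<close>. The centre \<open>p\<close> is the midpoint of the common edge, and the result
  exchanges the two half-size diamonds.\<close>

lemma planar_move_half_turn:
  "planar_move tile_int (diamond (1/2) \<union> (\<lambda>z. 1 + \<i> - z) ` diamond (1/2)) (\<lambda>z. 1 + \<i> - z)"
proof -
  define K where "K = diamond (1/2) \<union> (\<lambda>z. 1 + \<i> - z) ` diamond (1/2)"
  define p where "p = (1 + \<i>) / 2"
  have p: "Re p = 1/2" "Im p = 1/2" by (simp_all add: p_def)
  have K: "compact K" unfolding K_def
    by (intro compact_Un compact_continuous_image continuous_intros compact_diamond)
  have bd: "- 1 \<le> 2 * Re z - 2 * Im z \<and> 2 * Re z - 2 * Im z \<le> 1 \<and> - 1 \<le> 2 * Re z + 2 * Im z \<and> 2 * Re z + 2 * Im z \<le> 5" if "z \<in> K" for z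
    using that unfolding K_def by (auto dest!: half_diamondD)
  note sc = planar_move_scale[where p = p and U = tile_int and K = K, OF _ open_tile_int convex_tile_int K]
  have 0: "planar_move tile_int K (\<lambda>z. p + 1 * (z - p))"
    by (rule planar_move_cong[OF planar_move_id]) simp
  have 1: "planar_move tile_int K (\<lambda>z. p + (1/8) * 1 * (z - p))"
    by (rule sc[OF 0]) (auto simp: tile_int_def p abs_less_iff field_simps dest!: bd, (linarith+)?)
  have 2: "planar_move tile_int K (\<lambda>z. p + (1 + \<i>) * ((1/8) * 1) * (z - p))"
    by (rule sc[OF 1]) (auto simp: tile_int_def p abs_less_iff field_simps dest!: bd, (linarith+)?)
  have 3: "planar_move tile_int K (\<lambda>z. p + (1 + \<i>) * ((1 + \<i>) * ((1/8) * 1)) * (z - p))"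
    by (rule sc[OF 2]) (auto simp: tile_int_def p abs_less_iff field_simps dest!: bd, (linarith+)?)
  have 4: "planar_move tile_int K (\<lambda>z. p + (1 + \<i>) * ((1 + \<i>) * ((1 + \<i>) * ((1/8) * 1))) * (z - p))"
    by (rule sc[OF 3]) (auto simp: tile_int_def p abs_less_iff field_simps dest!: bd, (linarith+)?)
  have 5: "planar_move tile_int K (\<lambda>z. p + (1 + \<i>) * ((1 + \<i>) * ((1 + \<i>) * ((1 + \<i>) * ((1/8) * 1)))) * (z - p))"
    by (rule sc[OF 4]) (auto simp: tile_int_def p abs_less_iff field_simps dest!: bd, (linarith+)?)
  have 6: "planar_move tile_int K (\<lambda>z. p + 2 * ((1 + \<i>) * ((1 + \<i>) * ((1 + \<i>) * ((1 + \<i>) * ((1/8) * 1))))) * (z - p))"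
    by (rule sc[OF 5]) (auto simp: tile_int_def p abs_less_iff field_simps dest!: bd, (linarith+)?)
  show ?thesis unfolding K_def[symmetric]
    by (rule planar_move_cong[OF 6]) (simp add: complex_eq_iff p field_simps)
qed

section \<open>Rotating and exchanging germs of faces\<close>

lemma neighbourE:
  assumes "quad_surface F" "f \<in> F"
  obtains f' a b c d n c' d' where "f' \<in> F" "f = (a, b, c, d)" "(rotq ^^ n) f' = (b, a, c', d')"
proof -
  obtain a b c d where f: "f = (a, b, c, d)" by (cases f) auto
  then obtain f' where f': "f' \<in> F" "(b, a) \<in> dedges f'"
    using assms unfolding quad_surface_def by (metis dedges.simps insertI1)
  obtain n c' d' where "(rotq ^^ n) f' = (b, a, c', d')" using dedge_rotE[OF f'(2)] .
  then show ?thesis using that f f' by blast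
qed

text \<open>The quarter turn is supported in the open diamond of \<open>f\<close> alone; the
  neighbouring face is there only to make up a tile.\<close>

lemma rotate_germ:
  assumes dr: "drawing S F H" and surf: "quad_surface F" and f: "f \<in> F"
  shows "\<exists>H'. drawing S F H' \<and> (\<forall>z\<in>diamond (1/2). H' f z = H f (\<i> ^ k * z)) \<and>
    (\<forall>f'\<in>F - {f}. \<forall>z\<in>diamond (1/2). H' f' z = H f' z)"
proof (induction k)
  case 0
  then show ?case using dr by auto
next
  case (Suc k)
  then obtain H1 where H1: "drawing S F H1" "\<And>z. z \<in> diamond (1/2) \<Longrightarrow> H1 f z = H f (\<i> ^ k * z)"
    "\<And>f' z. f' \<in> F - {f} \<Longrightarrow> z \<in> diamond (1/2) \<Longrightarrow> H1 f' z = H f' z" by metis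
  obtain f' a b c d n c' d' where n: "f' \<in> F" "f = (a, b, c, d)" "(rotq ^^ n) f' = (b, a, c', d')"
    using neighbourE[OF surf f] .
  interpret two_tiles S F H1 f 0 f' n a b c d c' d'
    by unfold_locales (use H1 surf f n in auto)
  obtain h where h: "bij h" "continuous_on UNIV h" "\<And>z. \<not> nd z < 1 \<Longrightarrow> h z = z" "\<And>z. z \<in> diamond (1/2) \<Longrightarrow> h z = \<i> * z"
    using planar_move_quarter_turn unfolding planar_move_def by auto
  have h3: "h z = z" if "z \<notin> tile_int" for z
    using h(3) that by (auto simp: tile_int_def nd_less_iff)
  obtain H2 where H2: "drawing S F H2" "\<And>z. nd z \<le> 1 \<Longrightarrow> H2 f (\<i> ^ 0 * z) = \<xi> (h z)"
    "\<And>z. nd z \<le> 1 \<Longrightarrow> H2 f' (\<i> ^ n * z) = \<xi> (h (1 + \<i> - z))"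
    "\<And>f'' z. f'' \<in> F \<Longrightarrow> f'' \<noteq> f \<Longrightarrow> f'' \<noteq> f' \<Longrightarrow> H2 f'' z = H1 f'' z"
    using tile_move[OF h(1,2) h3] by metis
  have "H2 f z = H f (\<i> ^ Suc k * z)" if z: "z \<in> diamond (1/2)" for z
  proof -
    have iz: "\<i> * z \<in> diamond (1/2)" using z by (simp add: mem_diamond nd_rot)
    have "H2 f z = \<xi> (\<i> * z)" using H2(2)[of z] h(4)[OF z] z by (simp add: mem_diamond)
    also have "\<dots> = H1 f (\<i> * z)" using half_diamondD[OF iz] by (auto simp: tile_map_def)
    finally show ?thesis using H1(2)[OF iz] by (simp add: algebra_simps)
  qed
  moreover have "H2 f'' z = H f'' z" if f'': "f'' \<in> F - {f}" and z: "z \<in> diamond (1/2)" for f'' z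
  proof (cases "f'' = f'")
    case True
    define w where "w = z / \<i> ^ n"
    have zw: "z = \<i> ^ n * w" by (simp add: w_def)
    then have w: "nd w \<le> 1/2" using z nd_rot(2)[of n w] by (simp add: mem_diamond)
    then have s: "\<not> Re (1 + \<i> - w) + Im (1 + \<i> - w) \<le> 1"
      using half_diamondD[of w] by (auto simp: mem_diamond)
    then have "\<not> nd (1 + \<i> - w) < 1" by (auto simp: nd_less_iff)
    then have "H2 f' z = H1 f' z" using H2(3)[of w] w h(3) s unfolding zw by (simp add: tile_map_def)
    then show ?thesis using H1(3)[OF f'' z] True by simp
  next
    case False then show ?thesis using H2(4) H1(3) f'' z by auto
  qed
  ultimately show ?case using H2(1) by blast
qed

lemma i_pow_4: "\<i> ^ n * (\<i> ^ (3 * n) * z) = z"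
proof -
  have "\<i> ^ n * \<i> ^ (3 * n) = (\<i> ^ 4) ^ n" by (simp add: power_add[symmetric] power_mult[symmetric])
  then show ?thesis by (simp add: mult.assoc[symmetric])
qed

definition swp :: "'b \<Rightarrow> 'b \<Rightarrow> 'b \<Rightarrow> 'b" where
  "swp f f' x = (if x = f then f' else if x = f' then f else x)"

text \<open>Only the germs on half-size diamonds are prescribed, the rest of the face maps may
  change. Quantifying over all drawings makes the realisable rearrangements closed under
  composition.\<close>

definition realisable :: "'a::topological_space set \<Rightarrow> quad set \<Rightarrow> (quad \<Rightarrow> quad) \<Rightarrow> bool" where
  "realisable S F \<pi> \<longleftrightarrow> (\<forall>f\<in>F. \<pi> f \<in> F) \<and> (\<forall>H. drawing S F H \<longrightarrow>
     (\<exists>H'. drawing S F H' \<and> (\<forall>f\<in>F. \<forall>z\<in>diamond (1/2). H' (\<pi> f) z = H f z)))"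

lemma realisable_comp:
  assumes "realisable S F \<pi>" "realisable S F \<rho>"
  shows "realisable S F (\<lambda>f. \<rho> (\<pi> f))"
  unfolding realisable_def
proof (intro conjI allI impI)
  show "\<forall>f\<in>F. \<rho> (\<pi> f) \<in> F" using assms by (simp add: realisable_def)
  fix H assume "drawing S F H"
  then obtain H1 where H1: "drawing S F H1" "\<forall>f\<in>F. \<forall>z\<in>diamond (1/2). H1 (\<pi> f) z = H f z"
    using assms(1) unfolding realisable_def by blast
  then obtain H2 where H2: "drawing S F H2" "\<forall>f\<in>F. \<forall>z\<in>diamond (1/2). H2 (\<rho> f) z = H1 f z"
    using assms(2) unfolding realisable_def by blast
  have "\<pi> f \<in> F" if "f \<in> F" for f using assms(1) that by (auto simp: realisable_def)
  then show "\<exists>H'. drawing S F H' \<and> (\<forall>f\<in>F. \<forall>z\<in>diamond (1/2). H' (\<rho> (\<pi> f)) z = H f z)"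
    using H1 H2 by (intro exI[of _ H2]) auto
qed

text \<open>The half turn of the tile exchanges the two germs up to the rotations that brought the
  common edge into standard position. These rotations are undone afterwards, one face at a
  time.\<close>

lemma realisable_swp_adjacent:
  assumes surf: "quad_surface F" and f: "f \<in> F" "f' \<in> F" "adjacent f f'"
  shows "realisable S F (swp f f')"
  unfolding realisable_def
proof (intro conjI allI impI)
  show "\<forall>x\<in>F. swp f f' x \<in> F" using f by (simp add: swp_def)
  fix H assume dr: "drawing S F H"
  obtain a b where ab: "(a, b) \<in> dedges f" "(b, a) \<in> dedges f'" using f by (auto simp: adjacent_def)
  obtain m c d where m: "(rotq ^^ m) f = (a, b, c, d)" using dedge_rotE[OF ab(1)] .
  obtain n c' d' where n: "(rotq ^^ n) f' = (b, a, c', d')" using dedge_rotE[OF ab(2)] .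
  interpret two_tiles S F H f m f' n a b c d c' d'
    by unfold_locales (use dr surf f m n in auto)
  obtain h where h: "bij h" "continuous_on UNIV h" "\<And>z. z \<notin> tile_int \<Longrightarrow> h z = z"
    "\<And>z. z \<in> diamond (1/2) \<union> (\<lambda>z. 1 + \<i> - z) ` diamond (1/2) \<Longrightarrow> h z = 1 + \<i> - z"
    using planar_move_half_turn unfolding planar_move_def by metis
  obtain H1 where H1: "drawing S F H1" "\<And>z. nd z \<le> 1 \<Longrightarrow> H1 f (\<i> ^ m * z) = \<xi> (h z)"
    "\<And>z. nd z \<le> 1 \<Longrightarrow> H1 f' (\<i> ^ n * z) = \<xi> (h (1 + \<i> - z))"
    "\<And>f'' z. f'' \<in> F \<Longrightarrow> f'' \<noteq> f \<Longrightarrow> f'' \<noteq> f' \<Longrightarrow> H1 f'' z = H f'' z"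
    using tile_move[OF h(1-3)] by metis
  have sw: "H1 f (\<i> ^ m * z) = H f' (\<i> ^ n * z)" "H1 f' (\<i> ^ n * z) = H f (\<i> ^ m * z)" if z: "z \<in> diamond (1/2)" for z
  proof -
    have s: "\<not> Re (1 + \<i> - z) + Im (1 + \<i> - z) \<le> 1" "Re z + Im z \<le> 1" "nd z \<le> 1"
      using half_diamondD[OF z] by auto
    show "H1 f (\<i> ^ m * z) = H f' (\<i> ^ n * z)" using H1(2)[of z] h(4)[of z] s z by (simp add: tile_map_def)
    show "H1 f' (\<i> ^ n * z) = H f (\<i> ^ m * z)" using H1(3)[of z] h(4)[of "1 + \<i> - z"] s z by (simp add: tile_map_def)
  qed
  \<comment> \<open>The power \<open>\<i> ^ (3 * n)\<close> is the inverse of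
    \<open>\<i> ^ n\<close>: the exponent supplies the rotation belonging to \<open>f\<close> and
    cancels the one belonging to \<open>f'\<close>.\<close>
  obtain H2 where H2: "drawing S F H2" "\<And>z. z \<in> diamond (1/2) \<Longrightarrow> H2 f z = H1 f (\<i> ^ (m + 3 * n) * z)"
    "\<And>f'' z. f'' \<in> F - {f} \<Longrightarrow> z \<in> diamond (1/2) \<Longrightarrow> H2 f'' z = H1 f'' z"
    using rotate_germ[OF H1(1) surf f(1), of "m + 3 * n"] by metis
  obtain H3 where H3: "drawing S F H3" "\<And>z. z \<in> diamond (1/2) \<Longrightarrow> H3 f' z = H2 f' (\<i> ^ (n + 3 * m) * z)"
    "\<And>f'' z. f'' \<in> F - {f'} \<Longrightarrow> z \<in> diamond (1/2) \<Longrightarrow> H3 f'' z = H2 f'' z"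
    using rotate_germ[OF H2(1) surf f(2), of "n + 3 * m"] by metis
  have rot: "\<i> ^ j * z \<in> diamond (1/2)" if "z \<in> diamond (1/2)" for j z
    using that by (simp add: mem_diamond nd_rot)
  have "H3 (swp f f' x) z = H x z" if x: "x \<in> F" and z: "z \<in> diamond (1/2)" for x z
  proof -
    consider "x = f" | "x = f'" | "x \<noteq> f" "x \<noteq> f'" by auto
    then show ?thesis
    proof cases
      case 1
      have "H3 f' z = H1 f' (\<i> ^ n * (\<i> ^ (3 * m) * z))"
        using H3(2)[OF z] H2(3)[of f' "\<i> ^ (n + 3 * m) * z"] rot[OF z] ne f
        by (metis Diff_iff mult.assoc power_add singletonD)
      also have "\<dots> = H f z" using sw(2) rot[OF z] i_pow_4 by metis
      finally show ?thesis using 1 by (simp add: swp_def)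
    next
      case 2
      have "H3 f z = H1 f (\<i> ^ m * (\<i> ^ (3 * n) * z))"
        using H3(3)[of f z] H2(2)[OF z] z ne f by (simp add: power_add mult.assoc)
      also have "\<dots> = H f' z" using sw(1) rot[OF z] i_pow_4 by metis
      finally show ?thesis using 2 ne by (simp add: swp_def)
    next
      case 3 then show ?thesis using H1(4)[OF x] H2(3)[of x z] H3(3)[of x z] x z by (simp add: swp_def)
    qed
  qed
  then show "\<exists>H'. drawing S F H' \<and> (\<forall>x\<in>F. \<forall>z\<in>diamond (1/2). H' (swp f f' x) z = H x z)"
    using H3(1) by blast
qed

text \<open>Adjacent transpositions along a connected graph generate all transpositions.\<close>

lemma realisable_swp:
  assumes surf: "quad_surface F" and f: "f \<in> F" "f' \<in> F"
  shows "realisable S F (swp f f')"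
proof -
  have id: "realisable S F (swp f f)" by (auto simp: realisable_def swp_def)
  have conn: "(\<exists>x\<in>F. P x) \<and> (\<forall>x\<in>F. \<forall>x'\<in>F. adjacent x x' \<longrightarrow> P x \<longrightarrow> P x') \<Longrightarrow> \<forall>x\<in>F. P x" for P
  proof -
    assume "(\<exists>x\<in>F. P x) \<and> (\<forall>x\<in>F. \<forall>x'\<in>F. adjacent x x' \<longrightarrow> P x \<longrightarrow> P x')"
    moreover have "\<forall>P. (\<exists>f\<in>F. P f) \<and> (\<forall>f\<in>F. \<forall>f'\<in>F. adjacent f f' \<longrightarrow> P f \<longrightarrow> P f') \<longrightarrow> (\<forall>f\<in>F. P f)"
      using surf unfolding quad_surface_def by (elim conjE)
    ultimately show ?thesis by (elim allE[of _ P] mp)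
  qed
  have "\<forall>x\<in>F. realisable S F (swp f x)"
  proof (rule conn, intro conjI ballI impI)
    show "\<exists>x\<in>F. realisable S F (swp f x)" using id f by blast
    fix x x' assume x: "x \<in> F" "x' \<in> F" "adjacent x x'" "realisable S F (swp f x)"
    have a: "realisable S F (swp x x')" using realisable_swp_adjacent[OF surf x(1-3)] .
    show "realisable S F (swp f x')"
    proof (cases "f = x \<or> f = x'")
      case True then show ?thesis using a id by auto
    next
      case False
      \<comment> \<open>Conjugating the transposition of \<open>f\<close> and \<open>x\<close> by
        that of \<open>x\<close> and \<open>x'\<close> yields the transposition of \<open>f\<close>
        and \<open>x'\<close>.\<close>
      have "realisable S F (\<lambda>y. swp x x' (swp f x (swp x x' y)))"
        using realisable_comp[OF realisable_comp[OF a x(4)] a] .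
      moreover have "(\<lambda>y. swp x x' (swp f x (swp x x' y))) = swp f x'"
        using False by (auto simp: fun_eq_iff swp_def)
      ultimately show ?thesis by simp
    qed
  qed
  then show ?thesis using f by blast
qed

text \<open>Two transpositions suffice. The second one leaves \<open>f'\<close> alone, because
  \<open>f'\<close> is neither the target \<open>g'\<close> nor the place of the second germ after
  the first transposition.\<close>

lemma relocate_two_germs:
  assumes surf: "quad_surface F" and dr: "drawing S F H" and f: "f \<in> F" "g \<in> F" "f \<noteq> g"
    and f': "f' \<in> F" "g' \<in> F" "f' \<noteq> g'"
  obtains H' where "drawing S F H'" "\<And>z. z \<in> diamond (1/2) \<Longrightarrow> H' f' z = H f z"
    "\<And>z. z \<in> diamond (1/2) \<Longrightarrow> H' g' z = H g z"
proof -
  let ?g1 = "swp f f' g"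
  have g1: "?g1 \<in> F" using f f' by (simp add: swp_def)
  from realisable_comp[OF realisable_swp[OF surf f(1) f'(1)] realisable_swp[OF surf g1 f'(2)]]
  obtain H' where H': "drawing S F H'" "\<And>x z. x \<in> F \<Longrightarrow> z \<in> diamond (1/2) \<Longrightarrow> H' (swp ?g1 g' (swp f f' x)) z = H x z"
    using dr unfolding realisable_def by blast
  have "swp ?g1 g' (swp f f' f) = f'" "swp ?g1 g' (swp f f' g) = g'"
    using f f' by (auto simp: swp_def)
  then show ?thesis using that[OF H'(1)] H'(2)[OF f(1)] H'(2)[OF f(2)] by simp
qed

text \<open>The two germs lie on opposite sides of the line \<open>Re z + Im z = 0\<close>, so the neighbouring face can
  be pulled to the second one without disturbing the first.\<close>

lemma split_germ:
  assumes surf: "quad_surface F" and dr: "drawing S F H" and f: "f \<in> F"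
    and \<alpha>: "\<And>z. \<alpha> z = p + a * z + c * cnj z" "cmod c < Re a"
    and \<beta>: "\<And>z. \<beta> z = q - (b * z + d * cnj z)" "cmod d < Re b"
    and \<alpha>im: "\<And>z. z \<in> diamond (1/2) \<Longrightarrow> nd (\<alpha> z) < 1 \<and> Re (\<alpha> z) + Im (\<alpha> z) < 0"
    and \<beta>im: "\<And>z. z \<in> diamond (1/2) \<Longrightarrow> nd (\<beta> z) < 1 \<and> 0 < Re (\<beta> z) + Im (\<beta> z)"
  shows "\<exists>f'\<in>F. \<exists>H'. f' \<noteq> f \<and> drawing S F H' \<and>
    (\<forall>z\<in>diamond (1/2). H' f z = H f (\<alpha> z) \<and> H' f' z = H f (\<beta> z))"
proof -
  obtain f' x y v w n v' w' where n: "f' \<in> F" "f = (x, y, v, w)" "(rotq ^^ n) f' = (y, x, v', w')"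
    using neighbourE[OF surf f] .
  interpret two_tiles S F H f 0 f' n x y v w v' w'
    by unfold_locales (use dr surf f n in auto)
  have "planar_move {z. nd z < 1} (diamond (1/2)) (\<lambda>z. p + a * z + c * cnj z)"
    using \<alpha>im by (intro planar_move_affine nd_open_convex compact_diamond \<alpha>(2)) (auto simp: \<alpha>(1) mem_diamond)
  then obtain h1 where h1: "bij h1" "continuous_on UNIV h1" "\<And>z. \<not> nd z < 1 \<Longrightarrow> h1 z = z" "\<And>z. z \<in> diamond (1/2) \<Longrightarrow> h1 z = \<alpha> z"
    unfolding planar_move_def \<alpha>(1) by auto
  \<comment> \<open>In the tile, the germ of the neighbour sits at \<open>1 + \<i> - z\<close>. Its
    move is confined to the side of the line where the image of \<open>\<alpha>\<close> does not
    lie.\<close>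
  let ?U = "tile_int \<inter> {z. 0 < Re z + Im z}" and ?K = "(\<lambda>z. 1 + \<i> - z) ` diamond (1/2)"
  \<comment> \<open>The half turn absorbs the minus sign in \<open>\<beta>\<close>: in the
    coordinate \<open>w\<close> of the tile the map has the coefficients \<open>b\<close> and
    \<open>d\<close>, and thus the form that can be realised.\<close>
  have \<beta>': "\<beta> (1 + \<i> - w) = (q - b * (1 + \<i>) - d * (1 - \<i>)) + b * w + d * cnj w" for w
    by (simp add: \<beta>(1) algebra_simps)
  have "planar_move ?U ?K (\<lambda>w. (q - b * (1 + \<i>) - d * (1 - \<i>)) + b * w + d * cnj w)"
  proof (rule planar_move_affine)
    show "open ?U" by (intro open_Int open_tile_int open_Collect_less continuous_intros)
    show "convex ?U" by (intro convex_Int convex_tile_int convex_strips)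
    show "compact ?K" by (intro compact_continuous_image continuous_intros compact_diamond)
    show "?K \<subseteq> ?U" by (auto simp: tile_int_def abs_less_iff dest!: half_diamondD)
    show "cmod d < Re b" by (rule \<beta>(2))
    have "\<beta> z \<in> ?U" if "z \<in> diamond (1/2)" for z
      using \<beta>im[OF that] by (auto simp: nd_less_iff tile_int_def)
    then show "(\<lambda>w. (q - b * (1 + \<i>) - d * (1 - \<i>)) + b * w + d * cnj w) ` ?K \<subseteq> ?U"
      unfolding \<beta>'[symmetric] by auto
  qed
  then obtain h2 where h2: "bij h2" "continuous_on UNIV h2" "\<And>z. z \<notin> ?U \<Longrightarrow> h2 z = z" "\<And>z. z \<in> ?K \<Longrightarrow> h2 z = \<beta> (1 + \<i> - z)"
    unfolding planar_move_def \<beta>'[symmetric] by metis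
  \<comment> \<open>\<open>h1\<close> fixes the half diamond of the neighbour, which lies outside
    the open unit diamond, and \<open>h2\<close> fixes the image of \<open>\<alpha>\<close>. So the
    composite moves each of the two pieces as intended.\<close>
  define h where "h = h2 \<circ> h1"
  have "bij h" unfolding h_def using bij_comp[OF h1(1) h2(1)] .
  moreover have "continuous_on UNIV h" using continuous_on_compose2[OF h2(2) h1(2)] by (simp add: h_def o_def)
  moreover have "h z = z" if "z \<notin> tile_int" for z
  proof -
    have "\<not> nd z < 1" using that by (auto simp: tile_int_def nd_less_iff)
    then show ?thesis using that h1(3) h2(3) by (simp add: h_def)
  qed
  ultimately obtain H1 where H1: "drawing S F H1" "\<And>z. nd z \<le> 1 \<Longrightarrow> H1 f (\<i> ^ 0 * z) = \<xi> (h z)"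
    "\<And>z. nd z \<le> 1 \<Longrightarrow> H1 f' (\<i> ^ n * z) = \<xi> (h (1 + \<i> - z))"
    "\<And>f'' z. f'' \<in> F \<Longrightarrow> f'' \<noteq> f \<Longrightarrow> f'' \<noteq> f' \<Longrightarrow> H1 f'' z = H f'' z"
    using tile_move[of h] by metis
  have 1: "H1 f z = H f (\<alpha> z)" if z: "z \<in> diamond (1/2)" for z
  proof -
    have "h z = \<alpha> z" using h1(4)[OF z] \<alpha>im[OF z] h2(3)[of "\<alpha> z"] by (simp add: h_def)
    then show ?thesis using H1(2)[of z] z \<alpha>im[OF z] by (auto simp: mem_diamond tile_map_def)
  qed
  have 2: "H1 f' (\<i> ^ n * z) = H f (\<beta> z)" if z: "z \<in> diamond (1/2)" for z
  proof -
    have "\<not> nd (1 + \<i> - z) < 1" using z using half_diamondD[OF z] by (auto simp: nd_less_iff)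
    then have "h (1 + \<i> - z) = \<beta> z" using h1(3) h2(4)[of "1 + \<i> - z"] z by (simp add: h_def)
    moreover have "Re (\<beta> z) + Im (\<beta> z) \<le> 1" using \<beta>im[OF z] by (auto simp: nd_less_iff)
    ultimately show ?thesis using H1(3)[of z] z by (auto simp: mem_diamond tile_map_def)
  qed
  obtain H2 where H2: "drawing S F H2" "\<And>z. z \<in> diamond (1/2) \<Longrightarrow> H2 f' z = H1 f' (\<i> ^ n * z)"
    "\<And>f'' z. f'' \<in> F - {f'} \<Longrightarrow> z \<in> diamond (1/2) \<Longrightarrow> H2 f'' z = H1 f'' z"
    using rotate_germ[OF H1(1) surf n(1), of n] by metis
  have "H2 f z = H f (\<alpha> z) \<and> H2 f' z = H f (\<beta> z)" if z: "z \<in> diamond (1/2)" for z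
    using H2(2)[OF z] H2(3)[of f z] 1[OF z] 2[OF z] z ne f by simp
  then show ?thesis using n(1) ne H2(1) by (intro bexI[of _ f'] exI[of _ H2]) auto
qed

section \<open>Subdividing a face\<close>

text \<open>Comparing labels over all pairs of new faces would need very many cases. Instead every
  point of a diamond is traced to a key from which its place and its label can be read, and only
  keys are compared.\<close>

lemma drawing_by_keys:
  assumes cont: "\<And>f. f \<in> F \<Longrightarrow> continuous_on (diamond 1) (H f)"
    and union: "(\<Union>f\<in>F. H f ` diamond 1) = S"
    and keys: "\<And>f z. f \<in> F \<Longrightarrow> nd z \<le> 1 \<Longrightarrow> \<exists>k\<in>K. H f z = pt k \<and> label f z = lb k"
    and iff: "\<And>k k'. k \<in> K \<Longrightarrow> k' \<in> K \<Longrightarrow> pt k = pt k' \<longleftrightarrow> lb k = lb k'"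
  shows "drawing S F H"
  unfolding drawing_def
proof (intro conjI ballI cont union)
  fix f f' z z' assume "f \<in> F" "f' \<in> F" "z \<in> diamond 1" "z' \<in> diamond 1"
  then obtain k k' where "k \<in> K" "H f z = pt k" "label f z = lb k" "k' \<in> K" "H f' z' = pt k'" "label f' z' = lb k'"
    using keys[of f z] keys[of f' z'] by (auto simp: mem_diamond)
  then show "H f z = H f' z' \<longleftrightarrow> label f z = label f' z'" using iff by simp
qed

lemma bweight_inj:
  assumes "distinct [a, b, c, d]" "bweight (a, b, c, d) z = bweight (a, b, c, d) z'"
  shows "z = z'"
proof -
  have "max 0 (Re z) = max 0 (Re z')" "max 0 (Im z) = max 0 (Im z')"
    "max 0 (- Re z) = max 0 (- Re z')" "max 0 (- Im z) = max 0 (- Im z')"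
    using assms(1) fun_cong[OF assms(2), of a] fun_cong[OF assms(2), of b]
      fun_cong[OF assms(2), of c] fun_cong[OF assms(2), of d] by auto
  then show ?thesis by (auto simp: complex_eq_iff max_def split: if_splits)
qed

definition quad_vertices :: "quad set \<Rightarrow> nat set" where
  "quad_vertices F = (\<Union>f\<in>F. fst ` dedges f)"

lemma quad_verticesI: "(p, q, r, s) \<in> F \<Longrightarrow> p \<in> quad_vertices F \<and> q \<in> quad_vertices F \<and> r \<in> quad_vertices F \<and> s \<in> quad_vertices F"
  unfolding quad_vertices_def by force

lemma bweight_vertex: "f \<in> F \<Longrightarrow> bweight f z n \<noteq> 0 \<Longrightarrow> n \<in> quad_vertices F"
  using quad_verticesI[of _ _ _ _ F] by (cases f) (auto split: if_splits)

definition split_face :: "quad set \<Rightarrow> quad \<Rightarrow> nat \<Rightarrow> nat \<Rightarrow> quad set" where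
  "split_face F f x y = (case f of (a, b, c, d) \<Rightarrow> (F - {f}) \<union> {(a, b, c, x), (x, c, y, a), (a, y, c, d)})"

locale face_split =
  fixes S :: "'a::topological_space set" and F H a b c d x y
  assumes dr: "drawing S F H" and surf: "quad_surface F" and fF: "(a, b, c, d) \<in> F"
    and fresh: "x \<notin> quad_vertices F" "y \<notin> quad_vertices F" "x \<noteq> y"
begin

abbreviation "f \<equiv> (a, b, c, d)"
abbreviation "l \<equiv> (a, b, c, x)"
abbreviation "m \<equiv> (x, c, y, a)"
abbreviation "r \<equiv> (a, y, c, d)"

text \<open>The half-length of the vertical section of the diamond through \<open>z\<close>. The two
  new paths from \<open>a\<close> to \<open>c\<close> are the curves at heights plus and minus
  \<open>W / 3\<close>.\<close>

definition W :: "complex \<Rightarrow> real" where "W z = 1 - \<bar>Re z\<bar>"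
definition cell_l :: "complex \<Rightarrow> complex" where "cell_l z = Complex (Re z) ((Im z + 2 * W z) / 3)"
definition cell_r :: "complex \<Rightarrow> complex" where "cell_r z = Complex (Re z) ((Im z - 2 * W z) / 3)"
text \<open>Besides compressing by 3 this turns by a quarter, because the middle face starts at the
  corner \<open>x\<close>, which lies above the centre.\<close>

definition cell_m :: "complex \<Rightarrow> complex" where "cell_m z = Complex (- Im z) (Re z / 3)"

definition H' :: "quad \<Rightarrow> complex \<Rightarrow> 'a" where
  "H' g = (if g = l then \<lambda>z. H f (cell_l z) else if g = m then \<lambda>z. H f (cell_m z)
           else if g = r then \<lambda>z. H f (cell_r z) else H g)"

text \<open>The \<open>Inl\<close> keys are the points whose label survives, among them the boundary
  of the face being split; the \<open>Inr\<close> keys are its interior points, which are labelled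
  anew.\<close>

definition keys :: "(quad \<times> complex + complex) set" where
  "keys = Inl ` {(g, w). g \<in> F \<and> nd w \<le> 1 \<and> (g = f \<longrightarrow> nd w = 1)} \<union> Inr ` {w. nd w < 1}"

text \<open>The four cases off the paths invert the cell maps. A point of a new path receives the
  weights of the boundary point straight above or below it in a diamond with corners
  \<open>a, x, c, y\<close>.\<close>

definition lb_new :: "complex \<Rightarrow> (nat \<Rightarrow> real) + quad \<times> complex" where
  "lb_new w = (if W w < 3 * Im w then Inr (l, Complex (Re w) (3 * Im w - 2 * W w))
     else if 3 * Im w = W w then Inl (bweight (a, x, c, y) (Complex (Re w) (W w)))
     else if - W w < 3 * Im w then Inr (m, Complex (3 * Im w) (- Re w))
     else if 3 * Im w = - W w then Inl (bweight (a, x, c, y) (Complex (Re w) (- W w)))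
     else Inr (r, Complex (Re w) (3 * Im w + 2 * W w)))"

definition pt :: "quad \<times> complex + complex \<Rightarrow> 'a" where
  "pt k = (case k of Inl (g, w) \<Rightarrow> H g w | Inr w \<Rightarrow> H f w)"

definition lb :: "quad \<times> complex + complex \<Rightarrow> (nat \<Rightarrow> real) + quad \<times> complex" where
  "lb k = (case k of Inl (g, w) \<Rightarrow> label g w | Inr w \<Rightarrow> lb_new w)"

lemma distinct_vertices: "distinct [a, b, c, d, x, y]"
proof -
  have "distinct_quad f" using surf fF by (auto simp: quad_surface_def)
  then show ?thesis using quad_verticesI[OF fF] fresh by auto
qed

lemma new_not_in: "l \<notin> F" "m \<notin> F" "r \<notin> F"
  using fresh quad_verticesI[of _ _ _ _ F] by blast+

lemma key_l:
  assumes "nd z \<le> 1"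
  shows "\<exists>k\<in>keys. H f (cell_l z) = pt k \<and> label l z = lb k"
proof (cases "Im z = W z")
  case True
  then have "nd z = 1" "cell_l z = z" "0 \<le> Im z" using assms by (auto simp: nd_def W_def cell_l_def complex_eq_iff)
  then have "label l z = label f z" by (auto simp: label_def fun_eq_iff)
  then show ?thesis using \<open>nd z = 1\<close> \<open>cell_l z = z\<close> fF
    by (intro bexI[of _ "Inl (f, z)"]) (auto simp: keys_def pt_def lb_def)
next
  case False
  then have lt: "Im z < W z" "- W z \<le> Im z" using assms by (auto simp: nd_def W_def)
  have nd: "nd (cell_l z) < 1" using lt by (auto simp: nd_def cell_l_def W_def field_simps)
  have W: "W (cell_l z) = W z" by (simp add: W_def cell_l_def)
  have "label l z = lb_new (cell_l z)"
  proof (cases "Im z = - W z")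
    case True
    then have "\<not> nd z < 1" "0 < W z" using lt by (auto simp: nd_def W_def)
    moreover have "bweight l z = bweight (a, x, c, y) (Complex (Re z) (W z))"
    proof
      fix n
      have "max 0 (Im z) = 0" "max 0 (- Im z) = W z" "max 0 (W z) = W z" "max 0 (- W z) = 0"
        using True \<open>0 < W z\<close> by auto
      then show "bweight l z n = bweight (a, x, c, y) (Complex (Re z) (W z)) n" by simp
    qed
    ultimately show ?thesis using True by (simp add: label_def lb_new_def W, simp add: cell_l_def)
  next
    case False
    then have "- W z < Im z" using lt by auto
    moreover from this have "nd z < 1" using lt by (auto simp: nd_def W_def)
    ultimately show ?thesis by (simp add: label_def lb_new_def W, simp add: cell_l_def complex_eq_iff field_simps)
  qed
  then show ?thesis using nd by (intro bexI[of _ "Inr (cell_l z)"]) (auto simp: keys_def pt_def lb_def)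
qed

lemma key_r:
  assumes "nd z \<le> 1"
  shows "\<exists>k\<in>keys. H f (cell_r z) = pt k \<and> label r z = lb k"
proof (cases "Im z = - W z")
  case True
  then have "nd z = 1" "cell_r z = z" "Im z \<le> 0" using assms by (auto simp: nd_def W_def cell_r_def complex_eq_iff)
  then have "label r z = label f z" by (auto simp: label_def fun_eq_iff)
  then show ?thesis using \<open>nd z = 1\<close> \<open>cell_r z = z\<close> fF
    by (intro bexI[of _ "Inl (f, z)"]) (auto simp: keys_def pt_def lb_def)
next
  case False
  then have lt: "- W z < Im z" "Im z \<le> W z" using assms by (auto simp: nd_def W_def)
  have nd: "nd (cell_r z) < 1" using lt by (auto simp: nd_def cell_r_def W_def field_simps)
  have W: "W (cell_r z) = W z" by (simp add: W_def cell_r_def)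
  have "label r z = lb_new (cell_r z)"
  proof (cases "Im z = W z")
    case True
    then have "\<not> nd z < 1" "0 < W z" using lt by (auto simp: nd_def W_def)
    moreover have "bweight r z = bweight (a, x, c, y) (Complex (Re z) (- W z))"
    proof
      fix n
      have "max 0 (Im z) = W z" "max 0 (- Im z) = 0" "max 0 (W z) = W z" "max 0 (- W z) = 0"
        using True \<open>0 < W z\<close> by auto
      then show "bweight r z n = bweight (a, x, c, y) (Complex (Re z) (- W z)) n" by simp
    qed
    ultimately show ?thesis using True by (simp add: label_def lb_new_def W, simp add: cell_r_def)
  next
    case False
    then have "Im z < W z" using lt by auto
    moreover from this have "nd z < 1" using lt by (auto simp: nd_def W_def)
    ultimately show ?thesis using lt by (simp add: label_def lb_new_def W, simp add: cell_r_def complex_eq_iff field_simps)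
  qed
  then show ?thesis using nd by (intro bexI[of _ "Inr (cell_r z)"]) (auto simp: keys_def pt_def lb_def)
qed

text \<open>The middle cell meets the old boundary only in the corners \<open>a\<close> and
  \<open>c\<close>, that is, where \<open>\<bar>Im z\<bar> = 1\<close>.\<close>

lemma key_m:
  assumes "nd z \<le> 1"
  shows "\<exists>k\<in>keys. H f (cell_m z) = pt k \<and> label m z = lb k"
proof (cases "\<bar>Im z\<bar> = 1")
  case True
  then have z: "Re z = 0" "\<not> nd z < 1" "nd (cell_m z) = 1" "\<not> nd (cell_m z) < 1" using assms by (auto simp: nd_def cell_m_def)
  have "bweight m z = bweight f (cell_m z)"
    using z(1) distinct_vertices by (auto simp: fun_eq_iff cell_m_def)
  then have "label m z = label f (cell_m z)" using z by (simp add: label_def)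
  then show ?thesis using z fF
    by (intro bexI[of _ "Inl (f, cell_m z)"]) (auto simp: keys_def pt_def lb_def)
next
  case False
  then have im: "\<bar>Im z\<bar> < 1" "\<bar>Re z\<bar> \<le> 1 - \<bar>Im z\<bar>" using assms by (auto simp: nd_def)
  then have nd: "nd (cell_m z) < 1" by (auto simp: nd_def cell_m_def field_simps)
  have W: "W (cell_m z) = 1 - \<bar>Im z\<bar>" by (simp add: W_def cell_m_def)
  have c: "Re (cell_m z) = - Im z" "3 * Im (cell_m z) = Re z" by (simp_all add: cell_m_def)
  consider "Re z = 1 - \<bar>Im z\<bar>" | "Re z = - (1 - \<bar>Im z\<bar>)" | "\<bar>Re z\<bar> < 1 - \<bar>Im z\<bar>" using im by linarith
  then have "label m z = lb_new (cell_m z)"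
  proof cases
    case 1
    then have "\<not> nd z < 1" by (auto simp: nd_def)
    moreover have "bweight m z = bweight (a, x, c, y) (Complex (- Im z) (1 - \<bar>Im z\<bar>))"
    proof
      fix n
      have "max 0 (Re z) = 1 - \<bar>Im z\<bar>" "max 0 (- Re z) = 0" "max 0 (1 - \<bar>Im z\<bar>) = 1 - \<bar>Im z\<bar>" "max 0 (- (1 - \<bar>Im z\<bar>)) = 0"
        using 1 im by auto
      then show "bweight m z n = bweight (a, x, c, y) (Complex (- Im z) (1 - \<bar>Im z\<bar>)) n" by simp
    qed
    ultimately show ?thesis using 1 by (simp add: label_def lb_new_def W c)
  next
    case 2
    then have "\<not> nd z < 1" using im by (auto simp: nd_def)
    moreover have "bweight m z = bweight (a, x, c, y) (Complex (- Im z) (- (1 - \<bar>Im z\<bar>)))"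
    proof
      fix n
      have "max 0 (Re z) = 0" "max 0 (- Re z) = 1 - \<bar>Im z\<bar>" "max 0 (1 - \<bar>Im z\<bar>) = 1 - \<bar>Im z\<bar>" "max 0 (- (1 - \<bar>Im z\<bar>)) = 0"
        using 2 im by auto
      then show "bweight m z n = bweight (a, x, c, y) (Complex (- Im z) (- (1 - \<bar>Im z\<bar>))) n" by simp
    qed
    ultimately show ?thesis using 2 im by (simp add: label_def lb_new_def W c)
  next
    case 3
    then have "nd z < 1" by (auto simp: nd_def)
    then show ?thesis using 3 im by (auto simp: label_def lb_new_def W c complex_eq_iff)
  qed
  then show ?thesis using nd by (intro bexI[of _ "Inr (cell_m z)"]) (auto simp: keys_def pt_def lb_def)
qed

lemma cell_inverse:
  "cell_l (Complex (Re w) (3 * Im w - 2 * W w)) = w" "cell_r (Complex (Re w) (3 * Im w + 2 * W w)) = w"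
  "cell_m (Complex (3 * Im w) (- Re w)) = w"
  by (simp_all add: cell_l_def cell_r_def cell_m_def W_def complex_eq_iff field_simps)

lemma lb_new_Inr:
  "lb_new w = Inr (g, z) \<Longrightarrow> g = l \<and> w = cell_l z \<or> g = m \<and> w = cell_m z \<or> g = r \<and> w = cell_r z"
  unfolding lb_new_def by (simp split: if_splits) (metis cell_inverse)+

lemma lb_new_Inl:
  assumes "lb_new w = Inl B"
  obtains t where "B = bweight (a, x, c, y) (Complex (Re w) t)" "t = 3 * Im w" "\<bar>t\<bar> = \<bar>W w\<bar>"
  using assms by (auto simp: lb_new_def split: if_splits intro: that)

lemma lb_new_inj:
  assumes "lb_new w = lb_new w'"
  shows "w = w'"
proof (cases "lb_new w")
  case (Inr p)
  obtain g z where p: "p = (g, z)" by (cases p) auto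
  have "l \<noteq> m" "l \<noteq> r" "m \<noteq> r" using distinct_vertices by auto
  moreover have "g = l \<and> w = cell_l z \<or> g = m \<and> w = cell_m z \<or> g = r \<and> w = cell_r z"
    "g = l \<and> w' = cell_l z \<or> g = m \<and> w' = cell_m z \<or> g = r \<and> w' = cell_r z"
    using lb_new_Inr[of w g z] lb_new_Inr[of w' g z] Inr assms unfolding p by auto
  ultimately show ?thesis by (elim disjE conjE) blast+
next
  case (Inl B)
  obtain t where t: "B = bweight (a, x, c, y) (Complex (Re w) t)" "t = 3 * Im w" using lb_new_Inl[OF Inl] .
  obtain t' where t': "B = bweight (a, x, c, y) (Complex (Re w') t')" "t' = 3 * Im w'"
    using lb_new_Inl[of w' B] Inl assms by metis
  have "Complex (Re w) t = Complex (Re w') t'"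
    by (rule bweight_inj[of a x c y]) (use distinct_vertices t t' in auto)
  then show ?thesis using t t' by (simp add: complex_eq_iff)
qed

text \<open>Interior points of the new cells are labelled by faces outside \<open>F\<close>; points
  of the new paths have nonzero weight at one of the fresh vertices.\<close>

lemma lb_new_not_old:
  assumes "nd w < 1" "g \<in> F"
  shows "lb_new w \<noteq> label g w'"
proof
  assume eq: "lb_new w = label g w'"
  show False
  proof (cases "nd w' < 1")
    case True
    then have "lb_new w = Inr (g, w')" using eq by (simp add: label_def)
    then show False using lb_new_Inr[of w g w'] new_not_in assms(2) by blast
  next
    case False
    then have "lb_new w = Inl (bweight g w')" using eq by (simp add: label_def)
    then obtain t where t: "bweight g w' = bweight (a, x, c, y) (Complex (Re w) t)" "\<bar>t\<bar> = \<bar>W w\<bar>"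
      by (rule lb_new_Inl)
    have "t \<noteq> 0" using assms(1) t(2) by (auto simp: nd_def W_def)
    then have "bweight (a, x, c, y) (Complex (Re w) t) x \<noteq> 0 \<or> bweight (a, x, c, y) (Complex (Re w) t) y \<noteq> 0"
      using distinct_vertices by (auto simp: max_def)
    then show False using bweight_vertex[OF assms(2)] fresh unfolding t(1)[symmetric] by blast
  qed
qed

lemma drawing_split: "drawing S (split_face F f x y) H'"
proof (rule drawing_by_keys[where K = keys and pt = pt and lb = lb])
  have F': "split_face F f x y = (F - {f}) \<union> {l, m, r}" by (simp add: split_face_def)
  have ne: "l \<noteq> m" "l \<noteq> r" "m \<noteq> r" using distinct_vertices by auto
  have H'new: "H' l = (\<lambda>z. H f (cell_l z))" "H' m = (\<lambda>z. H f (cell_m z))" "H' r = (\<lambda>z. H f (cell_r z))"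
  proof -
    show "H' l = (\<lambda>z. H f (cell_l z))" unfolding H'_def by (rule if_P[OF refl])
    show "H' m = (\<lambda>z. H f (cell_m z))" unfolding H'_def
      by (rule trans[OF if_not_P[OF ne(1)[symmetric]] if_P[OF refl]])
    show "H' r = (\<lambda>z. H f (cell_r z))" unfolding H'_def
      by (rule trans[OF if_not_P[OF ne(2)[symmetric]] trans[OF if_not_P[OF ne(3)[symmetric]] if_P[OF refl]]])
  qed
  have H'old: "H' g = H g" if "g \<in> F" for g
  proof -
    have "g \<noteq> l" "g \<noteq> m" "g \<noteq> r" using that new_not_in by metis+
    then show ?thesis unfolding H'_def by (simp only: if_False)
  qed
  have cells: "nd (cell_l z) \<le> 1" "nd (cell_m z) \<le> 1" "nd (cell_r z) \<le> 1" if "nd z \<le> 1" for z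
    using that by (auto simp: nd_def cell_l_def cell_m_def cell_r_def W_def field_simps)
  have cont: "continuous_on (diamond 1) cell_l" "continuous_on (diamond 1) cell_m" "continuous_on (diamond 1) cell_r"
    unfolding cell_l_def cell_m_def cell_r_def W_def Complex_eq by (intro continuous_intros; simp)+
  have Hf: "continuous_on (diamond 1) (H f)" using dr fF by (auto simp: drawing_def)
  show "continuous_on (diamond 1) (H' g)" if "g \<in> split_face F f x y" for g
  proof -
    have "continuous_on (diamond 1) (H g)" if "g \<in> F" for g using dr that by (auto simp: drawing_def)
    moreover have "continuous_on (diamond 1) (\<lambda>z. H f (cell_l z))" "continuous_on (diamond 1) (\<lambda>z. H f (cell_m z))"
      "continuous_on (diamond 1) (\<lambda>z. H f (cell_r z))"
      by (rule continuous_on_compose2[OF Hf]; use cont cells in \<open>auto simp: mem_diamond\<close>)+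
    moreover have "g \<in> F \<or> g = l \<or> g = m \<or> g = r" using that unfolding F' by blast
    ultimately show ?thesis using H'new H'old[of g] by (elim disjE) (simp_all only:)
  qed
  show "(\<Union>g\<in>split_face F f x y. H' g ` diamond 1) = S"
  proof
    show "(\<Union>g\<in>split_face F f x y. H' g ` diamond 1) \<subseteq> S"
      using H'new H'old cells fF drawing_in[OF dr] unfolding F' by (auto simp: mem_diamond)
    show "S \<subseteq> (\<Union>g\<in>split_face F f x y. H' g ` diamond 1)"
    proof
      fix s assume "s \<in> S"
      then obtain g w where g: "g \<in> F" "nd w \<le> 1" "s = H g w" using dr by (auto simp: drawing_def mem_diamond)
      show "s \<in> (\<Union>g\<in>split_face F f x y. H' g ` diamond 1)"
      proof (cases "g = f")
        case False
        then show ?thesis using g H'old unfolding F' by (intro UN_I[of g]) (auto simp: mem_diamond)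
      next
        case True
        note inv = cell_inverse
        consider "W w \<le> 3 * Im w" | "3 * Im w \<le> - W w" | "\<bar>3 * Im w\<bar> \<le> W w" by linarith
        then show ?thesis
        proof cases
          case 1
          then have "nd (Complex (Re w) (3 * Im w - 2 * W w)) \<le> 1" using g(2) by (auto simp: nd_def W_def)
          then show ?thesis using g True inv H'new unfolding F'
            by (intro UN_I[of l] image_eqI[of _ _ "Complex (Re w) (3 * Im w - 2 * W w)"]) (auto simp: mem_diamond)
        next
          case 2
          then have "nd (Complex (Re w) (3 * Im w + 2 * W w)) \<le> 1" using g(2) by (auto simp: nd_def W_def)
          then show ?thesis using g True inv H'new unfolding F'
            by (intro UN_I[of r] image_eqI[of _ _ "Complex (Re w) (3 * Im w + 2 * W w)"]) (auto simp: mem_diamond)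
        next
          case 3
          then have "nd (Complex (3 * Im w) (- Re w)) \<le> 1" by (auto simp: nd_def W_def)
          then show ?thesis using g True inv H'new unfolding F'
            by (intro UN_I[of m] image_eqI[of _ _ "Complex (3 * Im w) (- Re w)"]) (auto simp: mem_diamond)
        qed
      qed
    qed
  qed
  show "\<exists>k\<in>keys. H' g z = pt k \<and> label g z = lb k" if g: "g \<in> split_face F f x y" and z: "nd z \<le> 1" for g z
  proof -
    consider "g = l" | "g = m" | "g = r" | "g \<in> F" "g \<noteq> f" using g unfolding F' by auto
    then show ?thesis
    proof cases
      case 4 then show ?thesis using z H'old by (intro bexI[of _ "Inl (g, z)"]) (auto simp: keys_def pt_def lb_def)
    qed (use key_l[OF z] key_m[OF z] key_r[OF z] H'new in auto)
  qed
  show "pt k = pt k' \<longleftrightarrow> lb k = lb k'" if k: "k \<in> keys" "k' \<in> keys" for k k'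
  proof -
    have mixed: "H g w \<noteq> H f w'" "label g w \<noteq> lb_new w'"
      if "g \<in> F" "nd w \<le> 1" "g = f \<longrightarrow> nd w = 1" "nd w' < 1" for g w w'
      using drawing_eq_iff[OF dr fF that(1), of w' w] lb_new_not_old[OF that(4,1), of w] that by auto
    consider g w g' w' where "k = Inl (g, w)" "k' = Inl (g', w')" | g w w' where "k = Inl (g, w)" "k' = Inr w'"
      | w g' w' where "k = Inr w" "k' = Inl (g', w')" | w w' where "k = Inr w" "k' = Inr w'"
      by (metis old.prod.exhaust old.sum.exhaust)
    then show ?thesis
    proof cases
      case 1
      then show ?thesis using k dr by (auto simp: keys_def pt_def lb_def drawing_def mem_diamond)
    next
      case 2
      then have "g \<in> F" "nd w \<le> 1" "g = f \<longrightarrow> nd w = 1" "nd w' < 1" using k by (auto simp: keys_def)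
      from mixed[OF this] show ?thesis using 2 by (simp add: pt_def lb_def)
    next
      case 3
      then have "g' \<in> F" "nd w' \<le> 1" "g' = f \<longrightarrow> nd w' = 1" "nd w < 1" using k by (auto simp: keys_def)
      from mixed[OF this] show ?thesis using 3 by (auto simp: pt_def lb_def)
    next
      case 4
      then have "nd w < 1" "nd w' < 1" using k by (auto simp: keys_def)
      then show ?thesis using 4 drawing_eq_iff[OF dr fF fF, of w w'] lb_new_inj[of w w'] by (auto simp: pt_def lb_def)
    qed
  qed
qed

end

section \<open>Joining two faces by a tube\<close>

text \<open>The cycle \<open>x, e, y, e'\<close> runs around the tube. On one side of it are the two
  faces that share the boundary of \<open>M\<close>, on the other the two that share the boundary of
  \<open>N\<close>; the order of corners keeps the orientation.\<close>

definition join_faces :: "quad set \<Rightarrow> quad \<Rightarrow> quad \<Rightarrow> quad set" where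
  "join_faces F M N = (case M of (x, a, y, c) \<Rightarrow> case N of (e, v, e', u) \<Rightarrow>
     (F - {M, N}) \<union> {(x, a, y, e), (e, y, e', u), (x, e', y, c), (e, v, e', x)})"

text \<open>\<open>z \<mapsto> \<i> * cnj z\<close> is the reflection that exchanges the corners
  \<open>1\<close> and \<open>\<i>\<close>, and the corners \<open>- 1\<close> and
  \<open>- \<i>\<close>. The two boundary circles must be matched by a map reversing orientation;
  this one puts \<open>x, a, y, c\<close> opposite to \<open>v, e, u, e'\<close>.\<close>

lemma i_cnj_i_cnj: "\<i> * cnj (\<i> * cnj q) = q"
  by (simp add: complex_eq_iff)

lemma bweight_corners:
  "bweight (p, q, r, s) 1 = (\<lambda>n. if n = p then 1 else 0)" "bweight (p, q, r, s) \<i> = (\<lambda>n. if n = q then 1 else 0)"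
  "bweight (p, q, r, s) (- 1) = (\<lambda>n. if n = r then 1 else 0)" "bweight (p, q, r, s) (- \<i>) = (\<lambda>n. if n = s then 1 else 0)"
  by (rule ext, simp)+

text \<open>The open half-size diamonds of the faces \<open>M\<close> and \<open>N\<close> are removed; \<open>J\<close> embeds the rest into the new
  surface, and the tube \<open>Tb\<close> joins the two boundary circles. On the new surface, the points \<open>\<Theta> p \<tau>\<close> with
  \<open>p\<close> on the boundary of the diamond and \<open>0 \<le> \<tau> \<le> 3\<close> form the annulus between the boundaries of \<open>M\<close> and
  \<open>N\<close>. The four new edges are the graph of \<open>\<tau> = 3 * \<bar>Im p\<bar>\<close>.\<close>

locale tube =
  fixes S S' :: "'a::topological_space set" and F H x a y c e v e' u J Tb
  assumes dr: "drawing S F H" and surf: "quad_surface F"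
    and MF: "(x, a, y, c) \<in> F" and NF: "(e, v, e', u) \<in> F" and MN: "(x, a, y, c) \<noteq> (e, v, e', u)"
    and fresh: "\<And>p q. p \<in> {x, y} \<Longrightarrow> q \<in> {e, e'} \<Longrightarrow> p \<noteq> q"
      "\<And>p q f. p \<in> {x, y} \<Longrightarrow> q \<in> {e, e'} \<Longrightarrow> f \<in> F \<Longrightarrow> (p, q) \<notin> dedges f \<and> (q, p) \<notin> dedges f"
    and J: "continuous_on (S - H (x, a, y, c) ` {z. nd z < 1/2} - H (e, v, e', u) ` {z. nd z < 1/2}) J"
      "inj_on J (S - H (x, a, y, c) ` {z. nd z < 1/2} - H (e, v, e', u) ` {z. nd z < 1/2})"
    and Tb: "continuous_on ({p. nd p = 1} \<times> {1..2}) (\<lambda>(p, \<tau>). Tb p \<tau>)"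
      "inj_on (\<lambda>(p, \<tau>). Tb p \<tau>) ({p. nd p = 1} \<times> {1..2::real})"
    and ends: "\<And>p. nd p = 1 \<Longrightarrow> Tb p 1 = J (H (x, a, y, c) (p / 2))"
      "\<And>p. nd p = 1 \<Longrightarrow> Tb p 2 = J (H (e, v, e', u) (\<i> * cnj p / 2))"
    and disj: "\<And>p \<tau>. nd p = 1 \<Longrightarrow> 1 < \<tau> \<Longrightarrow> \<tau> < 2 \<Longrightarrow>
      Tb p \<tau> \<notin> J ` (S - H (x, a, y, c) ` {z. nd z < 1/2} - H (e, v, e', u) ` {z. nd z < 1/2})"
    and cover: "S' = J ` (S - H (x, a, y, c) ` {z. nd z < 1/2} - H (e, v, e', u) ` {z. nd z < 1/2})
      \<union> (\<lambda>(p, \<tau>). Tb p \<tau>) ` ({p. nd p = 1} \<times> {1..2})"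
begin

abbreviation "M \<equiv> (x, a, y, c)"
abbreviation "N \<equiv> (e, v, e', u)"
abbreviation "T1 \<equiv> (x, a, y, e)"
abbreviation "T2 \<equiv> (e, y, e', u)"
abbreviation "T3 \<equiv> (x, e', y, c)"
abbreviation "T4 \<equiv> (e, v, e', x)"
abbreviation "R \<equiv> S - H M ` {z. nd z < 1/2} - H N ` {z. nd z < 1/2}"

text \<open>For \<open>\<tau>\<close> from 0 to 1 the point moves radially from the boundary of
  \<open>M\<close> to half size, from 1 to 2 it runs along the tube, and from 2 to 3 it moves
  outwards to the boundary of \<open>N\<close>.\<close>

definition \<Theta> :: "complex \<Rightarrow> real \<Rightarrow> 'a" where
  "\<Theta> p \<tau> = (if \<tau> \<le> 1 then J (H M (of_real (1 - \<tau> / 2) * p)) else if \<tau> \<le> 2 then Tb p \<tau>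
     else J (H N (of_real ((\<tau> - 1) / 2) * (\<i> * cnj p))))"

definition upper :: "complex \<Rightarrow> complex" where "upper z = Complex (Re z) (1 - \<bar>Re z\<bar>)"
definition lower :: "complex \<Rightarrow> complex" where "lower z = Complex (Re z) (\<bar>Re z\<bar> - 1)"
definition W :: "complex \<Rightarrow> real" where "W z = 1 - \<bar>Re z\<bar>"

text \<open>Vertical segments of a diamond go to segments of constant \<open>p\<close>. The symmetry
  \<open>(p, \<tau>) \<mapsto> (\<i> * cnj p, 3 - \<tau>)\<close> exchanges the two ends of the
  annulus and turns the formulas of \<open>T1\<close> and \<open>T3\<close> into those of
  \<open>T4\<close> and \<open>T2\<close>.\<close>

definition H' :: "quad \<Rightarrow> complex \<Rightarrow> 'a" where
  "H' g = (if g = T1 then \<lambda>z. \<Theta> (upper z) (3 / 2 * (W z - Im z))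
     else if g = T3 then \<lambda>z. \<Theta> (lower z) (3 / 2 * (W z + Im z))
     else if g = T4 then \<lambda>z. \<Theta> (\<i> * cnj (upper z)) (3 - 3 / 2 * (W z - Im z))
     else if g = T2 then \<lambda>z. \<Theta> (\<i> * cnj (lower z)) (3 - 3 / 2 * (W z + Im z))
     else (\<lambda>z. J (H g z)))"

lemma distinct_M: "distinct [x, a, y, c]" and distinct_N: "distinct [e, v, e', u]"
  using surf MF NF unfolding quad_surface_def by (metis distinct_quad.simps)+

lemma distinct_cross: "distinct [x, e, y, e']"
  using distinct_M distinct_N fresh(1)[of x e] fresh(1)[of x e'] fresh(1)[of y e] fresh(1)[of y e'] by auto

lemma T_not_in: "T1 \<notin> F" "T2 \<notin> F" "T3 \<notin> F" "T4 \<notin> F"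
  using fresh(2)[of y e T1] fresh(2)[of y e T2] fresh(2)[of y e' T3] fresh(2)[of x e T4] by auto

lemma T_distinct: "T1 \<noteq> T2" "T1 \<noteq> T3" "T1 \<noteq> T4" "T3 \<noteq> T2" "T3 \<noteq> T4" "T4 \<noteq> T2"
proof -
  have "a \<noteq> e'" using fresh(2)[of x e' M] MF by auto
  moreover have "v \<noteq> y" using fresh(2)[of y e N] NF by auto
  ultimately show "T1 \<noteq> T2" "T1 \<noteq> T3" "T1 \<noteq> T4" "T3 \<noteq> T2" "T3 \<noteq> T4" "T4 \<noteq> T2"
    using distinct_cross by auto
qed

lemma H'_T: "H' T1 z = \<Theta> (upper z) (3 / 2 * (W z - Im z))" "H' T3 z = \<Theta> (lower z) (3 / 2 * (W z + Im z))"
  "H' T4 z = \<Theta> (\<i> * cnj (upper z)) (3 - 3 / 2 * (W z - Im z))"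
  "H' T2 z = \<Theta> (\<i> * cnj (lower z)) (3 - 3 / 2 * (W z + Im z))"
  unfolding H'_def using T_distinct T_distinct[symmetric] by (simp_all only: if_False if_True simp_thms)

lemma H'_old: assumes "g \<in> F" shows "H' g z = J (H g z)"
proof -
  have "g \<noteq> T1" "g \<noteq> T2" "g \<noteq> T3" "g \<noteq> T4" using assms T_not_in by metis+
  then show ?thesis unfolding H'_def by (simp only: if_False)
qed

lemma in_R:
  assumes "g \<in> F" "nd w \<le> 1" "g \<in> {M, N} \<Longrightarrow> 1/2 \<le> nd w"
  shows "H g w \<in> R"
proof -
  have "H g w \<noteq> H g' w'" if "g' \<in> {M, N}" "nd w' < 1/2" for g' w'
  proof
    assume "H g w = H g' w'"
    moreover have "g' \<in> F" using that MF NF by auto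
    ultimately have "g' = g \<and> w' = w" using drawing_eq_iff[OF dr \<open>g' \<in> F\<close> assms(1), of w' w] that assms(2) by auto
    then show False using that assms(3) by auto
  qed
  then show ?thesis using drawing_in[OF dr assms(1,2)] by blast
qed

lemma J_eq_iff:
  assumes "g \<in> F" "nd w \<le> 1" "g \<in> {M, N} \<Longrightarrow> 1/2 \<le> nd w" "g' \<in> F" "nd w' \<le> 1" "g' \<in> {M, N} \<Longrightarrow> 1/2 \<le> nd w'"
  shows "J (H g w) = J (H g' w') \<longleftrightarrow> (nd w < 1 \<and> g = g' \<and> w = w') \<or> (nd w = 1 \<and> nd w' = 1 \<and> bweight g w = bweight g' w')"
  using inj_on_eq_iff[OF J(2) in_R[OF assms(1-3)] in_R[OF assms(4-6)]] drawing_eq_iff[OF dr assms(1,4,2,5)] by simp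

lemma nd_scale: "nd (of_real t * p) = \<bar>t\<bar> * nd p" "nd (\<i> * cnj p) = nd p"
  by (simp_all add: nd_def abs_mult algebra_simps)

lemma \<Theta>_M: "\<tau> \<le> 1 \<Longrightarrow> \<Theta> p \<tau> = J (H M (of_real (1 - \<tau> / 2) * p))"
  by (simp add: \<Theta>_def)

lemma \<Theta>_mid: assumes "nd p = 1" "1 \<le> \<tau>" "\<tau> \<le> 2" shows "\<Theta> p \<tau> = Tb p \<tau>"
  using assms ends(1)[OF assms(1)] by (cases "\<tau> = 1") (auto simp: \<Theta>_def)

lemma \<Theta>_N: assumes "nd p = 1" "2 \<le> \<tau>" shows "\<Theta> p \<tau> = J (H N (of_real ((\<tau> - 1) / 2) * (\<i> * cnj p)))"
proof (cases "\<tau> = 2")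
  case True
  then have "\<Theta> p \<tau> = Tb p 2" using \<Theta>_mid[OF assms(1), of 2] by simp
  also have "\<dots> = J (H N (\<i> * cnj p / 2))" using ends(2)[OF assms(1)] .
  also have "\<i> * cnj p / 2 = of_real ((\<tau> - 1) / 2) * (\<i> * cnj p)" using True by simp
  finally show ?thesis .
qed (use assms in \<open>simp add: \<Theta>_def\<close>)

lemma \<Theta>_bdry: "\<Theta> p 0 = J (H M p)" "nd p = 1 \<Longrightarrow> \<Theta> p 3 = J (H N (\<i> * cnj p))"
  using \<Theta>_M[of 0 p] \<Theta>_N[of p 3] by simp_all

lemma Tb_cases:
  assumes p: "nd p = 1" and \<tau>: "0 < \<tau>" "\<tau> < 3"
  obtains (M) "\<Theta> p \<tau> = J (H M (of_real (1 - \<tau> / 2) * p))" "1/2 \<le> nd (of_real (1 - \<tau> / 2) * p)" "nd (of_real (1 - \<tau> / 2) * p) < 1"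
      "nd (of_real (1 - \<tau> / 2) * p) = 1 - \<tau> / 2"
    | (mid) "\<Theta> p \<tau> = Tb p \<tau>" "1 < \<tau>" "\<tau> < 2"
    | (N) "\<Theta> p \<tau> = J (H N (of_real ((\<tau> - 1) / 2) * (\<i> * cnj p)))" "1/2 \<le> nd (of_real ((\<tau> - 1) / 2) * (\<i> * cnj p))"
      "nd (of_real ((\<tau> - 1) / 2) * (\<i> * cnj p)) < 1" "nd (of_real ((\<tau> - 1) / 2) * (\<i> * cnj p)) = (\<tau> - 1) / 2"
proof -
  consider "\<tau> \<le> 1" | "1 < \<tau>" "\<tau> < 2" | "2 \<le> \<tau>" by linarith
  then show thesis
  proof cases
    case 1 then show thesis using M[OF \<Theta>_M[OF 1]] p \<tau> unfolding nd_scale by simp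
  next
    case 2 then show thesis using mid \<Theta>_mid[OF p, of \<tau>] by simp
  next
    case 3 then show thesis using N[OF \<Theta>_N[OF p 3]] p \<tau> unfolding nd_scale by simp
  qed
qed

lemma \<Theta>_not_old:
  assumes p: "nd p = 1" and \<tau>: "0 < \<tau>" "\<tau> < 3" and g: "g \<in> F" "nd w \<le> 1" "g \<in> {M, N} \<Longrightarrow> nd w = 1"
  shows "\<Theta> p \<tau> \<noteq> J (H g w)"
proof -
  have g': "g \<in> {M, N} \<Longrightarrow> 1/2 \<le> nd w" using g(3) by simp
  show ?thesis
    using p \<tau>
  proof (cases rule: Tb_cases)
    case M
    have "J (H M (of_real (1 - \<tau> / 2) * p)) \<noteq> J (H g w)"
    proof
      assume "J (H M (of_real (1 - \<tau> / 2) * p)) = J (H g w)"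
      then have "M = g \<and> of_real (1 - \<tau> / 2) * p = w"
        using J_eq_iff[OF MF _ _ g(1,2) g', of "of_real (1 - \<tau> / 2) * p"] M by linarith
      then show False using g(3) M by force
    qed
    then show ?thesis using M by simp
  next
    case mid
    then show ?thesis using disj[OF p mid(2,3)] in_R[OF g(1,2) g'] by (metis imageI)
  next
    case N
    have "J (H N (of_real ((\<tau> - 1) / 2) * (\<i> * cnj p))) \<noteq> J (H g w)"
    proof
      assume "J (H N (of_real ((\<tau> - 1) / 2) * (\<i> * cnj p))) = J (H g w)"
      then have "N = g \<and> of_real ((\<tau> - 1) / 2) * (\<i> * cnj p) = w"
        using J_eq_iff[OF NF _ _ g(1,2) g', of "of_real ((\<tau> - 1) / 2) * (\<i> * cnj p)"] N by linarith
      then show False using g(3) N by force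
    qed
    then show ?thesis using N by simp
  qed
qed

text \<open>The two collars and the open tube have disjoint images: the collars lie in different
  faces of an injectively embedded set, and the open tube misses that set. Inside a collar,
  \<open>nd\<close> recovers \<open>\<tau>\<close>.\<close>

lemma \<Theta>_inj:
  assumes p: "nd p = 1" "nd p' = 1" and \<tau>: "0 < \<tau>" "\<tau> < 3" "0 < \<tau>'" "\<tau>' < 3" and eq: "\<Theta> p \<tau> = \<Theta> p' \<tau>'"
  shows "p = p' \<and> \<tau> = \<tau>'"
proof -
  let ?m = "\<lambda>p \<tau>. of_real (1 - \<tau> / 2) * p :: complex" and ?n = "\<lambda>p \<tau>. of_real ((\<tau> - 1) / 2) * (\<i> * cnj p) :: complex"
  have canc: "p = p' \<and> \<tau> = \<tau>'" if "of_real r * p = of_real r' * p'" "r = r'" "r \<noteq> 0" "\<tau> = \<tau>'" for r r' :: real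
    using that by simp
  have canc': "p = p' \<and> \<tau> = \<tau>'" if "of_real r * (\<i> * cnj p) = of_real r' * (\<i> * cnj p')" "r = r'" "r \<noteq> 0" "\<tau> = \<tau>'" for r r' :: real
    using that by simp
  from p(1) \<tau>(1,2) show ?thesis
  proof (cases rule: Tb_cases)
    case M
    from p(2) \<tau>(3,4) show ?thesis
    proof (cases rule: Tb_cases)
      case M': M
      have "?m p \<tau> = ?m p' \<tau>'" using J_eq_iff[OF MF less_imp_le[OF M(3)] M(2) MF less_imp_le[OF M'(3)] M'(2)] M(1,3) M'(1) eq
        by (metis less_irrefl)
      moreover from this have "1 - \<tau> / 2 = 1 - \<tau>' / 2" using M(4) M'(4) by metis
      ultimately show ?thesis using M(2,4) by (intro canc[of "1 - \<tau> / 2" "1 - \<tau>' / 2"]) (simp_all del: of_real_diff)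
    next
      case mid
      then show ?thesis using disj[OF p(2) mid(2,3)] imageI[OF in_R[OF MF less_imp_le[OF M(3)] M(2)], of J] M(1) mid(1) eq by simp
    next
      case N
      then show ?thesis using J_eq_iff[OF MF less_imp_le[OF M(3)] M(2) NF less_imp_le[OF N(3)] N(2)] M(1,3) eq MN
        by (metis less_irrefl)
    qed
  next
    case mid
    from p(2) \<tau>(3,4) show ?thesis
    proof (cases rule: Tb_cases)
      case M
      then show ?thesis using disj[OF p(1) mid(2,3)] imageI[OF in_R[OF MF less_imp_le[OF M(3)] M(2)], of J] M(1) mid(1) eq by simp
    next
      case mid': mid
      have "(p, \<tau>) = (p', \<tau>')" by (rule inj_onD[OF Tb(2)]) (use mid mid' eq p in auto)
      then show ?thesis by simp
    next
      case N
      then show ?thesis using disj[OF p(1) mid(2,3)] imageI[OF in_R[OF NF less_imp_le[OF N(3)] N(2)], of J] N(1) mid(1) eq by simp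
    qed
  next
    case N
    from p(2) \<tau>(3,4) show ?thesis
    proof (cases rule: Tb_cases)
      case M
      then show ?thesis using J_eq_iff[OF MF less_imp_le[OF M(3)] M(2) NF less_imp_le[OF N(3)] N(2)] M(3) N(1) eq MN
        by (metis less_irrefl)
    next
      case mid
      then show ?thesis using disj[OF p(2) mid(2,3)] imageI[OF in_R[OF NF less_imp_le[OF N(3)] N(2)], of J] N(1) mid(1) eq by simp
    next
      case N': N
      have "?n p \<tau> = ?n p' \<tau>'" using J_eq_iff[OF NF less_imp_le[OF N(3)] N(2) NF less_imp_le[OF N'(3)] N'(2)] N(1,3) N'(1) eq
        by (metis less_irrefl)
      moreover from this have "(\<tau> - 1) / 2 = (\<tau>' - 1) / 2" using N(4) N'(4) by metis
      ultimately show ?thesis using N(2,4) by (intro canc'[of "(\<tau> - 1) / 2" "(\<tau>' - 1) / 2"]) (simp_all del: of_real_diff of_real_divide)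
    qed
  qed
qed

definition keys :: "(quad \<times> complex + complex \<times> real) set" where
  "keys = Inl ` {(g, w). g \<in> F \<and> nd w \<le> 1 \<and> (g \<in> {M, N} \<longrightarrow> nd w = 1)} \<union> Inr ` {(p, \<tau>). nd p = 1 \<and> 0 < \<tau> \<and> \<tau> < 3}"

text \<open>These are the inverses of the formulas in \<open>H'\<close>. On the new edges the
  weights are those of \<open>p\<close> as a boundary point of a diamond with corners
  \<open>x, e, y, e'\<close>.\<close>

definition lb_new :: "complex \<Rightarrow> real \<Rightarrow> (nat \<Rightarrow> real) + quad \<times> complex" where
  "lb_new p \<tau> = (if \<tau> < 3 * \<bar>Im p\<bar> then
       (if 0 < Im p then Inr (T1, Complex (Re p) (Im p - 2 * \<tau> / 3)) else Inr (T3, Complex (Re p) (Im p + 2 * \<tau> / 3)))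
     else if \<tau> = 3 * \<bar>Im p\<bar> then Inl (bweight (x, e, y, e') p)
     else if 0 < Re p then Inr (T4, Complex (Im p) (Re p - 2 * (3 - \<tau>) / 3))
     else Inr (T2, Complex (Im p) (Re p + 2 * (3 - \<tau>) / 3)))"

definition pt :: "quad \<times> complex + complex \<times> real \<Rightarrow> 'a" where
  "pt k = (case k of Inl (g, w) \<Rightarrow> J (H g w) | Inr (p, \<tau>) \<Rightarrow> \<Theta> p \<tau>)"

definition lb :: "quad \<times> complex + complex \<times> real \<Rightarrow> (nat \<Rightarrow> real) + quad \<times> complex" where
  "lb k = (case k of Inl (g, w) \<Rightarrow> label g w | Inr (p, \<tau>) \<Rightarrow> lb_new p \<tau>)"

lemma old_key:
  assumes "X = J (H g w)" "L = label g w" "g \<in> F" "nd w \<le> 1" "g \<in> {M, N} \<Longrightarrow> nd w = 1"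
  shows "\<exists>k\<in>keys. X = pt k \<and> L = lb k"
  by (rule bexI[of _ "Inl (g, w)"]) (use assms in \<open>auto simp: keys_def pt_def lb_def\<close>)

lemma new_key:
  assumes "X = \<Theta> p \<tau>" "L = lb_new p \<tau>" "nd p = 1" "0 < \<tau>" "\<tau> < 3"
  shows "\<exists>k\<in>keys. X = pt k \<and> L = lb k"
  by (rule bexI[of _ "Inr (p, \<tau>)"]) (use assms in \<open>auto simp: keys_def pt_def lb_def\<close>)

lemma nd_upper: "nd z \<le> 1 \<Longrightarrow> nd (upper z) = 1" "nd z \<le> 1 \<Longrightarrow> nd (lower z) = 1"
  by (auto simp: nd_def upper_def lower_def)

lemma bweight_upper:
  "0 \<le> Im z \<Longrightarrow> bweight (p, q, r, s) z n = bweight (p, q, r, s') z n"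
  "Im z \<le> 0 \<Longrightarrow> bweight (p, q, r, s) z n = bweight (p, q', r, s) z n"
  by auto

text \<open>The upper two sides of the diamond lie on the boundary of \<open>M\<close> and the lower
  two on new edges. The exception is the bottom corner \<open>e\<close>: it has
  \<open>\<tau> = 3\<close>, belongs to the boundary of \<open>N\<close>, and needs an old
  key.\<close>

lemma key_T1:
  assumes z: "nd z \<le> 1"
  shows "\<exists>k\<in>keys. H' T1 z = pt k \<and> label T1 z = lb k"
proof -
  have ww: "\<bar>Im z\<bar> \<le> W z" "0 \<le> W z" using z by (auto simp: nd_def W_def)
  have up: "Re (upper z) = Re z" "Im (upper z) = W z" by (simp_all add: upper_def W_def)
  consider "Im z = W z" | "\<bar>Im z\<bar> < W z" | "Im z = - W z" "0 < W z" "W z < 1" | "Im z = - W z" "W z = 1"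
    using ww by (auto simp: W_def) linarith
  then show ?thesis
  proof cases
    case 1
    then have nd: "nd z = 1" "upper z = z" "0 \<le> Im z" using ww by (auto simp: nd_def W_def upper_def complex_eq_iff)
    then have "label T1 z = label M z" using bweight_upper(1)[OF nd(3)] by (simp add: label_def fun_eq_iff del: bweight.simps)
    then show ?thesis using nd MF 1 \<Theta>_bdry(1)[of z] by (intro old_key[of _ M z]) (auto simp: H'_T)
  next
    case 2
    have "nd z < 1" using 2 by (auto simp: nd_def W_def)
    then have "label T1 z = lb_new (upper z) (3 / 2 * (W z - Im z))"
      using 2 unfolding label_def lb_new_def up by (auto simp: complex_eq_iff field_simps)
    moreover have "0 < 3 / 2 * (W z - Im z)" "3 / 2 * (W z - Im z) < 3" using 2 by (auto simp: W_def abs_if split: if_splits)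
    ultimately show ?thesis by (intro new_key[OF H'_T(1) _ nd_upper(1)[OF z]]) auto
  next
    case 3
    have "\<not> nd z < 1" using 3 by (auto simp: nd_def W_def)
    moreover have "bweight T1 z = bweight (x, e, y, e') (upper z)"
    proof
      fix n
      have "max 0 (Im z) = 0" "max 0 (- Im z) = W z" "max 0 (W z) = W z" "max 0 (- W z) = 0" using 3 by auto
      then show "bweight T1 z n = bweight (x, e, y, e') (upper z) n" using up by simp
    qed
    ultimately have "label T1 z = lb_new (upper z) (3 / 2 * (W z - Im z))"
      using 3 by (simp add: label_def lb_new_def up)
    then show ?thesis using 3 by (intro new_key[OF H'_T(1) _ nd_upper(1)[OF z]]) (auto simp: field_simps)
  next
    case 4
    then have z: "z = - \<i>" by (auto simp: W_def complex_eq_iff)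
    have "upper z = \<i>" "nd \<i> = 1" by (auto simp: upper_def z complex_eq_iff nd_def)
    then have "H' T1 z = J (H N 1)" using \<Theta>_bdry(2)[of \<i>] 4 by (simp add: H'_T)
    moreover have "label T1 z = label N 1"
    proof -
      have "bweight T1 z = bweight N 1" by (simp only: z bweight_corners)
      then show ?thesis by (simp add: z label_def nd_def del: bweight.simps)
    qed
    ultimately show ?thesis using NF by (intro old_key[of _ N 1]) (auto simp: nd_def)
  qed
qed

lemma key_T3:
  assumes z: "nd z \<le> 1"
  shows "\<exists>k\<in>keys. H' T3 z = pt k \<and> label T3 z = lb k"
proof -
  have ww: "\<bar>Im z\<bar> \<le> W z" "0 \<le> W z" using z by (auto simp: nd_def W_def)
  have up: "Re (lower z) = Re z" "Im (lower z) = - W z" by (simp_all add: lower_def W_def)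
  consider "Im z = - W z" | "\<bar>Im z\<bar> < W z" | "Im z = W z" "0 < W z" "W z < 1" | "Im z = W z" "W z = 1"
    using ww by (auto simp: W_def) linarith
  then show ?thesis
  proof cases
    case 1
    then have nd: "nd z = 1" "lower z = z" "Im z \<le> 0" using ww by (auto simp: nd_def W_def lower_def complex_eq_iff)
    then have "label T3 z = label M z" using bweight_upper(2)[OF nd(3)] by (simp add: label_def fun_eq_iff del: bweight.simps)
    then show ?thesis using nd MF 1 \<Theta>_bdry(1)[of z] by (intro old_key[of _ M z]) (auto simp: H'_T)
  next
    case 2
    have "nd z < 1" using 2 by (auto simp: nd_def W_def)
    then have "label T3 z = lb_new (lower z) (3 / 2 * (W z + Im z))"
      using 2 unfolding label_def lb_new_def up by (auto simp: complex_eq_iff field_simps)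
    moreover have "0 < 3 / 2 * (W z + Im z)" "3 / 2 * (W z + Im z) < 3" using 2 by (auto simp: W_def abs_if split: if_splits)
    ultimately show ?thesis by (intro new_key[OF H'_T(2) _ nd_upper(2)[OF z]]) auto
  next
    case 3
    have "\<not> nd z < 1" using 3 by (auto simp: nd_def W_def)
    moreover have "bweight T3 z = bweight (x, e, y, e') (lower z)"
    proof
      fix n
      have "max 0 (Im z) = W z" "max 0 (- Im z) = 0" "max 0 (W z) = W z" "max 0 (- W z) = 0" using 3 by auto
      then show "bweight T3 z n = bweight (x, e, y, e') (lower z) n" using up by simp
    qed
    ultimately have "label T3 z = lb_new (lower z) (3 / 2 * (W z + Im z))"
      using 3 by (simp add: label_def lb_new_def up)
    then show ?thesis using 3 by (intro new_key[OF H'_T(2) _ nd_upper(2)[OF z]]) (auto simp: field_simps)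
  next
    case 4
    then have z: "z = \<i>" by (auto simp: W_def complex_eq_iff)
    have "lower z = - \<i>" "nd (- \<i>) = 1" by (auto simp: lower_def z complex_eq_iff nd_def)
    then have "H' T3 z = J (H N (- 1))" using \<Theta>_bdry(2)[of "- \<i>"] 4 by (simp add: H'_T)
    moreover have "label T3 z = label N (- 1)"
    proof -
      have "bweight T3 z = bweight N (- 1)" by (simp only: z bweight_corners)
      then show ?thesis by (simp add: z label_def nd_def del: bweight.simps)
    qed
    ultimately show ?thesis using NF by (intro old_key[of _ N "- 1"]) (auto simp: nd_def)
  qed
qed

lemma key_T4:
  assumes z: "nd z \<le> 1"
  shows "\<exists>k\<in>keys. H' T4 z = pt k \<and> label T4 z = lb k"
proof -
  have ww: "\<bar>Im z\<bar> \<le> W z" "0 \<le> W z" using z by (auto simp: nd_def W_def)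
  have up: "Re (\<i> * cnj (upper z)) = W z" "Im (\<i> * cnj (upper z)) = Re z" by (simp_all add: upper_def W_def)
  have nd1: "nd (\<i> * cnj (upper z)) = 1" using nd_upper(1)[OF z] by (simp add: nd_scale)
  have Re: "\<bar>Re z\<bar> = 1 - W z" by (simp add: W_def)
  consider "Im z = W z" | "\<bar>Im z\<bar> < W z" | "Im z = - W z" "0 < W z" "W z < 1" | "Im z = - W z" "W z = 1"
    using ww by (auto simp: W_def) linarith
  then show ?thesis
  proof cases
    case 1
    then have nd: "nd z = 1" "upper z = z" "0 \<le> Im z" using ww by (auto simp: nd_def W_def upper_def complex_eq_iff)
    then have "label T4 z = label N z" using bweight_upper(1)[OF nd(3)] by (simp add: label_def fun_eq_iff del: bweight.simps)
    moreover have "H' T4 z = J (H N z)" using \<Theta>_bdry(2)[OF nd1] 1 nd by (simp add: H'_T algebra_simps)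
    ultimately show ?thesis using nd NF by (intro old_key[of _ N z]) auto
  next
    case 2
    have "nd z < 1" using 2 by (auto simp: nd_def W_def)
    then have "label T4 z = lb_new (\<i> * cnj (upper z)) (3 - 3 / 2 * (W z - Im z))"
      using 2 unfolding label_def lb_new_def up Re by (auto simp: complex_eq_iff field_simps)
    moreover have "0 < 3 / 2 * (W z - Im z)" "3 / 2 * (W z - Im z) < 3" using 2 by (auto simp: W_def abs_if split: if_splits)
    ultimately show ?thesis by (intro new_key[OF H'_T(3) _ nd1]) auto
  next
    case 3
    have "\<not> nd z < 1" using 3 by (auto simp: nd_def W_def)
    moreover have "bweight T4 z = bweight (x, e, y, e') (\<i> * cnj (upper z))"
    proof
      fix n
      have "max 0 (Im z) = 0" "max 0 (- Im z) = W z" "max 0 (W z) = W z" "max 0 (- W z) = 0" using 3 by auto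
      then show "bweight T4 z n = bweight (x, e, y, e') (\<i> * cnj (upper z)) n" using up by simp
    qed
    moreover have "3 - 3 / 2 * (W z - Im z) = 3 * \<bar>Re z\<bar>" using 3 unfolding Re by simp
    ultimately have "label T4 z = lb_new (\<i> * cnj (upper z)) (3 - 3 / 2 * (W z - Im z))"
      unfolding label_def lb_new_def up by (simp del: bweight.simps)
    then show ?thesis using 3 by (intro new_key[OF H'_T(3) _ nd1]) (auto simp: field_simps)
  next
    case 4
    then have z: "z = - \<i>" by (auto simp: W_def complex_eq_iff)
    have "\<i> * cnj (upper z) = 1" by (auto simp: upper_def z complex_eq_iff)
    then have "H' T4 z = J (H M 1)" using \<Theta>_bdry(1)[of 1] 4 by (simp add: H'_T)
    moreover have "label T4 z = label M 1"
    proof -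
      have "bweight T4 z = bweight M 1" by (simp only: z bweight_corners)
      then show ?thesis by (simp add: z label_def nd_def del: bweight.simps)
    qed
    ultimately show ?thesis using MF by (intro old_key[of _ M 1]) (auto simp: nd_def)
  qed
qed

lemma key_T2:
  assumes z: "nd z \<le> 1"
  shows "\<exists>k\<in>keys. H' T2 z = pt k \<and> label T2 z = lb k"
proof -
  have ww: "\<bar>Im z\<bar> \<le> W z" "0 \<le> W z" using z by (auto simp: nd_def W_def)
  have up: "Re (\<i> * cnj (lower z)) = - W z" "Im (\<i> * cnj (lower z)) = Re z" by (simp_all add: lower_def W_def)
  have nd1: "nd (\<i> * cnj (lower z)) = 1" using nd_upper(2)[OF z] by (simp add: nd_scale)
  have Re: "\<bar>Re z\<bar> = 1 - W z" by (simp add: W_def)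
  consider "Im z = - W z" | "\<bar>Im z\<bar> < W z" | "Im z = W z" "0 < W z" "W z < 1" | "Im z = W z" "W z = 1"
    using ww by (auto simp: W_def) linarith
  then show ?thesis
  proof cases
    case 1
    then have nd: "nd z = 1" "lower z = z" "Im z \<le> 0" using ww by (auto simp: nd_def W_def lower_def complex_eq_iff)
    then have "label T2 z = label N z" using bweight_upper(2)[OF nd(3)] by (simp add: label_def fun_eq_iff del: bweight.simps)
    moreover have "H' T2 z = J (H N z)" using \<Theta>_bdry(2)[OF nd1] 1 nd by (simp add: H'_T algebra_simps)
    ultimately show ?thesis using nd NF by (intro old_key[of _ N z]) auto
  next
    case 2
    have "nd z < 1" using 2 by (auto simp: nd_def W_def)
    then have "label T2 z = lb_new (\<i> * cnj (lower z)) (3 - 3 / 2 * (W z + Im z))"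
      using 2 unfolding label_def lb_new_def up Re by (auto simp: complex_eq_iff field_simps)
    moreover have "0 < 3 / 2 * (W z + Im z)" "3 / 2 * (W z + Im z) < 3" using 2 by (auto simp: W_def abs_if split: if_splits)
    ultimately show ?thesis by (intro new_key[OF H'_T(4) _ nd1]) auto
  next
    case 3
    have "\<not> nd z < 1" using 3 by (auto simp: nd_def W_def)
    moreover have "bweight T2 z = bweight (x, e, y, e') (\<i> * cnj (lower z))"
    proof
      fix n
      have "max 0 (Im z) = W z" "max 0 (- Im z) = 0" "max 0 (W z) = W z" "max 0 (- W z) = 0" using 3 by auto
      then show "bweight T2 z n = bweight (x, e, y, e') (\<i> * cnj (lower z)) n" using up by simp
    qed
    moreover have "3 - 3 / 2 * (W z + Im z) = 3 * \<bar>Re z\<bar>" using 3 unfolding Re by simp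
    ultimately have "label T2 z = lb_new (\<i> * cnj (lower z)) (3 - 3 / 2 * (W z + Im z))"
      unfolding label_def lb_new_def up by (simp del: bweight.simps)
    then show ?thesis using 3 by (intro new_key[OF H'_T(4) _ nd1]) (auto simp: field_simps)
  next
    case 4
    then have z: "z = \<i>" by (auto simp: W_def complex_eq_iff)
    have "\<i> * cnj (lower z) = - 1" by (auto simp: lower_def z complex_eq_iff)
    then have "H' T2 z = J (H M (- 1))" using \<Theta>_bdry(1)[of "- 1"] 4 by (simp add: H'_T)
    moreover have "label T2 z = label M (- 1)"
    proof -
      have "bweight T2 z = bweight M (- 1)" by (simp only: z bweight_corners)
      then show ?thesis by (simp add: z label_def nd_def del: bweight.simps)
    qed
    ultimately show ?thesis using MF by (intro old_key[of _ M "- 1"]) (auto simp: nd_def)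
  qed
qed

lemma lb_new_Inr:
  assumes "lb_new p \<tau> = Inr (g, z)" "nd p = 1"
  shows "g = T1 \<and> p = upper z \<and> \<tau> = 3 / 2 * (W z - Im z) \<or> g = T3 \<and> p = lower z \<and> \<tau> = 3 / 2 * (W z + Im z)
    \<or> g = T4 \<and> p = \<i> * cnj (upper z) \<and> \<tau> = 3 - 3 / 2 * (W z - Im z) \<or> g = T2 \<and> p = \<i> * cnj (lower z) \<and> \<tau> = 3 - 3 / 2 * (W z + Im z)"
proof -
  have nd: "\<bar>Re p\<bar> + \<bar>Im p\<bar> = 1" using assms(2) by (simp add: nd_def)
  consider "\<tau> < 3 * \<bar>Im p\<bar>" "0 < Im p" | "\<tau> < 3 * \<bar>Im p\<bar>" "\<not> 0 < Im p"
    | "\<tau> = 3 * \<bar>Im p\<bar>" | "\<tau> > 3 * \<bar>Im p\<bar>" "0 < Re p" | "\<tau> > 3 * \<bar>Im p\<bar>" "\<not> 0 < Re p"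
    by linarith
  then show ?thesis
  proof cases
    case 1
    then have "g = T1" and z: "z = Complex (Re p) (Im p - 2 * \<tau> / 3)" using assms(1) by (auto simp: lb_new_def)
    moreover have "p = upper z" "\<tau> = 3 / 2 * (W z - Im z)" using 1 nd by (auto simp: z upper_def W_def complex_eq_iff)
    ultimately show ?thesis by blast
  next
    case 2
    then have "g = T3" and z: "z = Complex (Re p) (Im p + 2 * \<tau> / 3)" using assms(1) by (auto simp: lb_new_def)
    moreover have "p = lower z" "\<tau> = 3 / 2 * (W z + Im z)" using 2 nd by (auto simp: z lower_def W_def complex_eq_iff)
    ultimately show ?thesis by blast
  next
    case 3
    then show ?thesis using assms(1) by (simp add: lb_new_def)
  next
    case 4
    then have "g = T4" and z: "z = Complex (Im p) (Re p - 2 * (3 - \<tau>) / 3)" using assms(1) by (auto simp: lb_new_def)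
    moreover have "p = \<i> * cnj (upper z)" "\<tau> = 3 - 3 / 2 * (W z - Im z)" using 4 nd by (auto simp: z upper_def W_def complex_eq_iff field_simps)
    ultimately show ?thesis by blast
  next
    case 5
    then have "g = T2" and z: "z = Complex (Im p) (Re p + 2 * (3 - \<tau>) / 3)" using assms(1) by (auto simp: lb_new_def)
    moreover have "p = \<i> * cnj (lower z)" "\<tau> = 3 - 3 / 2 * (W z + Im z)" using 5 nd by (auto simp: z lower_def W_def complex_eq_iff field_simps)
    ultimately show ?thesis by blast
  qed
qed

lemma lb_new_Inl:
  assumes "lb_new p \<tau> = Inl B"
  shows "B = bweight (x, e, y, e') p \<and> \<tau> = 3 * \<bar>Im p\<bar>"
  using assms unfolding lb_new_def by (simp split: if_splits)

lemma lb_new_inj: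
  assumes "lb_new p \<tau> = lb_new p' \<tau>'" "nd p = 1" "nd p' = 1"
  shows "p = p' \<and> \<tau> = \<tau>'"
proof (cases "lb_new p \<tau>")
  case (Inl B)
  then have "bweight (x, e, y, e') p = bweight (x, e, y, e') p'" "\<tau> = 3 * \<bar>Im p\<bar>" "\<tau>' = 3 * \<bar>Im p'\<bar>"
    using lb_new_Inl[of p \<tau> B] lb_new_Inl[of p' \<tau>' B] assms(1) by auto
  then show ?thesis using bweight_inj[OF distinct_cross] by auto
next
  case (Inr q)
  obtain g z where q: "q = (g, z)" by (cases q) auto
  have "lb_new p' \<tau>' = Inr (g, z)" "lb_new p \<tau> = Inr (g, z)" using Inr assms(1) q by auto
  from lb_new_Inr[OF this(1) assms(3)] lb_new_Inr[OF this(2) assms(2)]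
  show ?thesis by (elim disjE conjE) (metis T_distinct)+
qed

text \<open>A point inside a new edge has positive weight at a vertex of \<open>{x, y}\<close> and
  at one of \<open>{e, e'}\<close>; if an old face had such a boundary point, these two vertices
  would already be joined.\<close>

lemma lb_new_not_old:
  assumes p: "nd p = 1" "0 < \<tau>" "\<tau> < 3" and g: "g \<in> F"
  shows "lb_new p \<tau> \<noteq> label g w"
proof
  assume eq: "lb_new p \<tau> = label g w"
  show False
  proof (cases "nd w < 1")
    case True
    then have "lb_new p \<tau> = Inr (g, w)" using eq by (simp add: label_def)
    from lb_new_Inr[OF this p(1)] T_not_in g show False by metis
  next
    case False
    then have "lb_new p \<tau> = Inl (bweight g w)" using eq by (simp add: label_def)
    from lb_new_Inl[OF this] have B: "bweight g w = bweight (x, e, y, e') p" and \<tau>: "\<tau> = 3 * \<bar>Im p\<bar>" by auto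
    have ne: "Im p \<noteq> 0" "Re p \<noteq> 0" using p \<tau> by (auto simp: nd_def)
    define X where "X = (if 0 < Re p then x else y)"
    define E where "E = (if 0 < Im p then e else e')"
    have "bweight (x, e, y, e') p X > 0" "bweight (x, e, y, e') p E > 0"
      using ne distinct_cross by (cases "0 < Re p"; cases "0 < Im p"; simp add: X_def E_def max_def)+
    moreover have XE: "X \<in> {x, y}" "E \<in> {e, e'}" by (auto simp: X_def E_def)
    ultimately show False
      using bweight_pos_dedge[of g w X E] fresh(1)[OF XE] fresh(2)[OF XE g] unfolding B by auto
  qed
qed

lemma keys_iff:
  assumes k: "k \<in> keys" "k' \<in> keys"
  shows "pt k = pt k' \<longleftrightarrow> lb k = lb k'"
proof -
  have oldD: "g \<in> F \<and> nd w \<le> 1 \<and> (g \<in> {M, N} \<longrightarrow> nd w = 1)" if "Inl (g, w) \<in> keys" for g w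
    using that unfolding keys_def by blast
  have newD: "nd p = 1 \<and> 0 < \<tau> \<and> \<tau> < 3" if "Inr (p, \<tau>) \<in> keys" for p \<tau>
    using that unfolding keys_def by blast
  have mixed: "pt (Inl (g, w)) \<noteq> pt (Inr (p, \<tau>)) \<and> lb (Inl (g, w)) \<noteq> lb (Inr (p, \<tau>))"
    if "Inl (g, w) \<in> keys" "Inr (p, \<tau>) \<in> keys" for g w p \<tau>
    using \<Theta>_not_old[of p \<tau> g w] lb_new_not_old[of p \<tau> g w] oldD[OF that(1)] newD[OF that(2)]
    by (auto simp: pt_def lb_def)
  consider g w g' w' where "k = Inl (g, w)" "k' = Inl (g', w')" | g w p \<tau> where "k = Inl (g, w)" "k' = Inr (p, \<tau>)"
    | p \<tau> g' w' where "k = Inr (p, \<tau>)" "k' = Inl (g', w')" | p \<tau> p' \<tau>' where "k = Inr (p, \<tau>)" "k' = Inr (p', \<tau>')"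
    by (metis old.prod.exhaust old.sum.exhaust)
  then show ?thesis
  proof cases
    case 1
    have D: "g \<in> F \<and> nd w \<le> 1 \<and> (g \<in> {M, N} \<longrightarrow> nd w = 1)" "g' \<in> F \<and> nd w' \<le> 1 \<and> (g' \<in> {M, N} \<longrightarrow> nd w' = 1)"
      using oldD k 1 by auto
    have h: "g \<in> {M, N} \<Longrightarrow> 1/2 \<le> nd w" "g' \<in> {M, N} \<Longrightarrow> 1/2 \<le> nd w'" using D by simp_all
    have "J (H g w) = J (H g' w') \<longleftrightarrow> label g w = label g' w'"
      using J_eq_iff[of g w g' w', OF _ _ h(1) _ _ h(2)] label_eq_iff[of w w' g g'] D by metis
    then show ?thesis using 1 by (simp add: pt_def lb_def)
  next
    case 2 then show ?thesis using mixed[of g w p \<tau>] k by simp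
  next
    case 3 then show ?thesis using mixed[of g' w' p \<tau>] k by auto
  next
    case 4
    then have D: "nd p = 1 \<and> 0 < \<tau> \<and> \<tau> < 3" "nd p' = 1 \<and> 0 < \<tau>' \<and> \<tau>' < 3" using newD k by auto
    show ?thesis using \<Theta>_inj[of p p' \<tau> \<tau>'] lb_new_inj[of p \<tau> p' \<tau>'] D 4 by (auto simp: pt_def lb_def)
  qed
qed

lemma continuous_\<Theta>: "continuous_on ({p. nd p = 1} \<times> {0..3}) (\<lambda>(p, \<tau>). \<Theta> p \<tau>)"
proof -
  let ?C = "{p. nd p = 1}"
  have cl: "closed ?C" by (intro closed_Collect_eq continuous_on_nd continuous_on_const)
  have HM: "continuous_on (diamond 1) (H M)" "continuous_on (diamond 1) (H N)" using dr MF NF by (auto simp: drawing_def)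
  have comp: "continuous_on A (\<lambda>q. J (H g (k q)))"
    if "g \<in> {M, N}" "continuous_on A k" "\<And>q. q \<in> A \<Longrightarrow> 1/2 \<le> nd (k q) \<and> nd (k q) \<le> 1" for A g and k :: "complex \<times> real \<Rightarrow> complex"
  proof (rule continuous_on_compose2[OF J(1)])
    show "continuous_on A (\<lambda>q. H g (k q))"
      by (rule continuous_on_compose2[of "diamond 1" "H g"]) (use that HM in \<open>auto simp: mem_diamond\<close>)
    have gF: "g \<in> F" using that(1) MF NF by blast
    show "(\<lambda>q. H g (k q)) ` A \<subseteq> R"
    proof (rule image_subsetI)
      fix q assume "q \<in> A"
      from that(3)[OF this] show "H g (k q) \<in> R" by (intro in_R[OF gF]) simp_all
    qed
  qed
  have c1: "continuous_on (?C \<times> {0..1}) (\<lambda>q. J (H M (of_real (1 - snd q / 2) * fst q)))"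
    by (rule comp) (auto simp: nd_scale simp del: of_real_diff of_real_divide intro!: continuous_intros)
  have c3: "continuous_on (?C \<times> {2..3}) (\<lambda>q. J (H N (of_real ((snd q - 1) / 2) * (\<i> * cnj (fst q)))))"
    by (rule comp) (auto simp: nd_scale simp del: of_real_diff of_real_divide intro!: continuous_intros)
  have "continuous_on (?C \<times> {0..1}) (\<lambda>(p, \<tau>). \<Theta> p \<tau>)"
    by (rule continuous_on_cong[THEN iffD1, OF refl _ c1]) (auto simp: \<Theta>_M)
  moreover have "continuous_on (?C \<times> {1..2}) (\<lambda>(p, \<tau>). \<Theta> p \<tau>)"
    by (rule continuous_on_cong[THEN iffD1, OF refl _ Tb(1)]) (auto simp: \<Theta>_mid)
  moreover have "continuous_on (?C \<times> {2..3}) (\<lambda>(p, \<tau>). \<Theta> p \<tau>)"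
    by (rule continuous_on_cong[THEN iffD1, OF refl _ c3]) (auto simp: \<Theta>_N)
  ultimately have "continuous_on (?C \<times> {0..1} \<union> ?C \<times> {1..2} \<union> ?C \<times> {2..3}) (\<lambda>(p, \<tau>). \<Theta> p \<tau>)"
    by (intro continuous_on_closed_Un closed_Un closed_Times cl) auto
  moreover have "?C \<times> {0..1} \<union> ?C \<times> {1..2} \<union> ?C \<times> {2..3} = ?C \<times> {0..3::real}" by auto
  ultimately show ?thesis by simp
qed

lemma \<Theta>_in_S': assumes "nd p = 1" "0 \<le> \<tau>" "\<tau> \<le> 3" shows "\<Theta> p \<tau> \<in> S'"
proof -
  consider "\<tau> \<le> 1" | "1 \<le> \<tau>" "\<tau> \<le> 2" | "2 \<le> \<tau>" by linarith
  then show ?thesis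
  proof cases
    case 1
    have "H M (of_real (1 - \<tau> / 2) * p) \<in> R" using assms 1 by (intro in_R MF) (auto simp: nd_scale simp del: of_real_diff of_real_divide)
    then show ?thesis unfolding \<Theta>_M[OF 1] cover by blast
  next
    case 2
    then show ?thesis unfolding \<Theta>_mid[OF assms(1) 2] cover using assms(1) by force
  next
    case 3
    have "H N (of_real ((\<tau> - 1) / 2) * (\<i> * cnj p)) \<in> R" using assms 3 by (intro in_R NF) (auto simp: nd_scale simp del: of_real_diff of_real_divide)
    then show ?thesis unfolding \<Theta>_N[OF assms(1) 3] cover by blast
  qed
qed

lemma \<Theta>_covered:
  assumes p: "nd p = 1" "0 \<le> \<tau>" "\<tau> \<le> 3"
  shows "\<exists>g\<in>{T1, T2, T3, T4}. \<exists>z\<in>diamond 1. \<Theta> p \<tau> = H' g z"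
proof -
  have nd: "\<bar>Re p\<bar> + \<bar>Im p\<bar> = 1" using p by (simp add: nd_def)
  consider "\<tau> \<le> 3 * \<bar>Im p\<bar>" "0 \<le> Im p" | "\<tau> \<le> 3 * \<bar>Im p\<bar>" "Im p < 0"
    | "\<tau> \<ge> 3 * \<bar>Im p\<bar>" "0 \<le> Re p" | "\<tau> \<ge> 3 * \<bar>Im p\<bar>" "Re p < 0" by linarith
  then show ?thesis
  proof cases
    case 1
    let ?z = "Complex (Re p) (Im p - 2 * \<tau> / 3)"
    have "p = upper ?z" "\<tau> = 3 / 2 * (W ?z - Im ?z)" using 1 nd by (auto simp: upper_def W_def complex_eq_iff)
    moreover have "?z \<in> diamond 1" using 1 nd p by (auto simp: mem_diamond nd_def)
    ultimately have "?z \<in> diamond 1" "\<Theta> p \<tau> = H' T1 ?z" unfolding H'_T by (blast intro: arg_cong2[where f = \<Theta>])+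
    then show ?thesis by blast
  next
    case 2
    let ?z = "Complex (Re p) (Im p + 2 * \<tau> / 3)"
    have "p = lower ?z" "\<tau> = 3 / 2 * (W ?z + Im ?z)" using 2 nd by (auto simp: lower_def W_def complex_eq_iff)
    moreover have "?z \<in> diamond 1" using 2 nd p by (auto simp: mem_diamond nd_def)
    ultimately have "?z \<in> diamond 1" "\<Theta> p \<tau> = H' T3 ?z" unfolding H'_T by (blast intro: arg_cong2[where f = \<Theta>])+
    then show ?thesis by blast
  next
    case 3
    let ?z = "Complex (Im p) (Re p - 2 * (3 - \<tau>) / 3)"
    have "p = \<i> * cnj (upper ?z)" "\<tau> = 3 - 3 / 2 * (W ?z - Im ?z)" using 3 nd by (auto simp: upper_def W_def complex_eq_iff field_simps)
    moreover have "?z \<in> diamond 1" using 3 nd p by (auto simp: mem_diamond nd_def field_simps)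
    ultimately have "?z \<in> diamond 1" "\<Theta> p \<tau> = H' T4 ?z" unfolding H'_T by (blast intro: arg_cong2[where f = \<Theta>])+
    then show ?thesis by blast
  next
    case 4
    let ?z = "Complex (Im p) (Re p + 2 * (3 - \<tau>) / 3)"
    have "p = \<i> * cnj (lower ?z)" "\<tau> = 3 - 3 / 2 * (W ?z + Im ?z)" using 4 nd by (auto simp: lower_def W_def complex_eq_iff field_simps)
    moreover have "?z \<in> diamond 1" using 4 nd p by (auto simp: mem_diamond nd_def field_simps)
    ultimately have "?z \<in> diamond 1" "\<Theta> p \<tau> = H' T2 ?z" unfolding H'_T by (blast intro: arg_cong2[where f = \<Theta>])+
    then show ?thesis by blast
  qed
qed

lemma T_args:
  assumes "nd z \<le> 1"
  shows "0 \<le> 3 / 2 * (W z - Im z)" "3 / 2 * (W z - Im z) \<le> 3" "0 \<le> 3 / 2 * (W z + Im z)" "3 / 2 * (W z + Im z) \<le> 3"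
    "nd (upper z) = 1" "nd (lower z) = 1" "nd (\<i> * cnj (upper z)) = 1" "nd (\<i> * cnj (lower z)) = 1"
proof -
  have "\<bar>Im z\<bar> \<le> W z" "W z \<le> 1" using assms by (auto simp: nd_def W_def)
  then show "0 \<le> 3 / 2 * (W z - Im z)" "3 / 2 * (W z - Im z) \<le> 3" "0 \<le> 3 / 2 * (W z + Im z)" "3 / 2 * (W z + Im z) \<le> 3"
    by (auto simp: field_simps)
qed (use nd_upper[OF assms] in \<open>simp_all add: nd_scale\<close>)

lemma drawing_join: "drawing S' (join_faces F M N) H'"
proof (rule drawing_by_keys[where K = keys and pt = pt and lb = lb, OF _ _ _ keys_iff])
  have F': "join_faces F M N = (F - {M, N}) \<union> {T1, T2, T3, T4}" by (simp add: join_faces_def)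
  have old_cont: "continuous_on (diamond 1) (H' g)" if g: "g \<in> F" "g \<notin> {M, N}" for g
  proof -
    have Hg: "continuous_on (diamond 1) (H g)" using dr g by (auto simp: drawing_def)
    have "continuous_on (diamond 1) (\<lambda>z. J (H g z))"
    proof (rule continuous_on_compose2[OF J(1) Hg], rule image_subsetI)
      fix z assume "z \<in> diamond 1"
      then have "nd z \<le> 1" by (simp add: mem_diamond)
      from in_R[OF g(1) this] show "H g z \<in> R" using g(2) by blast
    qed
    moreover have "H' g = (\<lambda>z. J (H g z))" using H'_old[OF g(1)] by (rule ext)
    ultimately show ?thesis by simp
  qed
  have c: "continuous_on (diamond 1) upper" "continuous_on (diamond 1) lower" "continuous_on (diamond 1) W"
    unfolding upper_def lower_def W_def Complex_eq by (intro continuous_intros)+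
  have new_cont: "continuous_on (diamond 1) (\<lambda>z. \<Theta> (p z) (t z))"
    if "continuous_on (diamond 1) p" "continuous_on (diamond 1) t" "\<And>z. nd z \<le> 1 \<Longrightarrow> nd (p z) = 1 \<and> 0 \<le> t z \<and> t z \<le> 3" for p t
    using continuous_on_compose2[OF continuous_\<Theta> continuous_on_Pair[OF that(1,2)]] that(3) by (auto simp: mem_diamond image_subset_iff)
  have "continuous_on (diamond 1) (H' T1)" "continuous_on (diamond 1) (H' T3)"
    "continuous_on (diamond 1) (H' T4)" "continuous_on (diamond 1) (H' T2)"
    unfolding H'_T[abs_def]
    by (intro new_cont continuous_intros c conjI; use T_args in simp)+
  then show "continuous_on (diamond 1) (H' g)" if "g \<in> join_faces F M N" for g
    using that old_cont unfolding F' by blast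
  show "\<exists>k\<in>keys. H' g z = pt k \<and> label g z = lb k" if g: "g \<in> join_faces F M N" and z: "nd z \<le> 1" for g z
  proof -
    consider "g = T1" | "g = T2" | "g = T3" | "g = T4" | "g \<in> F" "g \<notin> {M, N}" using g unfolding F' by blast
    then show ?thesis
    proof cases
      case 5 then show ?thesis using z H'_old by (intro old_key[of _ g z]) auto
    qed (use key_T1[OF z] key_T2[OF z] key_T3[OF z] key_T4[OF z] in blast)+
  qed
  show "(\<Union>g\<in>join_faces F M N. H' g ` diamond 1) = S'"
  proof
    have "H' g z \<in> S'" if gz: "g \<in> join_faces F M N" "nd z \<le> 1" for g z
    proof -
      consider "g = T1" | "g = T2" | "g = T3" | "g = T4" | "g \<in> F" "g \<notin> {M, N}" using gz unfolding F' by blast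
      then show ?thesis
      proof cases
        case 5
        then have "H g z \<in> R" using in_R[OF 5(1) gz(2)] by blast
        then show ?thesis unfolding H'_old[OF 5(1)] cover by blast
      qed (use T_args[OF gz(2)] \<Theta>_in_S' in \<open>simp_all add: H'_T\<close>)
    qed
    then show "(\<Union>g\<in>join_faces F M N. H' g ` diamond 1) \<subseteq> S'" by (auto simp: mem_diamond)
    have th: "\<Theta> p \<tau> \<in> (\<Union>g\<in>join_faces F M N. H' g ` diamond 1)" if "nd p = 1" "0 \<le> \<tau>" "\<tau> \<le> 3" for p \<tau>
      using \<Theta>_covered[OF that] unfolding F' by blast
    show "S' \<subseteq> (\<Union>g\<in>join_faces F M N. H' g ` diamond 1)"
    proof
      fix s assume "s \<in> S'"
      then consider r where "r \<in> R" "s = J r" | p \<tau> where "nd p = 1" "1 \<le> \<tau>" "\<tau> \<le> 2" "s = Tb p \<tau>"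
        unfolding cover by auto
      then show "s \<in> (\<Union>g\<in>join_faces F M N. H' g ` diamond 1)"
      proof cases
        case 1
        then obtain g w where g: "g \<in> F" "nd w \<le> 1" "r = H g w" using dr by (auto simp: drawing_def mem_diamond)
        \<comment> \<open>Polar coordinates with respect to \<open>nd\<close>. The parameters
          \<open>2 * (1 - nd w)\<close> at the end \<open>M\<close> and \<open>1 + 2 * nd w\<close>
          at the end \<open>N\<close> come from solving the radius in \<open>\<Theta>\<close> for
          \<open>\<tau>\<close>.\<close>
        have n0: "w = of_real (nd w) * (w / of_real (nd w))" "nd (w / of_real (nd w)) = 1" if "1/2 \<le> nd w"
          using that nd_scale(1)[of "inverse (nd w)" w] by (simp_all add: field_simps)
        show ?thesis
        proof (cases "g = M \<or> g = N")
          case False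
          then have "g \<in> join_faces F M N" using g unfolding F' by blast
          moreover have "s = H' g w" using 1 g H'_old by simp
          ultimately show ?thesis using g(2) by (intro UN_I[of g]) (auto simp: mem_diamond)
        next
          case True
          have ge: "1/2 \<le> nd w" using 1 g True by force
          let ?q = "w / of_real (nd w)"
          show ?thesis
          proof (cases "g = M")
            case True
            have "\<Theta> ?q (2 * (1 - nd w)) = J (H M (of_real (1 - 2 * (1 - nd w) / 2) * ?q))"
              by (rule \<Theta>_M) (use ge in simp)
            also have "1 - 2 * (1 - nd w) / 2 = nd w" by (simp add: field_simps)
            finally have "\<Theta> ?q (2 * (1 - nd w)) = J (H M (of_real (nd w) * ?q))" .
            then have "s = \<Theta> ?q (2 * (1 - nd w))" using 1 g True n0[OF ge] by simp
            then show ?thesis using th[of ?q "2 * (1 - nd w)"] n0[OF ge] ge g(2) by simp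
          next
            case False
            let ?p = "\<i> * cnj ?q"
            have p: "nd ?p = 1" "\<i> * cnj ?p = ?q" using n0(2)[OF ge] unfolding nd_scale(2) by (simp_all only: i_cnj_i_cnj)
            have "\<Theta> ?p (1 + 2 * nd w) = J (H N (of_real ((1 + 2 * nd w - 1) / 2) * (\<i> * cnj ?p)))"
              by (rule \<Theta>_N[OF p(1)]) (use ge in simp)
            also have "(1 + 2 * nd w - 1) / 2 = nd w" by simp
            finally have "\<Theta> ?p (1 + 2 * nd w) = J (H N (of_real (nd w) * ?q))" unfolding p(2) .
            then have "s = \<Theta> ?p (1 + 2 * nd w)" using 1 g False \<open>g = M \<or> g = N\<close> n0[OF ge] by simp
            then show ?thesis using th[OF p(1), of "1 + 2 * nd w"] ge g(2) by simp
          qed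
        qed
      next
        case 2 then show ?thesis using th[of p \<tau>] \<Theta>_mid[of p \<tau>] by simp
      qed
    qed
  qed
qed

end

section \<open>Attaching a handle to the pierced block\<close>

lemma mem_pierced_block:
  "(x, y, z) \<in> pierced_block g \<longleftrightarrow> 0 \<le> x \<and> x \<le> 2 * real g + 1 \<and> 0 \<le> y \<and> y \<le> 3 \<and> 0 \<le> z \<and> z \<le> 1 \<and>
    (\<forall>i<g. \<not> (2 * real i + 1 < x \<and> x < 2 * real i + 2 \<and> 1 < y \<and> y < 2))"
  by (auto simp: pierced_block_def tunnel_def)

text \<open>For recognising points that are not interior: an interior point can be pushed a little
  in every direction, a point on a wall cannot be pushed outwards.\<close>

lemma interior_push:
  fixes p d :: "'b::real_normed_vector"
  assumes "p \<in> interior P"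
  obtains t where "0 < t" "t \<le> 1" "p + t *\<^sub>R d \<in> P"
proof -
  obtain e where e: "0 < e" "ball p e \<subseteq> P" using assms mem_interior by blast
  define t where "t = min 1 (e / (2 * (norm d + 1)))"
  have t: "0 < t" "t \<le> 1" using e by (auto simp: t_def add_nonneg_pos)
  have "t * norm d \<le> e / (2 * (norm d + 1)) * norm d" by (intro mult_right_mono) (auto simp: t_def)
  also have "\<dots> < e"
  proof -
    have "norm d / (2 * (norm d + 1)) < 1" by (simp add: divide_less_eq add_nonneg_pos)
    then have "e * (norm d / (2 * (norm d + 1))) < e * 1" using e by (intro mult_strict_left_mono)
    then show ?thesis by simp
  qed
  finally have "p + t *\<^sub>R d \<in> ball p e" using t by (simp add: dist_norm)
  then show ?thesis using that t e by blast
qed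

text \<open>The candidate \<open>I\<close> for the interior is the open box without the closed
  tunnels. It is open and contained in the block; conversely, a point on an outer wall is pushed out
  of the block, and a point on the wall of a tunnel is pushed towards the centre of that
  tunnel.\<close>

lemma mem_genus_surface:
  "(x, y, z) \<in> genus_surface g \<longleftrightarrow> (x, y, z) \<in> pierced_block g \<and>
    (x = 0 \<or> x = 2 * real g + 1 \<or> y = 0 \<or> y = 3 \<or> z = 0 \<or> z = 1 \<or>
     (\<exists>i<g. 2 * real i + 1 \<le> x \<and> x \<le> 2 * real i + 2 \<and> 1 \<le> y \<and> y \<le> 2))"
proof -
  let ?P = "pierced_block g"
  define I :: "(real \<times> real \<times> real) set" where "I = ({0 <..< 2 * real g + 1} \<times> {0 <..< 3} \<times> {0 <..< 1}) \<inter>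
    (\<Inter>i<g. - ({2 * real i + 1 .. 2 * real i + 2} \<times> {1 .. 2} \<times> (UNIV :: real set)))"
  have "?P = ({0 .. 2 * real g + 1} \<times> {0 .. 3} \<times> {0 .. 1}) \<inter>
    (\<Inter>i<g. - ({2 * real i + 1 <..< 2 * real i + 2} \<times> {1 <..< 2} \<times> UNIV))"
    by (auto simp: pierced_block_def tunnel_def)
  also have "closed \<dots>"
    by (intro closed_Int closed_Times closed_INT ballI closed_Compl open_Times) auto
  finally have cl: "closed ?P" .
  have "open I" unfolding I_def
    by (intro open_Int open_Times open_INT ballI open_Compl closed_Times finite_lessThan
        open_greaterThanLessThan closed_atLeastAtMost closed_UNIV)
  moreover have "I \<subseteq> ?P"
  proof
    fix w assume w: "w \<in> I"
    obtain u v t where uvt: "w = (u, v, t)" by (cases w) auto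
    have "\<not> (2 * real i + 1 < u \<and> u < 2 * real i + 2 \<and> 1 < v \<and> v < 2)" if "i < g" for i
    proof -
      have "w \<in> - ({2 * real i + 1 .. 2 * real i + 2} \<times> {1 .. 2} \<times> UNIV)" using w that by (simp add: I_def)
      then show ?thesis by (auto simp: uvt)
    qed
    moreover have "w \<in> {0 <..< 2 * real g + 1} \<times> {0 <..< 3} \<times> {0 <..< 1}" using w by (simp add: I_def)
    ultimately show "w \<in> ?P" unfolding uvt mem_pierced_block by auto
  qed
  ultimately have sub: "I \<subseteq> interior ?P" by (rule interior_maximal[rotated])
  have "(x, y, z) \<in> I" if int: "(x, y, z) \<in> interior ?P"
  proof -
    have P: "(x, y, z) \<in> ?P" using int interior_subset by blast
    have push: "\<exists>t. 0 < t \<and> t \<le> 1 \<and> (x + t * a, y + t * b, z + t * c) \<in> ?P" for a b c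
    proof -
      obtain t where "0 < t" "t \<le> 1" "(x, y, z) + t *\<^sub>R (a, b, c) \<in> ?P" by (rule interior_push[OF int])
      then show ?thesis by auto
    qed
    have "0 < x" using push[of "-1" 0 0] unfolding mem_pierced_block by auto
    moreover have "x < 2 * real g + 1" using push[of 1 0 0] unfolding mem_pierced_block by auto
    moreover have "0 < y" using push[of 0 "-1" 0] unfolding mem_pierced_block by auto
    moreover have "y < 3" using push[of 0 1 0] unfolding mem_pierced_block by auto
    moreover have "0 < z" using push[of 0 0 "-1"] unfolding mem_pierced_block by auto
    moreover have "z < 1" using push[of 0 0 1] unfolding mem_pierced_block by auto
    moreover have "\<not> (2 * real i + 1 \<le> x \<and> x \<le> 2 * real i + 2 \<and> 1 \<le> y \<and> y \<le> 2)" if i: "i < g" for i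
    proof
      assume *: "2 * real i + 1 \<le> x \<and> x \<le> 2 * real i + 2 \<and> 1 \<le> y \<and> y \<le> 2"
      have conv: "lo < w + t * ((lo + hi) / 2 - w) \<and> w + t * ((lo + hi) / 2 - w) < hi"
        if "lo \<le> w" "w \<le> hi" "0 < t" "t \<le> 1" "lo < hi" for lo hi w t :: real
      proof
        have e: "w + t * ((lo + hi) / 2 - w) - lo = (1 - t) * (w - lo) + t * ((hi - lo) / 2)"
          "hi - (w + t * ((lo + hi) / 2 - w)) = (1 - t) * (hi - w) + t * ((hi - lo) / 2)"
          by (simp_all add: field_simps)
        have "0 < w + t * ((lo + hi) / 2 - w) - lo" "0 < hi - (w + t * ((lo + hi) / 2 - w))"
          unfolding e using that by (auto intro!: add_nonneg_pos)
        then show "lo < w + t * ((lo + hi) / 2 - w)" "w + t * ((lo + hi) / 2 - w) < hi"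
          unfolding diff_gt_0_iff_gt by blast+
      qed
      \<comment> \<open>The direction leads to the centre of the cross-section of the tunnel, so any
        positive step ends strictly inside the tunnel.\<close>
      obtain t where t: "0 < t" "t \<le> 1" "(x + t * ((2 * real i + 1 + (2 * real i + 2)) / 2 - x), y + t * ((1 + 2) / 2 - y), z + t * 0) \<in> ?P"
        using push by blast
      have "2 * real i + 1 < x + t * ((2 * real i + 1 + (2 * real i + 2)) / 2 - x) \<and> x + t * ((2 * real i + 1 + (2 * real i + 2)) / 2 - x) < 2 * real i + 2"
        "1 < y + t * ((1 + 2) / 2 - y) \<and> y + t * ((1 + 2) / 2 - y) < 2"
        by (rule conv; use * t in simp)+
      then show False using t(3) i unfolding mem_pierced_block by blast
    qed
    ultimately show ?thesis by (auto simp: I_def)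
  qed
  then have "(x, y, z) \<in> interior ?P \<longleftrightarrow> (x, y, z) \<in> I" using sub by blast
  moreover have "frontier ?P = ?P - interior ?P" using cl by (simp add: frontier_def)
  ultimately have "(x, y, z) \<in> genus_surface g \<longleftrightarrow> (x, y, z) \<in> ?P \<and> (x, y, z) \<notin> I"
    by (simp add: genus_surface_def)
  also have "\<dots> \<longleftrightarrow> (x, y, z) \<in> ?P \<and> (x = 0 \<or> x = 2 * real g + 1 \<or> y = 0 \<or> y = 3 \<or> z = 0 \<or> z = 1 \<or>
     (\<exists>i<g. 2 * real i + 1 \<le> x \<and> x \<le> 2 * real i + 2 \<and> 1 \<le> y \<and> y \<le> 2))"
  proof (rule conj_cong[OF refl])
    assume "(x, y, z) \<in> ?P"
    then have "0 < x \<longleftrightarrow> x \<noteq> 0" "x < 2 * real g + 1 \<longleftrightarrow> x \<noteq> 2 * real g + 1" "0 < y \<longleftrightarrow> y \<noteq> 0" "y < 3 \<longleftrightarrow> y \<noteq> 3"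
      "0 < z \<longleftrightarrow> z \<noteq> 0" "z < 1 \<longleftrightarrow> z \<noteq> 1"
      unfolding mem_pierced_block by auto
    moreover have "(x, y, z) \<in> I \<longleftrightarrow> (0 < x \<and> x < 2 * real g + 1 \<and> 0 < y \<and> y < 3 \<and> 0 < z \<and> z < 1) \<and>
      (\<forall>i<g. \<not> (2 * real i + 1 \<le> x \<and> x \<le> 2 * real i + 2 \<and> 1 \<le> y \<and> y \<le> 2))"
      by (auto simp: I_def)
    ultimately show "(x, y, z) \<notin> I \<longleftrightarrow> (x = 0 \<or> x = 2 * real g + 1 \<or> y = 0 \<or> y = 3 \<or> z = 0 \<or> z = 1 \<or>
     (\<exists>i<g. 2 * real i + 1 \<le> x \<and> x \<le> 2 * real i + 2 \<and> 1 \<le> y \<and> y \<le> 2))"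
      by blast
  qed
  finally show ?thesis .
qed

section \<open>Pins in the right wall, and coordinates for the bar that closes a new handle\<close>

definition pin_low :: "nat \<Rightarrow> complex \<Rightarrow> real \<times> real \<times> real" where
  "pin_low g z = (2 * real g + 1, 1/2 + (Re z + Im z) / 8, 9/32 + (Im z - Re z) / 8)"

text \<open>On the half-size diamond each pin is an axis-parallel square of side \<open>1/8\<close>.
  For the low pin this is the unit square shrunk by the factor \<open>1/8\<close> towards
  \<open>(1/2, 1/4)\<close>, which puts its centre at height \<open>9/32\<close>. The high pin is
  the mirror image of the low one after the reflection \<open>z \<mapsto> \<i> * cnj z\<close>, in
  accordance with the matching of the two ends of a tube; so both pins have the same orientation in
  the wall.\<close>

definition pin_high :: "nat \<Rightarrow> complex \<Rightarrow> real \<times> real \<times> real" where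
  "pin_high g z = (2 * real g + 1, 5/2 - (Re z + Im z) / 8, 9/32 - (Im z - Re z) / 8)"

text \<open>The gauge of the unit square with respect to the point \<open>(1/2, 1/4)\<close>. The centre is off the middle
  line so that after the attachment the new face \<open>(x, e', y, c)\<close> contains the two pins of the new
  right wall.\<close>

definition sq_gauge :: "real \<Rightarrow> real \<Rightarrow> real" where
  "sq_gauge y z = max (max (2 * y - 1) (1 - 2 * y)) (max ((4 * z - 1) / 3) (1 - 4 * z))"

lemma sq_gauge_scale:
  assumes "0 \<le> s" shows "sq_gauge (1/2 + s * (y - 1/2)) (1/4 + s * (z - 1/4)) = s * sq_gauge y z"
proof -
  have *: "max (s * a) (s * b) = s * max a b" for a b using assms by (simp add: max_mult_distrib_left)
  have "2 * (1/2 + s * (y - 1/2)) - 1 = s * (2 * y - 1)" "1 - 2 * (1/2 + s * (y - 1/2)) = s * (1 - 2 * y)"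
    "(4 * (1/4 + s * (z - 1/4)) - 1) / 3 = s * ((4 * z - 1) / 3)" "1 - 4 * (1/4 + s * (z - 1/4)) = s * (1 - 4 * z)"
    by (simp_all add: field_simps)
  then show ?thesis unfolding sq_gauge_def by (simp only: *)
qed

lemma sq_gauge_le_1: "sq_gauge y z \<le> 1 \<longleftrightarrow> 0 \<le> y \<and> y \<le> 1 \<and> 0 \<le> z \<and> z \<le> 1"
  by (auto simp: sq_gauge_def)

lemma sq_gauge_eq_1: "sq_gauge y z = 1 \<longleftrightarrow> 0 \<le> y \<and> y \<le> 1 \<and> 0 \<le> z \<and> z \<le> 1 \<and> (y = 0 \<or> y = 1 \<or> z = 0 \<or> z = 1)"
proof -
  have "sq_gauge y z < 1 \<longleftrightarrow> 0 < y \<and> y < 1 \<and> 0 < z \<and> z < 1" by (auto simp: sq_gauge_def)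
  then show ?thesis using sq_gauge_le_1[of y z] by (auto simp: order.order_iff_strict)
qed

lemma continuous_on_sq_gauge: "continuous_on A (\<lambda>w. sq_gauge (fst w) (snd w))"
  unfolding sq_gauge_def by (intro continuous_intros) auto

definition mirror :: "real \<times> real \<times> real \<Rightarrow> real \<times> real \<times> real" where
  "mirror w = (fst w, 3 - fst (snd w), snd (snd w))"

text \<open>The wall square without its pin is pulled out into an arm with square cross-section: the
  ray from the gauge centre through \<open>(q, r)\<close> becomes the segment of length
  \<open>2 - q\<close> over \<open>(q, r)\<close>. The factor \<open>8/7\<close> lets the boundary
  of the pin, where \<open>\<rho> = 1/8\<close>, reach the end. The length \<open>2 - q\<close> cuts
  the arm off at 45 degrees, as in a mitre joint.\<close>

definition bar :: "nat \<Rightarrow> real \<Rightarrow> real \<Rightarrow> real \<times> real \<times> real" where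
  "bar g y z = (let \<rho> = sq_gauge y z; q = 1/2 + (y - 1/2) / \<rho>; r = 1/4 + (z - 1/4) / \<rho>
     in (2 * real g + 1 + (2 - q) * (8/7 * (1 - \<rho>)), q, r))"

definition squeeze :: "nat \<Rightarrow> real \<times> real \<times> real \<Rightarrow> real \<times> real \<times> real" where
  "squeeze g w = (case w of (x, y, z) \<Rightarrow> if x = 2 * real g + 1 \<and> y \<le> 1 then bar g y z
     else if x = 2 * real g + 1 \<and> 2 \<le> y then mirror (bar g (3 - y) z) else (x, y, z))"

text \<open>The lateral surface of the piece connecting the slanted ends of the two arms. At
  distance \<open>r\<close> from the old wall, the second coordinate runs from \<open>2 - r\<close>
  at \<open>\<tau> = 1\<close> to \<open>1 + r\<close> at \<open>\<tau> = 2\<close>.\<close>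

definition bend :: "nat \<Rightarrow> complex \<Rightarrow> real \<Rightarrow> real \<times> real \<times> real" where
  "bend g p \<tau> = (let r = 3/2 - (Re p + Im p) / 2
     in (2 * real g + 1 + r, 3/2 + (r - 1/2) * (2 * \<tau> - 3), 1/2 + (Im p - Re p) / 2))"

lemma bar_sq_gauge_1: "sq_gauge y z = 1 \<Longrightarrow> bar g y z = (2 * real g + 1, y, z)"
  by (simp add: bar_def)

lemma bar_homothety:
  assumes "sq_gauge q r = 1" "0 < \<rho>"
  shows "bar g (1/2 + \<rho> * (q - 1/2)) (1/4 + \<rho> * (r - 1/4)) = (2 * real g + 1 + (2 - q) * (8/7 * (1 - \<rho>)), q, r)"
proof -
  have "sq_gauge (1/2 + \<rho> * (q - 1/2)) (1/4 + \<rho> * (r - 1/4)) = \<rho>"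
    using sq_gauge_scale[of \<rho> q r] assms by simp
  then show ?thesis using assms(2) unfolding bar_def Let_def by (simp add: field_simps)
qed

lemma homothetyE:
  assumes "0 < sq_gauge y z"
  obtains q r where "sq_gauge q r = 1" "y = 1/2 + sq_gauge y z * (q - 1/2)" "z = 1/4 + sq_gauge y z * (r - 1/4)"
proof -
  define s where "s = inverse (sq_gauge y z)"
  have "sq_gauge (1/2 + s * (y - 1/2)) (1/4 + s * (z - 1/4)) = 1"
    using sq_gauge_scale[of s y z] assms by (simp add: s_def)
  then show ?thesis by (rule that) (use assms in \<open>simp_all add: s_def field_simps\<close>)
qed

section \<open>The surface without the pins and its image under \<open>squeeze\<close>\<close>

definition wall_low :: "nat \<Rightarrow> (real \<times> real \<times> real) set" where
  "wall_low g = {(x, y, z). x = 2 * real g + 1 \<and> 1/8 \<le> sq_gauge y z \<and> sq_gauge y z \<le> 1}"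

text \<open>The part that is not moved. It includes the middle strip of the right wall, which
  becomes a wall of the new tunnel.\<close>

definition rest :: "nat \<Rightarrow> (real \<times> real \<times> real) set" where
  "rest g = {(x, y, z). (x, y, z) \<in> pierced_block g \<and>
    (x = 0 \<or> y = 0 \<or> y = 3 \<or> z = 0 \<or> z = 1 \<or> x = 2 * real g + 1 \<and> 1 \<le> y \<and> y \<le> 2 \<or>
     (\<exists>i<g. 2 * real i + 1 \<le> x \<and> x \<le> 2 * real i + 2 \<and> 1 \<le> y \<and> y \<le> 2))}"

lemma mirror_mirror: "mirror (mirror w) = w"
  by (simp add: mirror_def)

lemma mem_mirror: "(x, y, z) \<in> mirror ` A \<longleftrightarrow> (x, 3 - y, z) \<in> A"
proof -
  have "w \<in> mirror ` A \<longleftrightarrow> mirror w \<in> A" for w by (metis imageE image_eqI mirror_mirror)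
  then show ?thesis by (simp add: mirror_def)
qed

lemma pin_low_image: "pin_low g ` {z. nd z < 1/2} = {(x, y, z). x = 2 * real g + 1 \<and> sq_gauge y z < 1/8}"
proof (intro set_eqI iffI)
  fix w assume "w \<in> pin_low g ` {z. nd z < 1/2}"
  then obtain z where z: "nd z < 1/2" "w = pin_low g z" by auto
  then have "\<bar>Re z + Im z\<bar> < 1/2" "\<bar>Re z - Im z\<bar> < 1/2" by (simp_all only: nd_less_iff)
  then have "- 1/2 < Re z + Im z" "Re z + Im z < 1/2" "- 1/2 < Re z - Im z" "Re z - Im z < 1/2" by linarith+
  then have "sq_gauge (1/2 + (Re z + Im z) / 8) (9/32 + (Im z - Re z) / 8) < 1/8"
    unfolding sq_gauge_def max_less_iff_conj by (auto simp: field_simps)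
  then show "w \<in> {(x, y, z). x = 2 * real g + 1 \<and> sq_gauge y z < 1/8}"
    unfolding z(2) pin_low_def by simp
next
  fix w assume "w \<in> {(x, y, z). x = 2 * real g + 1 \<and> sq_gauge y z < 1/8}"
  then obtain y z where w: "w = (2 * real g + 1, y, z)" "sq_gauge y z < 1/8" by auto
  define s d where "s = 8 * (y - 1/2)" and "d = 8 * (z - 9/32)"
  have "2 * y - 1 < 1/8" "1 - 2 * y < 1/8" "(4 * z - 1) / 3 < 1/8" "1 - 4 * z < 1/8"
    using w(2) unfolding sq_gauge_def max_less_iff_conj by blast+
 moreover from this(3) have "4 * z - 1 < 3/8" by simp
  moreover have "s = 8 * y - 4" "d = 8 * z - 9/4" by (simp_all add: s_def d_def)
  ultimately have "\<bar>s\<bar> < 1/2" "\<bar>d\<bar> < 1/2" by linarith+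
  then have "nd (Complex ((s - d) / 2) ((s + d) / 2)) < 1/2" unfolding nd_less_iff by (simp add: field_simps)
  moreover have "w = pin_low g (Complex ((s - d) / 2) ((s + d) / 2))" by (simp add: w pin_low_def s_def d_def field_simps)
  ultimately show "w \<in> pin_low g ` {z. nd z < 1/2}" by auto
qed

lemma nd_reflect: "nd (\<i> * cnj z) = nd z"
  by (simp add: nd_def)

lemma pin_high_eq: "pin_high g z = mirror (pin_low g (\<i> * cnj z))"
  by (simp add: pin_high_def pin_low_def mirror_def field_simps)

lemma pin_high_image: "pin_high g ` {z. nd z < 1/2} = mirror ` {(x, y, z). x = 2 * real g + 1 \<and> sq_gauge y z < 1/8}"
proof -
  have "(\<lambda>z. \<i> * cnj z) ` {z. nd z < 1/2} = {z. nd z < 1/2}"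
  proof
    show "{z. nd z < 1/2} \<subseteq> (\<lambda>z. \<i> * cnj z) ` {z. nd z < 1/2}"
    proof
      fix z assume "z \<in> {z. nd z < 1/2}"
      then show "z \<in> (\<lambda>z. \<i> * cnj z) ` {z. nd z < 1/2}"
        by (intro image_eqI[of _ _ "\<i> * cnj z"]) (simp_all only: i_cnj_i_cnj nd_reflect mem_Collect_eq)
    qed
  qed (auto simp: nd_reflect)
  then have "pin_high g ` {z. nd z < 1/2} = mirror ` (pin_low g ` {z. nd z < 1/2})"
    by (metis (no_types, lifting) image_cong image_image pin_high_eq)
  then show ?thesis by (simp only: pin_low_image)
qed

text \<open>Off the two unit squares of the right wall nothing is removed and the surface agrees
  with \<open>rest\<close>. Inside a square, gauge at least \<open>1/8\<close> says that the point
  is not in the pin.\<close>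

lemma punctured_surface:
  "genus_surface g - pin_low g ` {z. nd z < 1/2} - pin_high g ` {z. nd z < 1/2}
     = wall_low g \<union> mirror ` wall_low g \<union> rest g" (is "?L = ?R")
proof -
  have "(x, y, z) \<in> ?L \<longleftrightarrow> (x, y, z) \<in> ?R" for x y z
  proof (cases "x = 2 * real g + 1 \<and> (0 \<le> y \<and> y \<le> 1 \<or> 2 \<le> y \<and> y \<le> 3) \<and> 0 \<le> z \<and> z \<le> 1")
    case True
    then have x: "x = 2 * real g + 1" by simp
    have S: "(x, y, z) \<in> genus_surface g" using True by (auto simp: mem_genus_surface mem_pierced_block)
    have bd: "(x, y, z) \<in> rest g \<Longrightarrow> y \<le> 1 \<Longrightarrow> sq_gauge y z = 1" "(x, y, z) \<in> rest g \<Longrightarrow> 2 \<le> y \<Longrightarrow> sq_gauge (3 - y) z = 1"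
      using True by (auto simp: rest_def sq_gauge_eq_1)
    from True consider "0 \<le> y" "y \<le> 1" | "2 \<le> y" "y \<le> 3" by blast
    then show ?thesis
    proof cases
      case 1
      then have "sq_gauge y z \<le> 1" "\<not> sq_gauge (3 - y) z \<le> 1" using True by (auto simp: sq_gauge_le_1)
      then show ?thesis using S x bd(1) 1
        unfolding pin_low_image pin_high_image Un_iff Diff_iff mem_mirror by (auto simp: wall_low_def)
    next
      case 2
      then have "\<not> sq_gauge y z \<le> 1" "sq_gauge (3 - y) z \<le> 1" using True by (auto simp: sq_gauge_le_1)
      then show ?thesis using S x bd(2) 2
        unfolding pin_low_image pin_high_image Un_iff Diff_iff mem_mirror by (auto simp: wall_low_def)
    qed
  next
    case False
    then have "(x, y, z) \<notin> wall_low g" "(x, y, z) \<notin> mirror ` wall_low g"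
      unfolding mem_mirror by (auto simp: wall_low_def sq_gauge_le_1)
    moreover have "(x, y, z) \<notin> pin_low g ` {z. nd z < 1/2}" "(x, y, z) \<notin> pin_high g ` {z. nd z < 1/2}"
      unfolding pin_low_image pin_high_image mem_mirror using False sq_gauge_le_1[of y z] sq_gauge_le_1[of "3 - y" z] by auto
    moreover have "(x, y, z) \<in> genus_surface g \<longleftrightarrow> (x, y, z) \<in> rest g"
      using False by (auto simp: mem_genus_surface rest_def mem_pierced_block)
    ultimately show ?thesis by blast
  qed
  then show ?thesis by (intro set_eqI) (metis prod_cases3)
qed

lemma squeeze_low: "squeeze g (2 * real g + 1, y, z) = bar g y z" if "y \<le> 1"
  using that by (simp add: squeeze_def)

lemma squeeze_high: "squeeze g (2 * real g + 1, y, z) = mirror (bar g (3 - y) z)" if "2 \<le> y"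
  using that by (simp add: squeeze_def)

lemma squeeze_rest:
  assumes "w \<in> rest g" shows "squeeze g w = w"
proof -
  obtain x y z where w: "w = (x, y, z)" by (cases w) auto
  have "sq_gauge y z = 1" if "x = 2 * real g + 1" "y \<le> 1"
    using assms that unfolding w by (auto simp: rest_def sq_gauge_eq_1 mem_pierced_block)
  moreover have "sq_gauge (3 - y) z = 1" if "x = 2 * real g + 1" "2 \<le> y"
    using assms that unfolding w by (auto simp: rest_def sq_gauge_eq_1 mem_pierced_block)
  ultimately show ?thesis using bar_sq_gauge_1 unfolding w by (auto simp: squeeze_def mirror_def)
qed

text \<open>Polar coordinates in the punctured square: \<open>(q, r)\<close> is the point of its
  boundary on the ray through the given point, and \<open>\<rho>\<close> is the gauge.\<close>

lemma wall_lowE: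
  assumes "w \<in> wall_low g"
  obtains q r \<rho> where "sq_gauge q r = 1" "1/8 \<le> \<rho>" "\<rho> \<le> 1"
    "w = (2 * real g + 1, 1/2 + \<rho> * (q - 1/2), 1/4 + \<rho> * (r - 1/4))"
    "squeeze g w = (2 * real g + 1 + (2 - q) * (8/7 * (1 - \<rho>)), q, r)"
    "squeeze g (mirror w) = (2 * real g + 1 + (2 - q) * (8/7 * (1 - \<rho>)), 3 - q, r)"
proof -
  obtain y z where w: "w = (2 * real g + 1, y, z)" and G: "1/8 \<le> sq_gauge y z" "sq_gauge y z \<le> 1"
    using assms by (auto simp: wall_low_def)
  obtain q r where q: "sq_gauge q r = 1" "y = 1/2 + sq_gauge y z * (q - 1/2)" "z = 1/4 + sq_gauge y z * (r - 1/4)"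
    by (rule homothetyE[of y z]) (use G in auto)
  have y: "y \<le> 1" using G by (simp add: sq_gauge_le_1)
  have b: "bar g y z = (2 * real g + 1 + (2 - q) * (8/7 * (1 - sq_gauge y z)), q, r)"
    using bar_homothety[OF q(1), of "sq_gauge y z" g] G q(2,3) by simp
  show ?thesis
  proof (rule that[OF q(1) G])
    show "w = (2 * real g + 1, 1/2 + sq_gauge y z * (q - 1/2), 1/4 + sq_gauge y z * (r - 1/4))" using w q by simp
    show "squeeze g w = (2 * real g + 1 + (2 - q) * (8/7 * (1 - sq_gauge y z)), q, r)"
      unfolding w squeeze_low[OF y] by (rule b)
    have "squeeze g (mirror w) = mirror (bar g y z)" using y squeeze_high[of "3 - y" g z] by (simp add: w mirror_def)
    then show "squeeze g (mirror w) = (2 * real g + 1 + (2 - q) * (8/7 * (1 - sq_gauge y z)), 3 - q, r)"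
      using b by (simp add: mirror_def)
  qed
qed

lemma closed_wall_low: "closed (wall_low g)"
proof -
  have "wall_low g = {2 * real g + 1} \<times> {w. 1/8 \<le> sq_gauge (fst w) (snd w) \<and> sq_gauge (fst w) (snd w) \<le> 1}"
    by (auto simp: wall_low_def)
  then show ?thesis
    by (simp only:) (intro closed_Times closed_Collect_conj closed_Collect_le continuous_on_sq_gauge continuous_on_const closed_singleton)
qed

lemma continuous_on_bar: "continuous_on {w. 0 < sq_gauge (fst w) (snd w)} (\<lambda>w. bar g (fst w) (snd w))"
  unfolding bar_def Let_def by (intro continuous_intros continuous_on_sq_gauge) auto

lemma continuous_on_mirror: "continuous_on A mirror"
  unfolding mirror_def by (intro continuous_intros)

lemma continuous_squeeze: "continuous_on (wall_low g \<union> mirror ` wall_low g \<union> rest g) (squeeze g)"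
proof -
  have c1: "continuous_on (wall_low g) (squeeze g)"
  proof (rule continuous_on_eq)
    show "continuous_on (wall_low g) (\<lambda>w. bar g (fst (snd w)) (snd (snd w)))"
      by (rule continuous_on_compose2[OF continuous_on_bar, of _ snd]) (auto simp: wall_low_def intro!: continuous_intros)
    show "\<And>w. w \<in> wall_low g \<Longrightarrow> bar g (fst (snd w)) (snd (snd w)) = squeeze g w"
      using squeeze_low by (auto simp: wall_low_def sq_gauge_le_1)
  qed
  have sm: "squeeze g w = mirror (squeeze g (mirror w))" if "w \<in> mirror ` wall_low g" for w
  proof -
    obtain w' where w': "w' \<in> wall_low g" "w = mirror w'" using \<open>w \<in> mirror ` wall_low g\<close> by auto
    from w'(1) show ?thesis by (rule wall_lowE) (auto simp: w'(2) mirror_mirror, simp add: mirror_def)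
  qed
  have c2: "continuous_on (mirror ` wall_low g) (squeeze g)"
  proof (rule continuous_on_eq)
    have "continuous_on (mirror ` wall_low g) (\<lambda>w. squeeze g (mirror w))"
      by (rule continuous_on_compose2[OF c1 continuous_on_mirror]) (auto simp: mirror_mirror)
    then show "continuous_on (mirror ` wall_low g) (\<lambda>w. mirror (squeeze g (mirror w)))"
      by (rule continuous_on_compose2[OF continuous_on_mirror[of UNIV]]) auto
  qed (use sm in simp)
  have c3: "continuous_on (rest g) (squeeze g)"
    by (rule continuous_on_eq[OF continuous_on_id]) (simp add: squeeze_rest)
  have "mirror ` wall_low g = {w. mirror w \<in> wall_low g}" by (force simp: mirror_mirror image_iff intro: mirror_mirror[symmetric])
  then have cl2: "closed (mirror ` wall_low g)"
    using closed_vimage[OF closed_wall_low continuous_on_mirror, of g] by (simp add: vimage_def)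
  have cl3: "closed (rest g)"
  proof -
    have "closed (pierced_block g)"
    proof -
      have "pierced_block g = ({0 .. 2 * real g + 1} \<times> {0 .. 3} \<times> {0 .. 1}) \<inter>
        (\<Inter>i<g. - ({2 * real i + 1 <..< 2 * real i + 2} \<times> {1 <..< 2} \<times> UNIV))"
        by (auto simp: pierced_block_def tunnel_def)
      also have "closed \<dots>"
        by (intro closed_Int closed_Times closed_INT ballI closed_Compl open_Times) auto
      finally show ?thesis .
    qed
    moreover have "rest g = pierced_block g \<inter> ({w. fst w = 0} \<union> {w. fst (snd w) = 0} \<union> {w. fst (snd w) = 3}
        \<union> {w. snd (snd w) = 0} \<union> {w. snd (snd w) = 1}
        \<union> {w. fst w = 2 * real g + 1 \<and> 1 \<le> fst (snd w) \<and> fst (snd w) \<le> 2}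
        \<union> (\<Union>i<g. {w. 2 * real i + 1 \<le> fst w \<and> fst w \<le> 2 * real i + 2 \<and> 1 \<le> fst (snd w) \<and> fst (snd w) \<le> 2}))"
      unfolding rest_def
      by (rule set_eqI) (simp only: mem_Collect_eq Int_iff Un_iff UN_iff case_prod_unfold prod.collapse lessThan_iff Bex_def disj_assoc)
    moreover have "closed \<dots>" if "closed (pierced_block g)"
      by (intro that closed_Int closed_Un closed_UN finite_lessThan ballI closed_Collect_conj closed_Collect_eq closed_Collect_le continuous_intros)
    ultimately show ?thesis by simp
  qed
  show ?thesis by (intro continuous_on_closed_Un closed_Un closed_wall_low cl2 cl3 c1 c2 c3)
qed

text \<open>Put \<open>t = 8/7 * (1 - \<rho>)\<close>, the relative distance by which a wall point
  is pulled out. The image determines \<open>(q, r)\<close> and then \<open>t\<close>, as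
  \<open>2 - q\<close> is positive. The second coordinate is at most 1 on one arm and at least 2 on
  the other, and \<open>rest\<close> does not go beyond the old wall, which an arm touches only for
  \<open>t = 0\<close>, where nothing is moved.\<close>

lemma inj_squeeze: "inj_on (squeeze g) (wall_low g \<union> mirror ` wall_low g \<union> rest g)"
proof -
  have A: "\<exists>q r t. squeeze g w = (2 * real g + 1 + (2 - q) * t, q, r) \<and> sq_gauge q r = 1 \<and> 0 \<le> t \<and> t \<le> 1 \<and>
      w = (2 * real g + 1, 1/2 + (1 - 7/8 * t) * (q - 1/2), 1/4 + (1 - 7/8 * t) * (r - 1/4))" if "w \<in> wall_low g" for w
    using that
  proof (rule wall_lowE)
    fix q r \<rho> :: real
    assume *: "sq_gauge q r = 1" "1/8 \<le> \<rho>" "\<rho> \<le> 1" "w = (2 * real g + 1, 1/2 + \<rho> * (q - 1/2), 1/4 + \<rho> * (r - 1/4))"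
      "squeeze g w = (2 * real g + 1 + (2 - q) * (8/7 * (1 - \<rho>)), q, r)"
    then show ?thesis
      by (intro exI[of _ q] exI[of _ r] exI[of _ "8/7 * (1 - \<rho>)"]) (auto simp: field_simps)
  qed
  have B: "\<exists>q r t. squeeze g w = (2 * real g + 1 + (2 - q) * t, 3 - q, r) \<and> sq_gauge q r = 1 \<and> 0 \<le> t \<and> t \<le> 1 \<and>
      w = mirror (2 * real g + 1, 1/2 + (1 - 7/8 * t) * (q - 1/2), 1/4 + (1 - 7/8 * t) * (r - 1/4))" if "w \<in> mirror ` wall_low g" for w
  proof -
    obtain w' where w': "w' \<in> wall_low g" "w = mirror w'" using \<open>w \<in> mirror ` wall_low g\<close> by auto
    from w'(1) show ?thesis
    proof (rule wall_lowE)
      fix q r \<rho> :: real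
      assume *: "sq_gauge q r = 1" "1/8 \<le> \<rho>" "\<rho> \<le> 1" "w' = (2 * real g + 1, 1/2 + \<rho> * (q - 1/2), 1/4 + \<rho> * (r - 1/4))"
        "squeeze g (mirror w') = (2 * real g + 1 + (2 - q) * (8/7 * (1 - \<rho>)), 3 - q, r)"
      then show ?thesis unfolding w'(2)
        by (intro exI[of _ q] exI[of _ r] exI[of _ "8/7 * (1 - \<rho>)"]) (auto simp: field_simps)
    qed
  qed
  have par: "t = t'" if "2 * real g + 1 + (2 - q) * t = 2 * real g + 1 + (2 - q) * t'" "sq_gauge q r = 1" for t t' q r
    using that by (auto simp: sq_gauge_eq_1)
  have AC: "w = w'" if w: "w \<in> wall_low g" "w' \<in> rest g" "squeeze g w = squeeze g w'" for w w'
  proof -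
    obtain q r t where q: "squeeze g w = (2 * real g + 1 + (2 - q) * t, q, r)" "sq_gauge q r = 1" "0 \<le> t"
      "w = (2 * real g + 1, 1/2 + (1 - 7/8 * t) * (q - 1/2), 1/4 + (1 - 7/8 * t) * (r - 1/4))" using A[OF w(1)] by blast
    have w': "w' = (2 * real g + 1 + (2 - q) * t, q, r)" using q(1) w squeeze_rest[OF w(2)] by simp
    then have "(2 - q) * t \<le> 0" using w(2) by (auto simp: rest_def mem_pierced_block)
    moreover have "q \<le> 1" using q(2) by (simp add: sq_gauge_eq_1)
    ultimately have "t = 0" using q(3) by (auto simp: mult_le_0_iff)
    then show ?thesis using q w' by simp
  qed
  have BC: "w = w'" if w: "w \<in> mirror ` wall_low g" "w' \<in> rest g" "squeeze g w = squeeze g w'" for w w'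
  proof -
    obtain q r t where q: "squeeze g w = (2 * real g + 1 + (2 - q) * t, 3 - q, r)" "sq_gauge q r = 1" "0 \<le> t"
      "w = mirror (2 * real g + 1, 1/2 + (1 - 7/8 * t) * (q - 1/2), 1/4 + (1 - 7/8 * t) * (r - 1/4))" using B[OF w(1)] by blast
    have w': "w' = (2 * real g + 1 + (2 - q) * t, 3 - q, r)" using q(1) w squeeze_rest[OF w(2)] by simp
    then have "(2 - q) * t \<le> 0" using w(2) by (auto simp: rest_def mem_pierced_block)
    moreover have "q \<le> 1" using q(2) by (simp add: sq_gauge_eq_1)
    ultimately have "t = 0" using q(3) by (auto simp: mult_le_0_iff)
    then show ?thesis using q w' by (simp add: mirror_def)
  qed
  have AB: "squeeze g w \<noteq> squeeze g w'" if w: "w \<in> wall_low g" "w' \<in> mirror ` wall_low g" for w w'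
    using A[OF w(1)] B[OF w(2)] by (auto simp: sq_gauge_eq_1)
  show ?thesis
  proof (rule inj_onI)
    fix w w' assume in1: "w \<in> wall_low g \<union> mirror ` wall_low g \<union> rest g" and in2: "w' \<in> wall_low g \<union> mirror ` wall_low g \<union> rest g"
      and eq: "squeeze g w = squeeze g w'"
    consider "w \<in> wall_low g" "w' \<in> wall_low g" | "w \<in> mirror ` wall_low g" "w' \<in> mirror ` wall_low g"
      | "w \<in> rest g" "w' \<in> rest g"
      | "w \<in> wall_low g" "w' \<in> mirror ` wall_low g" | "w \<in> mirror ` wall_low g" "w' \<in> wall_low g"
      | "w \<in> wall_low g" "w' \<in> rest g" | "w \<in> rest g" "w' \<in> wall_low g"
      | "w \<in> mirror ` wall_low g" "w' \<in> rest g" | "w \<in> rest g" "w' \<in> mirror ` wall_low g"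
      using in1 in2 by blast
    then show "w = w'"
    proof cases
      case 1
      obtain q r t where q: "squeeze g w = (2 * real g + 1 + (2 - q) * t, q, r)" "sq_gauge q r = 1"
        "w = (2 * real g + 1, 1/2 + (1 - 7/8 * t) * (q - 1/2), 1/4 + (1 - 7/8 * t) * (r - 1/4))" using A[OF 1(1)] by blast
      obtain q' r' t' where q': "squeeze g w' = (2 * real g + 1 + (2 - q') * t', q', r')"
        "w' = (2 * real g + 1, 1/2 + (1 - 7/8 * t') * (q' - 1/2), 1/4 + (1 - 7/8 * t') * (r' - 1/4))" using A[OF 1(2)] by blast
      have "q = q'" "r = r'" using eq q(1) q'(1) by auto
      have "2 * real g + 1 + (2 - q) * t = 2 * real g + 1 + (2 - q) * t'"
        using eq unfolding q(1) q'(1) \<open>q = q'\<close>[symmetric] by (simp only: prod.inject)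
      then have "t = t'" by (rule par[OF _ q(2)])
      then show ?thesis using q(3) q'(2) \<open>q = q'\<close> \<open>r = r'\<close> by simp
    next
      case 2
      obtain q r t where q: "squeeze g w = (2 * real g + 1 + (2 - q) * t, 3 - q, r)" "sq_gauge q r = 1"
        "w = mirror (2 * real g + 1, 1/2 + (1 - 7/8 * t) * (q - 1/2), 1/4 + (1 - 7/8 * t) * (r - 1/4))" using B[OF 2(1)] by blast
      obtain q' r' t' where q': "squeeze g w' = (2 * real g + 1 + (2 - q') * t', 3 - q', r')"
        "w' = mirror (2 * real g + 1, 1/2 + (1 - 7/8 * t') * (q' - 1/2), 1/4 + (1 - 7/8 * t') * (r' - 1/4))" using B[OF 2(2)] by blast
      have "q = q'" "r = r'" using eq q(1) q'(1) by auto
      have "2 * real g + 1 + (2 - q) * t = 2 * real g + 1 + (2 - q) * t'"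
        using eq unfolding q(1) q'(1) \<open>q = q'\<close>[symmetric] by (simp only: prod.inject)
      then have "t = t'" by (rule par[OF _ q(2)])
      then show ?thesis using q(3) q'(2) \<open>q = q'\<close> \<open>r = r'\<close> by simp
    next
      case 3 then show ?thesis using eq squeeze_rest by metis
    next
      case 4 then show ?thesis using AB eq by blast
    next
      case 5 then show ?thesis using AB eq by metis
    next
      case 6 then show ?thesis using AC eq by blast
    next
      case 7 then show ?thesis using AC eq by metis
    next
      case 8 then show ?thesis using BC eq by blast
    next
      case 9 then show ?thesis using BC eq by metis
    qed
  qed
qed

lemma squeeze_wall:
  assumes "sq_gauge q r = 1" "1/8 \<le> \<rho>" "\<rho> \<le> 1"
  shows "squeeze g (2 * real g + 1, 1/2 + \<rho> * (q - 1/2), 1/4 + \<rho> * (r - 1/4)) = (2 * real g + 1 + (2 - q) * (8/7 * (1 - \<rho>)), q, r)"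
    "squeeze g (mirror (2 * real g + 1, 1/2 + \<rho> * (q - 1/2), 1/4 + \<rho> * (r - 1/4))) = (2 * real g + 1 + (2 - q) * (8/7 * (1 - \<rho>)), 3 - q, r)"
    "(2 * real g + 1, 1/2 + \<rho> * (q - 1/2), 1/4 + \<rho> * (r - 1/4)) \<in> wall_low g"
proof -
  have G: "sq_gauge (1/2 + \<rho> * (q - 1/2)) (1/4 + \<rho> * (r - 1/4)) = \<rho>"
    using sq_gauge_scale[of \<rho> q r] assms by simp
  then have y: "1/2 + \<rho> * (q - 1/2) \<le> 1" using assms(3) sq_gauge_le_1[of "1/2 + \<rho> * (q - 1/2)" "1/4 + \<rho> * (r - 1/4)"] by linarith
  have b: "bar g (1/2 + \<rho> * (q - 1/2)) (1/4 + \<rho> * (r - 1/4)) = (2 * real g + 1 + (2 - q) * (8/7 * (1 - \<rho>)), q, r)"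
    using bar_homothety[OF assms(1), of \<rho> g] assms(2) by simp
  show "squeeze g (2 * real g + 1, 1/2 + \<rho> * (q - 1/2), 1/4 + \<rho> * (r - 1/4)) = (2 * real g + 1 + (2 - q) * (8/7 * (1 - \<rho>)), q, r)"
    unfolding squeeze_low[OF y] by (rule b)
  have "squeeze g (mirror (2 * real g + 1, 1/2 + \<rho> * (q - 1/2), 1/4 + \<rho> * (r - 1/4)))
      = mirror (bar g (1/2 + \<rho> * (q - 1/2)) (1/4 + \<rho> * (r - 1/4)))"
    using y squeeze_high[of "3 - (1/2 + \<rho> * (q - 1/2))" g "1/4 + \<rho> * (r - 1/4)"] by (simp add: mirror_def)
  then show "squeeze g (mirror (2 * real g + 1, 1/2 + \<rho> * (q - 1/2), 1/4 + \<rho> * (r - 1/4))) = (2 * real g + 1 + (2 - q) * (8/7 * (1 - \<rho>)), 3 - q, r)"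
    unfolding b by (simp add: mirror_def)
  show "(2 * real g + 1, 1/2 + \<rho> * (q - 1/2), 1/4 + \<rho> * (r - 1/4)) \<in> wall_low g"
    unfolding wall_low_def using G assms by simp
qed

text \<open>Passing to half the sum and half the difference of the coordinates turns the unit
  diamond into the unit square; so \<open>p\<close> traverses the boundary of a cross-section of the
  bar.\<close>

lemma section_gauge:
  assumes "nd p = 1"
  shows "sq_gauge (1/2 + (Re p + Im p) / 2) (1/2 + (Im p - Re p) / 2) = 1"
proof -
  define s d where "s = Re p + Im p" and "d = Im p - Re p"
  have "\<bar>s\<bar> \<le> 1" "\<bar>d\<bar> \<le> 1" "\<bar>s\<bar> = 1 \<or> \<bar>d\<bar> = 1"
    using assms unfolding nd_def s_def d_def by linarith+
  then show ?thesis unfolding s_def[symmetric] d_def[symmetric] sq_gauge_eq_1 by (auto simp: abs_le_iff abs_if split: if_splits)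
qed

lemma pin_low_half:
  "pin_low g (p / 2) = (2 * real g + 1, 1/2 + 1/8 * (1/2 + (Re p + Im p) / 2 - 1/2), 1/4 + 1/8 * (1/2 + (Im p - Re p) / 2 - 1/4))"
  by (simp add: pin_low_def field_simps)

lemma pin_high_half: "pin_high g (\<i> * cnj p / 2) = mirror (pin_low g (p / 2))"
  using i_cnj_i_cnj[of "p / 2"] by (simp add: pin_high_eq)

text \<open>At \<open>\<tau> = 1\<close> the second coordinate is \<open>q = 2 - r\<close>, so the
  distance \<open>r\<close> from the old wall is \<open>2 - q\<close>, the full length of the arm
  over \<open>q\<close>. The other end is the mirror image.\<close>

lemma bend_ends:
  assumes "nd p = 1"
  shows "bend g p 1 = squeeze g (pin_low g (p / 2))" "bend g p 2 = squeeze g (pin_high g (\<i> * cnj p / 2))"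
proof -
  note sq = squeeze_wall[OF section_gauge[OF assms], of "1/8" g]
  show "bend g p 1 = squeeze g (pin_low g (p / 2))"
    unfolding pin_low_half using sq(1) by (simp add: bend_def Let_def field_simps)
  show "bend g p 2 = squeeze g (pin_high g (\<i> * cnj p / 2))"
    unfolding pin_high_half pin_low_half using sq(2) by (simp add: bend_def Let_def field_simps)
qed

lemma bend_radius:
  assumes "nd p = 1" shows "1 \<le> 3/2 - (Re p + Im p) / 2" "3/2 - (Re p + Im p) / 2 \<le> 2" "\<bar>Im p - Re p\<bar> \<le> 1"
  using assms unfolding nd_def by (auto simp: abs_if field_simps split: if_splits)

lemma continuous_bend: "continuous_on A (\<lambda>(p, \<tau>). bend g p \<tau>)"
  unfolding bend_def Let_def case_prod_unfold by (intro continuous_intros) auto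

lemma inj_bend: "inj_on (\<lambda>(p, \<tau>). bend g p \<tau>) ({p. nd p = 1} \<times> {1..2})"
proof (rule inj_onI, clarify)
  fix p \<tau> p' \<tau>' assume p: "nd p = 1" "nd p' = 1" and eq: "bend g p \<tau> = bend g p' \<tau>'"
  then have 1: "Re p + Im p = Re p' + Im p'" "Im p - Re p = Im p' - Re p'"
    and 2: "(3/2 - (Re p + Im p) / 2 - 1/2) * (2 * \<tau> - 3) = (3/2 - (Re p' + Im p') / 2 - 1/2) * (2 * \<tau>' - 3)"
    by (auto simp: bend_def Let_def)
  have "p = p'" using 1 by (simp add: complex_eq_iff)
  moreover have "2 * \<tau> - 3 = 2 * \<tau>' - 3" using 2 bend_radius(1)[OF p(1)] unfolding \<open>p = p'\<close> by auto
  ultimately show "p = p' \<and> \<tau> = \<tau>'" by simp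
qed

text \<open>The open connecting piece lies strictly beyond both mitre planes, where the distance
  from the old wall is \<open>2 - y\<close> and \<open>y - 1\<close> respectively. The arms do not
  cross these planes, and \<open>rest\<close> does not go beyond the old wall.\<close>

lemma bend_not_squeeze:
  assumes p: "nd p = 1" and \<tau>: "1 < \<tau>" "\<tau> < 2"
  shows "bend g p \<tau> \<notin> squeeze g ` (wall_low g \<union> mirror ` wall_low g \<union> rest g)"
proof
  assume "bend g p \<tau> \<in> squeeze g ` (wall_low g \<union> mirror ` wall_low g \<union> rest g)"
  then obtain w where w: "w \<in> wall_low g \<union> mirror ` wall_low g \<union> rest g" and eq: "bend g p \<tau> = squeeze g w" by auto
  define r where "r = 3/2 - (Re p + Im p) / 2"
  have r: "1 \<le> r" "r \<le> 2" using bend_radius[OF p] by (simp_all add: r_def)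
  have b: "bend g p \<tau> = (2 * real g + 1 + r, 3/2 + (r - 1/2) * (2 * \<tau> - 3), 1/2 + (Im p - Re p) / 2)"
    by (simp add: bend_def Let_def r_def)
  have lo: "2 - r < 3/2 + (r - 1/2) * (2 * \<tau> - 3)"
  proof -
    have "0 < (r - 1/2) * (2 * \<tau> - 2)" using r \<tau> by auto
    then show ?thesis by (simp add: algebra_simps)
  qed
  have hi: "3/2 + (r - 1/2) * (2 * \<tau> - 3) < 1 + r"
  proof -
    have "0 < (r - 1/2) * (4 - 2 * \<tau>)" using r \<tau> by auto
    then show ?thesis by (simp add: algebra_simps)
  qed
  have le: "(2 - q) * (8/7 * (1 - \<rho>)) \<le> 2 - q" if "sq_gauge q s = 1" "1/8 \<le> \<rho>" for q s \<rho>
  proof -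
    have "(2 - q) * (8/7 * (1 - \<rho>)) \<le> (2 - q) * 1" using that by (intro mult_left_mono) (auto simp: sq_gauge_eq_1)
    then show ?thesis by simp
  qed
  from w consider "w \<in> wall_low g" | w' where "w' \<in> wall_low g" "w = mirror w'" | "w \<in> rest g" by blast
  then show False
  proof cases
    case 1
    then show ?thesis
    proof (rule wall_lowE)
      fix q s \<rho> assume *: "sq_gauge q s = 1" "1/8 \<le> \<rho>" "\<rho> \<le> 1" "squeeze g w = (2 * real g + 1 + (2 - q) * (8/7 * (1 - \<rho>)), q, s)"
      then have "r = (2 - q) * (8/7 * (1 - \<rho>))" "3/2 + (r - 1/2) * (2 * \<tau> - 3) = q" using eq b by auto
      then show False using le[OF *(1,2)] lo by linarith
    qed
  next
    case 2
    from 2(1) show ?thesis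
    proof (rule wall_lowE)
      fix q s \<rho> assume *: "sq_gauge q s = 1" "1/8 \<le> \<rho>" "\<rho> \<le> 1" "squeeze g (mirror w') = (2 * real g + 1 + (2 - q) * (8/7 * (1 - \<rho>)), 3 - q, s)"
      then have "r = (2 - q) * (8/7 * (1 - \<rho>))" "3/2 + (r - 1/2) * (2 * \<tau> - 3) = 3 - q" using eq b 2(2) by auto
      then show False using le[OF *(1,2)] hi by linarith
    qed
  next
    case 3
    then have "w = (2 * real g + 1 + r, 3/2 + (r - 1/2) * (2 * \<tau> - 3), 1/2 + (Im p - Re p) / 2)"
      using squeeze_rest eq b by metis
    then show ?thesis using 3 r by (auto simp: rest_def mem_pierced_block)
  qed
qed

section \<open>The surface with one more handle as the union of arms, bend and unmoved part\<close>

lemma old_tunnels_left: "i < g \<Longrightarrow> 2 * real i + 2 < 2 * real g + 1"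
proof -
  assume "i < g"
  then have "real i + 1 \<le> real g" by linarith
  then show ?thesis by linarith
qed

lemma mem_pierced_block_Suc:
  assumes "x \<le> 2 * real g + 1"
  shows "(x, y, z) \<in> pierced_block (Suc g) \<longleftrightarrow> (x, y, z) \<in> pierced_block g"
  using assms unfolding mem_pierced_block by (auto simp: less_Suc_eq)

lemma mem_pierced_block_Suc_right:
  assumes "2 * real g + 1 \<le> x"
  shows "(x, y, z) \<in> pierced_block (Suc g) \<longleftrightarrow> x \<le> 2 * real g + 3 \<and> 0 \<le> y \<and> y \<le> 3 \<and> 0 \<le> z \<and> z \<le> 1 \<and>
    \<not> (2 * real g + 1 < x \<and> x < 2 * real g + 2 \<and> 1 < y \<and> y < 2)"
proof -
  have "\<not> x < 2 * real i + 2" if "i < g" for i using old_tunnels_left[OF that] assms by linarith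
  then show ?thesis using assms unfolding mem_pierced_block by (auto simp: less_Suc_eq)
qed

lemma genus_surface_Suc_right:
  assumes "2 * real g + 1 < x"
  shows "(x, y, z) \<in> genus_surface (Suc g) \<longleftrightarrow> (x \<le> 2 * real g + 3 \<and> 0 \<le> y \<and> y \<le> 3 \<and> 0 \<le> z \<and> z \<le> 1 \<and>
    \<not> (x < 2 * real g + 2 \<and> 1 < y \<and> y < 2)) \<and>
    (x = 2 * real g + 3 \<or> y = 0 \<or> y = 3 \<or> z = 0 \<or> z = 1 \<or> x \<le> 2 * real g + 2 \<and> 1 \<le> y \<and> y \<le> 2)"
proof -
  have "\<not> x \<le> 2 * real i + 2" if "i < g" for i using old_tunnels_left[OF that] assms by linarith
  then have "(\<exists>i<Suc g. 2 * real i + 1 \<le> x \<and> x \<le> 2 * real i + 2 \<and> 1 \<le> y \<and> y \<le> 2) \<longleftrightarrow> x \<le> 2 * real g + 2 \<and> 1 \<le> y \<and> y \<le> 2"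
    using assms by (auto simp: less_Suc_eq)
  moreover have "x \<noteq> 0" "x = 2 * real (Suc g) + 1 \<longleftrightarrow> x = 2 * real g + 3" using assms by auto
  moreover note mem_pierced_block_Suc_right[OF less_imp_le[OF assms], of y z]
  ultimately show ?thesis unfolding mem_genus_surface using assms by (simp only: simp_thms)
qed

text \<open>Up to the old right wall the enlarged block has the same points as the old one; of that
  wall, only the strip facing the new tunnel and points on other walls remain in the
  boundary.\<close>

lemma genus_surface_Suc_left:
  assumes "x \<le> 2 * real g + 1"
  shows "(x, y, z) \<in> genus_surface (Suc g) \<longleftrightarrow> (x, y, z) \<in> rest g"
proof -
  have "(\<exists>i<Suc g. 2 * real i + 1 \<le> x \<and> x \<le> 2 * real i + 2 \<and> 1 \<le> y \<and> y \<le> 2) \<longleftrightarrow>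
      x = 2 * real g + 1 \<and> 1 \<le> y \<and> y \<le> 2 \<or> (\<exists>i<g. 2 * real i + 1 \<le> x \<and> x \<le> 2 * real i + 2 \<and> 1 \<le> y \<and> y \<le> 2)"
    using assms by (auto simp: less_Suc_eq)
  then show ?thesis unfolding mem_genus_surface rest_def mem_Collect_eq prod.case
    using mem_pierced_block_Suc[OF assms] assms by auto
qed

lemma genus_surface_cover:
  "genus_surface (Suc g) = squeeze g ` (wall_low g \<union> mirror ` wall_low g \<union> rest g) \<union> (\<lambda>(p, \<tau>). bend g p \<tau>) ` ({p. nd p = 1} \<times> {1..2})"
  (is "?L = ?A \<union> ?B")
proof
  have low: "(2 * real g + 1 + (2 - q) * t, q, s) \<in> ?L \<and> (2 * real g + 1 + (2 - q) * t, 3 - q, s) \<in> ?L"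
    if q: "sq_gauge q s = 1" and t: "0 \<le> t" "t \<le> 1" for q s t
  proof -
    have G: "0 \<le> q" "q \<le> 1" "0 \<le> s" "s \<le> 1" "q = 0 \<or> q = 1 \<or> s = 0 \<or> s = 1" using q unfolding sq_gauge_eq_1 by blast+
    define w where "w = (2 - q) * t"
    have le: "0 \<le> w" "w \<le> 2 - q" unfolding w_def using G t by (auto simp: mult_left_le)
    show ?thesis unfolding w_def[symmetric]
    proof (cases "0 < w")
      case True
      then show "(2 * real g + 1 + w, q, s) \<in> ?L \<and> (2 * real g + 1 + w, 3 - q, s) \<in> ?L"
        using G le genus_surface_Suc_right[of g "2 * real g + 1 + w"] by auto
    next
      case False
      then have "w = 0" using le by simp
      then show "(2 * real g + 1 + w, q, s) \<in> ?L \<and> (2 * real g + 1 + w, 3 - q, s) \<in> ?L"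
        using G genus_surface_Suc_left[of "2 * real g + 1" g]
        by (auto simp: rest_def mem_pierced_block dest: old_tunnels_left)
    qed
  qed
  have A: "?A \<subseteq> ?L"
  proof
    fix v assume "v \<in> ?A"
    then obtain w where w: "w \<in> wall_low g \<union> mirror ` wall_low g \<union> rest g" "v = squeeze g w" by auto
    from w(1) consider "w \<in> wall_low g" | w' where "w' \<in> wall_low g" "w = mirror w'" | "w \<in> rest g" by blast
    then show "v \<in> ?L"
    proof cases
      case 1
      then show ?thesis
      proof (rule wall_lowE)
        fix q s \<rho> assume *: "sq_gauge q s = 1" "1/8 \<le> \<rho>" "\<rho> \<le> 1" "squeeze g w = (2 * real g + 1 + (2 - q) * (8/7 * (1 - \<rho>)), q, s)"
        then show "v \<in> ?L" using low[OF *(1), of "8/7 * (1 - \<rho>)"] unfolding w(2) *(4) by simp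
      qed
    next
      case 2
      from 2(1) show ?thesis
      proof (rule wall_lowE)
        fix q s \<rho> assume *: "sq_gauge q s = 1" "1/8 \<le> \<rho>" "\<rho> \<le> 1" "squeeze g (mirror w') = (2 * real g + 1 + (2 - q) * (8/7 * (1 - \<rho>)), 3 - q, s)"
        then show "v \<in> ?L" using low[OF *(1), of "8/7 * (1 - \<rho>)"] unfolding w(2) 2(2) *(4) by simp
      qed
    next
      case 3
      obtain x y z where xyz: "w = (x, y, z)" by (cases w) auto
      have "x \<le> 2 * real g + 1" using 3 by (auto simp: xyz rest_def mem_pierced_block)
      then show ?thesis using 3 genus_surface_Suc_left[of x g y z] squeeze_rest[OF 3] w(2) xyz by simp
    qed
  qed
  have B: "?B \<subseteq> ?L"
  proof
    fix v assume "v \<in> ?B"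
    then obtain p \<tau> where p: "nd p = 1" and \<tau>: "1 \<le> \<tau>" "\<tau> \<le> 2" and v: "v = bend g p \<tau>" by auto
    define r z \<theta> where "r = 3/2 - (Re p + Im p) / 2" and "z = 1/2 + (Im p - Re p) / 2" and "\<theta> = 2 * \<tau> - 3"
    have r: "1 \<le> r" "r \<le> 2" "0 \<le> z" "z \<le> 1"
      using bend_radius(1,2)[OF p] section_gauge[OF p] unfolding r_def z_def sq_gauge_eq_1 by blast+
    have v: "v = (2 * real g + 1 + r, 3/2 + (r - 1/2) * \<theta>, z)" by (simp add: v bend_def Let_def r_def z_def \<theta>_def)
    have "sq_gauge (2 - r) z = 1" using section_gauge[OF p] by (simp add: r_def z_def algebra_simps)
    then have c: "r = 2 \<or> r = 1 \<or> z = 0 \<or> z = 1" by (auto simp: sq_gauge_eq_1)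
    have "\<bar>(r - 1/2) * \<theta>\<bar> \<le> (r - 1/2) * 1" unfolding abs_mult using r \<tau> by (intro mult_mono) (auto simp: \<theta>_def)
    moreover define w where "w = (r - 1/2) * \<theta>"
    ultimately have y: "\<bar>w\<bar> \<le> r - 1/2" by simp
    show "v \<in> ?L" unfolding v w_def[symmetric] using r c y genus_surface_Suc_right[of g "2 * real g + 1 + r"] by (auto simp: abs_le_iff)
  qed
  show "?A \<union> ?B \<subseteq> ?L" using A B by blast
  show "?L \<subseteq> ?A \<union> ?B"
  proof
    fix v assume v: "v \<in> ?L"
    obtain x y z where xyz: "v = (x, y, z)" by (cases v) auto
    show "v \<in> ?A \<union> ?B"
    proof (cases "x \<le> 2 * real g + 1")
      case True
      then have "v \<in> rest g" using v genus_surface_Suc_left[OF True] xyz by simp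
      then have "squeeze g v \<in> ?A" by blast
      then show ?thesis unfolding squeeze_rest[OF \<open>v \<in> rest g\<close>] by blast
    next
      case False
      define r where "r = x - (2 * real g + 1)"
      have x: "x = 2 * real g + 1 + r" by (simp add: r_def)
      have r: "0 < r" "r \<le> 2" "0 \<le> y" "y \<le> 3" "0 \<le> z" "z \<le> 1" "\<not> (r < 1 \<and> 1 < y \<and> y < 2)"
        "r = 2 \<or> y = 0 \<or> y = 3 \<or> z = 0 \<or> z = 1 \<or> r \<le> 1 \<and> 1 \<le> y \<and> y \<le> 2"
        using v False genus_surface_Suc_right[of g x y z] unfolding xyz r_def by auto
      \<comment> \<open>The two mitre planes cut the added material into the lower arm, the upper
        arm and the connecting piece.\<close>
      consider "y \<le> 1" "r \<le> 2 - y" | "2 \<le> y" "r \<le> y - 1" | "2 - y \<le> r" "y - 1 \<le> r" using r by linarith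
      then show ?thesis
      proof cases
        case 1
        define t where "t = r / (2 - y)"
        have t: "0 < t" "t \<le> 1" "(2 - y) * t = r" using 1 r by (auto simp: t_def)
        have "sq_gauge y z = 1" using 1 r by (auto simp: sq_gauge_eq_1)
        from squeeze_wall(1,3)[OF this, of "1 - 7/8 * t" g] t have "v = squeeze g (2 * real g + 1, 1/2 + (1 - 7/8 * t) * (y - 1/2), 1/4 + (1 - 7/8 * t) * (z - 1/4))"
          "(2 * real g + 1, 1/2 + (1 - 7/8 * t) * (y - 1/2), 1/4 + (1 - 7/8 * t) * (z - 1/4)) \<in> wall_low g"
          by (auto simp: xyz x)
        then show ?thesis by blast
      next
        case 2
        define t where "t = r / (y - 1)"
        have t: "0 < t" "t \<le> 1" "(2 - (3 - y)) * t = r" using 2 r by (auto simp: t_def)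
        have "sq_gauge (3 - y) z = 1" using 2 r by (auto simp: sq_gauge_eq_1)
        from squeeze_wall(2,3)[OF this, of "1 - 7/8 * t" g] t have "v = squeeze g (mirror (2 * real g + 1, 1/2 + (1 - 7/8 * t) * (3 - y - 1/2), 1/4 + (1 - 7/8 * t) * (z - 1/4)))"
          "(2 * real g + 1, 1/2 + (1 - 7/8 * t) * (3 - y - 1/2), 1/4 + (1 - 7/8 * t) * (z - 1/4)) \<in> wall_low g"
          by (auto simp: xyz x)
        then show ?thesis by blast
      next
        case 3
        have r1: "1 \<le> r" using 3 r by auto
        \<comment> \<open>The values of \<open>r\<close> and \<open>z\<close> prescribe
          \<open>Re p + Im p\<close> and \<open>Im p - Re p\<close>; the ratio
          \<open>\<theta>\<close> is the affine image of \<open>\<tau>\<close> in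
          \<open>[-1, 1]\<close>.\<close>
        define p where "p = Complex (3/2 - r - (z - 1/2)) (3/2 - r + (z - 1/2))"
        define \<theta> where "\<theta> = (y - 3/2) / (r - 1/2)"
        have "r = 2 \<or> r = 1 \<or> z = 0 \<or> z = 1" using r r1 3 by auto
        then have "nd p = 1" using r r1 by (auto simp: nd_def p_def abs_if)
        moreover have "\<bar>\<theta>\<bar> \<le> 1" using 3 r1 by (auto simp: \<theta>_def abs_le_iff field_simps)
        moreover have "v = bend g p ((\<theta> + 3) / 2)"
          using r1 by (simp add: bend_def Let_def p_def \<theta>_def xyz x field_simps)
        ultimately show ?thesis by (intro UnI2 image_eqI[of _ _ "(p, (\<theta> + 3) / 2)"]) (auto simp: abs_le_iff)
      qed
    qed
  qed
qed

section \<open>Drawings in which two faces carry the pins\<close>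

definition pinned :: "nat \<Rightarrow> quad set \<Rightarrow> quad \<Rightarrow> quad \<Rightarrow> (quad \<Rightarrow> complex \<Rightarrow> real \<times> real \<times> real) \<Rightarrow> bool" where
  "pinned g F f f' H \<longleftrightarrow> drawing (genus_surface g) F H \<and>
     (\<forall>z\<in>diamond (1/2). H f z = pin_low g z \<and> H f' z = pin_high g z)"

text \<open>Since germs can be carried to any two faces, one pinned pair yields pinned drawings for
  every pair of distinct faces.\<close>

lemma pinned_relocate:
  assumes "quad_surface F" "pinned g F f f' H" "f \<in> F" "f' \<in> F" "f \<noteq> f'" "k \<in> F" "k' \<in> F" "k \<noteq> k'"
  shows "\<exists>H. pinned g F k k' H"
proof -
  have dr: "drawing (genus_surface g) F H" using assms(2) by (simp add: pinned_def)
  obtain H' where "drawing (genus_surface g) F H'" "\<And>z. z \<in> diamond (1/2) \<Longrightarrow> H' k z = H f z"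
    "\<And>z. z \<in> diamond (1/2) \<Longrightarrow> H' k' z = H f' z"
    by (rule relocate_two_germs[OF assms(1) dr assms(3-8)]) blast
  then show ?thesis using assms(2) unfolding pinned_def by auto
qed

text \<open>Pins that are found inside one and the same face are distributed to two faces by pulling
  a neighbour over one of them.\<close>

lemma pinned_from_germs:
  assumes surf: "quad_surface F" and dr: "drawing (genus_surface g) F H" and f: "f \<in> F"
    and \<alpha>: "\<And>z. \<alpha> z = p + a * z + c * cnj z" "cmod c < Re a"
    and \<beta>: "\<And>z. \<beta> z = q - (b * z + d * cnj z)" "cmod d < Re b"
    and im: "\<And>z. z \<in> diamond (1/2) \<Longrightarrow> nd (\<alpha> z) < 1 \<and> Re (\<alpha> z) + Im (\<alpha> z) < 0"
      "\<And>z. z \<in> diamond (1/2) \<Longrightarrow> nd (\<beta> z) < 1 \<and> 0 < Re (\<beta> z) + Im (\<beta> z)"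
    and H: "\<And>z. z \<in> diamond (1/2) \<Longrightarrow> H f (\<alpha> z) = pin_low g z" "\<And>z. z \<in> diamond (1/2) \<Longrightarrow> H f (\<beta> z) = pin_high g z"
    and k: "k \<in> F" "k' \<in> F" "k \<noteq> k'"
  shows "\<exists>H. pinned g F k k' H"
proof -
  have "\<exists>f'\<in>F. \<exists>H'. f' \<noteq> f \<and> drawing (genus_surface g) F H' \<and>
    (\<forall>z\<in>diamond (1/2). H' f z = H f (\<alpha> z) \<and> H' f' z = H f (\<beta> z))"
    by (rule split_germ[OF surf dr f \<alpha> \<beta>]; rule im)
  then obtain f' H' where *: "f' \<in> F" "f' \<noteq> f" "drawing (genus_surface g) F H'"
    "\<And>z. z \<in> diamond (1/2) \<Longrightarrow> H' f z = H f (\<alpha> z) \<and> H' f' z = H f (\<beta> z)" by blast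
  then have "pinned g F f f' H'" using H by (simp add: pinned_def)
  then show ?thesis using pinned_relocate[OF surf _ f *(1)] *(2) k by metis
qed

text \<open>The maps \<open>squeeze\<close> and \<open>bend\<close> fit the locale
  \<open>tube\<close>. What remains is to be ready for the next handle: both pins of the new right
  wall have to be found again, and they lie in the single face \<open>T3\<close>.\<close>

lemma drawing_join_genus:
  assumes surf: "quad_surface F" and MF: "(x, a, y, c) \<in> F" and NF: "(e, v, e', u) \<in> F" and MN: "(x, a, y, c) \<noteq> (e, v, e', u)"
    and fresh: "\<And>p q. p \<in> {x, y} \<Longrightarrow> q \<in> {e, e'} \<Longrightarrow> p \<noteq> q"
      "\<And>p q f. p \<in> {x, y} \<Longrightarrow> q \<in> {e, e'} \<Longrightarrow> f \<in> F \<Longrightarrow> (p, q) \<notin> dedges f \<and> (q, p) \<notin> dedges f"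
    and pin: "pinned g F (x, a, y, c) (e, v, e', u) H"
    and surf': "quad_surface (join_faces F (x, a, y, c) (e, v, e', u))"
    and k: "k \<in> join_faces F (x, a, y, c) (e, v, e', u)" "k' \<in> join_faces F (x, a, y, c) (e, v, e', u)" "k \<noteq> k'"
  shows "\<exists>H. pinned (Suc g) (join_faces F (x, a, y, c) (e, v, e', u)) k k' H"
proof -
  have dr: "drawing (genus_surface g) F H" using pin by (simp add: pinned_def)
  have Hp: "H (x, a, y, c) z = pin_low g z" "H (e, v, e', u) z = pin_high g z" if "nd z \<le> 1/2" for z
    using pin that by (auto simp: pinned_def mem_diamond)
  have "H (x, a, y, c) ` {z. nd z < 1/2} = pin_low g ` {z. nd z < 1/2}" "H (e, v, e', u) ` {z. nd z < 1/2} = pin_high g ` {z. nd z < 1/2}"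
    using Hp by (auto intro!: image_cong)
  then have R: "genus_surface g - H (x, a, y, c) ` {z. nd z < 1/2} - H (e, v, e', u) ` {z. nd z < 1/2} = wall_low g \<union> mirror ` wall_low g \<union> rest g"
    using punctured_surface[of g] by simp
  have nd_half: "nd (p / 2) \<le> 1/2" "nd (\<i> * cnj p / 2) \<le> 1/2" if "nd p = 1" for p
    using that by (simp_all add: nd_def)
  interpret tube "genus_surface g" "genus_surface (Suc g)" F H x a y c e v e' u "squeeze g" "bend g"
  proof (rule tube.intro, unfold R)
    show "drawing (genus_surface g) F H" "quad_surface F" "(x, a, y, c) \<in> F" "(e, v, e', u) \<in> F"
      "(x, a, y, c) \<noteq> (e, v, e', u)" by (fact dr surf MF NF MN)+
    show "p \<noteq> q" if "p \<in> {x, y}" "q \<in> {e, e'}" for p q using fresh(1)[OF that] .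
    show "(p, q) \<notin> dedges f \<and> (q, p) \<notin> dedges f" if "p \<in> {x, y}" "q \<in> {e, e'}" "f \<in> F" for p q f
      using fresh(2)[OF that] .
    show "bend g p 1 = squeeze g (H (x, a, y, c) (p / 2))" if "nd p = 1" for p
      using bend_ends(1)[OF that, of g] Hp(1)[OF nd_half(1)[OF that]] by simp
    show "bend g p 2 = squeeze g (H (e, v, e', u) (\<i> * cnj p / 2))" if "nd p = 1" for p
      using bend_ends(2)[OF that, of g] Hp(2)[OF nd_half(2)[OF that]] by simp
    show "bend g p \<tau> \<notin> squeeze g ` (wall_low g \<union> mirror ` wall_low g \<union> rest g)" if "nd p = 1" "1 < \<tau>" "\<tau> < 2" for p \<tau>
      using bend_not_squeeze[OF that] .
  qed (rule continuous_squeeze inj_squeeze continuous_bend inj_bend genus_surface_cover)+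
  \<comment> \<open>On the new right wall \<open>r = 2\<close>, and the height of a point is
    \<open>- Re p\<close>. There \<open>T3\<close> reaches up to
    \<open>\<tau> = 3 * (1 - height)\<close>. Pins have height at most \<open>11/32\<close> and
    parameter below \<open>15/8\<close>, so both fit. At height \<open>1/2\<close> the face would
    stop at \<open>\<tau> = 3/2\<close> and miss the upper pin.\<close>
  have patch: "H' T3 z = (2 * real (Suc g) + 1, 3/2 + 9/2 * (Re z + Im z), - Re z)"
    if z: "Re z \<le> 0" "nd z \<le> 1" "\<bar>3 * (Re z + Im z)\<bar> \<le> 1" for z
  proof -
    have W: "W z = 1 + Re z" using z by (simp add: W_def)
    have low: "Re (lower z) = Re z" "Im (lower z) = - 1 - Re z" using z by (simp_all add: lower_def)
    have nd: "nd (lower z) = 1" using nd_upper(2)[OF z(2)] .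
    have "H' T3 z = bend g (lower z) (3 / 2 * (W z + Im z))"
      unfolding H'_T(2) by (rule \<Theta>_mid[OF nd]) (use z W in \<open>auto simp: abs_le_iff\<close>)
    also have "\<dots> = (2 * real (Suc g) + 1, 3/2 + 9/2 * (Re z + Im z), - Re z)"
      unfolding bend_def Let_def low W by (simp add: field_simps)
    finally show ?thesis .
  qed
  \<comment> \<open>Solving \<open>patch\<close> for the points of the pins gives the affine maps
    \<open>\<alpha>\<close> and \<open>\<beta>\<close>; \<open>A\<close> and \<open>C\<close> are
    their complex-linear and conjugate-linear coefficients up to sign. After clearing the
    denominator 72, \<open>cmod C < Re A\<close> reads 65 < 100.\<close>
  define A where "A = Complex (10/72) (1/72)"
  define C where "C = Complex (- 1/72) (- 8/72)"
  have CA: "cmod C < Re A"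
  proof (rule power2_less_imp_less)
    show "(cmod C)\<^sup>2 < (Re A)\<^sup>2" unfolding cmod_power2 C_def A_def by (simp add: power2_eq_square)
  qed (simp add: A_def)
  define \<alpha> where "\<alpha> z = Complex (- 9/32) (9/32 - 2/9) + A * z + C * cnj z" for z
  define \<beta> where "\<beta> z = Complex (- 9/32) (9/32 + 2/9) - (A * z + C * cnj z)" for z
  have \<alpha>: "Re (\<alpha> z) = - 9/32 + (Re z - Im z) / 8" "Re (\<alpha> z) + Im (\<alpha> z) = - 2/9 + (Re z + Im z) / 36" for z
    by (simp_all add: \<alpha>_def A_def C_def field_simps)
  have \<beta>: "Re (\<beta> z) = - 9/32 - (Re z - Im z) / 8" "Re (\<beta> z) + Im (\<beta> z) = 2/9 - (Re z + Im z) / 36" for z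
    by (simp_all add: \<beta>_def A_def C_def field_simps)
  have in_patch: "Re w \<le> 0 \<and> nd w < 1 \<and> \<bar>3 * (Re w + Im w)\<bar> \<le> 1"
    if "- 11/32 \<le> Re w" "Re w \<le> - 7/32" "\<bar>Re w + Im w\<bar> \<le> 2/9 + 1/72" for w
    using that unfolding nd_def by (auto simp: abs_le_iff abs_if split: if_splits)
  have b: "\<bar>Re z - Im z\<bar> \<le> 1/2" "\<bar>Re z + Im z\<bar> \<le> 1/2" if "z \<in> diamond (1/2)" for z
    using that by (auto simp: mem_diamond nd_le_iff simp del: le_divide_eq_numeral1)
  have in\<alpha>: "Re (\<alpha> z) \<le> 0 \<and> nd (\<alpha> z) < 1 \<and> \<bar>3 * (Re (\<alpha> z) + Im (\<alpha> z))\<bar> \<le> 1" "Re (\<alpha> z) + Im (\<alpha> z) < 0" if z: "z \<in> diamond (1/2)" for z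
  proof -
    define D E where "D = (Re z - Im z) / 8" and "E = (Re z + Im z) / 36"
    have DE: "\<bar>D\<bar> \<le> 1/16" "\<bar>E\<bar> \<le> 1/72" using b[OF z] by (simp_all add: D_def E_def)
    note eqs = \<alpha>[of z, folded D_def E_def]
    show "Re (\<alpha> z) \<le> 0 \<and> nd (\<alpha> z) < 1 \<and> \<bar>3 * (Re (\<alpha> z) + Im (\<alpha> z))\<bar> \<le> 1"
      by (rule in_patch) (use DE eqs in linarith)+
    show "Re (\<alpha> z) + Im (\<alpha> z) < 0" using DE eqs by linarith
  qed
  have in\<beta>: "Re (\<beta> z) \<le> 0 \<and> nd (\<beta> z) < 1 \<and> \<bar>3 * (Re (\<beta> z) + Im (\<beta> z))\<bar> \<le> 1" "0 < Re (\<beta> z) + Im (\<beta> z)" if z: "z \<in> diamond (1/2)" for z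
  proof -
    define D E where "D = (Re z - Im z) / 8" and "E = (Re z + Im z) / 36"
    have DE: "\<bar>D\<bar> \<le> 1/16" "\<bar>E\<bar> \<le> 1/72" using b[OF z] by (simp_all add: D_def E_def)
    note eqs = \<beta>[of z, folded D_def E_def]
    show "Re (\<beta> z) \<le> 0 \<and> nd (\<beta> z) < 1 \<and> \<bar>3 * (Re (\<beta> z) + Im (\<beta> z))\<bar> \<le> 1"
      by (rule in_patch) (use DE eqs in linarith)+
    show "0 < Re (\<beta> z) + Im (\<beta> z)" using DE eqs by linarith
  qed
  have H\<alpha>: "H' T3 (\<alpha> z) = pin_low (Suc g) z" if z: "z \<in> diamond (1/2)" for z
  proof -
    have "H' T3 (\<alpha> z) = (2 * real (Suc g) + 1, 3/2 + 9/2 * (- 2/9 + (Re z + Im z) / 36), - (- 9/32 + (Re z - Im z) / 8))"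
      unfolding \<alpha>[symmetric] by (rule patch) (use in\<alpha>(1)[OF z] in auto)
    then show ?thesis by (simp add: pin_low_def field_simps)
  qed
  have H\<beta>: "H' T3 (\<beta> z) = pin_high (Suc g) z" if z: "z \<in> diamond (1/2)" for z
  proof -
    have "H' T3 (\<beta> z) = (2 * real (Suc g) + 1, 3/2 + 9/2 * (2/9 - (Re z + Im z) / 36), - (- 9/32 - (Re z - Im z) / 8))"
      unfolding \<beta>[symmetric] by (rule patch) (use in\<beta>(1)[OF z] in auto)
    then show ?thesis by (simp add: pin_high_def field_simps)
  qed
  have T3: "T3 \<in> join_faces F M N" by (simp add: join_faces_def)
  show ?thesis
    by (rule pinned_from_germs[OF surf' drawing_join T3 \<alpha>_def CA \<beta>_def CA _ _ H\<alpha> H\<beta> k])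
      (use in\<alpha> in\<beta> in blast)+
qed

section \<open>The starting drawing on the box\<close>

text \<open>The two sides of a four-cycle on the sphere. The opposite corners 0, 1 and 2, 3 are the
  pairs from which the multipartite graph grows.\<close>

definition base_faces :: "quad set" where "base_faces = {(0, 2, 1, 3), (2, 0, 3, 1)}"

text \<open>The half-size diamond covers the right wall \<open>x = 1\<close>, and the ring around it
  is folded over the adjacent walls down to the middle section \<open>x = 1/2\<close>. Bounding the
  denominator below by \<open>1/2\<close> is what makes the inner part flat.\<close>

definition half_box :: "complex \<Rightarrow> real \<times> real \<times> real" where
  "half_box z = (let s = Re z + Im z; d = Im z - Re z; n = max (max \<bar>s\<bar> \<bar>d\<bar>) (1/2)
     in (3/2 - n, 3/2 + 3/2 * (s / n), 1/2 + 1/2 * (d / n)))"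

text \<open>The other half is the mirror image in the plane \<open>x = 1/2\<close>; the reflection
  \<open>\<i> * cnj z\<close> is needed because the second face lists the common cycle in the
  opposite sense.\<close>

definition base_map :: "quad \<Rightarrow> complex \<Rightarrow> real \<times> real \<times> real" where
  "base_map f z = (if f = (0, 2, 1, 3) then half_box z else let w = half_box (\<i> * cnj z) in (1 - fst w, snd w))"

lemma half_box_alt:
  fixes z defines "n \<equiv> max (nd z) (1/2)"
  shows "half_box z = (3/2 - n, 3/2 + 3/2 * ((Re z + Im z) / n), 1/2 + 1/2 * ((Im z - Re z) / n))"
proof -
  have "max \<bar>Re z + Im z\<bar> \<bar>Im z - Re z\<bar> = nd z" unfolding nd_def by (auto simp: max_def abs_if)
  then show ?thesis by (simp add: half_box_def Let_def n_def)
qed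

lemma half_box_inj:
  assumes "half_box z = half_box z'" shows "z = z'"
proof -
  let ?n = "max (nd z) (1/2)" and ?n' = "max (nd z') (1/2)"
  have n: "?n = ?n'" using assms by (simp add: half_box_alt)
  have pos: "0 < ?n'" by (simp add: less_max_iff_disj)
  have canc: "A = B" if "r + k * (A / m) = r + k * (B / m)" "0 < m" "0 < k" for A B m r k :: real
    using that by simp
  have 1: "3/2 + 3/2 * ((Re z + Im z) / ?n') = 3/2 + 3/2 * ((Re z' + Im z') / ?n')"
    "1/2 + 1/2 * ((Im z - Re z) / ?n') = 1/2 + 1/2 * ((Im z' - Re z') / ?n')"
    using assms unfolding half_box_alt n prod.inject by blast+
  have "Re z + Im z = Re z' + Im z'" "Im z - Re z = Im z' - Re z'"
    using canc[OF 1(1) pos] canc[OF 1(2) pos] by simp_all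
  then show ?thesis by (simp add: complex_eq_iff)
qed

lemma continuous_half_box: "continuous_on A half_box"
  unfolding half_box_def Let_def by (intro continuous_intros) (auto simp: less_max_iff_disj)

lemma mem_box_surface:
  "(x, y, z) \<in> genus_surface 0 \<longleftrightarrow> 0 \<le> x \<and> x \<le> 1 \<and> 0 \<le> y \<and> y \<le> 3 \<and> 0 \<le> z \<and> z \<le> 1 \<and>
    (x = 0 \<or> x = 1 \<or> y = 0 \<or> y = 3 \<or> z = 0 \<or> z = 1)"
  by (auto simp: mem_genus_surface mem_pierced_block)

lemma half_box_image: "half_box ` diamond 1 = {w \<in> genus_surface 0. 1/2 \<le> fst w}"
proof
  show "half_box ` diamond 1 \<subseteq> {w \<in> genus_surface 0. 1/2 \<le> fst w}"
  proof
    fix w assume "w \<in> half_box ` diamond 1"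
    then obtain z where z: "nd z \<le> 1" "w = half_box z" by (auto simp: mem_diamond)
    define n s d where "n = max (nd z) (1/2)" and "s = (Re z + Im z) / n" and "d = (Im z - Re z) / n"
    have n: "1/2 \<le> n" "n \<le> 1" using z by (auto simp: n_def)
    have le: "\<bar>Re z + Im z\<bar> \<le> n" "\<bar>Im z - Re z\<bar> \<le> n" unfolding n_def nd_def by linarith+
    have sd: "\<bar>s\<bar> \<le> 1" "\<bar>d\<bar> \<le> 1" using le n by (auto simp: s_def d_def abs_divide divide_le_eq_1)
    have "n = 1/2 \<or> \<bar>s\<bar> = 1 \<or> \<bar>d\<bar> = 1"
    proof (cases "nd z \<le> 1/2")
      case False
      then have "n = nd z" by (simp add: n_def)
      moreover have "\<bar>Re z + Im z\<bar> = nd z \<or> \<bar>Im z - Re z\<bar> = nd z" unfolding nd_def by linarith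
      ultimately show ?thesis using n by (auto simp: s_def d_def abs_divide)
    qed (auto simp: n_def)
    moreover have "w = (3/2 - n, 3/2 + 3/2 * s, 1/2 + 1/2 * d)" unfolding z(2) half_box_alt n_def s_def d_def ..
    ultimately show "w \<in> {w \<in> genus_surface 0. 1/2 \<le> fst w}"
      using n sd by (auto simp: mem_box_surface abs_le_iff abs_if split: if_splits)
  qed
  show "{w \<in> genus_surface 0. 1/2 \<le> fst w} \<subseteq> half_box ` diamond 1"
  proof
    fix w assume w: "w \<in> {w \<in> genus_surface 0. 1/2 \<le> fst w}"
    obtain x y z where xyz: "w = (x, y, z)" by (cases w) auto
    have bd: "1/2 \<le> x" "x \<le> 1" "0 \<le> y" "y \<le> 3" "0 \<le> z" "z \<le> 1" "x = 1 \<or> y = 0 \<or> y = 3 \<or> z = 0 \<or> z = 1"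
      using w by (auto simp: xyz mem_box_surface)
    define n s d where "n = 3/2 - x" and "s = (2 * y - 3) / 3" and "d = 2 * z - 1"
    have n: "1/2 \<le> n" "n \<le> 1" "\<bar>s\<bar> \<le> 1" "\<bar>d\<bar> \<le> 1" "n = 1/2 \<or> \<bar>s\<bar> = 1 \<or> \<bar>d\<bar> = 1"
      using bd by (auto simp: n_def s_def d_def abs_le_iff)
    define p where "p = Complex ((n * s - n * d) / 2) ((n * s + n * d) / 2)"
    have p: "Re p + Im p = n * s" "Im p - Re p = n * d" by (simp_all add: p_def field_simps)
    have nd: "nd p = max \<bar>n * s\<bar> \<bar>n * d\<bar>"
      unfolding p[symmetric] nd_def by (auto simp: max_def abs_if)
    have "\<bar>n * s\<bar> \<le> n" "\<bar>n * d\<bar> \<le> n" using n by (auto simp: abs_mult mult_left_le)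
    moreover have "n = 1/2 \<or> \<bar>n * s\<bar> = n \<or> \<bar>n * d\<bar> = n" using n by (auto simp: abs_mult)
    moreover define S D where "S = \<bar>n * s\<bar>" and "D = \<bar>n * d\<bar>"
    ultimately have "max (nd p) (1/2) = n" using n(1) unfolding nd by (auto simp: max_def)
    then have "half_box p = (3/2 - n, 3/2 + 3/2 * s, 1/2 + 1/2 * d)" using n unfolding half_box_alt p by simp
    also have "\<dots> = w" by (simp add: xyz n_def s_def d_def field_simps)
    finally have "w = half_box p" ..
    moreover have "nd p \<le> 1" using \<open>max (nd p) (1/2) = n\<close> n by linarith
    ultimately show "w \<in> half_box ` diamond 1" by (auto simp: mem_diamond)
  qed
qed

lemma base_drawing: "drawing (genus_surface 0) base_faces base_map"
proof -
  let ?f = "(0, 2, 1, 3) :: quad" and ?f' = "(2, 0, 3, 1) :: quad"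
  have m: "base_map ?f z = half_box z" "base_map ?f' z = (1 - fst (half_box (\<i> * cnj z)), snd (half_box (\<i> * cnj z)))" for z
    by (simp_all add: base_map_def Let_def)
  have fst: "fst (half_box z) = 3/2 - max (nd z) (1/2)" for z by (simp add: half_box_alt)
  have bw: "bweight ?f' z = bweight ?f (\<i> * cnj z)" for z by (rule ext) simp
  have bwi: "bweight ?f z = bweight ?f z' \<longleftrightarrow> z = z'" for z z' using bweight_inj[of 0 2 1 3] by auto
  \<comment> \<open>The halves lie on different sides of \<open>x = 1/2\<close>, so they meet in the
    middle section only, which is the image of the boundary of the diamond.\<close>
  have fwd: "half_box z = (1 - fst (half_box w), snd (half_box w)) \<longleftrightarrow> nd z = 1 \<and> z = w" if "nd z \<le> 1" "nd w \<le> 1" for z w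
  proof
    assume eq: "half_box z = (1 - fst (half_box w), snd (half_box w))"
    then have "3/2 - max (nd z) (1/2) = 1 - (3/2 - max (nd w) (1/2))" by (metis fst fst_conv)
    then have 1: "nd z = 1" "nd w = 1" using that by (auto simp: max_def split: if_splits)
    then have "fst (half_box w) = 1/2" by (simp add: fst)
    then have "half_box z = half_box w" using eq by (simp add: prod_eq_iff)
    then show "nd z = 1 \<and> z = w" using half_box_inj 1 by simp
  next
    assume "nd z = 1 \<and> z = w"
    then have "nd w = 1" "z = w" by auto
    then show "half_box z = (1 - fst (half_box w), snd (half_box w))" using fst[of w] by (simp add: prod_eq_iff)
  qed
  have cc: "\<i> * cnj z = \<i> * cnj z' \<longleftrightarrow> z = z'" for z z' by simp
  show ?thesis
    unfolding drawing_def
  proof (intro conjI ballI)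
    show "continuous_on (diamond 1) (base_map f)" if "f \<in> base_faces" for f
    proof -
      have c: "continuous_on (diamond 1) (\<lambda>z. half_box (\<i> * cnj z))"
        by (rule continuous_on_compose2[OF continuous_half_box[of UNIV]]) (auto intro!: continuous_intros)
      have "continuous_on (diamond 1) (base_map ?f)" using continuous_half_box by (simp add: m[abs_def] base_map_def[abs_def])
      moreover have "continuous_on (diamond 1) (base_map ?f')"
        unfolding m(2)[abs_def] by (intro continuous_intros c)
      ultimately show ?thesis using that by (auto simp: base_faces_def)
    qed
    show "(\<Union>f\<in>base_faces. base_map f ` diamond 1) = genus_surface 0"
    proof -
      have "base_map ?f' ` diamond 1 = {w \<in> genus_surface 0. fst w \<le> 1/2}"
      proof -
        have refl: "(\<lambda>z. \<i> * cnj z) ` diamond 1 = diamond 1"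
        proof
          show "diamond 1 \<subseteq> (\<lambda>z. \<i> * cnj z) ` diamond 1"
          proof
            fix z assume "z \<in> diamond 1"
            then show "z \<in> (\<lambda>z. \<i> * cnj z) ` diamond 1"
              by (intro image_eqI[of _ _ "\<i> * cnj z"]) (simp_all only: i_cnj_i_cnj nd_reflect mem_diamond)
          qed
        qed (auto simp: nd_reflect mem_diamond)
        have "base_map ?f' ` diamond 1 = (\<lambda>w. (1 - fst w, snd w)) ` (half_box ` ((\<lambda>z. \<i> * cnj z) ` diamond 1))"
          unfolding image_image m(2) ..
        also have "\<dots> = (\<lambda>w. (1 - fst w, snd w)) ` {w \<in> genus_surface 0. 1/2 \<le> fst w}"
          unfolding refl half_box_image ..
        also have "\<dots> = {w \<in> genus_surface 0. fst w \<le> 1/2}"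
        proof -
          have S: "(1 - fst w, snd w) \<in> genus_surface 0 \<longleftrightarrow> w \<in> genus_surface 0" for w
            by (cases w) (auto simp: mem_box_surface)
          show ?thesis
          proof (intro set_eqI iffI)
            fix w :: "real \<times> real \<times> real" assume "w \<in> {w \<in> genus_surface 0. fst w \<le> 1/2}"
            then show "w \<in> (\<lambda>w. (1 - fst w, snd w)) ` {w \<in> genus_surface 0. 1/2 \<le> fst w}"
              using S by (intro image_eqI[of _ _ "(1 - fst w, snd w)"]) auto
          qed (use S in auto)
        qed
        finally show ?thesis .
      qed
      moreover have "base_map ?f ` diamond 1 = {w \<in> genus_surface 0. 1/2 \<le> fst w}"
        using half_box_image by (simp add: m(1)[abs_def] base_map_def[abs_def])
      ultimately show ?thesis by (auto simp: base_faces_def)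
    qed
    fix f f' z z' assume f: "f \<in> base_faces" "f' \<in> base_faces" and z: "z \<in> diamond 1" "z' \<in> diamond 1"
    then have le: "nd z \<le> 1" "nd z' \<le> 1" "nd (\<i> * cnj z) \<le> 1" "nd (\<i> * cnj z') \<le> 1" by (simp_all add: mem_diamond nd_reflect)
    have bwi': "bweight ?f' z = bweight ?f' z' \<longleftrightarrow> z = z'" for z z' unfolding bw bwi by simp
    have same: "half_box z = half_box z' \<longleftrightarrow> z = z'" for z z' using half_box_inj by auto
    have "base_map f z = base_map f' z' \<longleftrightarrow>
      (nd z < 1 \<and> f = f' \<and> z = z') \<or> (nd z = 1 \<and> nd z' = 1 \<and> bweight f z = bweight f' z')"
    proof -
      from f consider "f = ?f" "f' = ?f" | "f = ?f'" "f' = ?f'" | "f = ?f" "f' = ?f'" | "f = ?f'" "f' = ?f"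
        by (auto simp: base_faces_def)
      then show ?thesis
      proof cases
        case 1
        have "base_map ?f z = base_map ?f z' \<longleftrightarrow> z = z'" unfolding m by (rule same)
        then show ?thesis using 1 le bwi by (auto simp del: bweight.simps)
      next
        case 2
        have "base_map ?f' z = base_map ?f' z' \<longleftrightarrow> half_box (\<i> * cnj z) = half_box (\<i> * cnj z')"
          unfolding m by (auto simp: prod_eq_iff)
        then show ?thesis using 2 le same cc bwi' by (auto simp del: bweight.simps)
      next
        case 3
        have "base_map ?f z = base_map ?f' z' \<longleftrightarrow> nd z = 1 \<and> z = \<i> * cnj z'"
          unfolding m using fwd[OF le(1,4)] .
        then show ?thesis using 3 bw bwi nd_reflect[of z'] by (auto simp del: bweight.simps)
      next
        case 4
        have "base_map ?f' z = base_map ?f z' \<longleftrightarrow> nd z' = 1 \<and> z' = \<i> * cnj z"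
          unfolding m using fwd[OF le(2,3)] by auto
        then show ?thesis using 4 bw bwi nd_reflect[of z] by (auto simp del: bweight.simps)
      qed
    qed
    then show "base_map f z = base_map f' z' \<longleftrightarrow> label f z = label f' z'" using label_eq_iff[OF le(1,2)] by simp
  qed
qed

section \<open>Local replacements\<close>

definition dedge_set :: "quad set \<Rightarrow> (nat \<times> nat) set" where
  "dedge_set F = (\<Union>f\<in>F. dedges f)"

text \<open>The common pattern of both moves: the faces \<open>D\<close> give way to the connected
  patch \<open>N\<close> with the same boundary, and \<open>X\<close> collects the new edges in both
  directions. The combinatorial claims are proved once for this pattern.\<close>

definition replacement :: "quad set \<Rightarrow> quad set \<Rightarrow> quad set \<Rightarrow> (nat \<times> nat) set \<Rightarrow> bool" where
  "replacement F D N X \<longleftrightarrow> D \<subseteq> F \<and> D \<noteq> {} \<and> finite N \<and> (\<forall>f\<in>N. distinct_quad f) \<and>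
     dedge_set N = dedge_set D \<union> X \<and> X \<inter> dedge_set F = {} \<and> (\<forall>a b. (a, b) \<in> X \<longrightarrow> (b, a) \<in> X) \<and>
     (\<forall>f\<in>N. \<forall>f'\<in>N. \<forall>e. e \<in> dedges f \<longrightarrow> e \<in> dedges f' \<longrightarrow> f = f') \<and>
     (\<forall>P. (\<exists>f\<in>N. P f) \<longrightarrow> (\<forall>f\<in>N. \<forall>f'\<in>N. adjacent f f' \<longrightarrow> P f \<longrightarrow> P f') \<longrightarrow> (\<forall>f\<in>N. P f))"

lemma dedge_setI: "e \<in> dedges f \<Longrightarrow> f \<in> F \<Longrightarrow> e \<in> dedge_set F"
  by (auto simp: dedge_set_def)

lemma quad_surfaceD:
  assumes "quad_surface F"
  shows "finite F" "f \<in> F \<Longrightarrow> distinct_quad f" "f \<in> F \<Longrightarrow> f' \<in> F \<Longrightarrow> e \<in> dedges f \<Longrightarrow> e \<in> dedges f' \<Longrightarrow> f = f'"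
    "f \<in> F \<Longrightarrow> (a, b) \<in> dedges f \<Longrightarrow> \<exists>f'\<in>F. (b, a) \<in> dedges f'"
proof -
  note c1 = assms[unfolded quad_surface_def]
  note c2 = conjunct2[OF c1] note c3 = conjunct2[OF c2] note c4 = conjunct2[OF c3]
  show "finite F" by (rule conjunct1[OF c1])
  show "f \<in> F \<Longrightarrow> distinct_quad f" using conjunct1[OF c2] by blast
  show "f \<in> F \<Longrightarrow> f' \<in> F \<Longrightarrow> e \<in> dedges f \<Longrightarrow> e \<in> dedges f' \<Longrightarrow> f = f'" using conjunct1[OF c3] by blast
  show "f \<in> F \<Longrightarrow> (a, b) \<in> dedges f \<Longrightarrow> \<exists>f'\<in>F. (b, a) \<in> dedges f'" using conjunct1[OF c4] by blast
qed

lemma quad_surface_connected: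
  assumes "quad_surface F" "f \<in> F" "P f" "\<And>f f'. f \<in> F \<Longrightarrow> f' \<in> F \<Longrightarrow> adjacent f f' \<Longrightarrow> P f \<Longrightarrow> P f'" "f' \<in> F"
  shows "P f'"
proof -
  have "\<forall>P. (\<exists>f\<in>F. P f) \<and> (\<forall>f\<in>F. \<forall>f'\<in>F. adjacent f f' \<longrightarrow> P f \<longrightarrow> P f') \<longrightarrow> (\<forall>f\<in>F. P f)"
    using assms(1) unfolding quad_surface_def by (elim conjE)
  from spec[OF this, of P] show ?thesis using assms by blast
qed

lemma dedges_irrefl: "distinct_quad f \<Longrightarrow> (a, b) \<in> dedges f \<Longrightarrow> a \<noteq> b \<and> (b, a) \<notin> dedges f"
  by (cases f) auto

lemma replacementD:
  assumes "replacement F D N X"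
  shows "D \<subseteq> F" "D \<noteq> {}" "finite N" "f \<in> N \<Longrightarrow> distinct_quad f" "dedge_set N = dedge_set D \<union> X"
    "X \<inter> dedge_set F = {}" "(a, b) \<in> X \<Longrightarrow> (b, a) \<in> X"
    "f \<in> N \<Longrightarrow> f' \<in> N \<Longrightarrow> e \<in> dedges f \<Longrightarrow> e \<in> dedges f' \<Longrightarrow> f = f'"
proof -
  note c1 = assms[unfolded replacement_def]
  note c2 = conjunct2[OF c1] note c3 = conjunct2[OF c2] note c4 = conjunct2[OF c3] note c5 = conjunct2[OF c4]
  note c6 = conjunct2[OF c5] note c7 = conjunct2[OF c6] note c8 = conjunct2[OF c7]
  show "D \<subseteq> F" "D \<noteq> {}" "finite N" by (rule conjunct1[OF c1] conjunct1[OF c2] conjunct1[OF c3])+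
  show "f \<in> N \<Longrightarrow> distinct_quad f" using conjunct1[OF c4] by blast
  show "dedge_set N = dedge_set D \<union> X" "X \<inter> dedge_set F = {}" by (rule conjunct1[OF c5] conjunct1[OF c6])+
  show "(a, b) \<in> X \<Longrightarrow> (b, a) \<in> X" using conjunct1[OF c7] by blast
  show "f \<in> N \<Longrightarrow> f' \<in> N \<Longrightarrow> e \<in> dedges f \<Longrightarrow> e \<in> dedges f' \<Longrightarrow> f = f'" using conjunct1[OF c8] by blast
qed

lemma replacementI:
  assumes "D \<subseteq> F" "D \<noteq> {}" "finite N" "\<And>f. f \<in> N \<Longrightarrow> distinct_quad f" "dedge_set N = dedge_set D \<union> X"
    "X \<inter> dedge_set F = {}" "\<And>a b. (a, b) \<in> X \<Longrightarrow> (b, a) \<in> X"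
    "\<And>f f' e. f \<in> N \<Longrightarrow> f' \<in> N \<Longrightarrow> e \<in> dedges f \<Longrightarrow> e \<in> dedges f' \<Longrightarrow> f = f'"
    and conn: "\<And>P f f'. f \<in> N \<Longrightarrow> P f \<Longrightarrow> (\<And>h h'. h \<in> N \<Longrightarrow> h' \<in> N \<Longrightarrow> adjacent h h' \<Longrightarrow> P h \<Longrightarrow> P h') \<Longrightarrow> f' \<in> N \<Longrightarrow> P f'"
  shows "replacement F D N X"
  unfolding replacement_def
proof (intro conjI allI impI ballI)
  fix P f' assume "\<exists>f\<in>N. P f" and cl: "\<forall>f\<in>N. \<forall>f'\<in>N. adjacent f f' \<longrightarrow> P f \<longrightarrow> P f'" and f': "f' \<in> N"
  then obtain f where f: "f \<in> N" "P f" by (elim bexE)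
  show "P f'"
    by (rule conn[where P = P, OF f _ f']) (use cl in blast)
qed (fact assms(1-3) assms(5,6) | rule assms(4,7,8); assumption)+

lemma replacement_connected:
  assumes "replacement F D N X" "f \<in> N" "P f" "\<And>f f'. f \<in> N \<Longrightarrow> f' \<in> N \<Longrightarrow> adjacent f f' \<Longrightarrow> P f \<Longrightarrow> P f'" "f' \<in> N"
  shows "P f'"
proof -
  have "\<forall>P. (\<exists>f\<in>N. P f) \<longrightarrow> (\<forall>f\<in>N. \<forall>f'\<in>N. adjacent f f' \<longrightarrow> P f \<longrightarrow> P f') \<longrightarrow> (\<forall>f\<in>N. P f)"
    using assms(1) unfolding replacement_def by (elim conjE)
  from spec[OF this, of P] show ?thesis using assms by blast
qed

lemma dedge_set_replace:
  assumes "replacement F D N X"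
  shows "dedge_set ((F - D) \<union> N) = dedge_set F \<union> X"
proof -
  have "dedge_set ((F - D) \<union> N) = dedge_set (F - D) \<union> dedge_set N" by (simp add: dedge_set_def)
  also have "\<dots> = dedge_set (F - D) \<union> dedge_set D \<union> X" using replacementD(5)[OF assms] by blast
  also have "dedge_set (F - D) \<union> dedge_set D = dedge_set F" using replacementD(1)[OF assms] by (auto simp: dedge_set_def)
  finally show ?thesis .
qed

lemma dedge_cases_replace:
  assumes "quad_surface F" and r: "replacement F D N X" and n: "n \<in> N" "e \<in> dedges n"
  obtains (old) d where "d \<in> D" "e \<in> dedges d" | (new) "e \<in> X"
proof -
  have "e \<in> dedge_set D \<union> X" using replacementD(5)[OF r] dedge_setI[OF n(2,1)] by simp
  then show ?thesis using old new unfolding dedge_set_def by blast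
qed

lemma quad_surface_replace:
  assumes surf: "quad_surface F" and r: "replacement F D N X"
  shows "quad_surface ((F - D) \<union> N)"
proof -
  note S = quad_surfaceD[OF surf] and R = replacementD[OF r]
  let ?F = "(F - D) \<union> N"
  have un: "f = f'" if "f \<in> ?F" "f' \<in> ?F" "e \<in> dedges f" "e \<in> dedges f'" for f f' e
  proof -
    have mix: "False" if "g \<in> F - D" "n \<in> N" "e \<in> dedges g" "e \<in> dedges n" for g n
      using surf r that(2,4)
    proof (cases rule: dedge_cases_replace)
      case (old d)
      then have "g = d" using S(3)[of g d e] that(1,3) R(1) by blast
      then show False using that(1) old by blast
    next
      case new
      then show False using R(6) that(1,3) by (auto simp: dedge_set_def)
    qed
    from \<open>f \<in> ?F\<close> \<open>f' \<in> ?F\<close> consider "f \<in> F" "f' \<in> F" | "f \<in> N" "f' \<in> N" | "f \<in> F - D" "f' \<in> N" | "f \<in> N" "f' \<in> F - D" by blast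
    then show ?thesis
    proof cases
      case 1 then show ?thesis using S(3) that(3,4) by blast
    next
      case 2 then show ?thesis using R(8) that(3,4) by blast
    next
      case 3 then show ?thesis using mix that(3,4) by blast
    next
      case 4 then show ?thesis using mix that(3,4) by blast
    qed
  qed
  have rev: "\<exists>f'\<in>?F. (b, a) \<in> dedges f'" if "f \<in> ?F" "(a, b) \<in> dedges f" for f a b
  proof -
    have "(a, b) \<in> dedge_set F \<union> X" using that dedge_set_replace[OF r] by (blast intro: dedge_setI)
    then have "(b, a) \<in> dedge_set F \<union> X"
    proof
      assume "(a, b) \<in> dedge_set F"
      then obtain h where h: "h \<in> F" "(a, b) \<in> dedges h" by (auto simp: dedge_set_def)
      from S(4)[OF h] show ?thesis by (auto simp: dedge_set_def)
    next
      assume "(a, b) \<in> X"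
      from R(7)[OF this] show ?thesis by simp
    qed
    then have "(b, a) \<in> dedge_set ?F" unfolding dedge_set_replace[OF r] .
    then show ?thesis by (simp only: dedge_set_def UN_iff)
  qed
  have conn: "\<forall>f\<in>?F. P f" if ex: "\<exists>f\<in>?F. P f" and cl: "\<forall>f\<in>?F. \<forall>f'\<in>?F. adjacent f f' \<longrightarrow> P f \<longrightarrow> P f'" for P
  proof -
    have N: "P n'" if "n \<in> N" "P n" "n' \<in> N" for n n'
      by (rule replacement_connected[OF r that(1), of P]) (use that cl in blast)+
    \<comment> \<open>A property of the new complex is pulled back to the old one: a removed face
      counts as having it if some inserted face has it. As the patch is connected, this then holds
      for all inserted faces.\<close>
    define Q where "Q g \<longleftrightarrow> (if g \<in> D then \<exists>n\<in>N. P n else P g)" for g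
    have nx: "\<exists>n\<in>N. e \<in> dedges n" if "d \<in> D" "e \<in> dedges d" for d e
    proof -
      have "e \<in> dedge_set N" using R(5) dedge_setI[OF that(2,1)] by blast
      then show ?thesis by (auto simp: dedge_set_def)
    qed
    have Qcl: "Q f'" if f: "f \<in> F" "f' \<in> F" "adjacent f f'" "Q f" for f f'
    proof -
      obtain a b where ab: "(a, b) \<in> dedges f" "(b, a) \<in> dedges f'" using f by (auto simp: adjacent_def)
      consider "f \<in> D" "f' \<in> D" | "f \<notin> D" "f' \<notin> D" | "f \<in> D" "f' \<notin> D" | "f \<notin> D" "f' \<in> D" by blast
      then show ?thesis
      proof cases
        case 1 then show ?thesis using f by (simp add: Q_def)
      next
        case 2
        then have "P f" "f \<in> ?F" "f' \<in> ?F" using f by (simp_all add: Q_def)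
        then have "P f'" using cl f(3) by blast
        then show ?thesis using 2 by (simp add: Q_def)
      next
        case 3
        then obtain n where n: "n \<in> N" "(a, b) \<in> dedges n" using nx ab by blast
        have "\<exists>n\<in>N. P n" using f(4) 3 by (simp add: Q_def)
        then have "P n" using N n(1) by blast
        moreover have "adjacent n f'" using n ab by (auto simp: adjacent_def)
        ultimately have "P f'" using cl n 3 f by blast
        then show ?thesis using 3 by (simp add: Q_def)
      next
        case 4
        then obtain n where n: "n \<in> N" "(b, a) \<in> dedges n" using nx ab by blast
        have "P f" using f(4) 4 by (simp add: Q_def)
        moreover have "adjacent f n" using n ab by (auto simp: adjacent_def)
        ultimately have "P n" using cl n 4 f by blast
        then show ?thesis using 4 n by (auto simp: Q_def)
      qed
    qed
    obtain d where d: "d \<in> D" "d \<in> F" using R(1,2) by blast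
    obtain f where f: "f \<in> ?F" "P f" using ex by blast
    have "\<exists>q\<in>F. Q q"
    proof (cases "f \<in> N")
      case True then have "Q d" using d f by (auto simp: Q_def)
      then show ?thesis using d by blast
    next
      case False then show ?thesis using f by (auto simp: Q_def)
    qed
    then obtain q where q: "q \<in> F" "Q q" by blast
    have Qall: "Q g" if "g \<in> F" for g using quad_surface_connected[of F q Q g, OF surf q Qcl that] .
    have "\<exists>n\<in>N. P n" using Qall[OF d(2)] d(1) by (simp add: Q_def)
    then have "P n" if "n \<in> N" for n using N that by blast
    moreover have "P g" if "g \<in> F - D" for g using Qall[of g] that by (simp add: Q_def)
    ultimately show ?thesis by blast
  qed
  show ?thesis unfolding quad_surface_def
  proof (intro conjI)
    show "finite ?F" using S(1) R(3) by simp
    show "\<forall>f\<in>?F. distinct_quad f" using S(2) R(4) by blast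
    show "\<forall>f\<in>?F. \<forall>f'\<in>?F. \<forall>e. e \<in> dedges f \<longrightarrow> e \<in> dedges f' \<longrightarrow> f = f'" using un by blast
    show "\<forall>f\<in>?F. \<forall>a b. (a, b) \<in> dedges f \<longrightarrow> (\<exists>f'\<in>?F. (b, a) \<in> dedges f')" using rev by blast
    show "\<forall>P. (\<exists>f\<in>?F. P f) \<and> (\<forall>f\<in>?F. \<forall>f'\<in>?F. adjacent f f' \<longrightarrow> P f \<longrightarrow> P f') \<longrightarrow> (\<forall>f\<in>?F. P f)"
      using conn by blast
  qed
qed

definition face_colouring :: "quad set \<Rightarrow> (quad \<Rightarrow> nat) \<Rightarrow> bool" where
  "face_colouring F c \<longleftrightarrow> (\<forall>f\<in>F. \<forall>f'\<in>F. f \<noteq> f' \<longrightarrow> adjacent f f' \<longrightarrow> c f \<noteq> c f')"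

text \<open>An inserted face has the colour of the removed face with which it shares a directed
  edge. A conflict along an old edge would thus be one of the old colouring, and only the edges in
  \<open>X\<close> remain to be inspected.\<close>

lemma face_colouring_replace:
  assumes surf: "quad_surface F" and r: "replacement F D N X" and c: "face_colouring F c"
    and old: "\<And>f. f \<in> F - D \<Longrightarrow> c' f = c f"
    and inh: "\<And>n d e. n \<in> N \<Longrightarrow> d \<in> D \<Longrightarrow> e \<in> dedges n \<Longrightarrow> e \<in> dedges d \<Longrightarrow> c' n = c d"
    and new: "\<And>n n' a b. n \<in> N \<Longrightarrow> n' \<in> N \<Longrightarrow> (a, b) \<in> X \<Longrightarrow> (a, b) \<in> dedges n \<Longrightarrow> (b, a) \<in> dedges n' \<Longrightarrow> c' n \<noteq> c' n'"
  shows "face_colouring ((F - D) \<union> N) c'"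
  unfolding face_colouring_def
proof (intro ballI impI)
  fix f f' assume f: "f \<in> (F - D) \<union> N" "f' \<in> (F - D) \<union> N" "f \<noteq> f'" "adjacent f f'"
  note S = quad_surfaceD[OF surf] and R = replacementD[OF r]
  obtain a b where ab: "(a, b) \<in> dedges f" "(b, a) \<in> dedges f'" using f by (auto simp: adjacent_def)
  have parent: "\<exists>d\<in>F. (p, q) \<in> dedges d \<and> c' h = c d" if h: "h \<in> (F - D) \<union> N" "(p, q) \<in> dedges h" "(p, q) \<notin> X" for h p q
  proof (cases "h \<in> N")
    case True
    from surf r True h(2) show ?thesis
    proof (cases rule: dedge_cases_replace)
      case (old d)
      then show ?thesis using inh[OF True old(1) h(2) old(2)] R(1) by blast
    qed (use h in blast)
  next
    case False
    then show ?thesis using h old by blast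
  qed
  have inN: "h \<in> N" if h: "h \<in> (F - D) \<union> N" "e \<in> dedges h" "e \<in> X" for h e
  proof (rule ccontr)
    assume "h \<notin> N"
    then have "e \<in> dedge_set F" using h by (blast intro: dedge_setI)
    then show False using R(6) h(3) by blast
  qed
  show "c' f \<noteq> c' f'"
  proof (cases "(a, b) \<in> X")
    case True
    then show ?thesis using new[OF inN[OF f(1) ab(1)] inN[OF f(2) ab(2)] True ab] R(7) by blast
  next
    case False
    then have "(b, a) \<notin> X" using R(7) by blast
    then obtain d d' where d: "d \<in> F" "(a, b) \<in> dedges d" "c' f = c d" "d' \<in> F" "(b, a) \<in> dedges d'" "c' f' = c d'"
      using parent[OF f(1) ab(1) False] parent[OF f(2) ab(2)] by blast
    have "d \<noteq> d'" using d dedges_irrefl[OF S(2)] by blast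
    moreover have "adjacent d d'" using d by (auto simp: adjacent_def)
    ultimately show ?thesis using c d by (auto simp: face_colouring_def)
  qed
qed

lemma quad_vertices_dedge_set: "quad_vertices F = fst ` dedge_set F"
  by (auto simp: quad_vertices_def dedge_set_def)

lemma dedge_set_vertices:
  assumes "(p, q) \<in> dedge_set F" shows "p \<in> quad_vertices F" "q \<in> quad_vertices F"
proof -
  obtain f where f: "f \<in> F" "(p, q) \<in> dedges f" using assms by (auto simp: dedge_set_def)
  obtain a b c d where "f = (a, b, c, d)" by (cases f) auto
  then show "p \<in> quad_vertices F" "q \<in> quad_vertices F" using f quad_verticesI[of a b c d F] by auto
qed

text \<open>The complete bipartite graph on \<open>{a, c}\<close> and \<open>{x, y}\<close>. Both
  moves add such a four-cycle: a split between two opposite corners and the fresh vertices, a join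
  between two old pairs.\<close>

definition both_ways :: "nat \<Rightarrow> nat \<Rightarrow> nat \<Rightarrow> nat \<Rightarrow> (nat \<times> nat) set" where
  "both_ways a c x y = {(a, x), (x, a), (a, y), (y, a), (c, x), (x, c), (c, y), (y, c)}"

lemma split_replacement:
  assumes surf: "quad_surface F" and fF: "(a, b, c, d) \<in> F" and fresh: "x \<notin> quad_vertices F" "y \<notin> quad_vertices F" "x \<noteq> y"
  shows "replacement F {(a, b, c, d)} {(a, b, c, x), (x, c, y, a), (a, y, c, d)} (both_ways a c x y)"
proof -
  have dis: "distinct [a, b, c, d, x, y]"
    using quad_surfaceD(2)[OF surf fF] quad_verticesI[OF fF] fresh by auto
  have X: "both_ways a c x y \<inter> dedge_set F = {}"
    using dedge_set_vertices[of _ _ F] fresh unfolding both_ways_def by blast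
  have conn: "P f'" if "f \<in> {(a, b, c, x), (x, c, y, a), (a, y, c, d)}" "P f"
    "\<And>f f'. f \<in> {(a, b, c, x), (x, c, y, a), (a, y, c, d)} \<Longrightarrow> f' \<in> {(a, b, c, x), (x, c, y, a), (a, y, c, d)} \<Longrightarrow> adjacent f f' \<Longrightarrow> P f \<Longrightarrow> P f'"
    "f' \<in> {(a, b, c, x), (x, c, y, a), (a, y, c, d)}" for P f f'
  proof -
    have adj: "adjacent (a, b, c, x) (x, c, y, a)" "adjacent (x, c, y, a) (a, y, c, d)" by (auto simp: adjacent_def)
    note adj = adj adj[THEN adjacent_sym]
    have "P (x, c, y, a)" using that(1,2) that(3)[OF _ _ adj(1)] that(3)[OF _ _ adj(4)] by auto
    then show ?thesis using that(4) that(3)[OF _ _ adj(2)] that(3)[OF _ _ adj(3)] by auto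
  qed
  show ?thesis
  proof (rule replacementI[OF _ _ _ _ _ X])
    show "P f'" if "f \<in> {(a, b, c, x), (x, c, y, a), (a, y, c, d)}" "P f" "\<And>h h'. h \<in> {(a, b, c, x), (x, c, y, a), (a, y, c, d)} \<Longrightarrow> h' \<in> {(a, b, c, x), (x, c, y, a), (a, y, c, d)} \<Longrightarrow> adjacent h h' \<Longrightarrow> P h \<Longrightarrow> P h'" "f' \<in> {(a, b, c, x), (x, c, y, a), (a, y, c, d)}" for P f f'
      by (rule conn[where P = P, OF that(1,2) _ that(4)]) (rule that(3))
    show "dedge_set {(a, b, c, x), (x, c, y, a), (a, y, c, d)} = dedge_set {(a, b, c, d)} \<union> both_ways a c x y"
      by (auto simp: dedge_set_def both_ways_def)
    show "f = f'" if "f \<in> {(a, b, c, x), (x, c, y, a), (a, y, c, d)}" "f' \<in> {(a, b, c, x), (x, c, y, a), (a, y, c, d)}"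
      "e \<in> dedges f" "e \<in> dedges f'" for f f' e
      using that dis by auto
    show "(q, p) \<in> both_ways a c x y" if "(p, q) \<in> both_ways a c x y" for p q using that by (auto simp: both_ways_def)
  qed (use dis fF in auto)
qed

lemma join_replacement:
  assumes surf: "quad_surface F" and MF: "(x, a, y, c) \<in> F" and NF: "(e, v, e', u) \<in> F" and MN: "(x, a, y, c) \<noteq> (e, v, e', u)"
    and fresh: "\<And>p q. p \<in> {x, y} \<Longrightarrow> q \<in> {e, e'} \<Longrightarrow> p \<noteq> q"
      "\<And>p q. p \<in> {x, y} \<Longrightarrow> q \<in> {e, e'} \<Longrightarrow> (p, q) \<notin> dedge_set F \<and> (q, p) \<notin> dedge_set F"
  shows "replacement F {(x, a, y, c), (e, v, e', u)} {(x, a, y, e), (e, y, e', u), (x, e', y, c), (e, v, e', x)} (both_ways x y e e')"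
    (is "replacement F ?D {?T1, ?T2, ?T3, ?T4} ?X")
proof -
  note S = quad_surfaceD[OF surf]
  have dis: "distinct [x, a, y, c]" "distinct [e, v, e', u]" using S(2)[OF MF] S(2)[OF NF] by simp_all
  have ne: "x \<noteq> e" "x \<noteq> e'" "y \<noteq> e" "y \<noteq> e'" using fresh(1)[of x e] fresh(1)[of x e'] fresh(1)[of y e] fresh(1)[of y e'] by simp_all
  have X: "?X \<inter> dedge_set F = {}" using fresh(2)[of x e] fresh(2)[of x e'] fresh(2)[of y e] fresh(2)[of y e'] by (auto simp: both_ways_def)
  have nd: "(p, q) \<notin> dedges (x, a, y, c)" "(p, q) \<notin> dedges (e, v, e', u)" if "(p, q) \<in> ?X" for p q
    using that X MF NF by (auto simp: dedge_set_def simp del: dedges.simps)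
  have dj: "q \<notin> dedges (e, v, e', u)" if "q \<in> dedges (x, a, y, c)" for q
    using S(3)[OF MF NF that] MN by blast
  \<comment> \<open>For instance, \<open>a = e\<close> would turn the old edge from \<open>x\<close>
    to \<open>a\<close> into an edge from \<open>x\<close> to \<open>e\<close>, which is
    excluded.\<close>
  have ae: "a \<noteq> e" "a \<noteq> e'" "c \<noteq> e" "c \<noteq> e'" "v \<noteq> x" "v \<noteq> y" "u \<noteq> x" "u \<noteq> y"
    using nd[of x e] nd[of x e'] nd[of e x] nd[of e' x] nd[of e y] nd[of e' y] by (auto simp: both_ways_def)
  have dj': "(x, a) \<notin> dedges (e, v, e', u)" "(a, y) \<notin> dedges (e, v, e', u)" "(y, c) \<notin> dedges (e, v, e', u)" "(c, x) \<notin> dedges (e, v, e', u)"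
    using dj by auto
  have conn: "P f'" if N: "f \<in> {?T1, ?T2, ?T3, ?T4}" "P f" and cl: "\<And>f f'. f \<in> {?T1, ?T2, ?T3, ?T4} \<Longrightarrow> f' \<in> {?T1, ?T2, ?T3, ?T4} \<Longrightarrow> adjacent f f' \<Longrightarrow> P f \<Longrightarrow> P f'"
    and N': "f' \<in> {?T1, ?T2, ?T3, ?T4}" for P f f'
  proof -
    have adj: "adjacent ?T1 ?T2" "adjacent ?T2 ?T3" "adjacent ?T3 ?T4" by (auto simp: adjacent_def)
    note adj = adj adj[THEN adjacent_sym]
    have "P ?T4 \<Longrightarrow> P ?T3" "P ?T3 \<Longrightarrow> P ?T2" "P ?T2 \<Longrightarrow> P ?T1" "P ?T1 \<Longrightarrow> P ?T2" "P ?T2 \<Longrightarrow> P ?T3" "P ?T3 \<Longrightarrow> P ?T4"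
      using cl[OF _ _ adj(1)] cl[OF _ _ adj(2)] cl[OF _ _ adj(3)] cl[OF _ _ adj(4)] cl[OF _ _ adj(5)] cl[OF _ _ adj(6)] by blast+
    then show ?thesis using N N' by blast
  qed
  show ?thesis
  proof (rule replacementI[OF _ _ _ _ _ X])
    show "P f'" if "f \<in> {?T1, ?T2, ?T3, ?T4}" "P f" "\<And>h h'. h \<in> {?T1, ?T2, ?T3, ?T4} \<Longrightarrow> h' \<in> {?T1, ?T2, ?T3, ?T4} \<Longrightarrow> adjacent h h' \<Longrightarrow> P h \<Longrightarrow> P h'" "f' \<in> {?T1, ?T2, ?T3, ?T4}" for P f f'
      by (rule conn[where P = P, OF that(1,2) _ that(4)]) (rule that(3))
    show "dedge_set {?T1, ?T2, ?T3, ?T4} = dedge_set ?D \<union> ?X"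
      by (auto simp: dedge_set_def both_ways_def)
    show "f = f'" if "f \<in> {?T1, ?T2, ?T3, ?T4}" "f' \<in> {?T1, ?T2, ?T3, ?T4}" "q \<in> dedges f" "q \<in> dedges f'" for f f' q
      using that dis ne ae dj' by auto
    show "(q, p) \<in> ?X" if "(p, q) \<in> ?X" for p q using that by (auto simp: both_ways_def)
    show "distinct_quad f" if "f \<in> {?T1, ?T2, ?T3, ?T4}" for f using that dis ne ae by auto
  qed (use MF NF in auto)
qed

section \<open>Pinned drawings under subdivision\<close>

text \<open>The invariant for growing handles: whichever two faces are to be joined later, they can
  be brought to the pins.\<close>

definition all_pinned :: "nat \<Rightarrow> quad set \<Rightarrow> bool" where
  "all_pinned g F \<longleftrightarrow> (\<forall>k\<in>F. \<forall>k'\<in>F. k \<noteq> k' \<longrightarrow> (\<exists>H. pinned g F k k' H))"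

text \<open>Splitting a face without a pin leaves both pinned germs untouched, and they can be
  carried on afterwards. This takes three faces, so a third face has to be kept in stock wherever
  the lemma is applied.\<close>

lemma pinned_split:
  assumes surf: "quad_surface F" and f: "(a, b, c, d) \<in> F" and fresh: "x \<notin> quad_vertices F" "y \<notin> quad_vertices F" "x \<noteq> y"
    and k: "k \<in> F" "k' \<in> F" "k \<noteq> k'" "k \<noteq> (a, b, c, d)" "k' \<noteq> (a, b, c, d)" and pin: "pinned g F k k' H"
  shows "all_pinned g (split_face F (a, b, c, d) x y)"
proof -
  interpret face_split "genus_surface g" F H a b c d x y
    by unfold_locales (use pin surf f fresh in \<open>auto simp: pinned_def\<close>)
  have surf': "quad_surface (split_face F (a, b, c, d) x y)"
    using quad_surface_replace[OF surf split_replacement[OF surf f fresh]] by (simp add: split_face_def)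
  have old: "H' h = H h" "h \<in> split_face F (a, b, c, d) x y" if "h \<in> F" "h \<noteq> (a, b, c, d)" for h
  proof -
    have "h \<noteq> l" "h \<noteq> m" "h \<noteq> r" using that new_not_in by metis+
    then show "H' h = H h" unfolding H'_def by (simp only: if_False)
    show "h \<in> split_face F (a, b, c, d) x y" using that by (simp add: split_face_def)
  qed
  have "pinned g (split_face F (a, b, c, d) x y) k k' H'"
    using drawing_split pin old(1)[OF k(1,4)] old(1)[OF k(2,5)] by (simp add: pinned_def)
  then show ?thesis unfolding all_pinned_def
    using pinned_relocate[OF surf' _ old(2)[OF k(1,4)] old(2)[OF k(2,5)] k(3)] by blast
qed

lemma base_surface: "quad_surface base_faces"
proof -
  have "adjacent (0, 2, 1, 3) (2, 0, 3, 1)" by (auto simp: adjacent_def)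
  then show ?thesis
    unfolding quad_surface_def base_faces_def using adjacent_sym by (auto; blast)
qed

lemma base_vertices: "quad_vertices base_faces = {..<4}"
  by (auto simp: quad_vertices_def base_faces_def)

text \<open>With only two faces, none is free of a pin. Therefore the right wall is brought into the
  face that is not split, and both pins are found inside this face.\<close>

lemma pinned_split_base:
  assumes "x \<ge> 4" "y \<ge> 4" "x \<noteq> y"
  shows "all_pinned 0 (split_face base_faces (0, 2, 1, 3) x y)"
proof -
  let ?f = "(0, 2, 1, 3) :: quad" and ?f' = "(2, 0, 3, 1) :: quad"
  have F: "?f \<in> base_faces" "?f' \<in> base_faces" "?f \<noteq> ?f'" by (simp_all add: base_faces_def)
  have fr: "x \<notin> quad_vertices base_faces" "y \<notin> quad_vertices base_faces" using assms by (auto simp: base_vertices)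
  \<comment> \<open>The swap puts the germ covering the right wall into the second face.\<close>
  obtain H where H: "drawing (genus_surface 0) base_faces H" "\<And>h z. h \<in> base_faces \<Longrightarrow> z \<in> diamond (1/2) \<Longrightarrow> H (swp ?f ?f' h) z = base_map h z"
    using realisable_swp[OF base_surface F(1,2)] base_drawing unfolding realisable_def by blast
  have Hf': "H ?f' z = half_box z" if "z \<in> diamond (1/2)" for z
    using H(2)[OF F(1) that] by (simp add: swp_def base_map_def)
  interpret face_split "genus_surface 0" base_faces H 0 2 1 3 x y
    by unfold_locales (use H base_surface F fr assms in auto)
  let ?F = "split_face base_faces ?f x y"
  have surf': "quad_surface ?F"
    using quad_surface_replace[OF base_surface split_replacement[OF base_surface F(1) fr assms(3)]] by (simp add: split_face_def)
  have f'F: "?f' \<in> ?F" using F by (simp add: split_face_def)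
  have H'f': "H' ?f' = H ?f'"
  proof -
    have "?f' \<noteq> l" "?f' \<noteq> m" "?f' \<noteq> r" using F(2) new_not_in by metis+
    then show "H' ?f' = H ?f'" unfolding H'_def by (simp only: if_False)
  qed
  have patch: "H' ?f' z = (1, 3/2 + 3 * (Re z + Im z), 1/2 + (Im z - Re z))" if "\<bar>Re z + Im z\<bar> \<le> 1/2" "\<bar>Re z - Im z\<bar> \<le> 1/2" for z
  proof -
    have nd: "nd z \<le> 1/2" using that by (simp only: nd_le_iff)
    then have "max (nd z) (1/2) = 1/2" by simp
    then have "half_box z = (1, 3/2 + 3 * (Re z + Im z), 1/2 + (Im z - Re z))" by (simp add: half_box_alt)
    then show ?thesis using Hf'[of z] nd unfolding H'f' by (simp add: mem_diamond)
  qed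
  \<comment> \<open>Solving \<open>patch\<close> for the pins scales the sum of the coordinates by
    \<open>1/24\<close> and their difference by \<open>1/8\<close>, which means a complex-linear
    coefficient \<open>1/12\<close> and a conjugate-linear coefficient
    \<open>- \<i> / 24\<close>.\<close>
  define C where "C = Complex 0 (- 1/24)"
  have C: "cmod C < Re (1/12)" by (simp add: C_def complex_norm)
  define \<alpha> where "\<alpha> z = Complex (- 11/192) (- 53/192) + 1/12 * z + C * cnj z" for z
  define \<beta> where "\<beta> z = Complex (53/192) (11/192) - (1/12 * z + C * cnj z)" for z
  have \<alpha>: "Re (\<alpha> z) + Im (\<alpha> z) = - 1/3 + (Re z + Im z) / 24" "Im (\<alpha> z) - Re (\<alpha> z) = - 7/32 + (Im z - Re z) / 8" for z
    by (simp_all add: \<alpha>_def C_def field_simps)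
  have \<beta>: "Re (\<beta> z) + Im (\<beta> z) = 1/3 - (Re z + Im z) / 24" "Im (\<beta> z) - Re (\<beta> z) = - 7/32 - (Im z - Re z) / 8" for z
    by (simp_all add: \<beta>_def C_def field_simps)
  have b: "\<bar>(Im z - Re z) / 8\<bar> \<le> 1/16" "\<bar>(Re z + Im z) / 24\<bar> \<le> 1/48" if "z \<in> diamond (1/2)" for z
  proof -
    have "\<bar>Re z - Im z\<bar> \<le> 1/2" "\<bar>Re z + Im z\<bar> \<le> 1/2" using that by (simp_all only: mem_diamond nd_le_iff)
    then show "\<bar>(Im z - Re z) / 8\<bar> \<le> 1/16" "\<bar>(Re z + Im z) / 24\<bar> \<le> 1/48" by (simp_all add: abs_minus_commute)
  qed
  have in\<alpha>: "\<bar>Re (\<alpha> z) + Im (\<alpha> z)\<bar> \<le> 1/2 \<and> \<bar>Re (\<alpha> z) - Im (\<alpha> z)\<bar> \<le> 1/2 \<and> Re (\<alpha> z) + Im (\<alpha> z) < 0" if "z \<in> diamond (1/2)" for z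
    using b[OF that] \<alpha>[of z] by linarith
  have in\<beta>: "\<bar>Re (\<beta> z) + Im (\<beta> z)\<bar> \<le> 1/2 \<and> \<bar>Re (\<beta> z) - Im (\<beta> z)\<bar> \<le> 1/2 \<and> 0 < Re (\<beta> z) + Im (\<beta> z)" if "z \<in> diamond (1/2)" for z
    using b[OF that] \<beta>[of z] by linarith
  have lt: "nd w < 1" if "\<bar>Re w + Im w\<bar> \<le> 1/2" "\<bar>Re w - Im w\<bar> \<le> 1/2" for w
    unfolding nd_less_iff using that by linarith
  have H\<alpha>: "H' ?f' (\<alpha> z) = pin_low 0 z" if z: "z \<in> diamond (1/2)" for z
  proof -
    have "H' ?f' (\<alpha> z) = (1, 3/2 + 3 * (Re (\<alpha> z) + Im (\<alpha> z)), 1/2 + (Im (\<alpha> z) - Re (\<alpha> z)))"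
      by (rule patch) (use in\<alpha>[OF z] in blast)+
    then show ?thesis unfolding \<alpha> by (simp add: pin_low_def field_simps)
  qed
  have H\<beta>: "H' ?f' (\<beta> z) = pin_high 0 z" if z: "z \<in> diamond (1/2)" for z
  proof -
    have "H' ?f' (\<beta> z) = (1, 3/2 + 3 * (Re (\<beta> z) + Im (\<beta> z)), 1/2 + (Im (\<beta> z) - Re (\<beta> z)))"
      by (rule patch) (use in\<beta>[OF z] in blast)+
    then show ?thesis unfolding \<beta> by (simp add: pin_high_def field_simps)
  qed
  show ?thesis unfolding all_pinned_def
  proof (intro ballI impI)
    fix k k' assume k: "k \<in> ?F" "k' \<in> ?F" "k \<noteq> k'"
    show "\<exists>H. pinned 0 ?F k k' H"
      by (rule pinned_from_germs[OF surf' drawing_split f'F \<alpha>_def C \<beta>_def C _ _ H\<alpha> H\<beta> k])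
        (use in\<alpha> in\<beta> lt in blast)+
  qed
qed

lemma pinned_join:
  assumes surf: "quad_surface F" and MF: "(x, a, y, c) \<in> F" and NF: "(e, v, e', u) \<in> F" and MN: "(x, a, y, c) \<noteq> (e, v, e', u)"
    and fresh: "\<And>p q. p \<in> {x, y} \<Longrightarrow> q \<in> {e, e'} \<Longrightarrow> p \<noteq> q"
      "\<And>p q. p \<in> {x, y} \<Longrightarrow> q \<in> {e, e'} \<Longrightarrow> (p, q) \<notin> dedge_set F \<and> (q, p) \<notin> dedge_set F"
    and pin: "all_pinned g F"
  shows "all_pinned (Suc g) (join_faces F (x, a, y, c) (e, v, e', u))"
proof -
  obtain H where H: "pinned g F (x, a, y, c) (e, v, e', u) H" using pin[unfolded all_pinned_def, rule_format, OF MF NF MN] by blast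
  have "quad_surface (join_faces F (x, a, y, c) (e, v, e', u))"
    using quad_surface_replace[OF surf join_replacement[OF surf MF NF MN fresh]] by (simp add: join_faces_def)
  moreover have "(p, q) \<notin> dedges f \<and> (q, p) \<notin> dedges f" if "p \<in> {x, y}" "q \<in> {e, e'}" "f \<in> F" for p q f
    using fresh(2)[OF that(1,2)] that(3) by (auto simp: dedge_set_def)
  ultimately show ?thesis unfolding all_pinned_def
    using drawing_join_genus[OF surf MF NF MN fresh(1) _ H] by blast
qed

section \<open>From drawings to quadrangulations\<close>

definition edge_weight :: "nat \<Rightarrow> nat \<Rightarrow> real \<Rightarrow> nat \<Rightarrow> real" where
  "edge_weight a b t n = (if n = a then 1 - t else 0) + (if n = b then t else 0)"

definition undirected_edges :: "quad set \<Rightarrow> nat set set" where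
  "undirected_edges F = (\<lambda>(a, b). {a, b}) ` dedge_set F"

text \<open>Each ray is rescaled so that the Euclidean norm becomes \<open>nd\<close>. This passes
  from the round disc in the notion of a quadrilateral to the diamond.\<close>

definition radial :: "complex \<Rightarrow> complex" where
  "radial z = of_real (norm z / nd z) * z"

lemma nd_eq_0: "nd z = 0 \<longleftrightarrow> z = 0"
  by (auto simp: nd_def complex_eq_iff)

lemma nd_of_real_mult: "nd (of_real t * z) = \<bar>t\<bar> * nd z"
  by (simp add: nd_def abs_mult algebra_simps)

lemma nd_radial: "nd (radial z) = norm z"
  using nd_nonneg[of z] by (cases "z = 0") (simp_all add: radial_def nd_of_real_mult nd_eq_0 abs_divide del: of_real_divide)

lemma norm_radial: "norm (radial z) = norm z / nd z * norm z"
  by (simp only: radial_def norm_mult norm_of_real abs_of_nonneg[OF divide_nonneg_nonneg[OF norm_ge_zero nd_nonneg]])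

lemma continuous_radial: "continuous_on A radial"
proof -
  have "isCont radial z" for z
  proof (cases "z = 0")
    case True
    \<comment> \<open>At the origin the defining quotient degenerates; continuity there rests on
      \<open>norm w \<le> nd w\<close>, which bounds the map by the norm.\<close>
    have "norm (radial w) \<le> norm w" for w
    proof -
      have "norm w \<le> nd w" using cmod_le[of w] by (simp add: nd_def)
      from divide_right_mono[OF this nd_nonneg[of w]] have "norm w / nd w \<le> 1"
        by (rule order_trans) (cases "nd w = 0", simp_all)
      then have "norm w / nd w * norm w \<le> 1 * norm w" by (intro mult_right_mono) auto
      then show ?thesis by (simp only: norm_radial mult_1)
    qed
    then have "(radial \<longlongrightarrow> 0) (at 0)"
      by (intro Lim_null_comparison[of radial norm]) (auto intro!: tendsto_norm_zero)
    then show ?thesis using True by (simp add: isCont_def radial_def)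
  next
    case False
    have "isCont nd z" using continuous_on_nd[of UNIV] by (simp add: continuous_on_eq_continuous_at)
    then show ?thesis unfolding radial_def using False by (intro continuous_intros) (auto simp: nd_eq_0)
  qed
  then show ?thesis by (simp add: continuous_at_imp_continuous_on)
qed

lemma inj_radial: "inj_on radial A"
proof (rule inj_onI)
  fix z w assume eq: "radial z = radial w"
  then have n: "norm z = norm w" by (metis nd_radial)
  show "z = w"
  proof (cases "z = 0")
    case True then show ?thesis using n by simp
  next
    case False
    moreover have "w \<noteq> 0" using n False by auto
    moreover have "0 < nd x" if "x \<noteq> 0" for x using that nd_nonneg[of x] nd_eq_0[of x] by linarith
    ultimately have pos: "norm z / nd z > 0" "norm w / nd w > 0" by (intro divide_pos_pos; simp)+
    have "norm z / nd z * norm z = norm w / nd w * norm w"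
      using arg_cong[OF eq, of norm] by (simp only: norm_radial)
    then have "norm z / nd z = norm w / nd w" using n False by simp
    then have "of_real (norm z / nd z) * z = of_real (norm z / nd z) * w" using eq by (simp add: radial_def)
    moreover have "of_real (norm z / nd z) \<noteq> (0 :: complex)" using pos by (auto simp only: of_real_eq_0_iff)
    ultimately show ?thesis by (simp del: of_real_divide)
  qed
qed

lemma surj_radial: "\<exists>z. w = radial z"
proof (cases "w = 0")
  case True then show ?thesis by (intro exI[of _ 0]) (simp add: radial_def)
next
  case False
  define z where "z = of_real (nd w / norm w) * w"
  have nz: "nd w > 0" using False nd_nonneg[of w] by (simp add: less_le nd_eq_0)
  have "norm z = nd w" using False nz by (simp add: z_def norm_mult norm_divide)
  moreover have "nd z = nd w / norm w * nd w" using nz by (simp add: z_def nd_of_real_mult del: of_real_divide)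
  ultimately have "norm z / nd z = nd w / (nd w / norm w * nd w)" by simp
  also have "\<dots> = norm w / nd w" using nz False by (simp add: field_simps)
  finally have "radial z = of_real (norm w / nd w) * of_real (nd w / norm w) * w" by (simp only: radial_def z_def mult.assoc)
  also have "of_real (norm w / nd w) * of_real (nd w / norm w) = (1 :: complex)"
    unfolding of_real_mult[symmetric] using nz False by simp
  finally show ?thesis by (metis mult_1)
qed

lemma radial_image: "radial ` {z. Q (norm z)} = {z. Q (nd z)}"
  using surj_radial nd_radial by (auto simp: image_iff) metis

lemma closure_open_diamond: "diamond 1 \<subseteq> closure {z. nd z < 1}"
proof
  fix z assume "z \<in> diamond 1"
  then have z: "nd z \<le> 1" by (simp add: mem_diamond)
  have "of_real (1 - 1 / real (Suc n)) * z \<in> {z. nd z < 1}" for n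
  proof -
    have "\<bar>1 - 1 / real (Suc n)\<bar> < 1" by (auto simp: abs_if)
    then show ?thesis unfolding mem_Collect_eq nd_of_real_mult
      by (rule le_less_trans[OF mult_left_le[OF z abs_ge_zero]])
  qed
  moreover have "(\<lambda>n. of_real (1 - 1 / real (Suc n)) * z) \<longlonglongrightarrow> of_real (1 - 0) * z"
    by (intro tendsto_intros) (rule LIMSEQ_Suc, rule lim_1_over_n)
  ultimately show "z \<in> closure {z. nd z < 1}" unfolding closure_sequential
    by (intro exI[of _ "\<lambda>n. of_real (1 - 1 / real (Suc n)) * z"]) auto
qed

lemma chromatic_number_le: "proper_colouring X adj n c \<Longrightarrow> chromatic_number X adj \<le> n"
  unfolding chromatic_number_def by (rule Least_le) blast

text \<open>In a Hausdorff space the faces, being compact, are closed; this identifies closures and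
  components.\<close>

locale drawn_surface =
  fixes S :: "'a::t2_space set" and F H
  assumes dr: "drawing S F H" and surf: "quad_surface F"
begin

abbreviation "V \<equiv> quad_vertices F"
abbreviation "E \<equiv> undirected_edges F"

text \<open>The point of the surface with given boundary weights. By the labels of a drawing it is
  the same in every face where the weights occur, so vertices and edges can be defined without
  choosing a face.\<close>

definition bpoint :: "(nat \<Rightarrow> real) \<Rightarrow> 'a" where
  "bpoint B = (SOME s. \<exists>f\<in>F. \<exists>w. nd w = 1 \<and> bweight f w = B \<and> s = H f w)"

definition \<phi> :: "nat \<Rightarrow> 'a" where "\<phi> n = bpoint (\<lambda>m. if m = n then 1 else 0)"

text \<open>Edges are unordered pairs; the order of the natural numbers decides where the
  parametrisation starts.\<close>

definition \<gamma> :: "nat set \<Rightarrow> real \<Rightarrow> 'a" where "\<gamma> e t = bpoint (edge_weight (Min e) (Max e) t)"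

definition inner :: "quad \<Rightarrow> 'a set" where "inner f = H f ` {z. nd z < 1}"

lemma bpoint_eq: assumes "f \<in> F" "nd w = 1" shows "bpoint (bweight f w) = H f w"
proof -
  have "\<exists>s. \<exists>f'\<in>F. \<exists>w'. nd w' = 1 \<and> bweight f' w' = bweight f w \<and> s = H f' w'" using assms by blast
  from someI_ex[OF this] obtain f' w' where *: "f' \<in> F" "nd w' = 1" "bweight f' w' = bweight f w" "bpoint (bweight f w) = H f' w'"
    unfolding bpoint_def by blast
  then show ?thesis using drawing_eq_iff[OF dr *(1) assms(1), of w' w] assms(2) by simp
qed

lemma edge_face:
  assumes "(a, b) \<in> dedge_set F"
  shows "\<exists>f m. f \<in> F \<and> (a, b) \<in> dedges f \<and>
    (\<forall>t. 0 \<le> t \<longrightarrow> t \<le> 1 \<longrightarrow> nd (\<i> ^ m * Complex (1 - t) t) = 1 \<and> bweight f (\<i> ^ m * Complex (1 - t) t) = edge_weight a b t)"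
proof -
  obtain f where f: "f \<in> F" "(a, b) \<in> dedges f" using assms by (auto simp: dedge_set_def)
  obtain m c d where m: "(rotq ^^ m) f = (a, b, c, d)" using dedge_rotE[OF f(2)] .
  have "nd (\<i> ^ m * Complex (1 - t) t) = 1 \<and> bweight f (\<i> ^ m * Complex (1 - t) t) = edge_weight a b t" if "0 \<le> t" "t \<le> 1" for t
  proof -
    have "bweight f (\<i> ^ m * Complex (1 - t) t) = bweight (a, b, c, d) (Complex (1 - t) t)"
      using bweight_rot_pow[of m f "Complex (1 - t) t"] m by simp
    also have "\<dots> = edge_weight a b t"
    proof
      fix n
      have "max 0 (1 - t) = 1 - t" "max 0 t = t" "max 0 (- (1 - t)) = 0" "max 0 (- t) = 0" using that by auto
      then show "bweight (a, b, c, d) (Complex (1 - t) t) n = edge_weight a b t n" by (simp add: edge_weight_def)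
    qed
    moreover have "nd (\<i> ^ m * Complex (1 - t) t) = 1" unfolding nd_rot(2) using that by (simp add: nd_def)
    ultimately show ?thesis by simp
  qed
  then show ?thesis using f by blast
qed

lemma bpoint_inj:
  assumes "f \<in> F" "nd w = 1" "f' \<in> F" "nd w' = 1" "bpoint (bweight f w) = bpoint (bweight f' w')"
  shows "bweight f w = bweight f' w'"
  using assms drawing_eq_iff[OF dr assms(1,3), of w w'] by (simp add: bpoint_eq)

lemma dedge_sym: "(a, b) \<in> dedge_set F \<Longrightarrow> (b, a) \<in> dedge_set F"
  using quad_surfaceD(4)[OF surf] by (auto simp: dedge_set_def)

lemma dedge_ne:
  assumes "(a, b) \<in> dedge_set F" shows "a \<noteq> b"
proof -
  obtain f where f: "f \<in> F" "(a, b) \<in> dedges f" using assms by (auto simp: dedge_set_def)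
  obtain p q r u where pq: "f = (p, q, r, u)" by (cases f) auto
  show ?thesis using quad_surfaceD(2)[OF surf f(1)] f(2) unfolding pq by auto
qed

lemma edge_weight_inj:
  assumes "(a, b) \<in> dedge_set F" "(a', b') \<in> dedge_set F" "0 \<le> t" "t \<le> 1" "0 \<le> t'" "t' \<le> 1"
    "bpoint (edge_weight a b t) = bpoint (edge_weight a' b' t')"
  shows "edge_weight a b t = edge_weight a' b' t'"
proof -
  obtain f m where f: "f \<in> F" "nd (\<i> ^ m * Complex (1 - t) t) = 1" "bweight f (\<i> ^ m * Complex (1 - t) t) = edge_weight a b t"
    using edge_face[OF assms(1)] assms(3,4) by blast
  obtain f' m' where f': "f' \<in> F" "nd (\<i> ^ m' * Complex (1 - t') t') = 1" "bweight f' (\<i> ^ m' * Complex (1 - t') t') = edge_weight a' b' t'"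
    using edge_face[OF assms(2)] assms(5,6) by blast
  show ?thesis using bpoint_inj[OF f(1,2) f'(1,2)] f(3) f'(3) assms(7) by simp
qed

lemma edge_weight_swap: "edge_weight b a t = edge_weight a b (1 - t)"
  by (rule ext) (simp add: edge_weight_def)

lemma edge_weight_ends: "a \<noteq> b \<Longrightarrow> edge_weight a b 0 = (\<lambda>m. if m = a then 1 else 0)" "a \<noteq> b \<Longrightarrow> edge_weight a b 1 = (\<lambda>m. if m = b then 1 else 0)"
  by (rule ext, simp add: edge_weight_def)+

lemma E_E:
  assumes "e \<in> E"
  shows "\<exists>a b. e = {a, b} \<and> a \<noteq> b \<and> (a, b) \<in> dedge_set F \<and> (b, a) \<in> dedge_set F"
proof -
  obtain p q where pq: "(p, q) \<in> dedge_set F" "e = {p, q}" using assms by (auto simp: undirected_edges_def)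
  then show ?thesis using dedge_ne[OF pq(1)] dedge_sym[OF pq(1)] by blast
qed

lemma E_MinMax:
  assumes "e \<in> E"
  shows "e = {Min e, Max e}" "Min e \<noteq> Max e" "(Min e, Max e) \<in> dedge_set F"
proof -
  obtain p q where pq: "e = {p, q}" "p \<noteq> q" "(p, q) \<in> dedge_set F" "(q, p) \<in> dedge_set F" using E_E[OF assms] by blast
  have "Min e = p \<and> Max e = q \<or> Min e = q \<and> Max e = p" unfolding pq(1) by (auto simp: min_def max_def)
  then show "e = {Min e, Max e}" "Min e \<noteq> Max e" "(Min e, Max e) \<in> dedge_set F" using pq by auto
qed

lemma image_\<gamma>:
  assumes "(a, b) \<in> dedge_set F"
  shows "path_image (\<gamma> {a, b}) = (\<lambda>t. bpoint (edge_weight a b t)) ` {0..1}"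
proof -
  have e: "{a, b} \<in> E" using assms by (force simp: undirected_edges_def)
  define p q where pq: "p = Min {a, b}" "q = Max {a, b}"
  have "path_image (\<gamma> {a, b}) = (\<lambda>t. bpoint (edge_weight p q t)) ` {0..1}"
    unfolding path_image_def \<gamma>_def[abs_def] pq ..
  moreover have "p = a \<and> q = b \<or> p = b \<and> q = a" unfolding pq by (auto simp: min_def max_def)
  moreover have "(\<lambda>t. bpoint (edge_weight b a t)) ` {0..1} = (\<lambda>t. bpoint (edge_weight a b t)) ` {0..1}"
  proof -
    have "(\<lambda>t. bpoint (edge_weight b a t)) ` {0..1} = (\<lambda>t. bpoint (edge_weight a b t)) ` ((\<lambda>t. 1 - t) ` {0..1})"
      unfolding image_image edge_weight_swap[of b a] ..
    also have "(\<lambda>t. 1 - t) ` {0..1} = {0..1::real}" by (auto intro!: image_eqI[of _ _ "1 - x" for x])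
    finally show ?thesis .
  qed
  ultimately show ?thesis by auto
qed

lemma \<phi>_face:
  assumes "n \<in> V" shows "\<exists>f w. f \<in> F \<and> nd w = 1 \<and> bweight f w = (\<lambda>m. if m = n then 1 else 0) \<and> \<phi> n = H f w"
proof -
  obtain b where b: "(n, b) \<in> dedge_set F" using assms by (auto simp: quad_vertices_dedge_set)
  obtain f m where f: "f \<in> F" and fm: "\<And>t. 0 \<le> t \<Longrightarrow> t \<le> 1 \<Longrightarrow> nd (\<i> ^ m * Complex (1 - t) t) = 1 \<and> bweight f (\<i> ^ m * Complex (1 - t) t) = edge_weight n b t"
    using edge_face[OF b] by blast
  define w where "w = \<i> ^ m * Complex (1 - 0) 0"
  have w: "nd w = 1" "bweight f w = (\<lambda>m. if m = n then 1 else 0)"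
    using fm[of 0] edge_weight_ends(1)[OF dedge_ne[OF b]] unfolding w_def by (simp_all del: diff_zero)
  have "\<phi> n = H f w" using bpoint_eq[OF f w(1)] unfolding w(2) \<phi>_def .
  then show ?thesis using f w by blast
qed

lemma inj_\<phi>: "inj_on \<phi> V"
proof (rule inj_onI)
  fix n n' assume n: "n \<in> V" "n' \<in> V" and eq: "\<phi> n = \<phi> n'"
  obtain f w where f: "f \<in> F" "nd w = 1" "bweight f w = (\<lambda>m. if m = n then 1 else 0)" using \<phi>_face[OF n(1)] by blast
  obtain f' w' where f': "f' \<in> F" "nd w' = 1" "bweight f' w' = (\<lambda>m. if m = n' then 1 else 0)" using \<phi>_face[OF n(2)] by blast
  have "bweight f w = bweight f' w'" using bpoint_inj[OF f(1,2) f'(1,2)] eq f(3) f'(3) by (simp add: \<phi>_def)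
  then show "n = n'" using f(3) f'(3) by (metis zero_neq_one)
qed

lemma \<phi>_on_edge:
  assumes "(a, b) \<in> dedge_set F" "n \<in> V" "0 \<le> t" "t \<le> 1" "bpoint (edge_weight a b t) = \<phi> n"
  shows "n \<in> {a, b} \<and> edge_weight a b t = (\<lambda>m. if m = n then 1 else 0)"
proof -
  obtain c where c: "(n, c) \<in> dedge_set F" using assms(2) by (auto simp: quad_vertices_dedge_set)
  have "bpoint (edge_weight a b t) = bpoint (edge_weight n c 0)"
    using assms(5) edge_weight_ends(1)[OF dedge_ne[OF c]] by (simp add: \<phi>_def)
  from edge_weight_inj[OF assms(1) c assms(3,4) _ _ this] have eq: "edge_weight a b t = (\<lambda>m. if m = n then 1 else 0)"
    using edge_weight_ends(1)[OF dedge_ne[OF c]] by simp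
  then have "edge_weight a b t n = 1" by simp
  then have "n \<in> {a, b}" by (auto simp: edge_weight_def split: if_splits)
  then show ?thesis using eq by simp
qed

lemma \<phi>_ends:
  assumes "(a, b) \<in> dedge_set F"
  shows "bpoint (edge_weight a b 0) = \<phi> a" "bpoint (edge_weight a b 1) = \<phi> b"
  using edge_weight_ends[OF dedge_ne[OF assms]] by (simp_all add: \<phi>_def)

lemma edge_in_V: "e \<in> E \<Longrightarrow> e \<subseteq> V"
  using dedge_set_vertices[of _ _ F] by (auto simp: undirected_edges_def)

lemma arc_\<gamma>:
  assumes "e \<in> E"
  shows "arc (\<gamma> e)" "path_image (\<gamma> e) \<subseteq> S" "{pathstart (\<gamma> e), pathfinish (\<gamma> e)} = \<phi> ` e" "path_image (\<gamma> e) \<inter> \<phi> ` V = \<phi> ` e"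
proof -
  define a b where m: "a = Min e" "b = Max e"
  have ab: "e = {a, b}" "a \<noteq> b" "(a, b) \<in> dedge_set F" unfolding m using E_MinMax[OF assms] .
  have \<gamma>: "\<gamma> e t = bpoint (edge_weight a b t)" for t by (simp add: \<gamma>_def m)
  obtain f m where f: "f \<in> F" and fm: "\<And>t. 0 \<le> t \<Longrightarrow> t \<le> 1 \<Longrightarrow> nd (\<i> ^ m * Complex (1 - t) t) = 1 \<and> bweight f (\<i> ^ m * Complex (1 - t) t) = edge_weight a b t"
    using edge_face[OF ab(3)] by blast
  have \<gamma>H: "\<gamma> e t = H f (\<i> ^ m * Complex (1 - t) t)" if "t \<in> {0..1}" for t
    using bpoint_eq[OF f, of "\<i> ^ m * Complex (1 - t) t"] fm[of t] that by (simp add: \<gamma>)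
  have "continuous_on {0..1} (\<gamma> e)"
  proof (rule continuous_on_eq)
    have "continuous_on (diamond 1) (H f)" using dr f by (auto simp: drawing_def)
    then show "continuous_on {0..1} (\<lambda>t. H f (\<i> ^ m * Complex (1 - t) t))"
      by (rule continuous_on_compose2) (use fm in \<open>auto simp: Complex_eq mem_diamond intro!: continuous_intros\<close>)
  qed (use \<gamma>H in simp)
  moreover have "inj_on (\<gamma> e) {0..1}"
  proof (rule inj_onI)
    fix t t' :: real assume t: "t \<in> {0..1}" "t' \<in> {0..1}" "\<gamma> e t = \<gamma> e t'"
    then have "edge_weight a b t = edge_weight a b t'" using edge_weight_inj[OF ab(3) ab(3), of t t'] by (simp add: \<gamma>)
    from fun_cong[OF this, of b] show "t = t'" using ab(2) by (simp add: edge_weight_def)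
  qed
  ultimately show "arc (\<gamma> e)" by (simp add: arc_def path_def)
  show "path_image (\<gamma> e) \<subseteq> S"
    using \<gamma>H fm drawing_in[OF dr f] by (auto simp: path_image_def)
  have ends: "\<gamma> e 0 = \<phi> a" "\<gamma> e 1 = \<phi> b" using \<phi>_ends[OF ab(3)] by (simp_all add: \<gamma>)
  then show "{pathstart (\<gamma> e), pathfinish (\<gamma> e)} = \<phi> ` e" by (simp add: pathstart_def pathfinish_def ab(1))
  show "path_image (\<gamma> e) \<inter> \<phi> ` V = \<phi> ` e"
  proof
    show "path_image (\<gamma> e) \<inter> \<phi> ` V \<subseteq> \<phi> ` e"
    proof
      fix s assume "s \<in> path_image (\<gamma> e) \<inter> \<phi> ` V"
      then obtain t n where "0 \<le> t" "t \<le> 1" "s = bpoint (edge_weight a b t)" "n \<in> V" "s = \<phi> n"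
        by (auto simp: path_image_def \<gamma>)
      then show "s \<in> \<phi> ` e" using \<phi>_on_edge[OF ab(3), of n t] ab(1) by auto
    qed
    have "\<phi> a \<in> path_image (\<gamma> e)" "\<phi> b \<in> path_image (\<gamma> e)" unfolding path_image_def ends[symmetric] by auto
    then show "\<phi> ` e \<subseteq> path_image (\<gamma> e) \<inter> \<phi> ` V" using edge_in_V[OF assms] by (auto simp: ab(1))
  qed
qed

text \<open>Inside an edge both ends have nonzero weight and hence determine the edge, so distinct
  edges can meet in vertices only.\<close>

lemma edges_meet:
  assumes e: "e \<in> E" "e' \<in> E" "e \<noteq> e'"
  shows "path_image (\<gamma> e) \<inter> path_image (\<gamma> e') = \<phi> ` (e \<inter> e')"
proof
  obtain a b where ab: "e = {a, b}" "a \<noteq> b" "(a, b) \<in> dedge_set F" using E_E[OF e(1)] by blast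
  obtain a' b' where ab': "e' = {a', b'}" "a' \<noteq> b'" "(a', b') \<in> dedge_set F" using E_E[OF e(2)] by blast
  show "path_image (\<gamma> e) \<inter> path_image (\<gamma> e') \<subseteq> \<phi> ` (e \<inter> e')"
  proof
    fix s assume "s \<in> path_image (\<gamma> e) \<inter> path_image (\<gamma> e')"
    then obtain t t' where t: "0 \<le> t" "t \<le> 1" "s = bpoint (edge_weight a b t)" "0 \<le> t'" "t' \<le> 1" "s = bpoint (edge_weight a' b' t')"
      unfolding ab(1) ab'(1) image_\<gamma>[OF ab(3)] image_\<gamma>[OF ab'(3)] by auto
    have eq: "edge_weight a b t = edge_weight a' b' t'" using edge_weight_inj[OF ab(3) ab'(3)] t by simp
    have supp: "n \<in> {a', b'}" if "edge_weight a b t n \<noteq> 0" for n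
      using that unfolding eq by (auto simp: edge_weight_def split: if_splits)
    have w: "edge_weight a b t a = 1 - t" "edge_weight a b t b = t" using ab(2) by (simp_all add: edge_weight_def)
    have "t = 0 \<or> t = 1"
    proof (rule ccontr)
      assume "\<not> (t = 0 \<or> t = 1)"
      then have "a \<in> {a', b'}" "b \<in> {a', b'}" using supp[of a] supp[of b] w by auto
      then have "e = e'" using ab(1,2) ab'(1) by auto
      then show False using e(3) by simp
    qed
    then show "s \<in> \<phi> ` (e \<inter> e')"
    proof
      assume "t = 0"
      then have "a \<in> e \<inter> e'" "s = \<phi> a" using supp[of a] w t(3) \<phi>_ends[OF ab(3)] ab(1) ab'(1) by auto
      then show ?thesis by blast
    next
      assume "t = 1"
      then have "b \<in> e \<inter> e'" "s = \<phi> b" using supp[of b] w t(3) \<phi>_ends[OF ab(3)] ab(1) ab'(1) by auto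
      then show ?thesis by blast
    qed
  qed
  show "\<phi> ` (e \<inter> e') \<subseteq> path_image (\<gamma> e) \<inter> path_image (\<gamma> e')"
    using arc_\<gamma>(4)[OF e(1)] arc_\<gamma>(4)[OF e(2)] by blast
qed

lemma face_boundary:
  assumes f: "f \<in> F"
  shows "H f ` {z. nd z = 1} = (\<Union>(a, b)\<in>dedges f. path_image (\<gamma> {a, b}))"
proof
  show "(\<Union>(a, b)\<in>dedges f. path_image (\<gamma> {a, b})) \<subseteq> H f ` {z. nd z = 1}"
  proof clarify
    fix a b s assume ab: "(a, b) \<in> dedges f" and s: "s \<in> path_image (\<gamma> {a, b})"
    have abF: "(a, b) \<in> dedge_set F" using ab f by (rule dedge_setI)
    obtain t where t: "0 \<le> t" "t \<le> 1" "s = bpoint (edge_weight a b t)" using s unfolding image_\<gamma>[OF abF] by auto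
    obtain f' m where f': "f' \<in> F" "(a, b) \<in> dedges f'" "nd (\<i> ^ m * Complex (1 - t) t) = 1 \<and> bweight f' (\<i> ^ m * Complex (1 - t) t) = edge_weight a b t"
      using edge_face[OF abF] t(1,2) by blast
    have "f' = f" using quad_surfaceD(3)[OF surf f'(1) f f'(2) ab] .
    then show "s \<in> H f ` {z. nd z = 1}" using bpoint_eq[OF f] f'(3) t(3) by (metis (mono_tags, lifting) imageI mem_Collect_eq)
  qed
  show "H f ` {z. nd z = 1} \<subseteq> (\<Union>(a, b)\<in>dedges f. path_image (\<gamma> {a, b}))"
  proof
    fix s assume "s \<in> H f ` {z. nd z = 1}"
    then obtain z where z: "nd z = 1" "s = H f z" by auto
    obtain p q r u where pq: "f = (p, q, r, u)" by (cases f) auto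
    have "\<exists>a b t. (a, b) \<in> dedges f \<and> 0 \<le> t \<and> t \<le> 1 \<and> bweight f z = edge_weight a b t"
    proof -
      have nd: "\<bar>Re z\<bar> + \<bar>Im z\<bar> = 1" using z(1) by (simp add: nd_def)
      consider "0 \<le> Re z" "0 \<le> Im z" | "Re z < 0" "0 \<le> Im z" | "Re z < 0" "Im z < 0" | "0 \<le> Re z" "Im z < 0" by linarith
      then show ?thesis
      proof cases
        case 1
        then have "bweight f z = edge_weight p q (Im z)" using nd
          by (intro ext) (simp add: pq edge_weight_def max_def)
        then show ?thesis using 1 nd by (intro exI[of _ p] exI[of _ q] exI[of _ "Im z"]) (simp add: pq)
      next
        case 2
        then have "bweight f z = edge_weight q r (- Re z)" using nd
          by (intro ext) (simp add: pq edge_weight_def max_def)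
        then show ?thesis using 2 nd by (intro exI[of _ q] exI[of _ r] exI[of _ "- Re z"]) (simp add: pq)
      next
        case 3
        then have "bweight f z = edge_weight r u (- Im z)" using nd
          by (intro ext) (simp add: pq edge_weight_def max_def)
        then show ?thesis using 3 nd by (intro exI[of _ r] exI[of _ u] exI[of _ "- Im z"]) (simp add: pq)
      next
        case 4
        then have "bweight f z = edge_weight u p (Re z)" using nd
          by (intro ext) (simp add: pq edge_weight_def max_def)
        then show ?thesis using 4 nd by (intro exI[of _ u] exI[of _ p] exI[of _ "Re z"]) (simp add: pq)
      qed
    qed
    then obtain a b t where ab: "(a, b) \<in> dedges f" "0 \<le> t" "t \<le> 1" "bweight f z = edge_weight a b t" by blast
    have "s = bpoint (edge_weight a b t)" using bpoint_eq[OF f z(1)] z(2) ab(4) by simp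
    then have "s \<in> path_image (\<gamma> {a, b})" unfolding image_\<gamma>[OF dedge_setI[OF ab(1) f]] using ab(2,3) by auto
    then show "s \<in> (\<Union>(a, b)\<in>dedges f. path_image (\<gamma> {a, b}))" using ab(1) by blast
  qed
qed

lemma embedded: "embedded_graph V E \<phi> \<gamma> = (\<Union>f\<in>F. H f ` {z. nd z = 1})"
proof -
  have "\<phi> ` V \<subseteq> (\<Union>e\<in>E. path_image (\<gamma> e))"
  proof clarify
    fix n assume "n \<in> V"
    then obtain b where b: "(n, b) \<in> dedge_set F" by (auto simp: quad_vertices_dedge_set)
    then have "{n, b} \<in> E" by (force simp: undirected_edges_def)
    then show "\<phi> n \<in> (\<Union>e\<in>E. path_image (\<gamma> e))" using arc_\<gamma>(4)[of "{n, b}"] by blast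
  qed
  then have "embedded_graph V E \<phi> \<gamma> = (\<Union>e\<in>E. path_image (\<gamma> e))" by (auto simp: embedded_graph_def)
  also have "\<dots> = (\<Union>f\<in>F. \<Union>(a, b)\<in>dedges f. path_image (\<gamma> {a, b}))"
    by (auto simp: undirected_edges_def dedge_set_def)
  finally show ?thesis using face_boundary by simp
qed

section \<open>The faces as components of the complement of the graph\<close>

lemma inner_disjoint:
  assumes f: "f \<in> F" "f' \<in> F" and z: "z \<in> diamond 1" "H f' z \<in> inner f" shows "f' = f \<and> nd z < 1"
proof -
  obtain x where x: "nd x < 1" "H f' z = H f x" using z(2) unfolding inner_def by blast
  then have "label f' z = label f x" using drawing_eq_iff[OF dr f(2,1), of z x] z(1) by (simp add: mem_diamond)
  then show ?thesis using x(1) by (auto simp: label_def split: if_splits)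
qed

lemma compact_face: "f \<in> F \<Longrightarrow> compact (H f ` diamond 1)"
  using dr compact_diamond by (auto simp: drawing_def intro!: compact_continuous_image)

lemma inner_ne: "inner f \<noteq> {}"
  by (auto simp: inner_def nd_def intro!: exI[of _ 0])

lemma inner_inj: "f \<in> F \<Longrightarrow> f' \<in> F \<Longrightarrow> inner f = inner f' \<Longrightarrow> f = f'"
proof -
  assume f: "f \<in> F" "f' \<in> F" "inner f = inner f'"
  have "H f' 0 \<in> inner f" unfolding f(3) by (auto simp: inner_def nd_def)
  then show "f = f'" using inner_disjoint[OF f(1,2), of 0] by (auto simp: mem_diamond nd_def)
qed

lemma complement: "S - embedded_graph V E \<phi> \<gamma> = (\<Union>f\<in>F. inner f)"
proof
  show "S - embedded_graph V E \<phi> \<gamma> \<subseteq> (\<Union>f\<in>F. inner f)"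
  proof
    fix s assume s: "s \<in> S - embedded_graph V E \<phi> \<gamma>"
    then obtain f z where f: "f \<in> F" "nd z \<le> 1" "s = H f z" using dr by (auto simp: drawing_def mem_diamond)
    then have "nd z \<noteq> 1" using s unfolding embedded by blast
    then have "nd z < 1" using f(2) by simp
    then have "s \<in> inner f" using f(3) by (simp add: inner_def)
    then show "s \<in> (\<Union>f\<in>F. inner f)" using f(1) by blast
  qed
  show "(\<Union>f\<in>F. inner f) \<subseteq> S - embedded_graph V E \<phi> \<gamma>"
  proof clarify
    fix f s assume f: "f \<in> F" "s \<in> inner f"
    then obtain x where "s = H f x" "nd x < 1" by (auto simp: inner_def)
    then have "s \<in> S" using drawing_in[OF dr f(1), of x] by simp
    moreover have "s \<notin> embedded_graph V E \<phi> \<gamma>" unfolding embedded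
    proof
      assume "s \<in> (\<Union>f\<in>F. H f ` {z. nd z = 1})"
      then obtain f' z where "f' \<in> F" "nd z = 1" "s = H f' z" by auto
      then show False using inner_disjoint[OF f(1), of f' z] f(2) by (simp add: mem_diamond)
    qed
    ultimately show "s \<in> S - embedded_graph V E \<phi> \<gamma>" by simp
  qed
qed

text \<open>Within the complement of the graph, the connected set \<open>inner f\<close> is closed,
  being cut out by a compact face, and open, because it avoids exactly the finitely many other
  compact faces.\<close>

lemma faces_eq: "faces S V E \<phi> \<gamma> = inner ` F"
proof -
  let ?U = "\<Union>f\<in>F. inner f"
  have comp: "inner f \<in> components ?U" if f: "f \<in> F" for f
    unfolding in_components_maximal
  proof (intro conjI allI impI)
    have "continuous_on {z. nd z < 1} (H f)"
      by (rule continuous_on_subset[of "diamond 1"]) (use dr f in \<open>auto simp: drawing_def mem_diamond\<close>)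
    then show conn: "connected (inner f)" unfolding inner_def
      using nd_open_convex(2) by (intro connected_continuous_image convex_connected) auto
    fix d assume d: "d \<noteq> {} \<and> inner f \<subseteq> d \<and> d \<subseteq> ?U \<and> connected d"
    have 1: "inner f = d \<inter> H f ` diamond 1"
    proof
      show "inner f \<subseteq> d \<inter> H f ` diamond 1" using d by (auto simp: inner_def mem_diamond)
      show "d \<inter> H f ` diamond 1 \<subseteq> inner f"
      proof
        fix s assume s: "s \<in> d \<inter> H f ` diamond 1"
        then obtain f' z where f': "f' \<in> F" "s \<in> inner f'" "z \<in> diamond 1" "s = H f z" using d by blast
        then have "f = f'" using inner_disjoint[OF f'(1) f] by blast
        then show "s \<in> inner f" using f' by simp
      qed
    qed
    have 2: "inner f = d \<inter> - (\<Union>f'\<in>F - {f}. H f' ` diamond 1)"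
    proof
      show "inner f \<subseteq> d \<inter> - (\<Union>f'\<in>F - {f}. H f' ` diamond 1)" using d inner_disjoint[OF f] by blast
      show "d \<inter> - (\<Union>f'\<in>F - {f}. H f' ` diamond 1) \<subseteq> inner f"
      proof
        fix s assume s: "s \<in> d \<inter> - (\<Union>f'\<in>F - {f}. H f' ` diamond 1)"
        then obtain f' where f': "f' \<in> F" "s \<in> inner f'" using d by blast
        then have "s \<in> H f' ` diamond 1" by (auto simp: inner_def mem_diamond)
        then have "f' = f" using s f' by blast
        then show "s \<in> inner f" using f' by simp
      qed
    qed
    have "closedin (top_of_set d) (inner f)"
      using compact_imp_closed[OF compact_face[OF f]] 1 by (metis closedin_closed)
    moreover have "openin (top_of_set d) (inner f)"
    proof -
      have "closed (\<Union>f'\<in>F - {f}. H f' ` diamond 1)"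
        using quad_surfaceD(1)[OF surf] compact_face by (intro closed_UN ballI compact_imp_closed) auto
      then show ?thesis using 2 by (metis open_Compl openin_open)
    qed
    ultimately show "d = inner f" using d inner_ne[of f] connected_clopen[of d] by blast
  qed (use inner_ne f in auto)
  have "components ?U = inner ` F"
  proof
    show "inner ` F \<subseteq> components ?U" using comp by blast
    show "components ?U \<subseteq> inner ` F"
    proof
      fix C assume C: "C \<in> components ?U"
      then obtain s where s: "s \<in> C" using in_components_nonempty by blast
      then obtain f where f: "f \<in> F" "s \<in> inner f" using in_components_subset[OF C] by blast
      then have "C = inner f" using components_nonoverlap[OF C comp[OF f(1)]] s by blast
      then show "C \<in> inner ` F" using f by blast
    qed
  qed
  then show ?thesis by (simp add: faces_def complement)
qed

lemma closure_inner: assumes "f \<in> F" shows "closure (inner f) = H f ` diamond 1"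
proof
  show "closure (inner f) \<subseteq> H f ` diamond 1"
    by (rule closure_minimal) (use compact_imp_closed[OF compact_face[OF assms]] in \<open>auto simp: inner_def mem_diamond\<close>)
  have cl: "closure {z. nd z < 1} = diamond 1"
  proof
    show "closure {z. nd z < 1} \<subseteq> diamond 1" by (rule closure_minimal[OF _ closed_diamond]) (auto simp: mem_diamond)
  qed (rule closure_open_diamond)
  have "continuous_on (closure {z. nd z < 1}) (H f)" unfolding cl using dr assms by (auto simp: drawing_def)
  from image_closure_subset[OF this closed_closure, of "inner f"] show "H f ` diamond 1 \<subseteq> closure (inner f)"
    unfolding cl by (auto simp: inner_def intro: closure_subset[THEN subsetD])
qed

lemma inj_face: assumes f: "f \<in> F" shows "inj_on (H f) (diamond 1)"
proof (rule inj_onI)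
  fix z w assume z: "z \<in> diamond 1" "w \<in> diamond 1" "H f z = H f w"
  obtain a b c d where q: "f = (a, b, c, d)" by (cases f) auto
  have "distinct [a, b, c, d]" using quad_surfaceD(2)[OF surf f] unfolding q by simp
  then show "z = w" using drawing_eq_iff[OF dr f f, of z w] z bweight_inj[of a b c d z w] unfolding q by (auto simp: mem_diamond simp del: bweight.simps)
qed

lemma quadrilateral_inner: assumes f: "f \<in> F" shows "quadrilateral E \<gamma> (inner f)"
proof -
  obtain a b c d where q: "f = (a, b, c, d)" by (cases f) auto
  have dis: "distinct [a, b, c, d]" using quad_surfaceD(2)[OF surf f] unfolding q by simp
  have sub: "{{a, b}, {b, c}, {c, d}, {d, a}} \<subseteq> E"
    using f unfolding q undirected_edges_def dedge_set_def by force
  let ?h = "\<lambda>z. H f (radial z)"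
  have im: "?h ` {z. Q (norm z)} = H f ` {z. Q (nd z)}" for Q
    unfolding image_image[of "H f" radial, symmetric] radial_image ..
  have cb: "cball (0::complex) 1 = {z. norm z \<le> 1}" "ball (0::complex) 1 = {z. norm z < 1}" "sphere (0::complex) 1 = {z. norm z = 1}"
    by (auto simp: dist_norm)
  have "\<exists>h'. homeomorphism (cball (0::complex) 1) (closure (inner f)) ?h h'"
  proof (rule homeomorphism_compact)
    have "continuous_on (diamond 1) (H f)" using dr f by (auto simp: drawing_def)
    then show "continuous_on (cball 0 1) ?h"
      by (rule continuous_on_compose2[OF _ continuous_radial]) (auto simp: mem_diamond nd_radial)
    show "?h ` cball 0 1 = closure (inner f)" unfolding cb im[of "\<lambda>r. r \<le> 1"] closure_inner[OF f] diamond_def ..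
    show "inj_on ?h (cball 0 1)"
    proof (rule inj_onI)
      fix z w :: complex assume "z \<in> cball 0 1" "w \<in> cball 0 1" "?h z = ?h w"
      then have "radial z = radial w" using inj_onD[OF inj_face[OF f], of "radial z" "radial w"] by (simp add: mem_diamond nd_radial)
      then show "z = w" by (rule inj_onD[OF inj_radial[of UNIV]]) auto
    qed
  qed simp
  then obtain h' where h': "homeomorphism (cball (0::complex) 1) (closure (inner f)) ?h h'" by blast
  moreover have "?h ` ball 0 1 = inner f" unfolding cb im[of "\<lambda>r. r < 1"] inner_def ..
  moreover have "?h ` sphere 0 1 = (\<Union>e\<in>{{a, b}, {b, c}, {c, d}, {d, a}}. path_image (\<gamma> e))"
    unfolding cb im[of "\<lambda>r. r = 1"] face_boundary[OF f] by (simp add: q)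
  ultimately show ?thesis unfolding quadrilateral_def using dis sub by blast
qed

text \<open>It is enough to look at the midpoint of the edge: it has positive weight at both ends,
  so a face whose closure contains it has the edge on its boundary.\<close>

lemma meets_iff:
  assumes f: "f \<in> F" and ab: "(a, b) \<in> dedge_set F"
  shows "meets_edge \<gamma> (inner f) {a, b} \<longleftrightarrow> (a, b) \<in> dedges f \<or> (b, a) \<in> dedges f"
proof
  assume "meets_edge \<gamma> (inner f) {a, b}"
  then have sub: "path_image (\<gamma> {a, b}) \<subseteq> H f ` diamond 1" by (simp add: meets_edge_def closure_inner[OF f])
  have "bpoint (edge_weight a b (1/2)) \<in> path_image (\<gamma> {a, b})" unfolding image_\<gamma>[OF ab] by auto
  then obtain w where w: "nd w \<le> 1" "bpoint (edge_weight a b (1/2)) = H f w" using sub by (auto simp: mem_diamond)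
  obtain f' m where f': "f' \<in> F" and fm: "\<And>t. 0 \<le> t \<Longrightarrow> t \<le> 1 \<Longrightarrow> nd (\<i> ^ m * Complex (1 - t) t) = 1 \<and> bweight f' (\<i> ^ m * Complex (1 - t) t) = edge_weight a b t"
    using edge_face[OF ab] by blast
  define x where "x = \<i> ^ m * Complex (1 - 1/2) (1/2)"
  have e: "nd x = 1" "bweight f' x = edge_weight a b (1/2)" using fm[of "1/2"] unfolding x_def by simp_all
  have "H f' x = H f w" using bpoint_eq[OF f' e(1)] e(2) w(2) by simp
  then have "bweight f w = edge_weight a b (1/2)"
    using drawing_eq_iff[OF dr f' f, of x w] e w(1) by (simp add: label_def split: if_splits)
  moreover have "edge_weight a b (1/2) a > 0" "edge_weight a b (1/2) b > 0" by (simp_all add: edge_weight_def)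
  ultimately show "(a, b) \<in> dedges f \<or> (b, a) \<in> dedges f" using bweight_pos_dedge[of f w a b] dedge_ne[OF ab] by simp
next
  assume "(a, b) \<in> dedges f \<or> (b, a) \<in> dedges f"
  then have "path_image (\<gamma> {a, b}) \<subseteq> H f ` {z. nd z = 1}"
    unfolding face_boundary[OF f] by (auto simp: insert_commute)
  then show "meets_edge \<gamma> (inner f) {a, b}" unfolding meets_edge_def closure_inner[OF f] by (auto simp: mem_diamond)
qed

text \<open>The two faces are the owner of \<open>(a, b)\<close> and the owner of
  \<open>(b, a)\<close>; no face has both directions, since its corners are distinct.\<close>

lemma two_faces: assumes "e \<in> E" shows "card {f \<in> faces S V E \<phi> \<gamma>. meets_edge \<gamma> f e} = 2"
proof -
  obtain a b where ab: "e = {a, b}" "a \<noteq> b" "(a, b) \<in> dedge_set F" "(b, a) \<in> dedge_set F" using E_E[OF assms] by blast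
  obtain f where f: "f \<in> F" "(a, b) \<in> dedges f" using ab(3) by (auto simp: dedge_set_def)
  obtain f' where f': "f' \<in> F" "(b, a) \<in> dedges f'" using ab(4) by (auto simp: dedge_set_def)
  have "f \<noteq> f'" using f f' dedges_irrefl quad_surfaceD(2)[OF surf] by blast
  then have ne: "inner f \<noteq> inner f'" using inner_inj f f' by blast
  have "{f \<in> faces S V E \<phi> \<gamma>. meets_edge \<gamma> f e} = {inner f, inner f'}"
  proof
    show "{f \<in> faces S V E \<phi> \<gamma>. meets_edge \<gamma> f e} \<subseteq> {inner f, inner f'}"
    proof
      fix X assume "X \<in> {f \<in> faces S V E \<phi> \<gamma>. meets_edge \<gamma> f e}"
      then obtain h where h: "h \<in> F" "X = inner h" "meets_edge \<gamma> (inner h) {a, b}" unfolding faces_eq ab(1) by blast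
      then have "(a, b) \<in> dedges h \<or> (b, a) \<in> dedges h" using meets_iff[OF h(1) ab(3)] by simp
      then have "h = f \<or> h = f'" using quad_surfaceD(3)[OF surf h(1) f(1) _ f(2)] quad_surfaceD(3)[OF surf h(1) f'(1) _ f'(2)] by blast
      then show "X \<in> {inner f, inner f'}" using h by blast
    qed
    show "{inner f, inner f'} \<subseteq> {f \<in> faces S V E \<phi> \<gamma>. meets_edge \<gamma> f e}"
      unfolding faces_eq ab(1) using meets_iff[OF f(1) ab(3)] meets_iff[OF f'(1) ab(3)] f f' by blast
  qed
  then show ?thesis using ne by simp
qed

lemma finite_V: "finite V"
proof -
  have "finite (dedges f)" for f by (cases f) auto
  then show ?thesis unfolding quad_vertices_def using quad_surfaceD(1)[OF surf] by auto
qed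

lemma quadrangulation: "quadrangulation S V E \<phi> \<gamma>"
  unfolding quadrangulation_def
proof (intro conjI ballI)
  show "simple_graph V E" unfolding simple_graph_def
  proof (intro conjI ballI)
    show "finite V" by (rule finite_V)
    fix e assume e: "e \<in> E"
    show "e \<subseteq> V" using edge_in_V[OF e] .
    show "card e = 2" using E_E[OF e] by (elim exE conjE) (metis card_2_iff)
  qed
  have "\<phi> ` V \<subseteq> S"
  proof clarify
    fix n assume "n \<in> V"
    then show "\<phi> n \<in> S" using \<phi>_face[of n] drawing_in[OF dr] by fastforce
  qed
  then show "graph_embedding S V E \<phi> \<gamma>" unfolding graph_embedding_def
    by (intro conjI ballI impI inj_\<phi> arc_\<gamma> edges_meet)
  show "quadrilateral E \<gamma> f" if "f \<in> faces S V E \<phi> \<gamma>" for f using that quadrilateral_inner unfolding faces_eq by blast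
  show "card {f \<in> faces S V E \<phi> \<gamma>. meets_edge \<gamma> f e} = 2" if "e \<in> E" for e using two_faces[OF that] .
qed

section \<open>Chromatic numbers of a drawn complex\<close>

lemma face_chromatic:
  assumes c: "face_colouring F c" "\<And>f. f \<in> F \<Longrightarrow> c f < k"
  shows "face_chromatic_number S V E \<phi> \<gamma> \<le> k"
proof -
  have inj: "inj_on inner F" using inner_inj by (auto intro: inj_onI)
  show ?thesis unfolding face_chromatic_number_def
  proof (rule chromatic_number_le[of _ _ _ "\<lambda>X. c (inv_into F inner X)"])
    show "proper_colouring (faces S V E \<phi> \<gamma>) (\<lambda>f f'. f \<noteq> f' \<and> (\<exists>e\<in>E. meets_edge \<gamma> f e \<and> meets_edge \<gamma> f' e)) k (\<lambda>X. c (inv_into F inner X))"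
      unfolding proper_colouring_def faces_eq
    proof (intro conjI ballI impI)
      fix X assume "X \<in> inner ` F"
      then show "c (inv_into F inner X) < k" using c(2) inv_into_into by metis
    next
      fix X Y assume "X \<in> inner ` F" "Y \<in> inner ` F" and adj: "X \<noteq> Y \<and> (\<exists>e\<in>E. meets_edge \<gamma> X e \<and> meets_edge \<gamma> Y e)"
      then obtain f f' where f: "f \<in> F" "X = inner f" "f' \<in> F" "Y = inner f'" by blast
      obtain e where e: "e \<in> E" "meets_edge \<gamma> X e" "meets_edge \<gamma> Y e" using adj by blast
      obtain a b where ab: "e = {a, b}" "(a, b) \<in> dedge_set F" using E_E[OF e(1)] by blast
      have m: "(a, b) \<in> dedges f \<or> (b, a) \<in> dedges f" "(a, b) \<in> dedges f' \<or> (b, a) \<in> dedges f'"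
        using e meets_iff[OF f(1) ab(2)] meets_iff[OF f(3) ab(2)] f ab(1) by auto
      have ne: "f \<noteq> f'" using adj f by blast
      then have "adjacent f f'" using m quad_surfaceD(3)[OF surf f(1,3)] unfolding adjacent_def by blast
      then have "c f \<noteq> c f'" using c(1) f ne by (simp add: face_colouring_def)
      then show "c (inv_into F inner X) \<noteq> c (inv_into F inner Y)" using f inv_into_f_f[OF inj] by simp
    qed
  qed
qed

text \<open>The colouring bounds the chromatic number from above, the clique \<open>w\<close> bounds
  it from below.\<close>

lemma vertex_chromatic:
  assumes c: "\<And>v. v \<in> V \<Longrightarrow> c v < k" "\<And>u v. (u, v) \<in> dedge_set F \<Longrightarrow> c u \<noteq> c v"
    and clique: "inj_on w {..<k}" "\<And>i. i < k \<Longrightarrow> w i \<in> V" "\<And>i j. i < k \<Longrightarrow> j < k \<Longrightarrow> i \<noteq> j \<Longrightarrow> (w i, w j) \<in> dedge_set F"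
  shows "vertex_chromatic_number V E = k"
proof -
  have Eiff: "{u, v} \<in> E \<longleftrightarrow> (u, v) \<in> dedge_set F" for u v
    using dedge_sym by (auto simp: undirected_edges_def doubleton_eq_iff)
  have proper: "proper_colouring V (\<lambda>u v. u \<noteq> v \<and> {u, v} \<in> E) k c"
    using c by (auto simp: proper_colouring_def Eiff)
  have lower: "k \<le> n" if "proper_colouring V (\<lambda>u v. u \<noteq> v \<and> {u, v} \<in> E) n c'" for n c'
  proof -
    have "inj_on (\<lambda>i. c' (w i)) {..<k}"
    proof (rule inj_onI, rule ccontr)
      fix i j assume ij: "i \<in> {..<k}" "j \<in> {..<k}" "c' (w i) = c' (w j)" "i \<noteq> j"
      then have "(w i, w j) \<in> dedge_set F" using clique(3) by simp
      then show False using that ij clique(2) dedge_ne unfolding proper_colouring_def Eiff by (metis lessThan_iff)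
    qed
    moreover have "(\<lambda>i. c' (w i)) ` {..<k} \<subseteq> {..<n}" using that clique(2) by (auto simp: proper_colouring_def)
    ultimately show ?thesis using card_inj_on_le[of _ "{..<k}" "{..<n}"] by simp
  qed
  show ?thesis unfolding vertex_chromatic_number_def chromatic_number_def
    by (rule Least_equality) (use proper lower in blast)+
qed

end

section \<open>Subdividing and joining coloured complexes\<close>

text \<open>Overriding colours is harmless because the inserted faces do not belong to
  \<open>F\<close>. The two outer faces inherit the colour, and the middle one has only new edges
  and thus a free choice among the other colours.\<close>

definition recolour_split :: "(quad \<Rightarrow> nat) \<Rightarrow> quad \<Rightarrow> nat \<Rightarrow> nat \<Rightarrow> nat \<Rightarrow> quad \<Rightarrow> nat" where
  "recolour_split k f x y m h = (case f of (a, b, c, d) \<Rightarrow>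
     if h = (x, c, y, a) then m else if h = (a, b, c, x) \<or> h = (a, y, c, d) then k f else k h)"

definition recolour_join :: "(quad \<Rightarrow> nat) \<Rightarrow> quad \<Rightarrow> quad \<Rightarrow> quad \<Rightarrow> nat" where
  "recolour_join k M N h = (case M of (x, a, y, c) \<Rightarrow> case N of (e, v, e', u) \<Rightarrow>
     if h = (x, a, y, e) \<or> h = (x, e', y, c) then k M
     else if h = (e, y, e', u) \<or> h = (e, v, e', x) then k N else k h)"

locale splittable =
  fixes F a b c d x y
  assumes surf: "quad_surface F" and fF: "(a, b, c, d) \<in> F"
    and fresh: "x \<notin> quad_vertices F" "y \<notin> quad_vertices F" "x \<noteq> y"
begin

abbreviation "F' \<equiv> split_face F (a, b, c, d) x y"

lemma F'_eq: "F' = (F - {(a, b, c, d)}) \<union> {(a, b, c, x), (x, c, y, a), (a, y, c, d)}"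
  by (simp add: split_face_def)

lemmas repl = split_replacement[OF surf fF fresh]

lemma surf': "quad_surface F'"
  using quad_surface_replace[OF surf repl] by (simp only: F'_eq)

lemma dedge_set': "dedge_set F' = dedge_set F \<union> both_ways a c x y"
  using dedge_set_replace[OF repl] by (simp only: F'_eq)

lemma vertices': "quad_vertices F' = quad_vertices F \<union> {x, y}"
  using quad_verticesI[OF fF] unfolding quad_vertices_dedge_set dedge_set' image_Un both_ways_def by auto

lemma new_not_in: "(a, b, c, x) \<notin> F" "(x, c, y, a) \<notin> F" "(a, y, c, d) \<notin> F"
  using fresh quad_verticesI[of _ _ _ _ F] by blast+

lemma distinct_vertices: "distinct [a, b, c, d, x, y]"
  using quad_surfaceD(2)[OF surf fF] quad_verticesI[OF fF] fresh by auto

lemma recolour: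
  assumes "k (a, b, c, d) \<noteq> m"
  shows "h \<in> F \<Longrightarrow> recolour_split k (a, b, c, d) x y m h = k h"
    "recolour_split k (a, b, c, d) x y m (a, b, c, x) = k (a, b, c, d)"
    "recolour_split k (a, b, c, d) x y m (x, c, y, a) = m"
    "recolour_split k (a, b, c, d) x y m (a, y, c, d) = k (a, b, c, d)"
proof -
  assume "h \<in> F"
  then have "h \<noteq> (x, c, y, a)" "h \<noteq> (a, b, c, x)" "h \<noteq> (a, y, c, d)" using new_not_in by metis+
  then show "recolour_split k (a, b, c, d) x y m h = k h" unfolding recolour_split_def prod.case by (simp only: if_False simp_thms)
next
  have "(a, b, c, x) \<noteq> (x, c, y, a)" "(a, y, c, d) \<noteq> (x, c, y, a)" using distinct_vertices by auto
  then show "recolour_split k (a, b, c, d) x y m (a, b, c, x) = k (a, b, c, d)"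
    "recolour_split k (a, b, c, d) x y m (x, c, y, a) = m"
    "recolour_split k (a, b, c, d) x y m (a, y, c, d) = k (a, b, c, d)"
    unfolding recolour_split_def prod.case by (simp_all only: if_False if_True simp_thms)
qed

lemma face_colouring':
  assumes k: "face_colouring F k" and m: "k (a, b, c, d) \<noteq> m"
  shows "face_colouring F' (recolour_split k (a, b, c, d) x y m)"
  unfolding F'_eq
proof (rule face_colouring_replace[OF surf repl k])
  note R = recolour[where k = k and m = m, OF m]
  show "recolour_split k (a, b, c, d) x y m h = k h" if "h \<in> F - {(a, b, c, d)}" for h using R(1) that by blast
  show "recolour_split k (a, b, c, d) x y m n = k h"
    if "n \<in> {(a, b, c, x), (x, c, y, a), (a, y, c, d)}" "h \<in> {(a, b, c, d)}" "e \<in> dedges n" "e \<in> dedges h" for n h e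
  proof -
    have "n \<noteq> (x, c, y, a)"
    proof
      assume "n = (x, c, y, a)"
      then show False using that distinct_vertices by auto
    qed
    then have "n = (a, b, c, x) \<or> n = (a, y, c, d)" using that(1) by blast
    then show ?thesis using R(2,4) that(2) by blast
  qed
  show "recolour_split k (a, b, c, d) x y m n \<noteq> recolour_split k (a, b, c, d) x y m n'"
    if n: "n \<in> {(a, b, c, x), (x, c, y, a), (a, y, c, d)}" "n' \<in> {(a, b, c, x), (x, c, y, a), (a, y, c, d)}"
      and e: "(p, q) \<in> both_ways a c x y" "(p, q) \<in> dedges n" "(q, p) \<in> dedges n'" for n n' p q
  proof -
    have "n = (x, c, y, a) \<and> n' \<noteq> (x, c, y, a) \<or> n \<noteq> (x, c, y, a) \<and> n' = (x, c, y, a)"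
    proof -
      have 1: "\<not> (n = (x, c, y, a) \<and> n' = (x, c, y, a))" using e distinct_vertices by auto
      have 2: "n = (x, c, y, a) \<or> n' = (x, c, y, a)"
      proof (rule ccontr)
        assume "\<not> (n = (x, c, y, a) \<or> n' = (x, c, y, a))"
        then have "n = (a, b, c, x) \<or> n = (a, y, c, d)" "n' = (a, b, c, x) \<or> n' = (a, y, c, d)" using n by blast+
        then show False using e distinct_vertices by (auto simp: both_ways_def)
      qed
      show ?thesis using 1 2 by blast
    qed
    then have "(n = (x, c, y, a) \<and> (n' = (a, b, c, x) \<or> n' = (a, y, c, d))) \<or> (n' = (x, c, y, a) \<and> (n = (a, b, c, x) \<or> n = (a, y, c, d)))"
      using n by blast
    then show ?thesis using R(2-4) m by metis
  qed
qed

end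

locale joinable =
  fixes F x a y c e v e' u
  assumes surf: "quad_surface F" and MF: "(x, a, y, c) \<in> F" and NF: "(e, v, e', u) \<in> F" and MN: "(x, a, y, c) \<noteq> (e, v, e', u)"
    and fresh: "\<And>p q. p \<in> {x, y} \<Longrightarrow> q \<in> {e, e'} \<Longrightarrow> p \<noteq> q"
      "\<And>p q. p \<in> {x, y} \<Longrightarrow> q \<in> {e, e'} \<Longrightarrow> (p, q) \<notin> dedge_set F \<and> (q, p) \<notin> dedge_set F"
begin

abbreviation "M \<equiv> (x, a, y, c)"
abbreviation "N \<equiv> (e, v, e', u)"
abbreviation "T1 \<equiv> (x, a, y, e)"
abbreviation "T2 \<equiv> (e, y, e', u)"
abbreviation "T3 \<equiv> (x, e', y, c)"
abbreviation "T4 \<equiv> (e, v, e', x)"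
abbreviation "F' \<equiv> join_faces F M N"

lemma F'_eq: "F' = (F - {M, N}) \<union> {T1, T2, T3, T4}"
  by (simp add: join_faces_def)

lemmas repl = join_replacement[OF surf MF NF MN fresh]

lemma surf': "quad_surface F'"
  using quad_surface_replace[OF surf repl] by (simp only: F'_eq)

lemma dedge_set': "dedge_set F' = dedge_set F \<union> both_ways x y e e'"
  using dedge_set_replace[OF repl] by (simp only: F'_eq)

lemma vertices': "quad_vertices F' = quad_vertices F"
  using quad_verticesI[OF MF] quad_verticesI[OF NF]
  unfolding quad_vertices_dedge_set dedge_set' image_Un both_ways_def by auto

lemma new_not_in: "T1 \<notin> F" "T2 \<notin> F" "T3 \<notin> F" "T4 \<notin> F"
proof -
  have *: "f \<notin> F" if "(p, q) \<in> dedges f" "(p, q) \<notin> dedge_set F" for f p q using that dedge_setI by blast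
  show "T1 \<notin> F" using fresh(2)[of y e] by (intro *[of y e]) auto
  show "T2 \<notin> F" using fresh(2)[of y e] by (intro *[of e y]) auto
  show "T3 \<notin> F" using fresh(2)[of x e'] by (intro *[of x e']) auto
  show "T4 \<notin> F" using fresh(2)[of x e] by (intro *[of x e]) auto
qed

lemma distinct_vertices: "x \<noteq> y" "e \<noteq> e'" "x \<noteq> e" "x \<noteq> e'" "y \<noteq> e" "y \<noteq> e'" "a \<noteq> x" "a \<noteq> y" "c \<noteq> x" "c \<noteq> y" "a \<noteq> c"
  "v \<noteq> e" "v \<noteq> e'" "u \<noteq> e" "u \<noteq> e'" "v \<noteq> u" "a \<noteq> e" "a \<noteq> e'" "c \<noteq> e" "c \<noteq> e'" "v \<noteq> x" "v \<noteq> y" "u \<noteq> x" "u \<noteq> y"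
proof -
  have "distinct_quad M" "distinct_quad N" using quad_surfaceD(2)[OF surf] MF NF by blast+
  then show "x \<noteq> y" "e \<noteq> e'" "a \<noteq> x" "a \<noteq> y" "c \<noteq> x" "c \<noteq> y" "a \<noteq> c" "v \<noteq> e" "v \<noteq> e'" "u \<noteq> e" "u \<noteq> e'" "v \<noteq> u" by auto
  show "x \<noteq> e" "x \<noteq> e'" "y \<noteq> e" "y \<noteq> e'" using fresh(1)[of x e] fresh(1)[of x e'] fresh(1)[of y e] fresh(1)[of y e'] by simp_all
  have m: "(x, a) \<in> dedge_set F" "(c, x) \<in> dedge_set F" "(e, v) \<in> dedge_set F" "(u, e) \<in> dedge_set F"
    using dedge_setI[OF _ MF] dedge_setI[OF _ NF] by auto
  show "a \<noteq> e" "a \<noteq> e'" "c \<noteq> e" "c \<noteq> e'" "v \<noteq> x" "v \<noteq> y" "u \<noteq> x" "u \<noteq> y"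
    using m fresh(2)[of x e] fresh(2)[of x e'] fresh(2)[of y e] by auto
qed

lemma recolour:
  shows "h \<in> F \<Longrightarrow> recolour_join k M N h = k h"
    "recolour_join k M N T1 = k M" "recolour_join k M N T3 = k M" "recolour_join k M N T2 = k N" "recolour_join k M N T4 = k N"
proof -
  assume "h \<in> F"
  then have "h \<noteq> T1" "h \<noteq> T2" "h \<noteq> T3" "h \<noteq> T4" using new_not_in by metis+
  then show "recolour_join k M N h = k h" unfolding recolour_join_def prod.case by (simp only: if_False simp_thms)
next
  have "T2 \<noteq> T1" "T2 \<noteq> T3" "T4 \<noteq> T1" "T4 \<noteq> T3" using distinct_vertices by auto
  then show "recolour_join k M N T1 = k M" "recolour_join k M N T3 = k M" "recolour_join k M N T2 = k N" "recolour_join k M N T4 = k N"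
    unfolding recolour_join_def prod.case by (simp_all only: if_False if_True simp_thms)
qed

lemma face_colouring':
  assumes k: "face_colouring F k" and m: "k M \<noteq> k N"
  shows "face_colouring F' (recolour_join k M N)"
  unfolding F'_eq
proof (rule face_colouring_replace[OF surf repl k])
  show "recolour_join k M N h = k h" if "h \<in> F - {M, N}" for h using recolour(1) that by blast
  have dj: "q \<notin> dedges N" if "q \<in> dedges M" for q using quad_surfaceD(3)[OF surf MF NF that] MN by blast
  show "recolour_join k M N n = k h"
    if n: "n \<in> {T1, T2, T3, T4}" and h: "h \<in> {M, N}" and q: "q \<in> dedges n" "q \<in> dedges h" for n h q
  proof -
    have X: "q \<notin> both_ways x y e e'" using replacementD(6)[OF repl] h q(2) MF NF dedge_setI by blast
    have M: "q \<in> dedges M" if "n = T1 \<or> n = T3" using that q(1) X by (auto simp: both_ways_def)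
    have N: "q \<in> dedges N" if "n = T2 \<or> n = T4" using that q(1) X by (auto simp: both_ways_def)
    show ?thesis
    proof (cases "n = T1 \<or> n = T3")
      case True
      then have "h = M" using M dj q(2) h by blast
      then show ?thesis using True recolour(2,3)[of k] by metis
    next
      case False
      then have nn: "n = T2 \<or> n = T4" using n by blast
      then have "h = N" using N dj q(2) h by blast
      then show ?thesis using nn recolour(4,5)[of k] by metis
    qed
  qed
  show "recolour_join k M N n \<noteq> recolour_join k M N n'"
    if n: "n \<in> {T1, T2, T3, T4}" "n' \<in> {T1, T2, T3, T4}" and q: "(p, q) \<in> both_ways x y e e'" "(p, q) \<in> dedges n" "(q, p) \<in> dedges n'" for n n' p q
  proof -
    \<comment> \<open>\<open>?A\<close> is the directed cycle of new edges as it occurs in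
      \<open>T1\<close> and \<open>T3\<close>, and \<open>?B\<close> is the reversed cycle, which
      occurs in \<open>T2\<close> and \<open>T4\<close>. So every new edge lies between one face of
      each kind.\<close>
    let ?A = "{(y, e), (e, x), (x, e'), (e', y)}" and ?B = "{(e, y), (y, e'), (e', x), (x, e)}"
    have swap: "(q, p) \<in> both_ways x y e e'" using q(1) replacementD(7)[OF repl] by blast
    have old: "r \<notin> both_ways x y e e'" if "r \<in> dedges M \<or> r \<in> dedges N" for r
      using that replacementD(6)[OF repl] MF NF dedge_setI by blast
    then have nX: "(x, a) \<notin> both_ways x y e e'" "(a, y) \<notin> both_ways x y e e'" "(y, c) \<notin> both_ways x y e e'" "(c, x) \<notin> both_ways x y e e'"
      "(e, v) \<notin> both_ways x y e e'" "(v, e') \<notin> both_ways x y e e'" "(e', u) \<notin> both_ways x y e e'" "(u, e) \<notin> both_ways x y e e'"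
      by simp_all
    have A: "r \<in> ?A" if "h = T1 \<or> h = T3" "r \<in> dedges h" "r \<in> both_ways x y e e'" for h r
    proof -
      have "r \<in> {(x, a), (a, y), (y, c), (c, x)} \<union> ?A" using that(1,2) by (elim disjE; simp; blast)
      then show ?thesis using nX that(3) by blast
    qed
    have B: "r \<in> ?B" if "h = T2 \<or> h = T4" "r \<in> dedges h" "r \<in> both_ways x y e e'" for h r
    proof -
      have "r \<in> {(e, v), (v, e'), (e', u), (u, e)} \<union> ?B" using that(1,2) by (elim disjE; simp; blast)
      then show ?thesis using nX that(3) by blast
    qed
    have AB: "(p, q) \<notin> ?A \<or> (q, p) \<notin> ?A" "(p, q) \<notin> ?B \<or> (q, p) \<notin> ?B"
    proof -
      have conv: "(q, p) \<in> ?B" if "(p, q) \<in> ?A" for p q using that by (elim insertE emptyE; clarify; blast)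
      have conv': "(q, p) \<in> ?A" if "(p, q) \<in> ?B" for p q using that by (elim insertE emptyE; clarify; blast)
      have "r \<notin> ?B" if "r \<in> ?A" for r
        using that distinct_vertices(1-6) by (elim insertE emptyE) simp_all
      then show "(p, q) \<notin> ?A \<or> (q, p) \<notin> ?A" "(p, q) \<notin> ?B \<or> (q, p) \<notin> ?B"
        using conv conv' by blast+
    qed
    have 1: "\<not> ((n = T1 \<or> n = T3) \<and> (n' = T1 \<or> n' = T3))"
    proof
      assume h: "(n = T1 \<or> n = T3) \<and> (n' = T1 \<or> n' = T3)"
      show False using AB(1) A[OF conjunct1[OF h] q(2,1)] A[OF conjunct2[OF h] q(3) swap]
        by (elim disjE) (erule notE, assumption)+
    qed
    have 2: "\<not> ((n = T2 \<or> n = T4) \<and> (n' = T2 \<or> n' = T4))"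
    proof
      assume h: "(n = T2 \<or> n = T4) \<and> (n' = T2 \<or> n' = T4)"
      show False using AB(2) B[OF conjunct1[OF h] q(2,1)] B[OF conjunct2[OF h] q(3) swap]
        by (elim disjE) (erule notE, assumption)+
    qed
    have "(n = T1 \<or> n = T3) \<and> (n' = T2 \<or> n' = T4) \<or> (n = T2 \<or> n = T4) \<and> (n' = T1 \<or> n' = T3)"
      using 1 2 n[unfolded insert_iff empty_iff] by argo
    then show ?thesis
      by (elim disjE conjE) (simp_all only: recolour(2-5)[of k] m m[symmetric] not_False_eq_True)
  qed
qed

end

section \<open>Counting handles and vertices\<close>

text \<open>Vertices are numbered consecutively, so \<open>p\<close> and \<open>p + 1\<close> are
  fresh for the next split. That \<open>k\<close> vertex colours are also necessary comes from the
  multipartite subgraph, which is tracked separately.\<close>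

definition coloured :: "nat \<Rightarrow> nat \<Rightarrow> quad set \<Rightarrow> (nat \<Rightarrow> nat) \<Rightarrow> (quad \<Rightarrow> nat) \<Rightarrow> bool" where
  "coloured k p F c fc \<longleftrightarrow> quad_surface F \<and> quad_vertices F = {..<p} \<and> (\<forall>v<p. c v < k) \<and>
     (\<forall>u v. (u, v) \<in> dedge_set F \<longrightarrow> c u \<noteq> c v) \<and> face_colouring F fc \<and> (\<forall>f\<in>F. fc f < k)"

lemma colouredD:
  assumes "coloured k p F c fc"
  shows "quad_surface F" "quad_vertices F = {..<p}" "v < p \<Longrightarrow> c v < k" "(u, v) \<in> dedge_set F \<Longrightarrow> c u \<noteq> c v"
    "face_colouring F fc" "f \<in> F \<Longrightarrow> fc f < k"
  using assms unfolding coloured_def by blast+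

lemma coloured_mono: "coloured k p F c fc \<Longrightarrow> k \<le> k' \<Longrightarrow> coloured k' p F c fc"
  unfolding coloured_def by (meson less_le_trans)

lemma coloured_splittable:
  assumes "coloured k p F c fc" "(a, b, e, d) \<in> F" shows "splittable F a b e d p (p + 1)"
  using colouredD(1,2)[OF assms(1)] assms(2) by unfold_locales auto

lemma coloured_split:
  assumes C: "coloured k p F c fc" and f: "(a, b, e, d) \<in> F"
    and i: "c a = i" "c e = i" "i' \<noteq> i" "i' < k" and m: "fc (a, b, e, d) \<noteq> m" "m < k"
  shows "coloured k (p + 2) (split_face F (a, b, e, d) p (p + 1)) (c(p := i', p + 1 := i')) (recolour_split fc (a, b, e, d) p (p + 1) m)"
proof -
  interpret splittable F a b e d p "p + 1" by (rule coloured_splittable[OF C f])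
  note D = colouredD[OF C]
  have ae: "a < p" "e < p" using quad_verticesI[OF f] D(2) by auto
  show ?thesis unfolding coloured_def
  proof (intro conjI allI impI ballI)
    show "quad_surface F'" by (rule surf')
    show "quad_vertices F' = {..<p + 2}" unfolding vertices' D(2) by auto
    show "(c(p := i', p + 1 := i')) v < k" if "v < p + 2" for v using that D(3)[of v] i(4) by auto
    show "(c(p := i', p + 1 := i')) u \<noteq> (c(p := i', p + 1 := i')) v" if "(u, v) \<in> dedge_set F'" for u v
    proof (cases "(u, v) \<in> dedge_set F")
      case True
      then have "u < p" "v < p" using dedge_set_vertices[of u v F] D(2) by auto
      then show ?thesis using D(4)[OF True] by simp
    next
      case False
      then have "(u, v) \<in> both_ways a e p (p + 1)" using that unfolding dedge_set' by simp
      then show ?thesis using ae i unfolding both_ways_def by auto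
    qed
    show "face_colouring F' (recolour_split fc (a, b, e, d) p (p + 1) m)" by (rule face_colouring'[OF D(5) m(1)])
    show "recolour_split fc (a, b, e, d) p (p + 1) m h < k" if "h \<in> F'" for h
    proof -
      consider "h \<in> F" | "h = (a, b, e, p)" | "h = (p, e, p + 1, a)" | "h = (a, p + 1, e, d)"
        using \<open>h \<in> F'\<close> unfolding F'_eq by blast
      then show ?thesis
      proof cases
        case 1 then show ?thesis using recolour(1)[where k = fc and m = m, OF m(1) 1] D(6)[OF 1] by simp
      qed (simp_all only: recolour(2-4)[where k = fc and m = m, OF m(1)] m(2) D(6)[OF f])
    qed
  qed
qed

lemma coloured_join:
  assumes C: "coloured k p F c fc" and J: "joinable F x a y b e v e' u"
    and i: "c x = i" "c y = i" "c e = i'" "c e' = i'" "i \<noteq> i'" and m: "fc (x, a, y, b) \<noteq> fc (e, v, e', u)"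
  shows "coloured k p (join_faces F (x, a, y, b) (e, v, e', u)) c (recolour_join fc (x, a, y, b) (e, v, e', u))"
proof -
  interpret joinable F x a y b e v e' u by (rule J)
  note D = colouredD[OF C]
  show ?thesis unfolding coloured_def
  proof (intro conjI allI impI ballI)
    show "quad_surface F'" by (rule surf')
    show "quad_vertices F' = {..<p}" unfolding vertices' D(2) ..
    show "c w < k" if "w < p" for w using D(3)[OF that] .
    show "c r \<noteq> c s" if "(r, s) \<in> dedge_set F'" for r s
    proof (cases "(r, s) \<in> dedge_set F")
      case False
      then have "(r, s) \<in> both_ways x y e e'" using that unfolding dedge_set' by simp
      then show ?thesis using i unfolding both_ways_def by auto
    qed (rule D(4))
    show "face_colouring F' (recolour_join fc M N)" by (rule face_colouring'[OF D(5) m])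
    show "recolour_join fc M N h < k" if "h \<in> F'" for h
    proof -
      consider "h \<in> F" | "h = T1" | "h = T2" | "h = T3" | "h = T4" using \<open>h \<in> F'\<close> unfolding F'_eq by blast
      then show ?thesis
      proof cases
        case 1 then show ?thesis using recolour(1)[OF 1, of fc] D(6)[OF 1] by simp
      qed (simp_all only: recolour(2-5)[of fc] D(6)[OF MF] D(6)[OF NF])
    qed
  qed
qed

text \<open>The pairs \<open>2 i, 2 i + 1\<close> are the parts of a complete multipartite graph, to which the
  pair \<open>m\<close> is attached step by step; \<open>j\<close> counts the steps.\<close>

definition pair_edges :: "nat \<Rightarrow> nat \<Rightarrow> (nat \<times> nat) set" where
  "pair_edges m j = {(u, v). u div 2 \<noteq> v div 2 \<and> u div 2 \<le> m \<and> v div 2 \<le> m \<and>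
     (u div 2 = m \<longrightarrow> v div 2 \<le> j) \<and> (v div 2 = m \<longrightarrow> u div 2 \<le> j)}"

lemma both_ways_pairs:
  "(u, v) \<in> both_ways (2 * a) (2 * a + 1) (2 * b) (2 * b + 1) \<longleftrightarrow>
    (u div 2 = a \<and> v div 2 = b) \<or> (u div 2 = b \<and> v div 2 = a)"
proof -
  have d: "w div 2 = n \<longleftrightarrow> w = 2 * n \<or> w = 2 * n + 1" for w n :: nat by presburger
  show ?thesis unfolding both_ways_def d by blast
qed

lemma pair_edges_start: "pair_edges 1 0 = both_ways 0 1 2 3"
proof -
  have "(u, v) \<in> pair_edges 1 0 \<longleftrightarrow> (u, v) \<in> both_ways (2 * 0) (2 * 0 + 1) (2 * 1) (2 * 1 + 1)" for u v
    unfolding both_ways_pairs unfolding pair_edges_def by auto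
  then show ?thesis by auto
qed

lemma pair_edges_new: "n \<ge> 1 \<Longrightarrow> pair_edges (Suc n) 0 = pair_edges n (n - 1) \<union> both_ways 0 1 (2 * n + 2) (2 * n + 2 + 1)"
proof -
  assume n: "n \<ge> 1"
  have ar: "(p \<noteq> q \<and> p \<le> Suc n \<and> q \<le> Suc n \<and> (p = Suc n \<longrightarrow> q \<le> 0) \<and> (q = Suc n \<longrightarrow> p \<le> 0)) \<longleftrightarrow>
    (p \<noteq> q \<and> p \<le> n \<and> q \<le> n \<and> (p = n \<longrightarrow> q \<le> n - 1) \<and> (q = n \<longrightarrow> p \<le> n - 1)) \<or>
    (p = 0 \<and> q = n + 1) \<or> (p = n + 1 \<and> q = 0)" for p q
    using n by presburger
  have "(u, v) \<in> pair_edges (Suc n) 0 \<longleftrightarrow> (u, v) \<in> pair_edges n (n - 1) \<or> (u, v) \<in> both_ways (2 * 0) (2 * 0 + 1) (2 * (n + 1)) (2 * (n + 1) + 1)" for u v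
    unfolding both_ways_pairs unfolding pair_edges_def mem_Collect_eq prod.case by (rule ar)
  then show ?thesis by auto
qed

lemma pair_edges_Suc:
  "j + 1 < m \<Longrightarrow> pair_edges m (j + 1) = pair_edges m j \<union> both_ways (2 * m) (2 * m + 1) (2 * (j + 1)) (2 * (j + 1) + 1)"
proof -
  assume j: "j + 1 < m"
  have "(u, v) \<in> pair_edges m (j + 1) \<longleftrightarrow> (u, v) \<in> pair_edges m j \<or> (u, v) \<in> both_ways (2 * m) (2 * m + 1) (2 * (j + 1)) (2 * (j + 1) + 1)" for u v
    unfolding both_ways_pairs unfolding pair_edges_def using j by auto
  then show ?thesis by auto
qed

text \<open>The face \<open>P i\<close> has the pair \<open>i\<close> as opposite corners and is
  kept for joining. The face of the newest pair has colour \<open>m\<close> and the others have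
  smaller colours, so \<open>P m\<close> may be joined to any of them.\<close>

definition stage :: "nat \<Rightarrow> nat \<Rightarrow> quad set \<Rightarrow> (nat \<Rightarrow> quad) \<Rightarrow> (quad \<Rightarrow> nat) \<Rightarrow> bool" where
  "stage m j F P fc \<longleftrightarrow> coloured (m + 1) (2 * m + 2) F (\<lambda>v. v div 2) fc \<and> dedge_set F = pair_edges m j \<and>
     (\<forall>i\<le>m. P i \<in> F \<and> (\<exists>a b. P i = (2 * i, a, 2 * i + 1, b))) \<and> fc (P m) = m \<and> (\<forall>i<m. fc (P i) < m)"

lemma stageD:
  assumes "stage m j F P fc"
  shows "coloured (m + 1) (2 * m + 2) F (\<lambda>v. v div 2) fc" "dedge_set F = pair_edges m j"
    "i \<le> m \<Longrightarrow> P i \<in> F" "i \<le> m \<Longrightarrow> \<exists>a b. P i = (2 * i, a, 2 * i + 1, b)" "fc (P m) = m" "i < m \<Longrightarrow> fc (P i) < m"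
  using assms unfolding stage_def by blast+

lemma stage_ne: 
  assumes "stage m j F P fc" "i \<le> m" "i' \<le> m" "i \<noteq> i'" shows "P i \<noteq> P i'"
proof -
  obtain a b a' b' where "P i = (2 * i, a, 2 * i + 1, b)" "P i' = (2 * i', a', 2 * i' + 1, b')"
    using stageD(4)[OF assms(1,2)] stageD(4)[OF assms(1,3)] by blast
  then show ?thesis using assms(4) by simp
qed

definition base_colour :: "quad \<Rightarrow> nat" where "base_colour f = (if f = (0, 2, 1, 3) then 0 else 1)"

lemma stage_base: "stage 1 0 base_faces (\<lambda>i. if i = 0 then (0, 2, 1, 3) else (2, 0, 3, 1)) base_colour"
proof -
  have E: "dedge_set base_faces = both_ways 0 1 2 3"
    unfolding dedge_set_def base_faces_def both_ways_def by auto
  have v: "\<forall>v<4. v div 2 < (2::nat)" by auto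
  have e: "\<forall>u v. (u, v) \<in> both_ways 0 1 2 3 \<longrightarrow> u div 2 \<noteq> v div 2" unfolding both_ways_def by auto
  have c: "face_colouring base_faces base_colour"
    unfolding face_colouring_def base_faces_def base_colour_def by auto
  show ?thesis unfolding stage_def coloured_def
    using base_surface base_vertices v e c E pair_edges_start
    by (auto simp: base_faces_def base_colour_def le_Suc_eq)
qed

text \<open>Splitting \<open>P 0\<close> puts the new pair into a face between the vertices 0 and 1
  and thereby attaches it to pair 0. The middle face becomes the face of the new pair and takes the
  one new colour.\<close>

lemma stage_next:
  assumes st: "stage n (n - 1) F P fc" and n: "n \<ge> 1"
  shows "\<exists>P' fc'. stage (Suc n) 0 (split_face F (P 0) (2 * n + 2) (2 * n + 2 + 1)) P' fc'"
proof -
  note D = stageD[OF st]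
  define p where "p = 2 * n + 2"
  obtain a b where P0: "P 0 = (0, a, 1, b)" using D(4)[of 0] by auto
  have f: "(0, a, 1, b) \<in> F" using D(3)[of 0] P0 by simp
  have C: "coloured (n + 2) p F (\<lambda>v. v div 2) fc" unfolding p_def by (rule coloured_mono[OF D(1)]) simp
  have lt: "fc f < n + 1" if "f \<in> F" for f using colouredD(6)[OF D(1) that] .
  have ne: "fc (0, a, 1, b) \<noteq> n + 1" using lt[OF f] by simp
  interpret splittable F 0 a 1 b p "p + 1" by (rule coloured_splittable[OF C f])
  let ?fc = "recolour_split fc (0, a, 1, b) p (p + 1) (n + 1)"
  note R = recolour[where k = fc and m = "n + 1", OF ne]
  have "coloured (n + 2) (p + 2) F' ((\<lambda>v. v div 2)(p := n + 1, p + 1 := n + 1)) ?fc"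
    by (rule coloured_split[OF C f, of 0]) (use ne in auto)
  moreover have "(\<lambda>v. v div 2)(p := n + 1, p + 1 := n + 1) = (\<lambda>v. v div 2)" unfolding p_def by (rule ext) auto
  ultimately have C': "coloured (Suc n + 1) (2 * Suc n + 2) F' (\<lambda>v. v div 2) ?fc" by (simp add: p_def)
  define P' where "P' i = (if i = 0 then (0, a, 1, p) else if i = Suc n then (p, 1, p + 1, 0) else P i)" for i
  have "stage (Suc n) 0 F' P' ?fc" unfolding stage_def
  proof (intro conjI allI impI)
    show "coloured (Suc n + 1) (2 * Suc n + 2) F' (\<lambda>v. v div 2) ?fc" by (rule C')
    show "dedge_set F' = pair_edges (Suc n) 0" unfolding dedge_set' D(2) pair_edges_new[OF n] unfolding p_def ..
    show "?fc (P' (Suc n)) = Suc n" using R(3) by (simp add: P'_def)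
    fix i
    have old: "P' i = P i \<and> P i \<in> F \<and> P i \<noteq> (0, a, 1, b)" if "0 < i" "i \<le> n"
      using that D(3)[of i] stage_ne[OF st, of i 0] P0 by (simp add: P'_def)
    have z: "P' 0 = (0, a, 1, p)" and s: "P' (Suc n) = (p, 1, p + 1, 0)" by (simp_all add: P'_def)
    show "P' i \<in> F'" if "i \<le> Suc n"
    proof -
      consider "i = 0" | "i = Suc n" | "0 < i" "i \<le> n" using \<open>i \<le> Suc n\<close> by linarith
      then show ?thesis unfolding F'_eq by cases (use z s old in simp_all)
    qed
    show "\<exists>a b. P' i = (2 * i, a, 2 * i + 1, b)" if "i \<le> Suc n"
    proof -
      consider "i = 0" | "i = Suc n" | "0 < i" "i \<le> n" using \<open>i \<le> Suc n\<close> by linarith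
      then show ?thesis by cases (use z s old D(4)[of i] in \<open>simp_all add: p_def\<close>)
    qed
    show "?fc (P' i) < Suc n" if "i < Suc n"
    proof (cases "i = 0")
      case True
      then show ?thesis using R(2) lt[OF f] z by simp
    next
      case False
      then have "P' i \<in> F" using old that False by simp
      then show ?thesis using R(1) lt by simp
    qed
  qed
  then show ?thesis unfolding P0 p_def by blast
qed

lemma stage_join:
  assumes st: "stage m j F P fc" and j: "j + 1 < m" and pin: "all_pinned g F"
  shows "\<exists>F' P' fc'. stage m (j + 1) F' P' fc' \<and> all_pinned (Suc g) F'"
proof -
  note D = stageD[OF st]
  obtain a b where M: "P m = (2 * m, a, 2 * m + 1, b)" using D(4)[of m] by auto
  obtain v u where N: "P (j + 1) = (2 * (j + 1), v, 2 * (j + 1) + 1, u)" using D(4)[of "j + 1"] j by auto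
  define x y e e' where xy: "x = 2 * m" "y = 2 * m + 1" "e = 2 * (j + 1)" "e' = 2 * (j + 1) + 1"
  have MF: "(x, a, y, b) \<in> F" using D(3)[of m] M xy by simp
  have NF: "(e, v, e', u) \<in> F" using D(3)[of "j + 1"] N xy j by simp
  have pq: "p div 2 = m" "q div 2 = j + 1" if "p \<in> {x, y}" "q \<in> {e, e'}" for p q using that xy by auto
  have fr: "p \<noteq> q" "(p, q) \<notin> dedge_set F \<and> (q, p) \<notin> dedge_set F" if "p \<in> {x, y}" "q \<in> {e, e'}" for p q
    using pq[OF that] j unfolding D(2) pair_edges_def by auto
  have MN: "(x, a, y, b) \<noteq> (e, v, e', u)" using xy j by simp
  interpret joinable F x a y b e v e' u
    by unfold_locales (use colouredD(1)[OF D(1)] MF NF MN fr in blast)+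
  let ?fc = "recolour_join fc M N"
  have fM: "fc M = m" using D(5) M xy by simp
  have fN: "fc N < m" using D(6)[of "j + 1"] j N xy by simp
  have C: "coloured (m + 1) (2 * m + 2) F' (\<lambda>v. v div 2) ?fc"
    by (rule coloured_join[OF D(1) joinable_axioms, of m "j + 1"]) (use xy j fM fN in auto)
  define P' where "P' i = (if i = m then T1 else if i = j + 1 then T2 else P i)" for i
  have old: "P' i = P i" "P i \<in> F" "P i \<noteq> M" "P i \<noteq> N" if "i \<le> m" "i \<noteq> m" "i \<noteq> j + 1" for i
    using that D(3)[of i] stage_ne[OF st, of i m] stage_ne[OF st, of i "j + 1"] M N xy j by (simp_all add: P'_def)
  have m: "P' m = T1" and s: "P' (j + 1) = T2" using j by (simp_all add: P'_def)
  have "stage m (j + 1) F' P' ?fc" unfolding stage_def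
  proof (intro conjI allI impI)
    show "coloured (m + 1) (2 * m + 2) F' (\<lambda>v. v div 2) ?fc" by (rule C)
    show "dedge_set F' = pair_edges m (j + 1)" unfolding dedge_set' D(2) pair_edges_Suc[OF j] unfolding xy ..
    show "?fc (P' m) = m" using recolour(2)[of fc] fM m by simp
    fix i
    show "P' i \<in> F'" if "i \<le> m"
    proof -
      consider "i = m" | "i = j + 1" | "i \<noteq> m" "i \<noteq> j + 1" by blast
      then show ?thesis
      proof cases
        case 3
        have "P' i \<in> F" "P' i \<noteq> M" "P' i \<noteq> N" using old[OF that 3] by simp_all
        then have "P' i \<in> F - {M, N}" by (simp only: Diff_iff insert_iff empty_iff simp_thms)
        then show ?thesis unfolding F'_eq by (rule UnI1)
      qed (use m s in \<open>simp_all only: F'_eq Un_iff insert_iff simp_thms\<close>)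
    qed
    show "\<exists>a b. P' i = (2 * i, a, 2 * i + 1, b)" if "i \<le> m"
    proof -
      consider "i = m" | "i = j + 1" | "i \<noteq> m" "i \<noteq> j + 1" by blast
      then show ?thesis
      proof cases
        case 3 then show ?thesis using old[OF that 3] D(4)[OF that] by simp
      next
        case 1 show ?thesis unfolding 1 m xy by blast
      next
        case 2 show ?thesis unfolding 2 s xy by blast
      qed
    qed
    show "?fc (P' i) < m" if "i < m"
    proof (cases "i = j + 1")
      case True
      show ?thesis unfolding True s recolour(4)[of fc] by (rule fN)
    next
      case False
      then have "P' i \<in> F" "P' i = P i" using old[of i] that by auto
      then show ?thesis using recolour(1)[of "P i" fc] D(6)[OF that] by simp
    qed
  qed
  moreover have "all_pinned (Suc g) F'"
    by (rule pinned_join[OF colouredD(1)[OF D(1)] MF NF MN fr pin])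
  ultimately show ?thesis by blast
qed

lemma stage_joins:
  assumes "stage m 0 F P fc" "all_pinned g F" "j < m"
  shows "\<exists>F P fc. stage m j F P fc \<and> all_pinned (g + j) F"
  using assms(3)
proof (induction j)
  case 0
  then show ?case using assms(1,2) by auto
next
  case (Suc j)
  then obtain F P fc where "stage m j F P fc" "all_pinned (g + j) F" by auto
  then show ?case using stage_join[of m j F P fc "g + j"] Suc.prems by simp
qed

text \<open>Pair \<open>m\<close> reaches pair 0 by the split and each of the remaining
  \<open>m - 1\<close> pairs by a join. The genus is therefore 1 + 2 + ... + (n - 1).\<close>

lemma stage_exists:
  assumes "n \<ge> 2" shows "\<exists>F P fc. stage n (n - 1) F P fc \<and> all_pinned (n * (n - 1) div 2) F"
  using assms
proof (induction n rule: dec_induct)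
  case base
  have "\<exists>P fc. stage (Suc 1) 0 (split_face base_faces ((\<lambda>i. if i = 0 then (0, 2, 1, 3) else (2, 0, 3, 1)) (0 :: nat)) (2 * 1 + 2) (2 * 1 + 2 + 1)) P fc"
    by (rule stage_next) (use stage_base in simp_all)
  moreover have "Suc 1 = 2" "2 * 1 + 2 = (4 :: nat)" "4 + 1 = (5 :: nat)" by simp_all
  ultimately obtain P fc where st: "stage 2 0 (split_face base_faces (0, 2, 1, 3) 4 5) P fc" by (simp only: if_True refl) blast
  have "all_pinned 0 (split_face base_faces (0, 2, 1, 3) 4 5)" by (rule pinned_split_base) auto
  from stage_joins[OF st this, of 1] show ?case by simp
next
  case (step n)
  then obtain F P fc where st: "stage n (n - 1) F P fc" and pin: "all_pinned (n * (n - 1) div 2) F" by blast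
  note D = stageD[OF st]
  obtain a b where P0: "P 0 = (0, a, 1, b)" using D(4)[of 0] by auto
  have f: "(0, a, 1, b) \<in> F" using D(3)[of 0] P0 by simp
  \<comment> \<open>The pins wait in the faces of the pairs 1 and 2 while the face of pair 0 is
    split; this is why the induction starts at \<open>n = 2\<close>.\<close>
  have P: "P 1 \<in> F" "P 2 \<in> F" "P 1 \<noteq> P 2" "P 1 \<noteq> (0, a, 1, b)" "P 2 \<noteq> (0, a, 1, b)"
  proof -
    have n: "0 \<le> n" "1 \<le> n" "2 \<le> n" using step.hyps by simp_all
    show "P 1 \<in> F" "P 2 \<in> F" using D(3) n by blast+
    show "P 1 \<noteq> P 2" using stage_ne[OF st n(2,3)] by simp
    show "P 1 \<noteq> (0, a, 1, b)" "P 2 \<noteq> (0, a, 1, b)"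
      using stage_ne[OF st n(2,1)] stage_ne[OF st n(3,1)] unfolding P0 by simp_all
  qed
  obtain H where H: "pinned (n * (n - 1) div 2) F (P 1) (P 2) H" using pin P(1-3) unfolding all_pinned_def by blast
  have "2 * n + 2 \<notin> quad_vertices F" "2 * n + 2 + 1 \<notin> quad_vertices F" using colouredD(2)[OF D(1)] by auto
  from pinned_split[OF colouredD(1)[OF D(1)] f this _ P H]
  have pin': "all_pinned (n * (n - 1) div 2) (split_face F (P 0) (2 * n + 2) (2 * n + 2 + 1))" unfolding P0 by simp
  obtain P' fc' where "stage (Suc n) 0 (split_face F (P 0) (2 * n + 2) (2 * n + 2 + 1)) P' fc'"
    using stage_next[OF st] step.hyps by auto
  from stage_joins[OF this pin', of n] have "\<exists>F P fc. stage (Suc n) n F P fc \<and> all_pinned (n * (n - 1) div 2 + n) F" by simp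
  moreover have "n * (n - 1) div 2 + n = Suc n * (Suc n - 1) div 2"
  proof -
    have "n * (n - 1) + n * 2 = Suc n * (Suc n - 1)" by (cases n) (auto simp: algebra_simps)
    then show ?thesis by (metis div_mult_self1 mult.commute zero_neq_numeral add.commute)
  qed
  ultimately show ?case by simp
qed

text \<open>What has to be remembered once the multipartite graph on \<open>k\<close> pairs is
  complete: it stays a subgraph and forces \<open>k\<close> colours, while \<open>P\<close> and
  \<open>Q\<close>, whose opposite corners have colours 0 and 1, are places for further
  vertices.\<close>

definition extendable :: "nat \<Rightarrow> nat \<Rightarrow> quad set \<Rightarrow> (nat \<Rightarrow> nat) \<Rightarrow> (quad \<Rightarrow> nat) \<Rightarrow> quad \<Rightarrow> quad \<Rightarrow> bool" where
  "extendable k p F c fc P Q \<longleftrightarrow> coloured k p F c fc \<and> pair_edges (k - 1) (k - 2) \<subseteq> dedge_set F \<and>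
     c 0 = 0 \<and> c 1 = 0 \<and> c 2 = 1 \<and> c 3 = 1 \<and> 4 \<le> p \<and> P \<in> F \<and> Q \<in> F \<and>
     (\<exists>a b. P = (0, a, 1, b)) \<and> (\<exists>a b. Q = (2, a, 3, b))"

lemma extendableD:
  assumes "extendable k p F c fc P Q"
  shows "coloured k p F c fc" "pair_edges (k - 1) (k - 2) \<subseteq> dedge_set F" "c 0 = 0" "c 1 = 0" "c 2 = 1" "c 3 = 1"
    "4 \<le> p" "P \<in> F" "Q \<in> F" "\<exists>a b. P = (0, a, 1, b)" "\<exists>a b. Q = (2, a, 3, b)"
  using assms unfolding extendable_def by blast+

lemma stage_extendable:
  assumes st: "stage n (n - 1) F P fc" and n: "n \<ge> 1"
  shows "extendable (n + 1) (2 * n + 2) F (\<lambda>v. v div 2) fc (P 0) (P 1)"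
proof -
  note D = stageD[OF st]
  have "\<exists>a b. P 0 = (0, a, 1, b)" using D(4)[of 0] by simp
  moreover have "\<exists>a b. P 1 = (2, a, 3, b)" using D(4)[of 1] n by simp
  ultimately show ?thesis unfolding extendable_def
    using D(1) D(2) D(3)[of 0] D(3)[of 1] n by (intro conjI) auto
qed

lemma extendable_split:
  assumes ex: "extendable k p F c fc P Q" and k: "k \<ge> 2"
  shows "\<exists>c' fc' P'. extendable k (p + 2) (split_face F P p (p + 1)) c' fc' P' Q"
proof -
  note D = extendableD[OF ex]
  obtain a b where P: "P = (0, a, 1, b)" using D(10) by blast
  obtain a' b' where Q: "Q = (2, a', 3, b')" using D(11) by blast
  have f: "(0, a, 1, b) \<in> F" using D(8) P by simp
  \<comment> \<open>Any colour other than that of the split face would do for the middle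
    face.\<close>
  define m where "m = (if fc (0, a, 1, b) = 0 then 1 else 0 :: nat)"
  have m: "fc (0, a, 1, b) \<noteq> m" "m < k" using k by (auto simp: m_def)
  interpret splittable F 0 a 1 b p "p + 1" by (rule coloured_splittable[OF D(1) f])
  have C: "coloured k (p + 2) F' (c(p := 1, p + 1 := 1)) (recolour_split fc (0, a, 1, b) p (p + 1) m)"
    by (rule coloured_split[OF D(1) f, of 0]) (use D(3,4) m k in auto)
  have "extendable k (p + 2) F' (c(p := 1, p + 1 := 1)) (recolour_split fc (0, a, 1, b) p (p + 1) m) (0, a, 1, p) Q"
    unfolding extendable_def
  proof (intro conjI)
    show "pair_edges (k - 1) (k - 2) \<subseteq> dedge_set F'" using D(2) unfolding dedge_set' by blast
    show "Q \<in> F'" using D(9) Q unfolding F'_eq by simp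
    show "(0, a, 1, p) \<in> F'" unfolding F'_eq by simp
    show "\<exists>a b. Q = (2, a, 3, b)" by (rule D(11))
  qed (use C D(3-7) in auto)
  then show ?thesis unfolding P by blast
qed

lemma extendable_splits:
  assumes "extendable k p F c fc P Q" "k \<ge> 2" "drawing S F H"
  shows "\<exists>F c fc P Q H. extendable k (p + 2 * n) F c fc P Q \<and> drawing S F H"
proof (induction n)
  case 0
  then show ?case using assms(1,3) by (metis add_0_right mult_0_right)
next
  case (Suc n)
  then obtain F c fc P Q H where ex: "extendable k (p + 2 * n) F c fc P Q" and dr: "drawing S F H" by blast
  note D = extendableD[OF ex]
  obtain a b where P: "P = (0, a, 1, b)" using D(10) by blast
  interpret face_split S F H 0 a 1 b "p + 2 * n" "p + 2 * n + 1"
    by unfold_locales (use dr colouredD(1,2)[OF D(1)] D(8) P in auto)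
  have "\<exists>H'. drawing S (split_face F P (p + 2 * n) (p + 2 * n + 1)) H'" unfolding P using drawing_split by blast
  then show ?case using extendable_split[OF ex assms(2)] by (metis add.assoc mult_Suc_right add.commute)
qed

text \<open>A new handle needs four new vertices: two are coloured like the pair \<open>1\<close> and two like the pair \<open>0\<close>,
  so that the tube may join them.\<close>

lemma extendable_handle:
  assumes ex: "extendable k p F c fc P Q" and k: "k \<ge> 3" and pin: "all_pinned g F"
    and R: "R \<in> F" "R \<noteq> P" "R \<noteq> Q"
  shows "\<exists>F c fc P Q R. extendable k (p + 4) F c fc P Q \<and> all_pinned (Suc g) F \<and> R \<in> F \<and> R \<noteq> P \<and> R \<noteq> Q"
proof -
  note D = extendableD[OF ex]
  obtain a b where P: "P = (0, a, 1, b)" using D(10) by blast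
  obtain a' b' where Q: "Q = (2, a', 3, b')" using D(11) by blast
  \<comment> \<open>Colours for the two middle faces: \<open>i\<close> avoids the colour of
    \<open>P\<close>, and \<open>j\<close> avoids both \<open>i\<close> and the colour of
    \<open>Q\<close>. The choice of \<open>j\<close> may need a third colour.\<close>
  define i where "i = (if fc P = 0 then 1 else 0 :: nat)"
  define j where "j = (if fc Q \<noteq> 0 \<and> i \<noteq> 0 then 0 else if fc Q \<noteq> 1 \<and> i \<noteq> 1 then 1 else 2 :: nat)"
  have i: "fc (0, a, 1, b) \<noteq> i" "i < k" using k P by (auto simp: i_def)
  have j: "fc Q \<noteq> j" "i \<noteq> j" "j < k" using k by (auto simp: i_def j_def)
  have f: "(0, a, 1, b) \<in> F" using D(8) P by simp
  have PQ: "Q \<noteq> (0, a, 1, b)" unfolding Q by simp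
  interpret s1: splittable F 0 a 1 b p "p + 1" by (rule coloured_splittable[OF D(1) f])
  define F1 c1 fc1 where 1: "F1 = split_face F (0, a, 1, b) p (p + 1)" "c1 = c(p := 1, p + 1 := 1)"
    "fc1 = recolour_split fc (0, a, 1, b) p (p + 1) i"
  have C1: "coloured k (p + 2) F1 c1 fc1" unfolding 1
    by (rule coloured_split[OF D(1) f, of 0]) (use D(3,4) i k in auto)
  define l m0 where lm: "l = (0 :: nat, a, 1 :: nat, p)" "m0 = (p, 1 :: nat, p + 1, 0 :: nat)"
  have in1: "Q \<in> F1" "l \<in> F1" "m0 \<in> F1" "l \<noteq> Q" "m0 \<noteq> Q" "l \<noteq> m0"
    using D(7,9) PQ Q unfolding 1 lm s1.F'_eq by auto
  have col1: "fc1 Q = fc Q" "fc1 m0 = i"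
    using s1.recolour(1,3)[where k = fc and m = i, OF i(1)] D(9) unfolding 1 lm by simp_all
  \<comment> \<open>While \<open>P\<close> is split, the pins are held by \<open>Q\<close> and the
    spare face \<open>R\<close>; for the split of \<open>Q\<close> they are held by two of the faces
    just made from \<open>P\<close>.\<close>
  obtain H where H: "pinned g F Q R H" using pin[unfolded all_pinned_def, rule_format, OF D(9) R(1) R(3)[symmetric]] by blast
  have pin1: "all_pinned g F1" unfolding 1
    by (rule pinned_split[OF s1.surf f s1.fresh D(9) R(1) R(3)[symmetric] PQ R(2)[unfolded P] H])
  have Q1: "(2, a', 3, b') \<in> F1" using in1(1) Q by simp
  interpret s2: splittable F1 2 a' 3 b' "p + 2" "p + 2 + 1" by (rule coloured_splittable[OF C1 Q1])
  define F2 c2 fc2 where 2: "F2 = split_face F1 (2, a', 3, b') (p + 2) (p + 2 + 1)" "c2 = c1(p + 2 := 0, p + 2 + 1 := 0)"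
    "fc2 = recolour_split fc1 (2, a', 3, b') (p + 2) (p + 2 + 1) j"
  have j1: "fc1 (2, a', 3, b') \<noteq> j" using col1(1) j(1) Q by simp
  have C2: "coloured k (p + 2 + 2) F2 c2 fc2" unfolding 2
    by (rule coloured_split[OF C1 Q1, of 1]) (use D(5-7) j1 j k in \<open>auto simp: 1\<close>)
  define l' m1 where lm': "l' = (2 :: nat, a', 3 :: nat, p + 2)" "m1 = (p + 2, 3 :: nat, p + 3, 2 :: nat)"
  have in2: "l \<in> F2" "m0 \<in> F2" "l' \<in> F2" "m1 \<in> F2"
    using in1 Q unfolding 2 lm' s2.F'_eq by (auto simp: add.assoc)
  have col2: "fc2 m0 = i" "fc2 m1 = j"
    using s2.recolour(1,3)[where k = fc1 and m = j, OF j1] in1(3) col1(2) unfolding 2 lm' by (simp_all add: numeral_3_eq_3)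
  obtain H1 where H1: "pinned g F1 l m0 H1" using pin1 in1 unfolding all_pinned_def by blast
  have pin2: "all_pinned g F2" unfolding 2
    by (rule pinned_split[OF s2.surf Q1 s2.fresh in1(2,3,6) in1(4,5)[unfolded Q] H1])
  have E2: "dedge_set F2 = dedge_set F \<union> both_ways 0 1 p (p + 1) \<union> both_ways 2 3 (p + 2) (p + 2 + 1)"
    unfolding 2 s2.dedge_set' unfolding 1 s1.dedge_set' ..
  have ltp: "u < p" "v < p" if "(u, v) \<in> dedge_set F" for u v
    using dedge_set_vertices[OF that] colouredD(2)[OF D(1)] by auto
  have fr: "r \<noteq> s" "(r, s) \<notin> dedge_set F2 \<and> (s, r) \<notin> dedge_set F2" if "r \<in> {p, p + 1}" "s \<in> {p + 2, p + 3}" for r s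
  proof -
    show "r \<noteq> s" using that by auto
    have "(r, s) \<notin> dedge_set F" "(s, r) \<notin> dedge_set F" using that ltp[of r s] ltp[of s r] by auto
    moreover have "(r, s) \<notin> both_ways 0 1 p (p + 1)" "(s, r) \<notin> both_ways 0 1 p (p + 1)"
      "(r, s) \<notin> both_ways 2 3 (p + 2) (p + 2 + 1)" "(s, r) \<notin> both_ways 2 3 (p + 2) (p + 2 + 1)"
      using that D(7) unfolding both_ways_def by auto
    ultimately show "(r, s) \<notin> dedge_set F2 \<and> (s, r) \<notin> dedge_set F2" unfolding E2 by blast
  qed
  have M: "(p, 1, p + 1, 0) \<in> F2" and N: "(p + 2, 3, p + 3, 2) \<in> F2" using in2 unfolding lm lm' by simp_all
  have MN: "(p, 1, p + 1, 0) \<noteq> (p + 2, 3, p + 3, 2 :: nat)" by simp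
  interpret j: joinable F2 p 1 "p + 1" 0 "p + 2" 3 "p + 3" 2
    by unfold_locales (use colouredD(1)[OF C2] M N MN fr in blast)+
  define F3 fc3 where 3: "F3 = join_faces F2 (p, 1, p + 1, 0) (p + 2, 3, p + 3, 2)"
    "fc3 = recolour_join fc2 (p, 1, p + 1, 0) (p + 2, 3, p + 3, 2)"
  have C2': "coloured k (p + 4) F2 c2 fc2" using C2 by (simp add: numeral_eq_Suc)
  have C3: "coloured k (p + 4) F3 c2 fc3" unfolding 3
    by (rule coloured_join[OF C2' j.joinable_axioms, of 1 0])
      (use col2 j(2) in \<open>simp_all add: lm lm' 2(2) 1(2)\<close>)
  have pin3: "all_pinned (Suc g) F3" unfolding 3 by (rule pinned_join[OF j.surf M N MN fr pin2])
  have "extendable k (p + 4) F3 c2 fc3 l l'"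
    unfolding extendable_def
  proof (intro conjI)
    show "pair_edges (k - 1) (k - 2) \<subseteq> dedge_set F3" using D(2) unfolding 3 j.dedge_set' E2 by blast
    show "l \<in> F3" "l' \<in> F3" using in2 D(7) unfolding 3 j.F'_eq lm lm' by auto
    show "\<exists>a b. l = (0, a, 1, b)" "\<exists>a b. l' = (2, a, 3, b)" unfolding lm lm' by blast+
  qed (use C3 D(3-7) in \<open>auto simp: 1 2\<close>)
  \<comment> \<open>One of the four faces on the tube is the spare face for the next handle.\<close>
  moreover have "(p, 1, p + 1, p + 2) \<in> F3" "(p, 1, p + 1, p + 2) \<noteq> l" "(p, 1, p + 1, p + 2) \<noteq> l'"
    using D(7) unfolding 3 j.F'_eq lm lm' by auto
  ultimately show ?thesis using pin3 by blast
qed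

lemma extendable_handles:
  assumes "extendable k p F c fc P Q" "k \<ge> 3" "all_pinned g F" "R \<in> F" "R \<noteq> P" "R \<noteq> Q"
  shows "\<exists>F c fc P Q R. extendable k (p + 4 * n) F c fc P Q \<and> all_pinned (g + n) F \<and> R \<in> F \<and> R \<noteq> P \<and> R \<noteq> Q"
proof (induction n)
  case 0
  then show ?case using assms by (metis add_0_right mult_0_right)
next
  case (Suc n)
  then obtain F c fc P Q R where "extendable k (p + 4 * n) F c fc P Q" "all_pinned (g + n) F" "R \<in> F" "R \<noteq> P" "R \<noteq> Q" by blast
  from extendable_handle[OF this(1) assms(2) this(2-5)] show ?case by (simp add: add.assoc add.commute[of 4])
qed

lemma extendable_quadrangulation:
  assumes ex: "extendable k p F c fc P Q" and k: "k \<ge> 2" and dr: "drawing S F H"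
  shows "\<exists>(V :: nat set) E \<phi> \<gamma>. quadrangulation (S :: 'a::t2_space set) V E \<phi> \<gamma> \<and> card V = p \<and>
    vertex_chromatic_number V E = k \<and> face_chromatic_number S V E \<phi> \<gamma> \<le> k"
proof -
  note D = extendableD[OF ex]
  note C = colouredD[OF D(1)]
  interpret drawn_surface S F H by unfold_locales (use dr C(1) in auto)
  \<comment> \<open>One vertex from each of the \<open>k\<close> pairs: the even numbers form the
    clique.\<close>
  have cl: "(2 * i, 2 * j) \<in> dedge_set F" if "i < k" "j < k" "i \<noteq> j" for i j
  proof -
    have "(2 * i, 2 * j) \<in> pair_edges (k - 1) (k - 2)" using that by (auto simp: pair_edges_def)
    then show ?thesis using D(2) by blast
  qed
  have "2 * i \<in> quad_vertices F" if "i < k" for i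
  proof -
    define j where "j = (if i = 0 then 1 else 0 :: nat)"
    have "j < k" "i \<noteq> j" using k by (auto simp: j_def)
    then show ?thesis using dedge_set_vertices(1)[OF cl[OF that]] by blast
  qed
  then have v: "vertex_chromatic_number V E = k"
    using C(2,3,4) cl by (intro vertex_chromatic[of c k "\<lambda>i. 2 * i"]) (auto intro: inj_onI)
  have f: "face_chromatic_number S V E \<phi> \<gamma> \<le> k" by (rule face_chromatic[OF C(5,6)])
  have "card V = p" using C(2) by simp
  then show ?thesis using quadrangulation v f by blast
qed

theorem theorem1p1:
  fixes g k p :: nat
  assumes "k \<ge> 2" and "p \<ge> 4"
    and "k = 2 \<Longrightarrow> g = 0"
    and "k \<ge> 3 \<Longrightarrow> real g \<ge> 1 / 2 * (real k - 1) * (real k - 2)"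
    and "even p" and "int p \<ge> 4 * int g - 2 * ((int k)\<^sup>2 - 4 * int k + 2)"
  shows "\<exists>(V :: nat set) E \<phi> \<gamma>.
           quadrangulation (genus_surface g) V E \<phi> \<gamma> \<and> card V = p \<and>
           vertex_chromatic_number V E = k \<and>
           face_chromatic_number (genus_surface g) V E \<phi> \<gamma> \<le> k"
proof (cases "k = 2")
  case True
  have "extendable 2 4 base_faces (\<lambda>v. v div 2) base_colour (0, 2, 1, 3) (2, 0, 3, 1)"
  proof -
    have "stage 1 (1 - 1) base_faces (\<lambda>i. if i = 0 then (0, 2, 1, 3) else (2, 0, 3, 1)) base_colour"
      using stage_base by simp
    from stage_extendable[OF this order_refl] show ?thesis by (simp add: numeral_eq_Suc)
  qed
  from extendable_splits[OF this order_refl base_drawing, of "(p - 4) div 2"] obtain F c fc P Q H where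
    "extendable 2 p F c fc P Q" "drawing (genus_surface 0) F H"
    using assms(2,5) by auto
  from extendable_quadrangulation[OF this(1) order_refl this(2)] show ?thesis using True assms(3) by simp
next
  case False
  then have k: "k \<ge> 3" using assms(1) by simp
  define n where "n = k - 1"
  have n: "n \<ge> 2" "k = n + 1" using k by (auto simp: n_def)
  define m where "m = n * (n - 1) div 2"
  have "even (n * (n - 1))" by (cases n) auto
  then have m2: "2 * m = n * (n - 1)" unfolding m_def by (rule dvd_mult_div_cancel)
  have rm: "2 * real m = (real k - 1) * (real k - 2)"
  proof -
    have "real (2 * m) = real n * real (n - 1)" unfolding m2 by simp
    then show ?thesis using n by (simp add: of_nat_diff)
  qed
  have "real m \<le> real g" using assms(4)[OF k] rm by simp
  then have mg: "m \<le> g" by simp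
  have im: "2 * int m = (int k - 1) * (int k - 2)"
  proof -
    have "int (2 * m) = int n * int (n - 1)" unfolding m2 by simp
    then show ?thesis using n by (simp add: of_nat_diff)
  qed
  \<comment> \<open>With \<open>2 * m = (k - 1) * (k - 2)\<close>, the bound on \<open>p\<close>
    counts the \<open>k\<close> pairs and four vertices for each of the \<open>g - m\<close> surplus
    handles.\<close>
  have "4 * int g - 2 * ((int k)\<^sup>2 - 4 * int k + 2) = 4 * (int g - int m) + 2 * int k"
    using im by (simp add: power2_eq_square algebra_simps)
  then have "int (2 * k + 4 * (g - m)) \<le> int p" using assms(6) mg by (simp add: of_nat_diff)
  then have p: "2 * k + 4 * (g - m) \<le> p" by linarith
  obtain F P fc where st: "stage n (n - 1) F P fc" and pin: "all_pinned m F" using stage_exists[OF n(1)] unfolding m_def by blast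
  have ex: "extendable k (2 * k) F (\<lambda>v. v div 2) fc (P 0) (P 1)"
    using stage_extendable[OF st] n by simp
  have R: "P 2 \<in> F" "P 2 \<noteq> P 0" "P 2 \<noteq> P 1"
    using stageD(3)[OF st, of 2] stage_ne[OF st, of 2 0] stage_ne[OF st, of 2 1] n(1) by auto
  from extendable_handles[OF ex k pin R, of "g - m"] mg obtain F c fc P Q R where
    ex': "extendable k (2 * k + 4 * (g - m)) F c fc P Q" and pin': "all_pinned g F" and R': "R \<in> F" "R \<noteq> P" by auto
  have "P \<in> F" using extendableD(8)[OF ex'] .
  then obtain H where "drawing (genus_surface g) F H" using pin' R' unfolding all_pinned_def pinned_def by blast
  \<comment> \<open>The remaining number of vertices is even because \<open>p\<close> is, so splits
    fill it up exactly.\<close>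
  from extendable_splits[OF ex' assms(1) this, of "(p - (2 * k + 4 * (g - m))) div 2"] obtain F c fc P Q H where
    "extendable k p F c fc P Q" "drawing (genus_surface g) F H"
    using p assms(5) by auto
  from extendable_quadrangulation[OF this(1) assms(1) this(2)] show ?thesis .
qed

end
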